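(* Let $\ell\ge 1$, let $T$ be the left shift on $\Omega=\mathcal A^{\mathbb Z}$ and $P$ a $T$-invariant probability measure as in the context. Assume that the entropy of the partition into 1-cylinders is finite, i.e. $$-\sum_{a\in\mathcal A}P([a])\ln P([a])<\infty.$$ Assume that $\sum_{n\ge1}\phi(n)<\infty$ if $\ell=1$, and that $\sum_{n\ge1}\psi(n)<\infty$ if $\ell>1$. Let $q_1,\ldots,q_\ell$ be functions taking nonnegative integer values on integers $n\ge 0$, and suppose there is a constant $K>0$ such that: (a) for any $i\ne j$, $1\le i,j\le\ell$, and every integer $k$ the number of integers $n\ge 0$ satisfying at least one of the equations $q_i(n)-q_j(n)=k$ and $q_i(n)=k$ does not exceed $K$ (when $\ell=1$ the requirement is only that for every integer $k$ the number of $n\ge 0$ with $q_1(n)=k$ does not exceed $K$); (b) the number of pairs of integers $n>m\ge 0$ satisfying $\max_{1\le i\le\ell}q_i(n)\le\max_{1\le i\le\ell}q_i(m)$ does not exceed $K$. Let $h$ be the Kolmogorov--Sinai entropy of the shift $T$ on $(\Omega,\mathcal F,P)$ (under these assumptions $h>0$). Fix $\gamma>0$ and, for $\tilde\omega^{(1)},\ldots,\tilde\omega^{(\ell)}\in\Omega$, set $$M_{N,\tilde\omega^{(1)},\ldots,\tilde\omega^{(\ell)}}(\omega)=\max_{1\le n\le N}\ \min_{1\le i\le\ell}\Phi_{\tilde\omega^{(i)}}(T^{q_i(n)}\omega),\qquad \Phi_{\tilde\omega}(\omega)=-\ln d(\omega,\tilde\omega),$$ where $d$ is the distance defined in the context with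 parameter $\gamma$. Then for almost all $\tilde\omega^{(1)},\ldots,\tilde\omega^{(\ell)}\in\Omega$ (i.e. $P^{\ell}$-almost every $\ell$-tuple), with probability one (for $P$-almost every $\omega$), $$\frac{M_{N,\tilde\omega^{(1)},\ldots,\tilde\omega^{(\ell)}}(\omega)}{\ln N}\to\frac{\gamma}{2\ell h}\quad\text{as}\quad N\to\infty.$$
   Context: Sequence space: $\mathcal A$ is a finite or countable alphabet which is not a singleton, $\Omega=\mathcal A^{\mathbb Z}$ is the space of sequences $\omega=(\omega_i)_{i\in\mathbb Z}$, $\mathcal F$ is the $\sigma$-algebra generated by all cylinder sets, $T:\Omega\to\Omega$ is the left shift $(T\omega)_i=\omega_{i+1}$, and $P$ is a $T$-invariant probability measure on $(\Omega,\mathcal F)$. It is assumed that $P([a])>0$ for every $a\in\mathcal A$, where $[a]=\{\omega:\omega_0=a\}$ (a 1-cylinder). Distance: for $\gamma>0$ and $\omega,\tilde\omega\in\Omega$, $$d(\omega,\tilde\omega)=\exp\big(-\gamma\min\{i\ge 0:\ \omega_i\ne\tilde\omega_i\ \text{or}\ \omega_{-i}\ne\tilde\omega_{-i}\}\big)$$ (with $d(\omega,\omega)=0$, so that $\Phi_\omega(\omega)=+\infty$). Dependence coefficients: for $-\infty\le m\le n\le\infty$ let $\mathcal F_{mn}$ be the $\sigma$-algebra generated by the coordinates $\omega_i$ with $m\le i\le n$ ($i\in\mathbb Z$). For sub-$\sigma$-algebras $\mathcal G,\mathcal H$ set $$\phi(\mathcal G,\mathcal H)=\sup\Big\{\Big|\frac{P(\Gamma\cap\Delta)}{P(\Gamma)}-P(\Delta)\Big|:\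 \Gamma\in\mathcal G,\ \Delta\in\mathcal H,\ P(\Gamma)\ne 0\Big\},$$ $$\psi(\mathcal G,\mathcal H)=\sup\Big\{\Big|\frac{P(\Gamma\cap\Delta)}{P(\Gamma)P(\Delta)}-1\Big|:\ \Gamma\in\mathcal G,\ \Delta\in\mathcal H,\ P(\Gamma)P(\Delta)\ne 0\Big\}\in[0,\infty],$$ and $\phi(k)=\sup_{m\in\mathbb Z}\phi(\mathcal F_{-\infty,m},\mathcal F_{m+k,\infty})$, $\psi(k)=\sup_{m\in\mathbb Z}\psi(\mathcal F_{-\infty,m},\mathcal F_{m+k,\infty})$ for $k=0,1,2,\ldots$. *)

theory Defs
  imports "HOL-Probability.Probability"
begin

section \<open>Sequence space over a countable alphabet\<close>

definition seq_space :: "(int \<Rightarrow> 'a) measure" where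
  "seq_space = PiM UNIV (\<lambda>_. count_space UNIV)"

definition left_shift :: "(int \<Rightarrow> 'a) \<Rightarrow> int \<Rightarrow> 'a" where
  "left_shift \<omega> = (\<lambda>i. \<omega> (i + 1))"

definition cylinder1 :: "'a \<Rightarrow> (int \<Rightarrow> 'a) set" where
  "cylinder1 a = {\<omega>. \<omega> 0 = a}"

definition seq_dist :: "real \<Rightarrow> (int \<Rightarrow> 'a) \<Rightarrow> (int \<Rightarrow> 'a) \<Rightarrow> real" where
  "seq_dist \<gamma> \<omega> \<omega>' =
     (if \<omega> = \<omega>' then 0
      else exp (- \<gamma> * real (LEAST i::nat. \<omega> (int i) \<noteq> \<omega>' (int i) \<or> \<omega> (- int i) \<noteq> \<omega>' (- int i))))"

text \<open>
  \<open>log_dist\<close> is minus the logarithm of the distance. The real-valued \<open>ln\<close> has \<open>ln 0 = 0\<close>,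
  so the value at distance zero is set to \<open>\<infinity>\<close> explicitly.
\<close>

definition log_dist :: "real \<Rightarrow> (int \<Rightarrow> 'a) \<Rightarrow> (int \<Rightarrow> 'a) \<Rightarrow> ereal" where
  "log_dist \<gamma> \<omega>' \<omega> =
     (if seq_dist \<gamma> \<omega> \<omega>' = 0 then \<infinity> else ereal (- ln (seq_dist \<gamma> \<omega> \<omega>')))"

text \<open>
  Tuples are indexed by \<open>{1..l}\<close>. The case \<open>N = 0\<close> (maximum of the empty set) is unspecified.
\<close>

definition max_log_dist ::
  "real \<Rightarrow> nat \<Rightarrow> (nat \<Rightarrow> nat \<Rightarrow> nat) \<Rightarrow> (nat \<Rightarrow> int \<Rightarrow> 'a) \<Rightarrow> nat \<Rightarrow> (int \<Rightarrow> 'a) \<Rightarrow> ereal" where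
  "max_log_dist \<gamma> l q \<omega>' N \<omega> =
     (MAX n\<in>{1..N}. MIN i\<in>{1..l}. log_dist \<gamma> (\<omega>' i) ((left_shift ^^ q i n) \<omega>))"

section \<open>Dependence coefficients\<close>

text \<open>
  \<open>coord_algebra I\<close> is generated by the coordinates with index in \<open>I\<close>; as the alphabet is
  countable, the events that a single coordinate takes a given value suffice as generators.
  The \<open>\<sigma>\<close>-algebra \<open>\<F>\<close> with lower index \<open>-\<infinity>, m\<close> is \<open>coord_algebra {..m}\<close>, the one with lower
  index \<open>m, \<infinity>\<close> is \<open>coord_algebra {m..}\<close>.
\<close>

definition coord_algebra :: "int set \<Rightarrow> (int \<Rightarrow> 'a::countable) set set" where
  "coord_algebra I = sigma_sets UNIV {{\<omega>. \<omega> i = a} | i a. i \<in> I}"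

definition phi_dep :: "'b measure \<Rightarrow> 'b set set \<Rightarrow> 'b set set \<Rightarrow> ennreal" where
  "phi_dep P G H =
     (SUP (\<Gamma>, \<Delta>) \<in> {(\<Gamma>, \<Delta>). \<Gamma> \<in> G \<and> \<Delta> \<in> H \<and> measure P \<Gamma> \<noteq> 0}.
        ennreal \<bar>measure P (\<Gamma> \<inter> \<Delta>) / measure P \<Gamma> - measure P \<Delta>\<bar>)"

definition psi_dep :: "'b measure \<Rightarrow> 'b set set \<Rightarrow> 'b set set \<Rightarrow> ennreal" where
  "psi_dep P G H =
     (SUP (\<Gamma>, \<Delta>) \<in> {(\<Gamma>, \<Delta>). \<Gamma> \<in> G \<and> \<Delta> \<in> H \<and> measure P \<Gamma> * measure P \<Delta> \<noteq> 0}.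
        ennreal \<bar>measure P (\<Gamma> \<inter> \<Delta>) / (measure P \<Gamma> * measure P \<Delta>) - 1\<bar>)"

definition phi_mix :: "(int \<Rightarrow> 'a::countable) measure \<Rightarrow> nat \<Rightarrow> ennreal" where
  "phi_mix P k = (SUP m. phi_dep P (coord_algebra {..m}) (coord_algebra {m + int k..}))"

definition psi_mix :: "(int \<Rightarrow> 'a::countable) measure \<Rightarrow> nat \<Rightarrow> ennreal" where
  "psi_mix P k = (SUP m. psi_dep P (coord_algebra {..m}) (coord_algebra {m + int k..}))"

section \<open>Kolmogorov--Sinai entropy\<close>

text \<open>
  The summands are nonnegative for a probability measure, so the sum always exists in the
  extended reals; a null set contributes zero because \<open>0 * ln 0 = 0\<close>.
\<close>

definition partition_entropy :: "'b measure \<Rightarrow> 'b set set \<Rightarrow> ereal" where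
  "partition_entropy M \<xi> = (\<Sum>\<^sub>\<infinity>A\<in>\<xi>. ereal (- (measure M A * ln (measure M A))))"

definition pullback_partition :: "'b measure \<Rightarrow> ('b \<Rightarrow> 'b) \<Rightarrow> 'b set set \<Rightarrow> 'b set set" where
  "pullback_partition M f \<xi> = (\<lambda>A. f -` A \<inter> space M) ` \<xi>"

text \<open>
  The join of the pullbacks of \<open>\<xi>\<close> under \<open>T ^^ i\<close>, \<open>i < n\<close>. A pullback may contain the empty
  set; \<open>common_refinement\<close> discards it.
\<close>

definition iterated_partition :: "'b measure \<Rightarrow> ('b \<Rightarrow> 'b) \<Rightarrow> 'b set set \<Rightarrow> nat \<Rightarrow> 'b set set" where
  "iterated_partition M T \<xi> n =
     common_refinement ((\<lambda>i. pullback_partition M (T ^^ i) \<xi>) ` {..<n})"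

definition entropy_wrt :: "'b measure \<Rightarrow> ('b \<Rightarrow> 'b) \<Rightarrow> 'b set set \<Rightarrow> ereal" where
  "entropy_wrt M T \<xi> =
     lim (\<lambda>n. partition_entropy M (iterated_partition M T \<xi> n) / ereal (real n))"

text \<open>The supremum is over finite measurable partitions.\<close>

definition KS_entropy :: "'b measure \<Rightarrow> ('b \<Rightarrow> 'b) \<Rightarrow> ereal" where
  "KS_entropy M T =
     (SUP \<xi> \<in> {\<xi>. finite \<xi> \<and> \<xi> \<subseteq> sets M \<and> partition_on (space M) \<xi>}. entropy_wrt M T \<xi>)"

section \<open>Counting\<close>

text \<open>The finiteness conjunct is needed because \<open>card\<close> of an infinite set is zero.\<close>

definition at_most :: "real \<Rightarrow> 'b set \<Rightarrow> bool" where
  "at_most K S \<longleftrightarrow> finite S \<and> real (card S) \<le> K"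

end

theory Submission
  imports Defs
begin

text \<open>
  Write \<open>h\<close> for the entropy rate of the coordinate process. For typical \<open>x\<close> the set of sequences that
  agree with \<open>x\<close> on \<open>[-s, s]\<close> has probability \<open>exp (- 2 s h + o(s))\<close>, a two-sided
  Shannon--McMillan--Breiman theorem: it is not much smaller because a \<open>k\<close>-step Markov approximation
  \<open>Q\<close> satisfies \<open>E (Q / P) \<le> 1\<close>, and not much larger because the conditional probability \<open>R\<close> of a word
  given the infinite past satisfies \<open>E (P / R) \<le> 1\<close>; the logarithms of \<open>Q\<close> and \<open>R\<close> are Birkhoff sums.
  By mixing, the \<open>l\<close> conditions at time \<open>n\<close> hold simultaneously with probability about
  \<open>exp (- 2 s l h)\<close>. Hence up to time \<open>N = exp (2 s l (h - 2 \<epsilon>))\<close> no match of level \<open>s\<close> occurs (union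
  bound), while up to \<open>N = exp (2 s l (h + 2 \<epsilon>))\<close> one does (second moment); both error probabilities are
  summable over \<open>s\<close>. That \<open>h\<close> equals the Kolmogorov--Sinai entropy follows from
  \<open>h(X) \<le> h(Y) + H(X | Y)\<close>.
\<close>

text \<open>The obstacle is that the window around 0 grows in both directions. The probability of
  the word on \<open>[-s, s]\<close> is a one-sided word probability taken at a point that moves
  with \<open>s\<close>; along such points stationarity transfers convergence in probability, but
  not almost sure convergence. This is why both comparisons are bounds on means: such a bound is
  invariant under the shift and, by Borel--Cantelli, needs no relation between different
  \<open>s\<close>. Only the Birkhoff sums have to be two-sided. The alphabet may be infinite, so
  limits of sums over symbols need domination, which finite entropy supplies; L1 convergence of
  conditional probabilities is then enough. The targets enter the hitting estimates only through
  their window probabilities. They are fixed first, as points with the right growth, and all later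
  null sets concern \<open>\<omega>\<close> alone. For one target the covariances are summed with
  \<phi>; for several, the coefficient \<psi> at gap \<open>g\<close> enters the variance as a
  relative error that does not decrease with \<open>N\<close>, so \<open>g\<close> has to grow
  exponentially in \<open>s\<close>.\<close>

section \<open>Ergodic averages\<close>

text \<open>Garsia's device: \<open>F n\<close> is the maximum of the first \<open>n + 1\<close>
  nonempty Birkhoff sums. The set \<open>A\<close> where it is unbounded is invariant, so it is null
  or full. If it were full, \<open>F (Suc n) - F n \<circ> T\<close> would converge to
  \<open>f\<close>, although its mean is nonnegative by invariance of the measure and monotonicity
  of \<open>F\<close>.\<close>

lemma (in prob_space) birkhoff_bounded_above:
  fixes f :: "'a \<Rightarrow> real"
  assumes T[measurable]: "T \<in> measurable M M" and inv: "distr M M T = M"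
    and ergodic: "\<And>A. A \<in> sets M \<Longrightarrow> T -` A \<inter> space M = A \<Longrightarrow> prob A = 0 \<or> prob A = 1"
    and f: "integrable M f" and neg: "expectation f < 0"
  shows "AE x in M. \<exists>C. \<forall>n. (\<Sum>i<n. f ((T ^^ i) x)) \<le> C"
proof -
  define F where "F = rec_nat f (\<lambda>_ g x. f x + max 0 (g (T x)))"
  have F0: "F 0 = f" and FS: "\<And>n x. F (Suc n) x = f x + max 0 (F n (T x))"
    by (simp_all add: F_def)
  note [measurable] = borel_measurable_integrable[OF f]
  have int_T: "integrable M (\<lambda>x. g (T x))" "expectation (\<lambda>x. g (T x)) = expectation g"
    if "integrable M g" for g :: "'a \<Rightarrow> real"
    using that integrable_distr[OF T, of g] integral_distr[OF T, of g] by (simp_all add: inv)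
  have int_F: "integrable M (F n)" for n
  proof (induction n)
    case 0 then show ?case using f by (simp add: F0)
  next
    case (Suc n)
    have "F (Suc n) = (\<lambda>x. f x + max 0 (F n (T x)))" by (auto simp: FS)
    then show ?case using f int_T(1)[OF Suc] by auto
  qed
  note [measurable] = borel_measurable_integrable[OF int_F]
  have mono1: "F n x \<le> F (Suc n) x" for n x
  proof (induction n arbitrary: x)
    case 0 then show ?case by (simp add: F0 FS)
  next
    case (Suc n) show ?case using Suc[of "T x"] by (simp add: FS[of n] FS[of "Suc n"] max_def)
  qed
  have mono: "m \<le> n \<Longrightarrow> F m x \<le> F n x" for m n x
    by (rule lift_Suc_mono_le[of "\<lambda>n. F n x"]) (use mono1 in auto)
  have S_le: "(\<Sum>i<Suc n. f ((T ^^ i) x)) \<le> F n x" for n x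
  proof (induction n arbitrary: x)
    case 0 then show ?case by (simp add: F0)
  next
    case (Suc n)
    have "(\<Sum>i<Suc (Suc n). f ((T ^^ i) x)) = f x + (\<Sum>i<Suc n. f ((T ^^ i) (T x)))"
      by (subst sum.lessThan_Suc_shift) (simp add: funpow_swap1)
    also have "\<dots> \<le> F (Suc n) x" using Suc[of "T x"] by (simp add: FS)
    finally show ?case .
  qed
  define A where "A = {x \<in> space M. \<forall>C::nat. \<exists>n. F n x > real C}"
  have A[measurable]: "A \<in> sets M" unfolding A_def by measurable
  have unb: "\<exists>n. F n x > c" if xA: "x \<in> A" for c x
  proof -
    obtain C :: nat where "c \<le> real C" using real_arch_simple by blast
    moreover obtain n where "F n x > real C" using xA by (auto simp: A_def)
    ultimately show ?thesis by (intro exI[of _ n]) simp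
  qed
  have "x \<in> A \<longleftrightarrow> T x \<in> A" if x: "x \<in> space M" for x
  proof
    assume a: "x \<in> A"
    show "T x \<in> A" unfolding A_def
    proof (safe)
      show "T x \<in> space M" using x measurable_space[OF T] by auto
      fix C :: nat
      obtain n where n: "F n x > real C + \<bar>f x\<bar>" using unb[OF a] by blast
      then have "F (Suc n) x > real C + \<bar>f x\<bar>" using mono1[of n x] by linarith
      then show "\<exists>n. F n (T x) > real C" by (intro exI[of _ n]) (auto simp: FS max_def split: if_splits)
    qed
  next
    assume a: "T x \<in> A"
    show "x \<in> A" unfolding A_def
    proof (safe)
      show "x \<in> space M" by fact
      fix C :: nat
      obtain n where n: "F n (T x) > real C + \<bar>f x\<bar>" using unb[OF a] by blast
      then show "\<exists>n. F n x > real C" by (intro exI[of _ "Suc n"]) (auto simp: FS max_def split: if_splits)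
    qed
  qed
  then have inv_A: "T -` A \<inter> space M = A" and TA: "\<And>x. x \<in> A \<Longrightarrow> T x \<in> A"
    by (auto simp: A_def)
  have "prob A \<noteq> 1"
  proof
    assume "prob A = 1"
    then have AE_A: "AE x in M. x \<in> A" using A by (simp add: prob_eq_1)
    \<comment> \<open>This is \<open>F (Suc n) x - F n (T x)\<close>, in the form that shows two
      things: it equals \<open>f x\<close> once \<open>F n (T x) \<ge> 0\<close>, and
      \<open>F n \<ge> f\<close> bounds it by
      \<open>\<bar>f x\<bar> + \<bar>f (T x)\<bar>\<close>.\<close>
    define D where "D n x = f x + max (- F n (T x)) 0" for n x
    have [measurable]: "D n \<in> borel_measurable M" for n unfolding D_def by measurable
    have "(\<lambda>n. expectation (D n)) \<longlonglongrightarrow> expectation f"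
    proof (rule integral_dominated_convergence[where w="\<lambda>x. \<bar>f x\<bar> + \<bar>f (T x)\<bar>"])
      show "integrable M (\<lambda>x. \<bar>f x\<bar> + \<bar>f (T x)\<bar>)" using f int_T(1)[OF f] by auto
      show "AE x in M. (\<lambda>n. D n x) \<longlonglongrightarrow> f x"
        using AE_A
      proof eventually_elim
        case (elim x)
        obtain n where n: "F n (T x) > 0" using unb[OF TA[OF elim]] by blast
        have "eventually (\<lambda>m. D m x = f x) sequentially"
          using eventually_ge_at_top[of n]
        proof eventually_elim
          case (elim m) then show ?case using n mono[of n m "T x"] by (simp add: D_def)
        qed
        then show ?case by (rule tendsto_eventually)
      qed
      show "AE x in M. norm (D n x) \<le> \<bar>f x\<bar> + \<bar>f (T x)\<bar>" for n
      proof (rule AE_I2)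
        fix x show "norm (D n x) \<le> \<bar>f x\<bar> + \<bar>f (T x)\<bar>"
          using mono[of 0 n "T x"] by (auto simp: D_def F0 max_def)
      qed
    qed auto
    moreover have "expectation (D n) \<ge> 0" for n
    proof -
      have "expectation (D n) = expectation (\<lambda>x. F (Suc n) x - F n (T x))"
        by (rule Bochner_Integration.integral_cong) (auto simp: D_def FS max_def)
      also have "\<dots> = expectation (F (Suc n)) - expectation (F n)"
        using int_F int_T[OF int_F] by (subst Bochner_Integration.integral_diff) auto
      also have "\<dots> \<ge> 0" using integral_mono[OF int_F[of n] int_F[of "Suc n"]] mono1 by auto
      finally show ?thesis .
    qed
    ultimately have "expectation f \<ge> 0" by (intro LIMSEQ_le_const[of "\<lambda>n. expectation (D n)"]) auto
    then show False using neg by simp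
  qed
  then have "prob A = 0" using ergodic[OF A inv_A] by auto
  then have "AE x in M. x \<notin> A" using A by (simp add: prob_eq_0)
  then show ?thesis using AE_space
  proof eventually_elim
    case (elim x)
    then obtain C :: nat where C: "\<And>n. F n x \<le> real C" by (auto simp: A_def not_less)
    show ?case
    proof (intro exI allI)
      fix n show "(\<Sum>i<n. f ((T ^^ i) x)) \<le> real C"
      proof (cases n)
        case 0 then show ?thesis by simp
      next
        case (Suc m) then show ?thesis using S_le[of x m] C[of m] by simp
      qed
    qed
  qed
qed

text \<open>A negative mean is forced by subtracting the mean plus \<open>1 / Suc k\<close>; the
  random constant \<open>C\<close> disappears after division by \<open>n\<close>. Countably many
  \<open>k\<close> leave one null set, and \<open>- f\<close> gives the lower bound.\<close>

theorem (in prob_space) birkhoff_ergodic: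
  fixes f :: "'a \<Rightarrow> real"
  assumes T[measurable]: "T \<in> measurable M M" and inv: "distr M M T = M"
    and ergodic: "\<And>A. A \<in> sets M \<Longrightarrow> T -` A \<inter> space M = A \<Longrightarrow> prob A = 0 \<or> prob A = 1"
    and f: "integrable M f"
  shows "AE x in M. (\<lambda>n. (\<Sum>i<n. f ((T ^^ i) x)) / real n) \<longlonglongrightarrow> expectation f"
proof -
  have upper: "AE x in M. \<forall>k. \<exists>C. \<forall>n. (\<Sum>i<n. g ((T ^^ i) x)) \<le> C + real n * (expectation g + 1 / real (Suc k))"
    if g: "integrable M g" for g :: "'a \<Rightarrow> real"
    unfolding AE_all_countable
  proof
    fix k
    let ?g = "\<lambda>x. g x - (expectation g + 1 / real (Suc k))"
    have "integrable M ?g" using g by auto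
    moreover have "expectation ?g < 0" using g by (simp add: prob_space)
    ultimately have "AE x in M. \<exists>C. \<forall>n. (\<Sum>i<n. ?g ((T ^^ i) x)) \<le> C"
      by (intro birkhoff_bounded_above[OF T inv ergodic])
    then show "AE x in M. \<exists>C. \<forall>n. (\<Sum>i<n. g ((T ^^ i) x)) \<le> C + real n * (expectation g + 1 / real (Suc k))"
      by eventually_elim (auto simp: sum_subtractf sum.distrib algebra_simps)
  qed
  have "integrable M (\<lambda>x. - f x)" using f by simp
  from upper[OF f] upper[OF this] show ?thesis
  proof eventually_elim
    case (elim x)
    let ?S = "\<lambda>n. \<Sum>i<n. f ((T ^^ i) x)"
    show ?case
    proof (rule LIMSEQ_I)
      fix r :: real assume r: "r > 0"
      then obtain k where k: "1 / real (Suc k) < r / 2"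
        using nat_approx_posE[of "r/2"] by auto
      from elim obtain C1 C2 where
        C1: "\<And>n. ?S n \<le> C1 + real n * (expectation f + 1 / real (Suc k))" and
        C2: "\<And>n. - ?S n \<le> C2 + real n * (- expectation f + 1 / real (Suc k))"
        by (simp add: sum_negf) blast
      obtain n0 :: nat where n0: "real n0 > 2 * (\<bar>C1\<bar> + \<bar>C2\<bar>) / r" using reals_Archimedean2 by blast
      show "\<exists>no. \<forall>n\<ge>no. norm (?S n / real n - expectation f) < r"
      proof (intro exI[of _ "Suc n0"] allI impI)
        fix n assume n: "n \<ge> Suc n0"
        then have n_pos: "real n > 0" by auto
        have "real n > 2 * (\<bar>C1\<bar> + \<bar>C2\<bar>) / r" using n n0 by linarith
        then have *: "\<bar>C1\<bar> + \<bar>C2\<bar> < real n * (r / 2)" using r by (simp add: field_simps)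
        have **: "real n * (1 / real (Suc k)) < real n * (r / 2)" using k n_pos by (intro mult_strict_left_mono)
        have "?S n - real n * expectation f < real n * r"
          using C1[of n] * ** unfolding distrib_left by linarith
        moreover have "?S n - real n * expectation f > - (real n * r)"
          using C2[of n] * ** unfolding distrib_left by linarith
        ultimately have "\<bar>?S n - real n * expectation f\<bar> < real n * r" by linarith
        then have "\<bar>?S n - real n * expectation f\<bar> / real n < r" using n_pos by (simp add: divide_less_eq mult.commute)
        moreover have "?S n / real n - expectation f = (?S n - real n * expectation f) / real n"
          using n_pos by (simp add: field_simps)
        ultimately show "norm (?S n / real n - expectation f) < r" by (simp add: abs_divide)
      qed
    qed
  qed
qed

section \<open>Information and entropy of discrete random variables\<close>

lemma (in prob_space) nn_integral_discrete:
  fixes X :: "'a \<Rightarrow> 'b::countable"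
  assumes X[measurable]: "X \<in> measurable M (count_space UNIV)"
  shows "(\<integral>\<^sup>+\<omega>. f (X \<omega>) \<partial>M) = (\<integral>\<^sup>+b. emeasure M {\<omega>\<in>space M. X \<omega> = b} * f b \<partial>count_space UNIV)"
proof -
  have "distr M (count_space UNIV) X = density (count_space UNIV) (\<lambda>b. emeasure M {\<omega>\<in>space M. X \<omega> = b})"
    by (rule measure_eqI_countable[of _ UNIV])
       (auto simp: emeasure_distr emeasure_density nn_integral_count_space' vimage_def Int_def
          conj_commute one_ennreal_def[symmetric] nn_integral_indicator_singleton)
  then have "(\<integral>\<^sup>+b. f b \<partial>distr M (count_space UNIV) X)
      = (\<integral>\<^sup>+b. emeasure M {\<omega>\<in>space M. X \<omega> = b} * f b \<partial>count_space UNIV)"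
    by (simp add: nn_integral_density)
  then show ?thesis by (simp add: nn_integral_distr)
qed

text \<open>\<open>N\<close> need not be \<open>M\<close>: with \<open>N\<close> a density of
  \<open>M\<close>, an integral is split along the values of \<open>X\<close> as a sum of measures,
  without a separate interchange of sum and integral.\<close>

lemma (in prob_space) emeasure_sum_discrete:
  fixes X :: "'a \<Rightarrow> 'b::countable"
  assumes X[measurable]: "X \<in> measurable M (count_space UNIV)" and N: "sets N = sets M"
    and A: "A \<in> sets M"
  shows "(\<integral>\<^sup>+b. emeasure N (A \<inter> {\<omega>\<in>space M. X \<omega> = b}) \<partial>count_space UNIV) = emeasure N A"
proof -
  have "emeasure N (\<Union>b\<in>UNIV. A \<inter> {\<omega>\<in>space M. X \<omega> = b}) =
      (\<integral>\<^sup>+b. emeasure N (A \<inter> {\<omega>\<in>space M. X \<omega> = b}) \<partial>count_space UNIV)"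
    using A by (intro emeasure_UN_countable) (auto simp: N disjoint_family_on_def)
  moreover have "(\<Union>b\<in>UNIV. A \<inter> {\<omega>\<in>space M. X \<omega> = b}) = A"
    using sets.sets_into_space[OF A] by auto
  ultimately show ?thesis by simp
qed

text \<open>
  The probability of the atom, containing \<open>\<omega>\<close>, of the partition induced by \<open>X\<close>; its negative logarithm
  is the information function of \<open>X\<close>.
\<close>

definition atom_prob :: "'w measure \<Rightarrow> ('w \<Rightarrow> 'b) \<Rightarrow> 'w \<Rightarrow> real" where
  "atom_prob M X \<omega> = measure M {\<omega>'\<in>space M. X \<omega>' = X \<omega>}"

text \<open>Shannon entropy as the mean of the information function, so that infinitely many values
  of \<open>X\<close> need no summation.\<close>

definition ent :: "'w measure \<Rightarrow> ('w \<Rightarrow> 'b) \<Rightarrow> real" where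
  "ent M X = (\<integral>\<omega>. - ln (atom_prob M X \<omega>) \<partial>M)"

text \<open>The integral in \<open>ent\<close> is 0, not infinite, when the information function is
  not integrable; this predicate rules that case out.\<close>

definition finite_ent :: "'w measure \<Rightarrow> ('w \<Rightarrow> 'b) \<Rightarrow> bool" where
  "finite_ent M X \<longleftrightarrow> integrable M (\<lambda>\<omega>. ln (atom_prob M X \<omega>))"

lemma measurable_discrete_comp:
  "X \<in> measurable M (count_space UNIV) \<Longrightarrow> (\<lambda>\<omega>. f (X \<omega>)) \<in> measurable M (count_space UNIV)"
  by (rule measurable_compose[where N="count_space UNIV"]) auto

lemma borel_measurable_discrete_comp:
  "X \<in> measurable M (count_space UNIV) \<Longrightarrow> (\<lambda>\<omega>. f (X \<omega>)) \<in> measurable M (borel :: 'c::topological_space measure)"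
  by (rule measurable_compose[where N="count_space UNIV"]) auto

lemma measurable_discrete_Pair:
  fixes X :: "'w \<Rightarrow> 'b::countable" and Y :: "'w \<Rightarrow> 'c::countable"
  assumes [measurable]: "X \<in> measurable M (count_space UNIV)" "Y \<in> measurable M (count_space UNIV)"
  shows "(\<lambda>\<omega>. (X \<omega>, Y \<omega>)) \<in> measurable M (count_space UNIV)"
proof -
  have "(\<lambda>\<omega>. (X \<omega>, Y \<omega>)) \<in> measurable M (count_space UNIV \<Otimes>\<^sub>M count_space UNIV)" by measurable
  then show ?thesis by (simp add: pair_measure_countable)
qed

lemma measurable_atom_prob:
  assumes "X \<in> measurable M (count_space UNIV)"
  shows "atom_prob M X \<in> borel_measurable M"
  unfolding atom_prob_def using borel_measurable_discrete_comp[OF assms] .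

lemma atom_prob_nonneg: "0 \<le> atom_prob M X \<omega>"
  by (simp add: atom_prob_def)

lemma (in prob_space) atom_prob_le_1: "atom_prob M X \<omega> \<le> 1"
  by (simp add: atom_prob_def)

lemma atom_prob_cong:
  "(\<And>\<omega> \<omega>'. X \<omega> = X \<omega>' \<longleftrightarrow> Y \<omega> = Y \<omega>') \<Longrightarrow> atom_prob M X = atom_prob M Y"
  by (auto simp: atom_prob_def fun_eq_iff)

lemma ent_cong:
  "(\<And>\<omega> \<omega>'. X \<omega> = X \<omega>' \<longleftrightarrow> Y \<omega> = Y \<omega>') \<Longrightarrow> ent M X = ent M Y"
  by (simp add: ent_def atom_prob_cong[of X Y])

lemma (in prob_space) atom_prob_mono:
  fixes Y :: "'a \<Rightarrow> 'b::countable"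
  assumes [measurable]: "Y \<in> measurable M (count_space UNIV)"
    and "\<And>\<omega> \<omega>'. X \<omega> = X \<omega>' \<Longrightarrow> Y \<omega> = Y \<omega>'"
  shows "atom_prob M X \<omega> \<le> atom_prob M Y \<omega>"
  unfolding atom_prob_def
proof (rule finite_measure_mono)
  show "{\<omega>'\<in>space M. X \<omega>' = X \<omega>} \<subseteq> {\<omega>'\<in>space M. Y \<omega>' = Y \<omega>}" using assms(2) by blast
qed measurable

lemma (in prob_space) atom_prob_AE_pos:
  fixes X :: "'a \<Rightarrow> 'b::countable"
  assumes X[measurable]: "X \<in> measurable M (count_space UNIV)"
  shows "AE \<omega> in M. atom_prob M X \<omega> > 0"
proof -
  note [measurable] = measurable_atom_prob[OF X]
  have "(\<integral>\<^sup>+\<omega>. indicator {b. prob {\<omega>'\<in>space M. X \<omega>' = b} = 0} (X \<omega>) \<partial>M) = 0"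
    by (subst nn_integral_discrete[OF X]) (auto simp: nn_integral_0_iff_AE AE_count_space emeasure_eq_measure indicator_def)
  then have "AE \<omega> in M. indicator {b. prob {\<omega>'\<in>space M. X \<omega>' = b} = 0} (X \<omega>) = (0::ennreal)"
    by (subst (asm) nn_integral_0_iff_AE) (auto intro: borel_measurable_discrete_comp[OF X])
  then show ?thesis
    by eventually_elim (auto simp: atom_prob_def indicator_def less_le split: if_splits)
qed

text \<open>Dividing by \<open>atom_prob\<close> turns the law of \<open>X\<close> into counting
  measure. Only an inequality remains, because values of probability zero contribute nothing on the
  left.\<close>

lemma (in prob_space) nn_integral_div_atom_prob:
  fixes X :: "'a \<Rightarrow> 'b::countable"
  assumes X: "X \<in> measurable M (count_space UNIV)"
  shows "(\<integral>\<^sup>+\<omega>. f (X \<omega>) * ennreal (1 / atom_prob M X \<omega>) \<partial>M) \<le> (\<integral>\<^sup>+b. f b \<partial>count_space UNIV)"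
proof -
  have "(\<integral>\<^sup>+\<omega>. f (X \<omega>) * ennreal (1 / atom_prob M X \<omega>) \<partial>M)
    = (\<integral>\<^sup>+b. emeasure M {\<omega>\<in>space M. X \<omega> = b} * (f b * ennreal (1 / prob {\<omega>\<in>space M. X \<omega> = b})) \<partial>count_space UNIV)"
    unfolding atom_prob_def by (rule nn_integral_discrete[OF X])
  also have "\<dots> \<le> (\<integral>\<^sup>+b. f b \<partial>count_space UNIV)"
  proof (rule nn_integral_mono)
    fix b
    have "emeasure M {\<omega>\<in>space M. X \<omega> = b} * (f b * ennreal (1 / prob {\<omega>\<in>space M. X \<omega> = b}))
      = f b * ennreal (prob {\<omega>\<in>space M. X \<omega> = b} * (1 / prob {\<omega>\<in>space M. X \<omega> = b}))"
      by (subst ennreal_mult) (auto simp: emeasure_eq_measure ac_simps)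
    also have "\<dots> \<le> f b * 1" by (intro mult_left_mono) auto
    finally show "emeasure M {\<omega>\<in>space M. X \<omega> = b} * (f b * ennreal (1 / prob {\<omega>\<in>space M. X \<omega> = b})) \<le> f b"
      by simp
  qed
  finally show ?thesis .
qed

text \<open>Jensen's inequality for the logarithm, from \<open>ln r \<le> r - 1\<close>. It turns
  each bound on the mass of a relative density into an entropy inequality.\<close>

lemma (in prob_space) integral_ln_nonpos:
  assumes [measurable]: "r \<in> borel_measurable M" and pos: "AE \<omega> in M. 0 < r \<omega>"
    and le: "(\<integral>\<^sup>+\<omega>. ennreal (r \<omega>) \<partial>M) \<le> 1" and int: "integrable M (\<lambda>\<omega>. ln (r \<omega>))"
  shows "expectation (\<lambda>\<omega>. ln (r \<omega>)) \<le> 0"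
proof -
  have r: "integrable M r"
    using pos le by (intro integrableI_nonneg) (auto intro: le_less_trans)
  have "ennreal (expectation r) \<le> 1"
    using le nn_integral_eq_integral[OF r eventually_mono[OF pos less_imp_le]] by simp
  then have "expectation r \<le> 1" by (simp add: ennreal_le_1)
  moreover have "expectation (\<lambda>\<omega>. ln (r \<omega>)) \<le> expectation (\<lambda>\<omega>. r \<omega> - 1)"
    using int r pos by (intro integral_mono_AE) (auto intro: ln_le_minus_one)
  moreover have "expectation (\<lambda>\<omega>. r \<omega> - 1) = expectation r - 1"
    using r by (simp add: prob_space)
  ultimately show ?thesis by simp
qed

lemma (in prob_space) finite_ent_coarser:
  fixes X :: "'a \<Rightarrow> 'b::countable" and Y :: "'a \<Rightarrow> 'c::countable"
  assumes X: "X \<in> measurable M (count_space UNIV)" and Y: "Y \<in> measurable M (count_space UNIV)"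
    and f: "\<And>\<omega> \<omega>'. X \<omega> = X \<omega>' \<Longrightarrow> Y \<omega> = Y \<omega>'" and fin: "finite_ent M X"
  shows "finite_ent M Y" "ent M Y \<le> ent M X"
proof -
  note [measurable] = measurable_atom_prob[OF X] measurable_atom_prob[OF Y]
  show Y': "finite_ent M Y" unfolding finite_ent_def
  proof (rule Bochner_Integration.integrable_bound[OF fin[unfolded finite_ent_def]])
    show "AE \<omega> in M. norm (ln (atom_prob M Y \<omega>)) \<le> norm (ln (atom_prob M X \<omega>))"
      using atom_prob_AE_pos[OF X]
    proof eventually_elim
      case (elim \<omega>)
      then show ?case using atom_prob_mono[OF Y f, of X \<omega>] atom_prob_le_1[of Y \<omega>] atom_prob_le_1[of X \<omega>] by auto
    qed
  qed auto
  show "ent M Y \<le> ent M X" unfolding ent_def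
  proof (rule integral_mono_AE)
    show "AE \<omega> in M. - ln (atom_prob M Y \<omega>) \<le> - ln (atom_prob M X \<omega>)"
      using atom_prob_AE_pos[OF X]
    proof eventually_elim
      case (elim \<omega>)
      then show ?case using atom_prob_mono[OF Y f, of X \<omega>] by auto
    qed
  qed (use Y' fin in \<open>auto simp: finite_ent_def\<close>)
qed

text \<open>
  Multiplying a weight \<open>f\<close> on the values of \<open>A\<close> by the conditional probability of \<open>B\<close> given \<open>Z\<close> does not
  increase its total mass.
\<close>

lemma (in prob_space) nn_integral_markov_ratio:
  fixes A :: "'a \<Rightarrow> 'b::countable" and B :: "'a \<Rightarrow> 'c::countable" and Z :: "'a \<Rightarrow> 'd::countable"
    and W :: "'a \<Rightarrow> 'e::countable"
  assumes A[measurable]: "A \<in> measurable M (count_space UNIV)" and B[measurable]: "B \<in> measurable M (count_space UNIV)"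
    and Z[measurable]: "Z \<in> measurable M (count_space UNIV)"
    and AZ: "\<And>\<omega> \<omega>'. A \<omega> = A \<omega>' \<Longrightarrow> Z \<omega> = Z \<omega>'" and BZ: "\<And>\<omega> \<omega>'. B \<omega> = B \<omega>' \<Longrightarrow> Z \<omega> = Z \<omega>'"
    and W: "\<And>\<omega> \<omega>'. W \<omega> = W \<omega>' \<longleftrightarrow> A \<omega> = A \<omega>' \<and> B \<omega> = B \<omega>'"
  shows "(\<integral>\<^sup>+\<omega>. f (A \<omega>) * ennreal (atom_prob M B \<omega> / (atom_prob M W \<omega> * atom_prob M Z \<omega>)) \<partial>M)
    \<le> (\<integral>\<^sup>+\<omega>. f (A \<omega>) * ennreal (1 / atom_prob M A \<omega>) \<partial>M)"
proof -
  let ?V = "\<lambda>\<omega>. (Z \<omega>, A \<omega>, B \<omega>)" and ?ZA = "\<lambda>\<omega>. (Z \<omega>, A \<omega>)"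
  define pA where "pA z a = prob {\<omega>\<in>space M. Z \<omega> = z \<and> A \<omega> = a}" for z a
  define pB where "pB z b = prob {\<omega>\<in>space M. B \<omega> = b \<and> Z \<omega> = z}" for z b
  define pZ where "pZ z = prob {\<omega>\<in>space M. Z \<omega> = z}" for z
  have V: "?V \<in> measurable M (count_space UNIV)" and ZA: "?ZA \<in> measurable M (count_space UNIV)"
    by (intro measurable_discrete_Pair A B Z)+
  have WV: "atom_prob M W = atom_prob M ?V" by (rule atom_prob_cong) (simp add: W, use AZ in blast)
  have AZA: "atom_prob M A = atom_prob M ?ZA" by (rule atom_prob_cong) (use AZ in blast)
  have at: "atom_prob M B \<omega> = pB (Z \<omega>) (B \<omega>)" "atom_prob M Z \<omega> = pZ (Z \<omega>)" for \<omega>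
    unfolding atom_prob_def pB_def pZ_def
    by (rule arg_cong[where f=prob], use AZ BZ in blast)+
  \<comment> \<open>The factor \<open>of_bool\<close> removes pairs of values that never occur
    together. Without it \<open>f\<close> would be summed over all pairs at the end, whereas only
    the occurring ones can be turned back into an integral over \<open>M\<close>.\<close>
  define g where "g = (\<lambda>(z, a, b). f a * of_bool (pA z a > 0) * (ennreal (pB z b) * ennreal (1 / pZ z)))"
  have Zs: "{\<omega>\<in>space M. Z \<omega> = z} \<in> sets M" for z by measurable
  have sB: "(\<integral>\<^sup>+b. ennreal (pB z b) \<partial>count_space UNIV) = ennreal (pZ z)" for z
    using emeasure_sum_discrete[OF B refl Zs[of z]]
    by (simp add: pB_def pZ_def emeasure_eq_measure Int_def conj_ac cong: conj_cong)
  have "(\<integral>\<^sup>+\<omega>. f (A \<omega>) * ennreal (atom_prob M B \<omega> / (atom_prob M W \<omega> * atom_prob M Z \<omega>)) \<partial>M)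
    = (\<integral>\<^sup>+\<omega>. g (?V \<omega>) * ennreal (1 / atom_prob M ?V \<omega>) \<partial>M)"
    unfolding WV
  proof (rule nn_integral_cong_AE)
    show "AE \<omega> in M. f (A \<omega>) * ennreal (atom_prob M B \<omega> / (atom_prob M ?V \<omega> * atom_prob M Z \<omega>))
      = g (?V \<omega>) * ennreal (1 / atom_prob M ?V \<omega>)"
      using atom_prob_AE_pos[OF ZA]
    proof eventually_elim
      case (elim \<omega>)
      then have "pA (Z \<omega>) (A \<omega>) > 0" by (simp add: atom_prob_def pA_def)
      then show ?case
        by (simp add: g_def at pB_def pZ_def atom_prob_nonneg ennreal_mult[symmetric] mult_ac)
    qed
  qed
  also have "\<dots> \<le> (\<integral>\<^sup>+v. g v \<partial>count_space UNIV)" by (rule nn_integral_div_atom_prob[OF V])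
  also have "\<dots> = (\<integral>\<^sup>+z. \<integral>\<^sup>+a. \<integral>\<^sup>+b. g (z, a, b) \<partial>count_space UNIV \<partial>count_space UNIV \<partial>count_space UNIV)"
    by (subst nn_integral_fst_count_space[symmetric], subst nn_integral_fst_count_space[symmetric]) simp
  also have "\<dots> = (\<integral>\<^sup>+z. \<integral>\<^sup>+a. f a * of_bool (pA z a > 0) * (ennreal (pZ z) * ennreal (1 / pZ z)) \<partial>count_space UNIV \<partial>count_space UNIV)"
    by (simp add: g_def nn_integral_cmult nn_integral_multc sB)
  also have "\<dots> \<le> (\<integral>\<^sup>+z. \<integral>\<^sup>+a. f a * of_bool (pA z a > 0) * 1 \<partial>count_space UNIV \<partial>count_space UNIV)"
    by (intro nn_integral_mono mult_left_mono) (auto simp: ennreal_mult[symmetric] pZ_def)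
  also have "\<dots> = (\<integral>\<^sup>+za. f (snd za) * of_bool (pA (fst za) (snd za) > 0) \<partial>count_space UNIV)"
    by (subst nn_integral_fst_count_space[symmetric]) simp
  also have "\<dots> = (\<integral>\<^sup>+za. emeasure M {\<omega>\<in>space M. ?ZA \<omega> = za} *
      (f (snd za) * ennreal (1 / prob {\<omega>\<in>space M. ?ZA \<omega> = za})) \<partial>count_space UNIV)"
  proof (rule nn_integral_cong)
    fix za :: "'d \<times> 'b"
    let ?p = "prob {\<omega>\<in>space M. ?ZA \<omega> = za}"
    have p: "pA (fst za) (snd za) = ?p" by (simp add: pA_def prod_eq_iff)
    have "ennreal ?p * ennreal (1 / ?p) = of_bool (?p > 0)"
      by (auto simp: ennreal_mult[symmetric] less_le)
    then show "f (snd za) * of_bool (pA (fst za) (snd za) > 0)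
      = emeasure M {\<omega>\<in>space M. ?ZA \<omega> = za} * (f (snd za) * ennreal (1 / ?p))"
      unfolding p emeasure_eq_measure by (simp only: mult.left_commute)
  qed
  also have "\<dots> = (\<integral>\<^sup>+\<omega>. f (A \<omega>) * ennreal (1 / atom_prob M A \<omega>) \<partial>M)"
    unfolding AZA atom_prob_def
    by (subst nn_integral_discrete[OF ZA, symmetric]) simp
  finally show ?thesis .
qed

text \<open>The integrand is the density, relative to the joint law, of the law that keeps the laws
  of \<open>A\<close> and \<open>B\<close> but makes them conditionally independent given
  \<open>Z\<close>.\<close>

lemma (in prob_space) nn_integral_submodular_ratio:
  fixes A :: "'a \<Rightarrow> 'b::countable" and B :: "'a \<Rightarrow> 'c::countable" and Z :: "'a \<Rightarrow> 'd::countable"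
    and W :: "'a \<Rightarrow> 'e::countable"
  assumes A: "A \<in> measurable M (count_space UNIV)" and B: "B \<in> measurable M (count_space UNIV)"
    and Z: "Z \<in> measurable M (count_space UNIV)"
    and AZ: "\<And>\<omega> \<omega>'. A \<omega> = A \<omega>' \<Longrightarrow> Z \<omega> = Z \<omega>'" and BZ: "\<And>\<omega> \<omega>'. B \<omega> = B \<omega>' \<Longrightarrow> Z \<omega> = Z \<omega>'"
    and W: "\<And>\<omega> \<omega>'. W \<omega> = W \<omega>' \<longleftrightarrow> A \<omega> = A \<omega>' \<and> B \<omega> = B \<omega>'"
  shows "(\<integral>\<^sup>+\<omega>. ennreal (atom_prob M A \<omega> * atom_prob M B \<omega> / (atom_prob M W \<omega> * atom_prob M Z \<omega>)) \<partial>M) \<le> 1"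
proof -
  have "(\<integral>\<^sup>+\<omega>. ennreal (atom_prob M A \<omega> * atom_prob M B \<omega> / (atom_prob M W \<omega> * atom_prob M Z \<omega>)) \<partial>M)
    = (\<integral>\<^sup>+\<omega>. ennreal (prob {\<omega>'\<in>space M. A \<omega>' = A \<omega>}) * ennreal (atom_prob M B \<omega> / (atom_prob M W \<omega> * atom_prob M Z \<omega>)) \<partial>M)"
    by (rule nn_integral_cong) (simp add: atom_prob_def ennreal_mult[symmetric])
  also have "\<dots> \<le> (\<integral>\<^sup>+\<omega>. ennreal (prob {\<omega>'\<in>space M. A \<omega>' = A \<omega>}) * ennreal (1 / atom_prob M A \<omega>) \<partial>M)"
    by (rule nn_integral_markov_ratio[OF A B Z AZ BZ W])
  also have "\<dots> \<le> (\<integral>\<^sup>+\<omega>. 1 \<partial>M)"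
    by (rule nn_integral_mono) (auto simp: atom_prob_def ennreal_mult[symmetric])
  finally show ?thesis by (simp add: emeasure_space_1)
qed

text \<open>The mean logarithm of the preceding density is nonpositive, which is the strong
  subadditivity of entropy. A constant \<open>Z\<close> gives ordinary subadditivity.\<close>

lemma (in prob_space)
  fixes A :: "'a \<Rightarrow> 'b::countable" and B :: "'a \<Rightarrow> 'c::countable" and Z :: "'a \<Rightarrow> 'd::countable"
    and W :: "'a \<Rightarrow> 'e::countable"
  assumes A: "A \<in> measurable M (count_space UNIV)" and B: "B \<in> measurable M (count_space UNIV)"
    and Z: "Z \<in> measurable M (count_space UNIV)" and Wm: "W \<in> measurable M (count_space UNIV)"
    and AZ: "\<And>\<omega> \<omega>'. A \<omega> = A \<omega>' \<Longrightarrow> Z \<omega> = Z \<omega>'" and BZ: "\<And>\<omega> \<omega>'. B \<omega> = B \<omega>' \<Longrightarrow> Z \<omega> = Z \<omega>'"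
    and W: "\<And>\<omega> \<omega>'. W \<omega> = W \<omega>' \<longleftrightarrow> A \<omega> = A \<omega>' \<and> B \<omega> = B \<omega>'"
    and fA: "finite_ent M A" and fB: "finite_ent M B"
  shows finite_ent_join: "finite_ent M W"
    and ent_submodular: "ent M W + ent M Z \<le> ent M A + ent M B"
proof -
  note [measurable] = measurable_atom_prob[OF A] measurable_atom_prob[OF B] measurable_atom_prob[OF Z] measurable_atom_prob[OF Wm]
  let ?r = "\<lambda>\<omega>. atom_prob M A \<omega> * atom_prob M B \<omega> / (atom_prob M W \<omega> * atom_prob M Z \<omega>)"
  have le: "(\<integral>\<^sup>+\<omega>. ennreal (?r \<omega>) \<partial>M) \<le> 1"
    by (rule nn_integral_submodular_ratio[OF A B Z AZ BZ W])
  have r: "integrable M ?r"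
    using le by (intro integrableI_nonneg) (auto intro: le_less_trans simp: atom_prob_nonneg)
  have pos: "AE \<omega> in M. atom_prob M A \<omega> > 0 \<and> atom_prob M B \<omega> > 0 \<and> atom_prob M Z \<omega> > 0 \<and> atom_prob M W \<omega> > 0"
    using atom_prob_AE_pos[OF A] atom_prob_AE_pos[OF B] atom_prob_AE_pos[OF Z] atom_prob_AE_pos[OF Wm] by auto
  show fW: "finite_ent M W" unfolding finite_ent_def
  proof (rule Bochner_Integration.integrable_bound)
    \<comment> \<open>The information of \<open>W\<close> is not yet known to be integrable, so it
      is dominated by means of \<open>ln r \<le> r - 1\<close>, where the density \<open>r\<close>
      itself is integrable.\<close>
    show "integrable M (\<lambda>\<omega>. \<bar>ln (atom_prob M A \<omega>)\<bar> + \<bar>ln (atom_prob M B \<omega>)\<bar> + ?r \<omega>)"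
      using fA fB r by (auto simp: finite_ent_def)
    show "AE \<omega> in M. norm (ln (atom_prob M W \<omega>)) \<le> norm (\<bar>ln (atom_prob M A \<omega>)\<bar> + \<bar>ln (atom_prob M B \<omega>)\<bar> + ?r \<omega>)"
      using pos
    proof eventually_elim
      case (elim \<omega>)
      then have "ln (?r \<omega>) \<le> ?r \<omega> - 1" by (intro ln_le_minus_one) auto
      moreover have "ln (?r \<omega>) = ln (atom_prob M A \<omega>) + ln (atom_prob M B \<omega>) - (ln (atom_prob M W \<omega>) + ln (atom_prob M Z \<omega>))"
        using elim by (simp add: ln_div ln_mult)
      moreover have "ln (atom_prob M W \<omega>) \<le> 0" "ln (atom_prob M Z \<omega>) \<le> 0" using elim atom_prob_le_1 by auto
      moreover have "?r \<omega> \<ge> 0" using elim by auto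
      ultimately have "- ln (atom_prob M W \<omega>) \<le> \<bar>ln (atom_prob M A \<omega>)\<bar> + \<bar>ln (atom_prob M B \<omega>)\<bar> + ?r \<omega>" by linarith
      then show ?case using \<open>ln (atom_prob M W \<omega>) \<le> 0\<close> \<open>?r \<omega> \<ge> 0\<close> by auto
    qed
  qed auto
  have fZ: "finite_ent M Z" by (rule finite_ent_coarser(1)[OF A Z AZ fA])
  have eq: "AE \<omega> in M. ln (?r \<omega>) = ln (atom_prob M A \<omega>) + ln (atom_prob M B \<omega>) - (ln (atom_prob M W \<omega>) + ln (atom_prob M Z \<omega>))"
    using pos by eventually_elim (simp add: ln_div ln_mult)
  have int: "integrable M (\<lambda>\<omega>. ln (atom_prob M A \<omega>) + ln (atom_prob M B \<omega>) - (ln (atom_prob M W \<omega>) + ln (atom_prob M Z \<omega>)))"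
    using fA fB fW fZ by (auto simp: finite_ent_def)
  have "expectation (\<lambda>\<omega>. ln (?r \<omega>)) \<le> 0"
  proof (rule integral_ln_nonpos[OF _ _ le])
    show "integrable M (\<lambda>\<omega>. ln (?r \<omega>))" using int by (rule integrable_cong_AE_imp) (use eq in auto)
    show "AE \<omega> in M. 0 < ?r \<omega>" using pos by eventually_elim auto
  qed auto
  also have "expectation (\<lambda>\<omega>. ln (?r \<omega>)) = expectation (\<lambda>\<omega>. ln (atom_prob M A \<omega>) + ln (atom_prob M B \<omega>) - (ln (atom_prob M W \<omega>) + ln (atom_prob M Z \<omega>)))"
    by (rule integral_cong_AE) (use eq in auto)
  also have "\<dots> = - ent M A - ent M B + ent M W + ent M Z"
    using fA fB fW fZ by (simp add: ent_def finite_ent_def)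
  finally show "ent M W + ent M Z \<le> ent M A + ent M B" by simp
qed

lemma (in prob_space) ent_const: "ent M (\<lambda>_. c) = 0"
  by (simp add: ent_def atom_prob_def prob_space)

lemma (in prob_space) finite_ent_finite_range:
  fixes X :: "'a \<Rightarrow> 'b::countable"
  assumes X: "X \<in> measurable M (count_space UNIV)" and fin: "finite (X ` space M)"
  shows "finite_ent M X"
proof -
  note [measurable] = measurable_atom_prob[OF X]
  have "\<exists>C. \<forall>\<omega>\<in>space M. \<bar>ln (atom_prob M X \<omega>)\<bar> \<le> C"
  proof (intro exI ballI)
    fix \<omega> assume "\<omega> \<in> space M"
    then show "\<bar>ln (atom_prob M X \<omega>)\<bar> \<le> (\<Sum>b\<in>X ` space M. \<bar>ln (prob {\<omega>'\<in>space M. X \<omega>' = b})\<bar>)"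
      unfolding atom_prob_def using fin by (intro member_le_sum) auto
  qed
  then obtain C where "\<And>\<omega>. \<omega> \<in> space M \<Longrightarrow> \<bar>ln (atom_prob M X \<omega>)\<bar> \<le> C" by auto
  then show ?thesis unfolding finite_ent_def
    by (intro integrable_const_bound[where B=C]) auto
qed

text \<open>Markov's inequality bounds the exceptional probabilities by a geometric sequence, and
  Borel--Cantelli applies. No relation between different \<open>n\<close> is assumed, so
  \<open>r n\<close> may later be evaluated at a point shifted by an amount that depends on
  \<open>n\<close>.\<close>

lemma (in prob_space) eventually_le_exp:
  assumes [measurable]: "\<And>n::nat. r n \<in> borel_measurable M"
    and le: "\<And>n. (\<integral>\<^sup>+\<omega>. ennreal (r n \<omega>) \<partial>M) \<le> 1"
  shows "AE \<omega> in M. \<forall>\<delta>>0. eventually (\<lambda>n. r n \<omega> \<le> exp (\<delta> * real n)) sequentially"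
proof -
  have "AE \<omega> in M. eventually (\<lambda>n. \<omega> \<in> space M - {\<omega>\<in>space M. exp (1 / real (Suc k) * real n) < r n \<omega>}) sequentially" for k
  proof (rule borel_cantelli_AE1)
    let ?\<delta> = "1 / real (Suc k)"
    have *: "prob {\<omega>\<in>space M. exp (?\<delta> * real n) < r n \<omega>} \<le> exp (- ?\<delta>) ^ n" for n
    proof -
      let ?c = "ennreal (exp (- (?\<delta> * real n)))"
      have "emeasure M {\<omega>\<in>space M. exp (?\<delta> * real n) < r n \<omega>}
          \<le> emeasure M {\<omega>\<in>space M. 1 \<le> ?c * ennreal (r n \<omega>)}"
      proof (rule emeasure_mono)
        show "{\<omega>\<in>space M. exp (?\<delta> * real n) < r n \<omega>} \<subseteq> {\<omega>\<in>space M. 1 \<le> ?c * ennreal (r n \<omega>)}"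
        proof safe
          fix \<omega> assume *: "exp (?\<delta> * real n) < r n \<omega>"
          then have "1 \<le> exp (- (?\<delta> * real n)) * r n \<omega>" by (simp add: exp_minus field_simps)
          then show "1 \<le> ?c * ennreal (r n \<omega>)" 
            using * by (subst ennreal_mult'[symmetric]) (auto simp: ennreal_ge_1)
        qed
      qed measurable
      also have "\<dots> \<le> ?c * (\<integral>\<^sup>+\<omega>. ennreal (r n \<omega>) * indicator (space M) \<omega> \<partial>M)"
        by (rule nn_integral_Markov_inequality) auto
      also have "(\<integral>\<^sup>+\<omega>. ennreal (r n \<omega>) * indicator (space M) \<omega> \<partial>M) = (\<integral>\<^sup>+\<omega>. ennreal (r n \<omega>) \<partial>M)"
        by (intro nn_integral_cong) auto
      also have "?c * \<dots> \<le> ?c * 1" by (intro mult_left_mono le) auto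
      finally show ?thesis by (simp add: emeasure_eq_measure exp_of_nat_mult[symmetric] mult.commute)
    qed
    show "summable (\<lambda>n. prob {\<omega>\<in>space M. exp (?\<delta> * real n) < r n \<omega>})"
      by (rule summable_comparison_test'[OF summable_geometric[of "exp (- ?\<delta>)"]]) (use * in auto)
  qed (auto simp: emeasure_eq_measure)
  then have "AE \<omega> in M. \<forall>k. eventually (\<lambda>n. \<omega> \<in> space M - {\<omega>\<in>space M. exp (1 / real (Suc k) * real n) < r n \<omega>}) sequentially"
    by (simp add: AE_all_countable)
  then show ?thesis
  proof eventually_elim
    case (elim \<omega>)
    show ?case
    proof (intro allI impI)
      fix \<delta> :: real assume "\<delta> > 0"
      then obtain k where k: "1 / real (Suc k) < \<delta>" using nat_approx_posE by blast
      show "eventually (\<lambda>n. r n \<omega> \<le> exp (\<delta> * real n)) sequentially"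
        using elim[rule_format, of k]
      proof eventually_elim
        case (elim n)
        then have "r n \<omega> \<le> exp (1 / real (Suc k) * real n)" by auto
        also have "\<dots> \<le> exp (\<delta> * real n)" using k by (simp only: exp_le_cancel_iff) (intro mult_right_mono, auto)
        finally show ?case .
      qed
    qed
  qed
qed

section \<open>Convergence of conditional probabilities\<close>

definition eta :: "real \<Rightarrow> real" where "eta t = - t * ln t"

lemma eta_0 [simp]: "eta 0 = 0" and eta_1 [simp]: "eta 1 = 0"
  by (simp_all add: eta_def)

lemma borel_measurable_eta [measurable]: "eta \<in> borel_measurable borel"
  unfolding eta_def by measurable

lemma eta_nonneg: "0 \<le> t \<Longrightarrow> t \<le> 1 \<Longrightarrow> 0 \<le> eta t"
  by (cases "t = 0") (auto simp: eta_def mult_nonneg_nonpos)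

text \<open>The right-hand side is the tangent at \<open>c\<close> of the concave function
  \<open>eta\<close>.\<close>

lemma eta_le_tangent:
  assumes "0 \<le> t" "0 < c"
  shows "eta t \<le> c - t - t * ln c"
proof (cases "t = 0")
  case True then show ?thesis using assms by simp
next
  case False
  then have t: "t > 0" using assms by simp
  have "ln (c / t) \<le> c / t - 1" using t assms by (intro ln_le_minus_one) auto
  then have "t * ln (c / t) \<le> t * (c / t - 1)" using t by (intro mult_left_mono) auto
  then show ?thesis using t assms by (simp add: eta_def ln_div algebra_simps)
qed

lemma eta_le_1: "0 \<le> t \<Longrightarrow> eta t \<le> 1"
  using eta_le_tangent[of t 1] by simp

lemma continuous_on_eta: "continuous_on {0..} eta"
proof (rule continuous_on_eq_continuous_within[THEN iffD2], rule ballI)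
  fix t :: real assume "t \<in> {0..}"
  show "continuous (at t within {0..}) eta"
  proof (cases "t = 0")
    case False
    then have "t > 0" using \<open>t \<in> {0..}\<close> by auto
    then have "isCont (\<lambda>t. - t * ln t) t" by (intro continuous_intros) auto
    then have "isCont eta t" by (simp add: eta_def[abs_def])
    then show ?thesis by (rule continuous_at_imp_continuous_at_within)
  next
    case True
    have "(eta \<longlongrightarrow> 0) (at 0 within {0..})"
    proof (rule Lim_null_comparison)
      \<comment> \<open>Since \<open>ln x = - 2 * ln (1 / sqrt x)\<close>, the inequality
        \<open>ln y \<le> y - 1\<close> gives a bound that vanishes at 0.\<close>
      have "\<bar>eta x\<bar> \<le> 2 * sqrt x" if "0 < x" "x < 1" for x
      proof -
        have "eta x = 2 * x * ln (1 / sqrt x)" using that by (simp add: eta_def ln_div ln_sqrt)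
        also have "\<dots> \<le> 2 * x * (1 / sqrt x - 1)"
          using that by (intro mult_left_mono ln_le_minus_one) auto
        also have "\<dots> = 2 * (x / sqrt x) - 2 * x" by (simp add: algebra_simps)
        also have "\<dots> = 2 * sqrt x - 2 * x" using that by (simp only: real_div_sqrt less_imp_le)
        finally show ?thesis using that eta_nonneg[of x] by simp
      qed
      then show "\<forall>\<^sub>F x in at 0 within {0..}. norm (eta x) \<le> 2 * sqrt x"
        by (auto simp: eventually_at intro!: exI[of _ 1] simp: dist_real_def)
      show "((\<lambda>x::real. 2 * sqrt x) \<longlongrightarrow> 0) (at 0 within {0..})"
        by (auto intro!: tendsto_eq_intros)
    qed
    then show ?thesis using True by (simp add: continuous_within)
  qed
qed

text \<open>\<open>eta\<close> is not Lipschitz at 0. Uniform continuity handles small differences,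
  and for differences of at least \<open>d\<close> the bound \<open>eta \<le> 1\<close> suffices.
  The affine form of the estimate is what can be integrated.\<close>

lemma eta_modulus:
  assumes "\<epsilon> > 0"
  obtains C where "C \<ge> 0" "\<And>s t. s \<in> {0..1} \<Longrightarrow> t \<in> {0..1} \<Longrightarrow> \<bar>eta s - eta t\<bar> \<le> \<epsilon> + C * \<bar>s - t\<bar>"
proof -
  have "uniformly_continuous_on {0..1} eta"
    by (intro compact_uniformly_continuous continuous_on_subset[OF continuous_on_eta]) auto
  then obtain d where d: "d > 0" "\<And>s t. s \<in> {0..1} \<Longrightarrow> t \<in> {0..1} \<Longrightarrow> \<bar>s - t\<bar> < d \<Longrightarrow> \<bar>eta s - eta t\<bar> < \<epsilon>"
    using assms unfolding uniformly_continuous_on_def dist_real_def by metis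
  have "\<bar>eta s - eta t\<bar> \<le> \<epsilon> + (1 / d) * \<bar>s - t\<bar>" if st: "s \<in> {0..1}" "t \<in> {0..1}" for s t
  proof (cases "\<bar>s - t\<bar> < d")
    case True
    then have "\<bar>eta s - eta t\<bar> < \<epsilon>" using d st by auto
    then show ?thesis using d by (smt (verit) divide_nonneg_pos mult_nonneg_nonneg abs_ge_zero)
  next
    case False
    have "\<bar>eta s - eta t\<bar> \<le> 1"
      using eta_nonneg[of s] eta_nonneg[of t] eta_le_1[of s] eta_le_1[of t] st by auto
    also have "1 \<le> (1 / d) * \<bar>s - t\<bar>" using False d by (simp add: field_simps)
    finally show ?thesis using assms by simp
  qed
  then show thesis using d by (intro that[of "1/d"]) auto
qed

lemma (in prob_space) eta_L1_convergence:
  assumes p[measurable]: "\<And>k::nat. p k \<in> borel_measurable M" "q \<in> borel_measurable M"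
    and p01: "\<And>k. AE \<omega> in M. p k \<omega> \<in> {0..1}" and q01: "AE \<omega> in M. q \<omega> \<in> {0..1}"
    and lim: "(\<lambda>k. expectation (\<lambda>\<omega>. \<bar>p k \<omega> - q \<omega>\<bar>)) \<longlonglongrightarrow> 0"
  shows "(\<lambda>k. expectation (\<lambda>\<omega>. eta (p k \<omega>))) \<longlonglongrightarrow> expectation (\<lambda>\<omega>. eta (q \<omega>))"
proof (rule LIMSEQ_I)
  fix r :: real assume r: "r > 0"
  obtain C where C: "C \<ge> 0" "\<And>s t. s \<in> {0..1} \<Longrightarrow> t \<in> {0..1} \<Longrightarrow> \<bar>eta s - eta t\<bar> \<le> r/2 + C * \<bar>s - t\<bar>"
    using eta_modulus[of "r/2"] r by auto
  have b: "integrable M f" if "f \<in> borel_measurable M" "AE \<omega> in M. \<bar>f \<omega>\<bar> \<le> 1" for f :: "'a \<Rightarrow> real"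
    using that by (intro integrable_const_bound[where B=1]) auto
  have ie: "integrable M (\<lambda>\<omega>. eta (g \<omega>))" if [measurable]: "g \<in> borel_measurable M" and g: "AE \<omega> in M. g \<omega> \<in> {0..1}" for g
  proof (rule b)
    show "AE \<omega> in M. \<bar>eta (g \<omega>)\<bar> \<le> 1" using g
      by eventually_elim (use eta_nonneg eta_le_1 in auto)
  qed measurable
  have id: "integrable M (\<lambda>\<omega>. \<bar>p k \<omega> - q \<omega>\<bar>)" for k
  proof (rule b)
    show "AE \<omega> in M. \<bar>\<bar>p k \<omega> - q \<omega>\<bar>\<bar> \<le> 1" using p01[of k] q01 by eventually_elim auto
  qed measurable
  have "\<bar>expectation (\<lambda>\<omega>. eta (p k \<omega>)) - expectation (\<lambda>\<omega>. eta (q \<omega>))\<bar>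
      \<le> r/2 + C * expectation (\<lambda>\<omega>. \<bar>p k \<omega> - q \<omega>\<bar>)" for k
  proof -
    have "\<bar>expectation (\<lambda>\<omega>. eta (p k \<omega>)) - expectation (\<lambda>\<omega>. eta (q \<omega>))\<bar>
      = \<bar>expectation (\<lambda>\<omega>. eta (p k \<omega>) - eta (q \<omega>))\<bar>"
      by (subst Bochner_Integration.integral_diff) (rule ie[OF p(1) p01] ie[OF p(2) q01] refl)+
    also have "\<dots> \<le> expectation (\<lambda>\<omega>. \<bar>eta (p k \<omega>) - eta (q \<omega>)\<bar>)" by (rule integral_abs_bound)
    also have "\<dots> \<le> expectation (\<lambda>\<omega>. r/2 + C * \<bar>p k \<omega> - q \<omega>\<bar>)"
    proof (rule integral_mono_AE)
      show "AE \<omega> in M. \<bar>eta (p k \<omega>) - eta (q \<omega>)\<bar> \<le> r/2 + C * \<bar>p k \<omega> - q \<omega>\<bar>"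
        using p01[of k] q01 by eventually_elim (rule C(2))
    qed (intro Bochner_Integration.integrable_abs Bochner_Integration.integrable_diff Bochner_Integration.integrable_add
         ie[OF p(1) p01] ie[OF p(2) q01] integrable_const integrable_mult_right id)+
    also have "\<dots> = r/2 + C * expectation (\<lambda>\<omega>. \<bar>p k \<omega> - q \<omega>\<bar>)"
      using id by (simp add: prob_space)
    finally show ?thesis .
  qed
  moreover have "eventually (\<lambda>k. C * expectation (\<lambda>\<omega>. \<bar>p k \<omega> - q \<omega>\<bar>) < r/2) sequentially"
    using tendsto_mult_left[OF lim, of C] r by (intro order_tendstoD(2)[of _ "C * 0"]) auto
  ultimately show "\<exists>no. \<forall>n\<ge>no. norm (expectation (\<lambda>\<omega>. eta (p n \<omega>)) - expectation (\<lambda>\<omega>. eta (q \<omega>))) < r"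
    unfolding eventually_sequentially real_norm_def by (smt (verit) field_sum_of_halves)
qed

lemma refining_le:
  fixes X :: "nat \<Rightarrow> 'w \<Rightarrow> 'b"
  assumes chain: "\<And>k. \<exists>f. \<forall>\<omega>. X k \<omega> = f (X (Suc k) \<omega>)" and "k \<le> m"
  shows "\<exists>f. \<forall>\<omega>. X k \<omega> = f (X m \<omega>)"
  using \<open>k \<le> m\<close>
proof (induction m rule: dec_induct)
  case base show ?case by (rule exI[of _ id]) simp
next
  case (step m)
  then obtain f where f: "\<And>\<omega>. X k \<omega> = f (X m \<omega>)" by blast
  obtain g where "\<And>\<omega>. X m \<omega> = g (X (Suc m) \<omega>)" using chain[of m] by blast
  then show ?case using f by (intro exI[of _ "f \<circ> g"]) simp
qed

text \<open>The sets approximable by events of the refining sequence form a sigma-algebra containing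
  the generators; the chain condition brings finitely many approximants to a common index.\<close>

lemma (in prob_space) refining_approx_set:
  fixes X :: "nat \<Rightarrow> 'a \<Rightarrow> 'b::countable"
  assumes X[measurable]: "\<And>k. X k \<in> measurable M (count_space UNIV)"
    and chain: "\<And>k. \<exists>f. \<forall>\<omega>. X k \<omega> = f (X (Suc k) \<omega>)"
    and Gen: "\<And>G. G \<in> Gen \<Longrightarrow> \<exists>k S. G = {\<omega>\<in>space M. X k \<omega> \<in> S}"
    and A: "A \<in> sigma_sets (space M) Gen"
  shows "A \<in> sets M \<and> (\<forall>\<epsilon>>0. \<exists>k S. prob {\<omega>\<in>space M. (\<omega> \<in> A) \<noteq> (X k \<omega> \<in> S)} < \<epsilon>)"
  using A
proof (induction rule: sigma_sets.induct)
  case (Basic a)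
  then obtain k S where a: "a = {\<omega>\<in>space M. X k \<omega> \<in> S}" using Gen by blast
  show ?case
  proof (intro conjI allI impI)
    show "a \<in> events" unfolding a by measurable
    fix \<epsilon> :: real assume \<epsilon>: "\<epsilon> > 0"
    have e: "{\<omega>\<in>space M. (\<omega> \<in> a) \<noteq> (X k \<omega> \<in> S)} = {}" by (auto simp: a)
    show "\<exists>k S. prob {\<omega>\<in>space M. (\<omega> \<in> a) \<noteq> (X k \<omega> \<in> S)} < \<epsilon>"
      by (intro exI[of _ k] exI[of _ S]) (simp only: e measure_empty \<epsilon>)
  qed
next
  case Empty
  have "{\<omega>\<in>space M. (\<omega> \<in> {}) \<noteq> (X 0 \<omega> \<in> {})} = {}" by auto
  then show ?case by (auto intro!: exI[of _ 0] exI[of _ "{}"])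
next
  case (Compl a)
  then have *: "{\<omega>\<in>space M. (\<omega> \<in> space M - a) \<noteq> (X k \<omega> \<in> - S)} = {\<omega>\<in>space M. (\<omega> \<in> a) \<noteq> (X k \<omega> \<in> S)}" for k S
    by auto
  show ?case
  proof (intro conjI allI impI)
    fix \<epsilon> :: real assume "\<epsilon> > 0"
    then obtain k S where "prob {\<omega>\<in>space M. (\<omega> \<in> a) \<noteq> (X k \<omega> \<in> S)} < \<epsilon>" using Compl by blast
    then show "\<exists>k S. prob {\<omega>\<in>space M. (\<omega> \<in> space M - a) \<noteq> (X k \<omega> \<in> S)} < \<epsilon>"
      by (intro exI[of _ k] exI[of _ "- S"]) (simp only: *)
  qed (use Compl in auto)
next
  case (Union a)
  then have a[measurable]: "\<And>i. a i \<in> events" by blast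
  show ?case
  proof (intro conjI allI impI)
    show "(\<Union>i. a i) \<in> events" by measurable
    fix \<epsilon> :: real assume \<epsilon>: "\<epsilon> > 0"
    define U where "U n = (\<Union>i<n. a i)" for n
    have [measurable]: "U n \<in> events" for n unfolding U_def by measurable
    have "(\<lambda>n. prob (U n)) \<longlonglongrightarrow> prob (\<Union>n. U n)"
      by (intro finite_Lim_measure_incseq) (fastforce simp: incseq_def U_def)+
    moreover have "(\<Union>n. U n) = (\<Union>i. a i)" by (auto simp: U_def)
    ultimately have "eventually (\<lambda>n. prob (U n) > prob (\<Union>i. a i) - \<epsilon>/2) sequentially"
      using \<epsilon> by (intro order_tendstoD(1)) auto
    then obtain n where n: "prob (U n) > prob (\<Union>i. a i) - \<epsilon>/2" by (auto simp: eventually_sequentially)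
    \<comment> \<open>Half of \<epsilon> is spent on cutting the union after \<open>n\<close> sets,
      the other half is shared by the \<open>n\<close> approximations; \<open>Suc n\<close> avoids a
      division by zero.\<close>
    have "\<forall>i. \<exists>k S. prob {\<omega>\<in>space M. (\<omega> \<in> a i) \<noteq> (X k \<omega> \<in> S)} < \<epsilon> / (2 * real (Suc n))"
      using Union \<epsilon> by (auto simp del: of_nat_Suc)
    then obtain k S where kS: "\<And>i. prob {\<omega>\<in>space M. (\<omega> \<in> a i) \<noteq> (X (k i) \<omega> \<in> S i)} < \<epsilon> / (2 * real (Suc n))"
      by metis
    define m where "m = Max (k ` {..n})"
    have "k i \<le> m" if "i \<le> n" for i unfolding m_def using that by (intro Max_ge) auto
    then have "\<forall>i. \<exists>f. i \<le> n \<longrightarrow> (\<forall>\<omega>. X (k i) \<omega> = f (X m \<omega>))" using refining_le[of X, OF chain] by blast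
    then obtain f where f: "\<And>i \<omega>. i \<le> n \<Longrightarrow> X (k i) \<omega> = f i (X m \<omega>)" by metis
    define S' where "S' = (\<Union>i<n. f i -` S i)"
    have "prob {\<omega>\<in>space M. (\<omega> \<in> (\<Union>i. a i)) \<noteq> (X m \<omega> \<in> S')}
        \<le> prob (((\<Union>i. a i) - U n) \<union> (\<Union>i<n. {\<omega>\<in>space M. (\<omega> \<in> a i) \<noteq> (X (k i) \<omega> \<in> S i)}))"
    proof (rule finite_measure_mono)
      show "{\<omega>\<in>space M. (\<omega> \<in> (\<Union>i. a i)) \<noteq> (X m \<omega> \<in> S')}
        \<subseteq> ((\<Union>i. a i) - U n) \<union> (\<Union>i<n. {\<omega>\<in>space M. (\<omega> \<in> a i) \<noteq> (X (k i) \<omega> \<in> S i)})"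
        unfolding S'_def U_def using f by fastforce
    qed measurable
    also have "\<dots> \<le> prob ((\<Union>i. a i) - U n) + prob (\<Union>i<n. {\<omega>\<in>space M. (\<omega> \<in> a i) \<noteq> (X (k i) \<omega> \<in> S i)})"
      by (rule measure_Un_le) measurable
    also have "\<dots> \<le> (prob (\<Union>i. a i) - prob (U n)) + (\<Sum>i<n. prob {\<omega>\<in>space M. (\<omega> \<in> a i) \<noteq> (X (k i) \<omega> \<in> S i)})"
      by (intro add_mono measure_UNION_le, subst finite_measure_Diff) (auto simp: U_def)
    also have "(\<Sum>i<n. prob {\<omega>\<in>space M. (\<omega> \<in> a i) \<noteq> (X (k i) \<omega> \<in> S i)}) \<le> (\<Sum>i<n. \<epsilon> / (2 * real (Suc n)))"
      using kS by (intro sum_mono) (auto intro: less_imp_le)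
    also have "\<dots> \<le> \<epsilon> / 2" using \<epsilon> by (simp add: field_simps)
    finally have "prob {\<omega>\<in>space M. (\<omega> \<in> (\<Union>i. a i)) \<noteq> (X m \<omega> \<in> S')} < \<epsilon>" using n by simp
    then show "\<exists>k S. prob {\<omega>\<in>space M. (\<omega> \<in> (\<Union>i. a i)) \<noteq> (X k \<omega> \<in> S)} < \<epsilon>" by blast
  qed
qed

text \<open>The number of levels \<open>j / N\<close> with \<open>1 \<le> j \<le> N\<close> that do
  not exceed \<open>x\<close> is the floor of \<open>x * N\<close>. This reduces the approximation
  of a function to that of its superlevel sets.\<close>

lemma layer_cake_approx:
  assumes "x \<in> {0..1}" "N > 0"
  shows "\<bar>x - (\<Sum>j<N. of_bool (real (Suc j) / real N \<le> x)) / real N\<bar> \<le> 1 / real N"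
proof -
  define m where "m = nat \<lfloor>x * real N\<rfloor>"
  have m: "real m \<le> x * real N" "x * real N < real m + 1" unfolding m_def using assms by (auto simp: of_nat_nat)
  have "real m \<le> real N" using m(1) assms by (smt (verit) atLeastAtMost_iff mult_left_le_one_le of_nat_0_le_iff)
  then have "m \<le> N" by simp
  have "real (Suc j) / real N \<le> x \<longleftrightarrow> j < m" for j
  proof -
    have "real (Suc j) / real N \<le> x \<longleftrightarrow> real (Suc j) \<le> x * real N" using assms by (simp add: divide_le_eq)
    also have "\<dots> \<longleftrightarrow> Suc j \<le> m" unfolding m_def using assms by (subst le_nat_iff) (auto simp: le_floor_iff)
    finally show ?thesis by auto
  qed
  then have "(\<Sum>j<N. of_bool (real (Suc j) / real N \<le> x)) = (\<Sum>j<N. if j < m then 1 else (0::real))"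
    by (intro sum.cong) auto
  also have "\<dots> = real (card ({..<N} \<inter> {j. j < m}))" by (simp add: sum.If_cases)
  also have "{..<N} \<inter> {j. j < m} = {..<m}" using \<open>m \<le> N\<close> by auto
  finally have "(\<Sum>j<N. of_bool (real (Suc j) / real N \<le> x)) = real m" by simp
  moreover have "\<bar>x - real m / real N\<bar> = \<bar>x * real N - real m\<bar> / real N"
    using assms by (simp add: field_simps abs_divide[symmetric])
  ultimately show ?thesis using m assms by (auto intro!: divide_right_mono)
qed

text \<open>Finitely many superlevel sets are approximated separately; the average of the
  approximating indicators is a function of a single \<open>X m\<close> with values in the unit
  interval.\<close>

lemma (in prob_space) refining_approx_fun:
  fixes X :: "nat \<Rightarrow> 'a \<Rightarrow> 'b::countable" and p :: "'a \<Rightarrow> real"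
  assumes X[measurable]: "\<And>k. X k \<in> measurable M (count_space UNIV)"
    and chain: "\<And>k. \<exists>f. \<forall>\<omega>. X k \<omega> = f (X (Suc k) \<omega>)"
    and Gen: "\<And>G. G \<in> Gen \<Longrightarrow> \<exists>k S. G = {\<omega>\<in>space M. X k \<omega> \<in> S}"
    and p: "\<And>c. {\<omega>\<in>space M. c \<le> p \<omega>} \<in> sigma_sets (space M) Gen"
    and p01: "\<And>\<omega>. \<omega> \<in> space M \<Longrightarrow> p \<omega> \<in> {0..1}" and "\<epsilon> > 0"
  shows "\<exists>k v. expectation (\<lambda>\<omega>. \<bar>p \<omega> - v (X k \<omega>)\<bar>) < \<epsilon> \<and> (\<forall>b. v b \<in> {0..1})"
proof -
  have A: "{\<omega>\<in>space M. c \<le> p \<omega>} \<in> sets M" for c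
    using refining_approx_set[OF X chain Gen p] by blast
  have p_meas[measurable]: "p \<in> borel_measurable M" unfolding borel_measurable_iff_ge using A by blast
  obtain N0 where N0: "1 / real (Suc N0) < \<epsilon> / 2" using nat_approx_posE[of "\<epsilon>/2"] \<open>\<epsilon> > 0\<close> by auto
  define N where "N = Suc N0"
  have N: "N > 0" "1 / real N < \<epsilon>/2" using N0 by (auto simp: N_def)
  define D where "D j = {\<omega>\<in>space M. real (Suc j) / real N \<le> p \<omega>}" for j
  have D: "D j \<in> sigma_sets (space M) Gen" for j unfolding D_def by (rule p)
  have [measurable]: "D j \<in> sets M" for j unfolding D_def by (rule A)
  have "\<forall>j. \<exists>k S. prob {\<omega>\<in>space M. (\<omega> \<in> D j) \<noteq> (X k \<omega> \<in> S)} < \<epsilon> / 2"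
    using refining_approx_set[OF X chain Gen D] half_gt_zero[OF \<open>\<epsilon> > 0\<close>] by blast
  then obtain k S where kS: "\<And>j. prob {\<omega>\<in>space M. (\<omega> \<in> D j) \<noteq> (X (k j) \<omega> \<in> S j)} < \<epsilon> / 2" by metis
  define m where "m = Max (k ` {..N})"
  have "k i \<le> m" if "i \<le> N" for i unfolding m_def using that by (intro Max_ge) auto
  then have "\<forall>i. \<exists>f. i \<le> N \<longrightarrow> (\<forall>\<omega>. X (k i) \<omega> = f (X m \<omega>))" using refining_le[of X, OF chain] by blast
  then obtain f where f: "\<And>i \<omega>. i \<le> N \<Longrightarrow> X (k i) \<omega> = f i (X m \<omega>)" by metis
  define v where "v b = (\<Sum>j<N. of_bool (f j b \<in> S j)) / real N" for b
  have v01: "v b \<in> {0..1}" for b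
  proof -
    have "(\<Sum>j<N. of_bool (f j b \<in> S j)) \<le> (\<Sum>j<N. (1::real))" by (intro sum_mono) auto
    then show ?thesis using N by (auto simp: v_def sum_nonneg)
  qed
  define E where "E j = {\<omega>\<in>space M. (\<omega> \<in> D j) \<noteq> (X (k j) \<omega> \<in> S j)}" for j
  have [measurable]: "E j \<in> sets M" for j unfolding E_def by measurable
  have int_E: "integrable M (indicator (E j) :: 'a \<Rightarrow> real)" for j
    by (intro integrable_real_indicator) (auto simp: emeasure_eq_measure)
  have pw: "\<bar>p \<omega> - v (X m \<omega>)\<bar> \<le> 1 / real N + (\<Sum>j<N. indicator (E j) \<omega>) / real N" if \<omega>: "\<omega> \<in> space M" for \<omega>
  proof -
    have "\<bar>(\<Sum>j<N. of_bool (\<omega> \<in> D j)) - (\<Sum>j<N. of_bool (f j (X m \<omega>) \<in> S j) :: real)\<bar>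
       \<le> (\<Sum>j<N. \<bar>of_bool (\<omega> \<in> D j) - of_bool (f j (X m \<omega>) \<in> S j)\<bar>)"
      unfolding sum_subtractf[symmetric] by (rule sum_abs)
    also have "\<dots> = (\<Sum>j<N. indicator (E j) \<omega>)"
      using \<omega> by (intro sum.cong) (auto simp: indicator_def f E_def)
    finally have *: "\<bar>(\<Sum>j<N. of_bool (\<omega> \<in> D j)) / real N - v (X m \<omega>)\<bar> \<le> (\<Sum>j<N. indicator (E j) \<omega>) / real N"
      using N by (simp add: v_def diff_divide_distrib[symmetric] divide_right_mono abs_divide)
    have "\<bar>p \<omega> - (\<Sum>j<N. of_bool (\<omega> \<in> D j)) / real N\<bar> \<le> 1 / real N"
      using layer_cake_approx[OF p01[OF \<omega>] N(1)] \<omega> by (simp add: D_def)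
    with * show ?thesis by linarith
  qed
  have int_p: "integrable M (\<lambda>\<omega>. \<bar>p \<omega> - v (X m \<omega>)\<bar>)"
  proof (rule integrable_const_bound[where B=1])
    show "AE \<omega> in M. norm \<bar>p \<omega> - v (X m \<omega>)\<bar> \<le> 1"
    proof (rule AE_I2)
      fix \<omega> assume "\<omega> \<in> space M"
      then show "norm \<bar>p \<omega> - v (X m \<omega>)\<bar> \<le> 1" using p01[of \<omega>] v01[of "X m \<omega>"] by auto
    qed
    show "(\<lambda>\<omega>. \<bar>p \<omega> - v (X m \<omega>)\<bar>) \<in> borel_measurable M"
      using borel_measurable_discrete_comp[OF X[of m], of v] by measurable
  qed
  have "expectation (\<lambda>\<omega>. \<bar>p \<omega> - v (X m \<omega>)\<bar>)
      \<le> expectation (\<lambda>\<omega>. 1 / real N + (\<Sum>j<N. indicator (E j) \<omega>) / real N)"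
    using pw by (intro integral_mono int_p Bochner_Integration.integrable_add integrable_divide
      Bochner_Integration.integrable_sum int_E integrable_const)
  also have "\<dots> = 1 / real N + (\<Sum>j<N. prob (E j)) / real N"
    using int_E by (simp add: prob_space)
  also have "(\<Sum>j<N. prob (E j)) / real N \<le> (\<Sum>j<N. \<epsilon> / 2) / real N"
    using kS by (intro divide_right_mono sum_mono) (auto intro: less_imp_le simp: E_def)
  also have "\<dots> = \<epsilon> / 2" using N by simp
  finally show ?thesis using N(2) v01 by (intro exI[of _ m] exI[of _ v]) auto
qed

text \<open>The elementary conditional probability of \<open>A\<close> given the value of
  \<open>X\<close>; it is 0 on atoms of probability zero.\<close>

definition atom_cond_prob :: "'w measure \<Rightarrow> 'w set \<Rightarrow> ('w \<Rightarrow> 'b) \<Rightarrow> 'w \<Rightarrow> real" where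
  "atom_cond_prob M A X \<omega> = measure M {\<omega>'\<in>space M. \<omega>' \<in> A \<and> X \<omega>' = X \<omega>} / atom_prob M X \<omega>"

lemma measurable_atom_cond_prob:
  assumes "X \<in> measurable M (count_space UNIV)"
  shows "atom_cond_prob M A X \<in> borel_measurable M"
  unfolding atom_cond_prob_def atom_prob_def
  using borel_measurable_discrete_comp[OF assms, of "\<lambda>b. measure M {\<omega>'\<in>space M. \<omega>' \<in> A \<and> X \<omega>' = b} / measure M {\<omega>'\<in>space M. X \<omega>' = b}"]
  by simp

lemma (in prob_space) atom_cond_prob_bounds:
  fixes X :: "'a \<Rightarrow> 'b::countable"
  assumes X[measurable]: "X \<in> measurable M (count_space UNIV)"
  shows "atom_cond_prob M A X \<omega> \<in> {0..1}"
proof -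
  have "prob {\<omega>'\<in>space M. \<omega>' \<in> A \<and> X \<omega>' = X \<omega>} \<le> atom_prob M X \<omega>"
    unfolding atom_prob_def by (rule finite_measure_mono) auto
  then show ?thesis
    by (cases "atom_prob M X \<omega> = 0") (auto simp: atom_cond_prob_def atom_prob_nonneg divide_le_eq order.strict_iff_order[of 0])
qed

text \<open>The premise \<open>p_int\<close> says that the conditional expectation of
  \<open>p\<close> given \<open>X\<close> is the conditional probability of \<open>A\<close>.
  Conditioning contracts the L1 norm and leaves \<open>v (X \<omega>)\<close> unchanged; the
  argument runs atom by atom.\<close>

lemma (in prob_space) atom_cond_prob_contraction:
  fixes X :: "'a \<Rightarrow> 'b::countable"
  assumes X[measurable]: "X \<in> measurable M (count_space UNIV)"
    and p[measurable]: "p \<in> borel_measurable M" and p01: "\<And>\<omega>. \<omega> \<in> space M \<Longrightarrow> p \<omega> \<in> {0..1}"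
    and p_int: "\<And>b. expectation (\<lambda>\<omega>. p \<omega> * indicator {\<omega>\<in>space M. X \<omega> = b} \<omega>) = prob {\<omega>'\<in>space M. \<omega>' \<in> A \<and> X \<omega>' = b}"
    and v01: "\<And>b. v b \<in> {0..1}"
  shows "expectation (\<lambda>\<omega>. \<bar>atom_cond_prob M A X \<omega> - v (X \<omega>)\<bar>) \<le> expectation (\<lambda>\<omega>. \<bar>p \<omega> - v (X \<omega>)\<bar>)"
proof -
  note [measurable] = measurable_atom_cond_prob[OF X] borel_measurable_discrete_comp[OF X, of v]
  let ?B = "\<lambda>b. {\<omega>\<in>space M. X \<omega> = b}"
  define g where "g \<omega> = \<bar>p \<omega> - v (X \<omega>)\<bar>" for \<omega>
  have [measurable]: "g \<in> borel_measurable M" unfolding g_def by measurable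
  have g1: "\<bar>g \<omega>\<bar> \<le> 1" if "\<omega> \<in> space M" for \<omega> using p01[OF that] v01[of "X \<omega>"] by (auto simp: g_def)
  have int_g: "integrable M g" using g1 by (intro integrable_const_bound[where B=1]) auto
  have int_c: "integrable M (\<lambda>\<omega>. \<bar>atom_cond_prob M A X \<omega> - v (X \<omega>)\<bar>)"
  proof (rule integrable_const_bound[where B=1], rule AE_I2)
    fix \<omega> show "norm \<bar>atom_cond_prob M A X \<omega> - v (X \<omega>)\<bar> \<le> 1" using atom_cond_prob_bounds[OF X, of A \<omega>] v01[of "X \<omega>"] by auto
  qed measurable
  have atom: "ennreal (prob (?B b)) * ennreal \<bar>prob {\<omega>'\<in>space M. \<omega>' \<in> A \<and> X \<omega>' = b} / prob (?B b) - v b\<bar>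
      \<le> (\<integral>\<^sup>+\<omega>. ennreal (g \<omega>) * indicator (?B b) \<omega> \<partial>M)" for b
  proof -
    have i1: "integrable M (\<lambda>\<omega>. p \<omega> * indicator (?B b) \<omega>)"
      using p01 by (intro integrable_const_bound[where B=1]) (auto simp: indicator_def)
    have i2: "integrable M (\<lambda>\<omega>. g \<omega> * indicator (?B b) \<omega>)"
      using g1 by (intro integrable_const_bound[where B=1]) (auto simp: indicator_def)
    have i3: "integrable M (\<lambda>\<omega>. v b * indicator (?B b) \<omega>)"
      by (intro integrable_mult_right integrable_real_indicator) (auto simp: emeasure_eq_measure)
    have "prob {\<omega>'\<in>space M. \<omega>' \<in> A \<and> X \<omega>' = b} \<le> prob (?B b)" by (rule finite_measure_mono) auto
    then have z: "prob {\<omega>'\<in>space M. \<omega>' \<in> A \<and> X \<omega>' = b} = 0" if "prob (?B b) = 0" 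
      using that measure_nonneg[of M "{\<omega>'\<in>space M. \<omega>' \<in> A \<and> X \<omega>' = b}"] by linarith
    have "prob (?B b) * \<bar>prob {\<omega>'\<in>space M. \<omega>' \<in> A \<and> X \<omega>' = b} / prob (?B b) - v b\<bar>
       = \<bar>prob {\<omega>'\<in>space M. \<omega>' \<in> A \<and> X \<omega>' = b} - v b * prob (?B b)\<bar>"
    proof (cases "prob (?B b) = 0")
      case True then show ?thesis using z by simp
    next
      case False
      have "prob (?B b) * \<bar>prob {\<omega>'\<in>space M. \<omega>' \<in> A \<and> X \<omega>' = b} / prob (?B b) - v b\<bar>
        = \<bar>prob (?B b) * (prob {\<omega>'\<in>space M. \<omega>' \<in> A \<and> X \<omega>' = b} / prob (?B b) - v b)\<bar>"
        by (simp add: abs_mult)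
      then show ?thesis using False by (simp add: algebra_simps)
    qed
    also have "\<dots> = \<bar>expectation (\<lambda>\<omega>. p \<omega> * indicator (?B b) \<omega>) - expectation (\<lambda>\<omega>. v b * indicator (?B b) \<omega>)\<bar>"
      by (simp add: p_int)
    also have "\<dots> = \<bar>expectation (\<lambda>\<omega>. p \<omega> * indicator (?B b) \<omega> - v b * indicator (?B b) \<omega>)\<bar>"
      using i1 i3 by (subst Bochner_Integration.integral_diff) auto
    also have "\<dots> \<le> expectation (\<lambda>\<omega>. \<bar>p \<omega> * indicator (?B b) \<omega> - v b * indicator (?B b) \<omega>\<bar>)"
      by (rule integral_abs_bound)
    also have "\<dots> = expectation (\<lambda>\<omega>. g \<omega> * indicator (?B b) \<omega>)"
      by (rule Bochner_Integration.integral_cong) (auto simp: g_def indicator_def)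
    finally have "ennreal (prob (?B b) * \<bar>prob {\<omega>'\<in>space M. \<omega>' \<in> A \<and> X \<omega>' = b} / prob (?B b) - v b\<bar>)
      \<le> ennreal (expectation (\<lambda>\<omega>. g \<omega> * indicator (?B b) \<omega>))" by (rule ennreal_leI)
    also have "\<dots> = (\<integral>\<^sup>+\<omega>. ennreal (g \<omega> * indicator (?B b) \<omega>) \<partial>M)"
      using i2 by (subst nn_integral_eq_integral) (auto simp: g_def)
    also have "\<dots> = (\<integral>\<^sup>+\<omega>. ennreal (g \<omega>) * indicator (?B b) \<omega> \<partial>M)"
      by (intro nn_integral_cong) (auto simp: indicator_def)
    finally show ?thesis by (simp add: ennreal_mult)
  qed
  have "ennreal (expectation (\<lambda>\<omega>. \<bar>atom_cond_prob M A X \<omega> - v (X \<omega>)\<bar>)) = (\<integral>\<^sup>+\<omega>. ennreal \<bar>atom_cond_prob M A X \<omega> - v (X \<omega>)\<bar> \<partial>M)"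
    using int_c by (subst nn_integral_eq_integral) auto
  also have "\<dots> = (\<integral>\<^sup>+b. emeasure M (?B b) * ennreal \<bar>prob {\<omega>'\<in>space M. \<omega>' \<in> A \<and> X \<omega>' = b} / prob (?B b) - v b\<bar> \<partial>count_space UNIV)"
    unfolding atom_cond_prob_def atom_prob_def by (rule nn_integral_discrete[OF X])
  also have "\<dots> \<le> (\<integral>\<^sup>+b. (\<integral>\<^sup>+\<omega>. ennreal (g \<omega>) * indicator (?B b) \<omega> \<partial>M) \<partial>count_space UNIV)"
    using atom by (intro nn_integral_mono) (simp add: emeasure_eq_measure)
  also have "\<dots> = (\<integral>\<^sup>+b. emeasure (density M (\<lambda>\<omega>. ennreal (g \<omega>))) (space M \<inter> ?B b) \<partial>count_space UNIV)"
    by (intro nn_integral_cong) (simp add: emeasure_density Int_def)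
  also have "\<dots> = emeasure (density M (\<lambda>\<omega>. ennreal (g \<omega>))) (space M)"
    by (rule emeasure_sum_discrete[OF X]) auto
  also have "\<dots> = (\<integral>\<^sup>+\<omega>. ennreal (g \<omega>) \<partial>M)"
    by (simp add: emeasure_density nn_integral_set_ennreal cong: nn_integral_cong_simp)
  also have "\<dots> = ennreal (expectation g)"
    using int_g by (subst nn_integral_eq_integral) (auto simp: g_def)
  finally have "ennreal (expectation (\<lambda>\<omega>. \<bar>atom_cond_prob M A X \<omega> - v (X \<omega>)\<bar>)) \<le> ennreal (expectation g)" .
  then show ?thesis by (subst (asm) ennreal_le_iff) (auto simp: g_def[abs_def])
qed

text \<open>Levy's theorem in L1, without martingales: \<open>p\<close> is within
  \<open>r / 2\<close> of a function of some \<open>X m\<close>, and for \<open>k \<ge> m\<close>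
  the contraction keeps the conditional probability within \<open>r / 2\<close> of the same
  function.\<close>

lemma (in prob_space) atom_cond_prob_L1_convergence:
  fixes X :: "nat \<Rightarrow> 'a \<Rightarrow> 'b::countable" and p :: "'a \<Rightarrow> real"
  assumes X[measurable]: "\<And>k. X k \<in> measurable M (count_space UNIV)"
    and chain: "\<And>k. \<exists>f. \<forall>\<omega>. X k \<omega> = f (X (Suc k) \<omega>)"
    and Gen: "\<And>G. G \<in> Gen \<Longrightarrow> \<exists>k S. G = {\<omega>\<in>space M. X k \<omega> \<in> S}"
    and p: "\<And>c. {\<omega>\<in>space M. c \<le> p \<omega>} \<in> sigma_sets (space M) Gen"
    and p01: "\<And>\<omega>. \<omega> \<in> space M \<Longrightarrow> p \<omega> \<in> {0..1}"
    and p_int: "\<And>k b. expectation (\<lambda>\<omega>. p \<omega> * indicator {\<omega>\<in>space M. X k \<omega> = b} \<omega>) = prob {\<omega>'\<in>space M. \<omega>' \<in> A \<and> X k \<omega>' = b}"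
  shows "(\<lambda>k. expectation (\<lambda>\<omega>. \<bar>atom_cond_prob M A (X k) \<omega> - p \<omega>\<bar>)) \<longlonglongrightarrow> 0"
proof (rule LIMSEQ_I)
  fix r :: real assume "r > 0"
  have [measurable]: "p \<in> borel_measurable M"
    using refining_approx_set[OF X chain Gen p] unfolding borel_measurable_iff_ge by blast
  obtain m v where mv: "expectation (\<lambda>\<omega>. \<bar>p \<omega> - v (X m \<omega>)\<bar>) < r / 2" and v01: "\<And>b. v b \<in> {0..1}"
    using refining_approx_fun[OF X chain Gen p p01, of "r/2"] \<open>r > 0\<close> by auto
  show "\<exists>no. \<forall>n\<ge>no. norm (expectation (\<lambda>\<omega>. \<bar>atom_cond_prob M A (X n) \<omega> - p \<omega>\<bar>) - 0) < r"
  proof (intro exI[of _ m] allI impI)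
    fix k assume "k \<ge> m"
    then obtain f where f: "\<And>\<omega>. X m \<omega> = f (X k \<omega>)" using refining_le[of X, OF chain] by blast
    note [measurable] = measurable_atom_cond_prob[OF X] borel_measurable_discrete_comp[OF X[of m], of v]
    have ib: "integrable M (\<lambda>\<omega>. \<bar>a \<omega> - b \<omega>\<bar>)"
      if "a \<in> borel_measurable M" "b \<in> borel_measurable M" "\<And>\<omega>. \<omega> \<in> space M \<Longrightarrow> a \<omega> \<in> {0..1}" "\<And>\<omega>. b \<omega> \<in> {0..1}"
      for a b :: "'a \<Rightarrow> real"
    proof (rule integrable_const_bound[where B=1], rule AE_I2)
      fix \<omega> assume "\<omega> \<in> space M"
      then show "norm \<bar>a \<omega> - b \<omega>\<bar> \<le> 1" using that(3)[of \<omega>] that(4)[of \<omega>] by auto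
    qed (use that in measurable)
    have "expectation (\<lambda>\<omega>. \<bar>atom_cond_prob M A (X k) \<omega> - p \<omega>\<bar>)
      \<le> expectation (\<lambda>\<omega>. \<bar>atom_cond_prob M A (X k) \<omega> - v (X m \<omega>)\<bar> + \<bar>p \<omega> - v (X m \<omega>)\<bar>)"
    proof (rule integral_mono)
      have "integrable M (\<lambda>\<omega>. \<bar>p \<omega> - atom_cond_prob M A (X k) \<omega>\<bar>)"
        by (rule ib) (use p01 atom_cond_prob_bounds[OF X] in auto)
      then show "integrable M (\<lambda>\<omega>. \<bar>atom_cond_prob M A (X k) \<omega> - p \<omega>\<bar>)" by (simp add: abs_minus_commute)
      show "integrable M (\<lambda>\<omega>. \<bar>atom_cond_prob M A (X k) \<omega> - v (X m \<omega>)\<bar> + \<bar>p \<omega> - v (X m \<omega>)\<bar>)"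
        by (intro Bochner_Integration.integrable_add ib) (use p01 v01 atom_cond_prob_bounds[OF X] in auto)
    qed auto
    also have "\<dots> = expectation (\<lambda>\<omega>. \<bar>atom_cond_prob M A (X k) \<omega> - v (X m \<omega>)\<bar>) + expectation (\<lambda>\<omega>. \<bar>p \<omega> - v (X m \<omega>)\<bar>)"
      by (intro Bochner_Integration.integral_add ib) (use p01 v01 atom_cond_prob_bounds[OF X] in auto)
    also have "expectation (\<lambda>\<omega>. \<bar>atom_cond_prob M A (X k) \<omega> - v (X m \<omega>)\<bar>) \<le> expectation (\<lambda>\<omega>. \<bar>p \<omega> - v (X m \<omega>)\<bar>)"
      using atom_cond_prob_contraction[OF X _ p01 p_int, of "\<lambda>b. v (f b)" k] v01 by (simp add: f)
    finally have "expectation (\<lambda>\<omega>. \<bar>atom_cond_prob M A (X k) \<omega> - p \<omega>\<bar>) < r" using mv by simp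
    then show "norm (expectation (\<lambda>\<omega>. \<bar>atom_cond_prob M A (X k) \<omega> - p \<omega>\<bar>) - 0) < r" by simp
  qed
qed

section \<open>The shift and its ergodicity\<close>

text \<open>Negative shifts are needed as well: the two-sided window forces averages into the
  past.\<close>

definition sh :: "int \<Rightarrow> (int \<Rightarrow> 'a) \<Rightarrow> int \<Rightarrow> 'a" where
  "sh k \<omega> = (\<lambda>i. \<omega> (i + k))"

lemma sh_apply: "sh k \<omega> i = \<omega> (i + k)"
  by (simp add: sh_def)

lemma sh_sh [simp]: "sh j (sh k \<omega>) = sh (j + k) \<omega>"
  by (simp add: sh_def add.assoc)

lemma sh_0 [simp]: "sh 0 \<omega> = \<omega>"
  by (simp add: sh_def)

lemma left_shift_eq_sh: "left_shift = sh 1"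
  by (simp add: fun_eq_iff left_shift_def sh_apply)

lemma funpow_sh: "(sh k ^^ n) \<omega> = sh (int n * k) \<omega>"
  by (induction n) (auto simp: algebra_simps)

lemma funpow_left_shift: "(left_shift ^^ n) \<omega> = sh (int n) \<omega>"
  by (simp add: left_shift_eq_sh funpow_sh)

text \<open>\<open>coord_algebra\<close> as a measurable space (with zero measure), so that
  dependence on a set of coordinates becomes measurability.\<close>

definition coord_sigma :: "int set \<Rightarrow> (int \<Rightarrow> 'a::countable) measure" where
  "coord_sigma I = sigma UNIV {{\<omega>. \<omega> i = a} | i a. i \<in> I}"

lemma space_coord_sigma [simp]: "space (coord_sigma I) = UNIV"
  by (simp add: coord_sigma_def space_measure_of_conv)

lemma UNIV_coord_sigma [simp]: "UNIV \<in> sets (coord_sigma I)"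
  using sets.top[of "coord_sigma I"] by simp

lemma sets_coord_sigma: "sets (coord_sigma I) = coord_algebra I"
  by (simp add: coord_sigma_def coord_algebra_def sets_measure_of_conv)

lemma coord_algebra_mono: "I \<subseteq> J \<Longrightarrow> coord_algebra I \<subseteq> coord_algebra J"
  unfolding coord_algebra_def by (rule sigma_sets_mono') auto

lemma measurable_coord:
  assumes "i \<in> I"
  shows "(\<lambda>\<omega>. \<omega> i) \<in> measurable (coord_sigma I) (count_space (UNIV :: 'a::countable set))"
proof (subst measurable_count_space_eq_countable)
  show "(\<lambda>\<omega>. \<omega> i) \<in> space (coord_sigma I) \<rightarrow> UNIV \<and>
    (\<forall>a\<in>UNIV. (\<lambda>\<omega>. \<omega> i) -` {a} \<inter> space (coord_sigma I) \<in> sets (coord_sigma I))"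
    using assms by (auto simp: sets_coord_sigma coord_algebra_def vimage_def intro!: sigma_sets.Basic)
qed auto

lemma measurable_coord_sigmaI:
  fixes f :: "'w \<Rightarrow> int \<Rightarrow> 'a::countable"
  assumes "\<And>i. i \<in> I \<Longrightarrow> (\<lambda>x. f x i) \<in> measurable N (count_space UNIV)"
  shows "f \<in> measurable N (coord_sigma I)"
  unfolding coord_sigma_def
proof (rule measurable_measure_of)
  fix y :: "(int \<Rightarrow> 'a) set" assume "y \<in> {{\<omega>. \<omega> i = a} | i a. i \<in> I}"
  then obtain i a where "i \<in> I" "y = {\<omega>. \<omega> i = a}" by auto
  then have "f -` y \<inter> space N = (\<lambda>x. f x i) -` {a} \<inter> space N" by auto
  then show "f -` y \<inter> space N \<in> sets N"
    using measurable_sets[OF assms[OF \<open>i \<in> I\<close>], of "{a}"] by simp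
qed auto

lemma measurable_sh_coord_sigma:
  assumes "\<And>i. i \<in> I \<Longrightarrow> i + k \<in> J"
  shows "sh k \<in> measurable (coord_sigma J) (coord_sigma I)"
  by (rule measurable_coord_sigmaI) (use assms in \<open>auto simp: sh_apply intro: measurable_coord\<close>)

lemma sets_seq_space: "sets (seq_space :: (int \<Rightarrow> 'a::countable) measure) = coord_algebra UNIV"
proof
  show "sets (seq_space :: (int \<Rightarrow> 'a) measure) \<subseteq> coord_algebra UNIV"
  proof -
    have "(\<lambda>\<omega>. \<omega>) \<in> measurable (coord_sigma UNIV) (seq_space :: (int \<Rightarrow> 'a) measure)"
      unfolding seq_space_def by (rule measurable_PiM_single') (auto intro: measurable_coord)
    then show ?thesis
      by (auto simp: measurable_def sets_coord_sigma[symmetric] vimage_def seq_space_def space_PiM)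
  qed
  show "coord_algebra UNIV \<subseteq> sets (seq_space :: (int \<Rightarrow> 'a) measure)"
  proof -
    have "(\<lambda>\<omega>. \<omega>) \<in> measurable (seq_space :: (int \<Rightarrow> 'a) measure) (coord_sigma UNIV)"
      unfolding seq_space_def by (rule measurable_coord_sigmaI) (rule measurable_component_singleton, simp)
    then show ?thesis
      by (auto simp: measurable_def sets_coord_sigma[symmetric] vimage_def seq_space_def space_PiM)
  qed
qed

definition itinerary :: "((int \<Rightarrow> 'a) \<Rightarrow> 'b) \<Rightarrow> nat \<Rightarrow> (int \<Rightarrow> 'a) \<Rightarrow> 'b list" where
  "itinerary X n \<omega> = map (\<lambda>j. X (sh (int j) \<omega>)) [0..<n]"

abbreviation (input) coord0 :: "(int \<Rightarrow> 'a) \<Rightarrow> 'a" where "coord0 \<equiv> (\<lambda>\<omega>. \<omega> 0)"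

lemma itinerary_eq_iff: "itinerary X n \<omega> = itinerary X n \<omega>' \<longleftrightarrow> (\<forall>j<n. X (sh (int j) \<omega>) = X (sh (int j) \<omega>'))"
  by (auto simp: itinerary_def)

lemma length_itinerary [simp]: "length (itinerary X n \<omega>) = n" by (simp add: itinerary_def)

lemma nth_itinerary [simp]: "j < n \<Longrightarrow> itinerary X n \<omega> ! j = X (sh (int j) \<omega>)" by (simp add: itinerary_def)

lemma measurable_discrete_list:
  fixes X :: "nat \<Rightarrow> 'w \<Rightarrow> 'b::countable"
  assumes "\<And>j. X j \<in> measurable M (count_space UNIV)"
  shows "(\<lambda>\<omega>. map (\<lambda>j. X j \<omega>) [0..<n]) \<in> measurable M (count_space UNIV)"
proof (induction n)
  case (Suc n)
  have "(\<lambda>\<omega>. (map (\<lambda>j. X j \<omega>) [0..<n], X n \<omega>)) \<in> measurable M (count_space UNIV)"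
    by (rule measurable_discrete_Pair[OF Suc assms])
  from measurable_discrete_comp[OF this, of "\<lambda>(w, b). w @ [b]"] show ?case by simp
qed simp

definition window :: "nat \<Rightarrow> (int \<Rightarrow> 'a) \<Rightarrow> 'a list" where
  "window m \<omega> = map (\<lambda>j. \<omega> (int j - int m)) [0..<2 * m + 1]"

lemma window_eq_itinerary: "window m \<omega> = itinerary coord0 (2 * m + 1) (sh (- int m) \<omega>)"
  by (simp add: window_def itinerary_def sh_apply)

lemma window_refines: "\<exists>f. \<forall>\<omega>. window m \<omega> = f (window (Suc m) \<omega>)"
  by (rule exI[of _ "\<lambda>w. map (\<lambda>j. w ! (j + 1)) [0..<2 * m + 1]"]) (auto simp: window_def nth_append simp del: upt_Suc)

lemma coord_event_window: "\<exists>m S. {\<omega>. \<omega> i = a} = {\<omega>. window m \<omega> \<in> S}"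
proof -
  have "window (nat \<bar>i\<bar>) \<omega> ! nat (i + \<bar>i\<bar>) = \<omega> i" for \<omega> :: "int \<Rightarrow> 'a"
    by (auto simp: window_def simp del: upt_Suc)
  then show ?thesis by (intro exI[of _ "nat \<bar>i\<bar>"] exI[of _ "{w. w ! nat (i + \<bar>i\<bar>) = a}"]) auto
qed

lemma measurable_window:
  "window m \<in> measurable (coord_sigma {- int m..int m}) (count_space (UNIV :: 'a::countable list set))"
proof -
  \<comment> \<open>The list lemma asks for measurability of every entry, also beyond the end of the
    window; the default value covers those.\<close>
  have "(\<lambda>\<omega>. map (\<lambda>j. if j < 2 * m + 1 then \<omega> (int j - int m) else undefined) [0..<2 * m + 1])
    \<in> measurable (coord_sigma {- int m..int m}) (count_space (UNIV :: 'a list set))"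
  proof (rule measurable_discrete_list)
    fix j
    show "(\<lambda>\<omega>. if j < 2 * m + 1 then \<omega> (int j - int m) else undefined)
        \<in> measurable (coord_sigma {- int m..int m}) (count_space (UNIV :: 'a set))"
      by (cases "j < 2 * m + 1") (auto intro: measurable_coord)
  qed
  also have "(\<lambda>\<omega>. map (\<lambda>j. if j < 2 * m + 1 then \<omega> (int j - int m) else undefined) [0..<2 * m + 1]) = window m"
    by (auto simp: window_def fun_eq_iff)
  finally show ?thesis .
qed

locale stationary = prob_space P for P :: "(int \<Rightarrow> 'a::countable) measure" +
  assumes sets_P: "sets P = sets seq_space"
    and invariant: "distr P P left_shift = P"
begin

lemma sets_P_coord: "sets P = coord_algebra UNIV"
  by (simp add: sets_P sets_seq_space)

lemma space_P [simp]: "space P = UNIV"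
  using sets_eq_imp_space_eq[OF sets_P] by (simp add: seq_space_def space_PiM)

lemma prob_UNIV [simp]: "prob UNIV = 1" and emeasure_P_UNIV [simp]: "emeasure P UNIV = 1"
  using prob_space emeasure_space_1 by simp_all

lemma UNIV_events [simp]: "UNIV \<in> events"
  using sets.top[of P] by simp

lemma sets_coord_algebra: "coord_algebra I \<subseteq> events"
  using coord_algebra_mono[of I UNIV] by (simp add: sets_P_coord)

lemma subalg_coord: "subalgebra P (coord_sigma I)"
  using sets_coord_algebra by (simp add: subalgebra_def sets_coord_sigma)

lemma measurable_from_coord_sigma: "f \<in> measurable (coord_sigma I) N \<Longrightarrow> f \<in> measurable P N"
  by (rule measurable_from_subalg[OF subalg_coord])

lemma measurable_P_cong: "measurable N P = measurable N (coord_sigma UNIV)"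
  by (rule measurable_cong_sets) (auto simp: sets_P_coord sets_coord_sigma)

lemma measurable_sh [measurable]: "sh k \<in> measurable P P"
  unfolding measurable_P_cong
  by (rule measurable_from_coord_sigma[of _ UNIV]) (rule measurable_sh_coord_sigma, simp)

lemma measurable_coord0: "coord0 \<in> measurable P (count_space UNIV)"
  by (rule measurable_from_coord_sigma[OF measurable_coord[of 0 UNIV]]) simp

lemma distr_sh: "distr P P (sh k) = P"
proof -
  have nat: "distr P P (sh (int n)) = P" for n
  proof (induction n)
    case 0
    have "sh 0 = (\<lambda>\<omega>::int \<Rightarrow> 'a. \<omega>)" by (simp add: fun_eq_iff sh_apply)
    then show ?case by (simp add: distr_id)
  next
    case (Suc n)
    have "distr P P (sh (int (Suc n))) = distr (distr P P (sh (int n))) P left_shift"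
      unfolding left_shift_eq_sh by (subst distr_distr) (auto simp: comp_def add.commute)
    then show ?case by (simp add: Suc invariant)
  qed
  show ?thesis
  proof (cases "k \<ge> 0")
    case True then show ?thesis using nat[of "nat k"] by simp
  next
    case False
    then have k: "distr P P (sh (- k)) = P" using nat[of "nat (- k)"] by simp
    have "distr P P (sh k) = distr (distr P P (sh (- k))) P (sh k)" by (simp add: k)
    also have "\<dots> = distr P P (\<lambda>\<omega>. \<omega>)" by (subst distr_distr) (auto simp: comp_def)
    finally show ?thesis by (simp add: distr_id)
  qed
qed

lemma AE_sh: assumes "AE \<omega> in P. Q \<omega>" shows "AE \<omega> in P. Q (sh k \<omega>)"
proof -
  have "AE \<omega> in distr P P (sh k). Q \<omega>" using assms unfolding distr_sh .
  then show ?thesis by (rule AE_distrD[OF measurable_sh])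
qed

lemma nn_integral_sh: "f \<in> borel_measurable P \<Longrightarrow> (\<integral>\<^sup>+\<omega>. f (sh k \<omega>) \<partial>P) = (\<integral>\<^sup>+\<omega>. f \<omega> \<partial>P)"
  using nn_integral_distr[OF measurable_sh, of f k] by (simp add: distr_sh)

lemma integral_sh: "f \<in> borel_measurable P \<Longrightarrow> (\<integral>\<omega>. f (sh k \<omega>) \<partial>P) = (\<integral>\<omega>. f \<omega> \<partial>P)"
  for f :: "_ \<Rightarrow> real"
  using integral_distr[OF measurable_sh, of f k] by (simp add: distr_sh)

lemma integrable_sh: "integrable P f \<Longrightarrow> integrable P (\<lambda>\<omega>. f (sh k \<omega>))"
  for f :: "_ \<Rightarrow> real"
  using integrable_distr[OF measurable_sh, of k f] by (simp add: distr_sh)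

lemma prob_sh: "A \<in> events \<Longrightarrow> prob {\<omega>. sh k \<omega> \<in> A} = prob A"
  using measure_distr[OF measurable_sh, of A k] by (simp add: distr_sh vimage_def)

lemma sets_sh_coord_algebra:
  assumes "A \<in> coord_algebra I" "\<And>i. i \<in> I \<Longrightarrow> i + k \<in> J"
  shows "{\<omega>. sh k \<omega> \<in> A} \<in> coord_algebra J"
  using measurable_sets[OF measurable_sh_coord_sigma[OF assms(2), where I=I], of A] assms(1)
  by (simp add: sets_coord_sigma vimage_def)

lemma measurable_itinerary:
  fixes X :: "(int \<Rightarrow> 'a) \<Rightarrow> 'b::countable"
  assumes X: "X \<in> measurable P (count_space UNIV)"
  shows "itinerary X n \<in> measurable P (count_space UNIV)"
  unfolding itinerary_def[abs_def]
  by (rule measurable_discrete_list) (rule measurable_compose[OF measurable_sh X])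

lemma atom_prob_sh:
  fixes X :: "(int \<Rightarrow> 'a) \<Rightarrow> 'b::countable"
  assumes X[measurable]: "X \<in> measurable P (count_space UNIV)"
  shows "atom_prob P (\<lambda>\<omega>. X (sh k \<omega>)) \<omega> = atom_prob P X (sh k \<omega>)"
proof -
  have "{\<omega>'. X \<omega>' = X (sh k \<omega>)} = {\<omega>'\<in>space P. X \<omega>' = X (sh k \<omega>)}" by simp
  also have "\<dots> \<in> events" by measurable
  finally show ?thesis using prob_sh[of "{\<omega>'. X \<omega>' = X (sh k \<omega>)}" k] by (simp add: atom_prob_def)
qed

lemma finite_ent_sh:
  fixes X :: "(int \<Rightarrow> 'a) \<Rightarrow> 'b::countable"
  assumes X: "X \<in> measurable P (count_space UNIV)"
  shows "finite_ent P X \<Longrightarrow> finite_ent P (\<lambda>\<omega>. X (sh k \<omega>))"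
  unfolding finite_ent_def atom_prob_sh[OF X] by (rule integrable_sh)

lemma ent_sh:
  fixes X :: "(int \<Rightarrow> 'a) \<Rightarrow> 'b::countable"
  assumes X: "X \<in> measurable P (count_space UNIV)"
  shows "ent P (\<lambda>\<omega>. X (sh k \<omega>)) = ent P X"
  unfolding ent_def atom_prob_sh[OF X] using measurable_atom_prob[OF X] by (subst integral_sh) auto

text \<open>\<open>enn2real\<close> sends infinity to 0; bounds in terms of \<open>phi k\<close>
  therefore presuppose that \<open>phi_mix P k\<close> is finite.\<close>

definition phi :: "nat \<Rightarrow> real" where "phi k = enn2real (phi_mix P k)"

lemma phi_bound:
  assumes fin: "phi_mix P k < \<infinity>" and G: "\<Gamma> \<in> coord_algebra {..m}" and D: "\<Delta> \<in> coord_algebra {m + int k..}"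
  shows "\<bar>prob (\<Gamma> \<inter> \<Delta>) - prob \<Gamma> * prob \<Delta>\<bar> \<le> phi k * prob \<Gamma>"
proof (cases "prob \<Gamma> = 0")
  case True
  have "prob (\<Gamma> \<inter> \<Delta>) \<le> prob \<Gamma>" using G sets_coord_algebra by (intro finite_measure_mono) auto
  then show ?thesis using True measure_nonneg[of P "\<Gamma> \<inter> \<Delta>"] by simp
next
  case False
  have "ennreal \<bar>prob (\<Gamma> \<inter> \<Delta>) / prob \<Gamma> - prob \<Delta>\<bar> \<le> phi_dep P (coord_algebra {..m}) (coord_algebra {m + int k..})"
    unfolding phi_dep_def using False G D by (intro SUP_upper2[of "(\<Gamma>, \<Delta>)"]) auto
  also have "\<dots> \<le> phi_mix P k" unfolding phi_mix_def by (rule SUP_upper) simp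
  also have "\<dots> = ennreal (phi k)" unfolding phi_def using fin by simp
  finally have "\<bar>prob (\<Gamma> \<inter> \<Delta>) / prob \<Gamma> - prob \<Delta>\<bar> \<le> phi k"
    by (subst (asm) ennreal_le_iff) (auto simp: phi_def)
  then have "\<bar>prob (\<Gamma> \<inter> \<Delta>) / prob \<Gamma> - prob \<Delta>\<bar> * prob \<Gamma> \<le> phi k * prob \<Gamma>"
    by (intro mult_right_mono) auto
  also have "\<bar>prob (\<Gamma> \<inter> \<Delta>) / prob \<Gamma> - prob \<Delta>\<bar> * prob \<Gamma> = \<bar>(prob (\<Gamma> \<inter> \<Delta>) / prob \<Gamma> - prob \<Delta>) * prob \<Gamma>\<bar>"
    by (simp add: abs_mult)
  also have "\<dots> = \<bar>prob (\<Gamma> \<inter> \<Delta>) - prob \<Gamma> * prob \<Delta>\<bar>" using False by (simp add: algebra_simps)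
  finally show ?thesis .
qed

text \<open>The quantity measured by \<phi> is \<open>prob \<Delta>\<close> times the one measured
  by \<psi>.\<close>

lemma phi_mix_le_psi_mix: "phi_mix P k \<le> psi_mix P k"
  unfolding phi_mix_def psi_mix_def
proof (rule SUP_mono)
  fix m :: int
  have "phi_dep P (coord_algebra {..m}) (coord_algebra {m + int k..})
    \<le> psi_dep P (coord_algebra {..m}) (coord_algebra {m + int k..})"
    unfolding phi_dep_def
  proof (rule SUP_least, clarify)
    fix \<Gamma> \<Delta> :: "(int \<Rightarrow> 'a) set" assume GD: "\<Gamma> \<in> coord_algebra {..m}" "\<Delta> \<in> coord_algebra {m + int k..}" "prob \<Gamma> \<noteq> 0"
    show "ennreal \<bar>prob (\<Gamma> \<inter> \<Delta>) / prob \<Gamma> - prob \<Delta>\<bar> \<le> psi_dep P (coord_algebra {..m}) (coord_algebra {m + int k..})"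
    proof (cases "prob \<Delta> = 0")
      case True
      have "prob (\<Gamma> \<inter> \<Delta>) \<le> prob \<Delta>" using GD sets_coord_algebra by (intro finite_measure_mono) auto
      then have "prob (\<Gamma> \<inter> \<Delta>) = 0" using True measure_nonneg[of P "\<Gamma> \<inter> \<Delta>"] by linarith
      then show ?thesis using True by simp
    next
      case False
      have "\<bar>prob (\<Gamma> \<inter> \<Delta>) / prob \<Gamma> - prob \<Delta>\<bar> = prob \<Delta> * \<bar>prob (\<Gamma> \<inter> \<Delta>) / (prob \<Gamma> * prob \<Delta>) - 1\<bar>"
      proof -
        have "prob \<Delta> * \<bar>prob (\<Gamma> \<inter> \<Delta>) / (prob \<Gamma> * prob \<Delta>) - 1\<bar> = \<bar>prob \<Delta> * (prob (\<Gamma> \<inter> \<Delta>) / (prob \<Gamma> * prob \<Delta>) - 1)\<bar>"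
          by (simp add: abs_mult)
        also have "prob \<Delta> * (prob (\<Gamma> \<inter> \<Delta>) / (prob \<Gamma> * prob \<Delta>) - 1) = prob (\<Gamma> \<inter> \<Delta>) / prob \<Gamma> - prob \<Delta>"
          using False GD by (simp add: field_simps)
        finally show ?thesis by simp
      qed
      also have "\<dots> \<le> 1 * \<bar>prob (\<Gamma> \<inter> \<Delta>) / (prob \<Gamma> * prob \<Delta>) - 1\<bar>" by (intro mult_right_mono) auto
      finally have "ennreal \<bar>prob (\<Gamma> \<inter> \<Delta>) / prob \<Gamma> - prob \<Delta>\<bar> \<le> ennreal \<bar>prob (\<Gamma> \<inter> \<Delta>) / (prob \<Gamma> * prob \<Delta>) - 1\<bar>"
        by (intro ennreal_leI) simp
      also have "\<dots> \<le> psi_dep P (coord_algebra {..m}) (coord_algebra {m + int k..})"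
        unfolding psi_dep_def using False GD by (intro SUP_upper2[of "(\<Gamma>, \<Delta>)"]) auto
      finally show ?thesis .
    qed
  qed
  then show "\<exists>n\<in>UNIV. phi_dep P (coord_algebra {..m}) (coord_algebra {m + int k..})
    \<le> psi_dep P (coord_algebra {..n}) (coord_algebra {n + int k..})" by blast
qed

end

section \<open>Monotonicity and decay of the dependence coefficients\<close>

lemma phi_mix_antimono:
  assumes "j \<le> k" shows "phi_mix P k \<le> phi_mix P j"
  unfolding phi_mix_def
proof (rule SUP_mono)
  fix m :: int
  have "coord_algebra {m + int k..} \<subseteq> (coord_algebra {m + int j..} :: (int \<Rightarrow> 'a) set set)"
    using assms by (intro coord_algebra_mono) auto
  then have "phi_dep P (coord_algebra {..m}) (coord_algebra {m + int k..})
    \<le> phi_dep P (coord_algebra {..m}) (coord_algebra {m + int j..})"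
    unfolding phi_dep_def by (intro SUP_subset_mono) auto
  then show "\<exists>n\<in>UNIV. phi_dep P (coord_algebra {..m}) (coord_algebra {m + int k..})
    \<le> phi_dep P (coord_algebra {..n}) (coord_algebra {n + int j..})" by blast
qed

lemma psi_mix_antimono:
  assumes "j \<le> k" shows "psi_mix P k \<le> psi_mix P j"
  unfolding psi_mix_def
proof (rule SUP_mono)
  fix m :: int
  have "coord_algebra {m + int k..} \<subseteq> (coord_algebra {m + int j..} :: (int \<Rightarrow> 'a) set set)"
    using assms by (intro coord_algebra_mono) auto
  then have "psi_dep P (coord_algebra {..m}) (coord_algebra {m + int k..})
    \<le> psi_dep P (coord_algebra {..m}) (coord_algebra {m + int j..})"
    unfolding psi_dep_def by (intro SUP_subset_mono) auto
  then show "\<exists>n\<in>UNIV. psi_dep P (coord_algebra {..m}) (coord_algebra {m + int k..})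
    \<le> psi_dep P (coord_algebra {..n}) (coord_algebra {n + int j..})" by blast
qed

text \<open>For a decreasing sequence, \<open>k * f k\<close> is at most the sum of the terms at
  \<open>1, ..., k\<close>, so mere summability yields a rate of decay. Everything starts at index 1
  because the coefficient at 0 may be infinite.\<close>

lemma antimono_summable_bounds:
  fixes f :: "nat \<Rightarrow> ennreal"
  assumes anti: "\<And>j k. j \<le> k \<Longrightarrow> f k \<le> f j" and sum: "(\<Sum>n. f (Suc n)) < \<infinity>"
  shows "f (Suc n) < \<infinity>" "summable (\<lambda>n. enn2real (f (Suc n)))"
    "\<exists>C>0. \<forall>k\<ge>1. enn2real (f k) \<le> C / real k"
proof -
  have fin: "f (Suc n) < \<infinity>" for n
  proof -
    have "f (Suc n) \<le> (\<Sum>n. f (Suc n))" using sum_le_suminf[of "\<lambda>n. f (Suc n)" "{n}"] by auto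
    then show ?thesis using sum by (rule le_less_trans)
  qed
  then show "f (Suc n) < \<infinity>" .
  have eq: "f (Suc n) = ennreal (enn2real (f (Suc n)))" for n using fin[of n] by simp
  have "(\<Sum>n. ennreal (enn2real (f (Suc n)))) < \<infinity>" using sum by (simp only: eq[symmetric])
  then show s: "summable (\<lambda>n. enn2real (f (Suc n)))"
    by (intro summable_suminf_not_top) auto
  define S where "S = (\<Sum>n. enn2real (f (Suc n)))"
  have "enn2real (f k) \<le> (S + 1) / real k" if "k \<ge> 1" for k
  proof -
    have "real k * enn2real (f k) = (\<Sum>n<k. enn2real (f k))" by simp
    also have "\<dots> \<le> (\<Sum>n<k. enn2real (f (Suc n)))"
    proof (rule sum_mono)
      fix n assume "n \<in> {..<k}"
      then show "enn2real (f k) \<le> enn2real (f (Suc n))"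
        using anti[of "Suc n" k] fin[of n] by (intro enn2real_mono) auto
    qed
    also have "\<dots> \<le> S" unfolding S_def by (intro sum_le_suminf s) auto
    finally show ?thesis using that by (simp add: field_simps)
  qed
  moreover have "S \<ge> 0" unfolding S_def by (intro suminf_nonneg s) auto
  ultimately show "\<exists>C>0. \<forall>k\<ge>1. enn2real (f k) \<le> C / real k" by (intro exI[of _ "S + 1"]) auto
qed

section \<open>Ergodicity and two-sided Birkhoff averages\<close>

locale mixing = stationary P for P :: "(int \<Rightarrow> 'a::countable) measure" +
  assumes phi_sum: "(\<Sum>n. phi_mix P (Suc n)) < \<infinity>"
begin

lemma phi_fin: "k \<ge> 1 \<Longrightarrow> phi_mix P k < \<infinity>"
  using antimono_summable_bounds(1)[of "phi_mix P", OF phi_mix_antimono phi_sum, of "k - 1"] by simp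

lemma phi_nonneg: "phi k \<ge> 0" by (simp add: phi_def)

lemma summable_phi: "summable (\<lambda>n. phi (Suc n))"
  unfolding phi_def by (rule antimono_summable_bounds(2)[of "phi_mix P", OF phi_mix_antimono phi_sum])

lemma phi_small: "\<epsilon> > 0 \<Longrightarrow> \<exists>k\<ge>1. phi k < \<epsilon>"
proof -
  assume "\<epsilon> > 0"
  then have "eventually (\<lambda>n. phi (Suc n) < \<epsilon>) sequentially"
    using summable_LIMSEQ_zero[OF summable_phi] by (intro order_tendstoD(2)) auto
  then show ?thesis by (auto simp: eventually_sequentially)
qed

lemma cylinder_approx:
  assumes A: "A \<in> events" and "\<epsilon> > 0"
  shows "\<exists>m::nat. \<exists>B\<in>coord_algebra {- int m..int m}. prob {\<omega>. (\<omega> \<in> A) \<noteq> (\<omega> \<in> B)} < \<epsilon>"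
proof -
  have X: "window m \<in> measurable P (count_space UNIV)" for m
    by (rule measurable_from_coord_sigma[OF measurable_window])
  have Gen: "\<exists>k S. G = {\<omega>\<in>space P. window k \<omega> \<in> S}" if GG: "G \<in> {{\<omega>. \<omega> i = a} | i a. i \<in> UNIV}" for G
    using GG coord_event_window by auto
  have "A \<in> sigma_sets (space P) {{\<omega>. \<omega> i = a} | i a. i \<in> UNIV}"
    using A by (simp add: sets_P_coord coord_algebra_def)
  from refining_approx_set[OF X window_refines Gen this] \<open>\<epsilon> > 0\<close>
  obtain k S where kS: "prob {\<omega>\<in>space P. (\<omega> \<in> A) \<noteq> (window k \<omega> \<in> S)} < \<epsilon>" by blast
  have "window k -` S \<inter> space (coord_sigma {- int k..int k}) \<in> sets (coord_sigma {- int k..int k})"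
    by (rule measurable_sets[OF measurable_window]) simp
  then show ?thesis using kS
    by (intro exI[of _ k] bexI[of _ "window k -` S"]) (auto simp: sets_coord_sigma)
qed

text \<open>An invariant \<open>A\<close> agrees up to \<epsilon> with a cylinder event
  \<open>B\<close>, hence also with every forward shifted copy of \<open>B\<close>. When the copy is
  far away, mixing gives
  \<open>prob A \<approx> prob B * prob B \<approx> prob A * prob A\<close>.\<close>

lemma ergodic:
  assumes A: "A \<in> events" and inv: "left_shift -` A \<inter> space P = A"
  shows "prob A = 0 \<or> prob A = 1"
proof -
  have inv_n: "{\<omega>. sh (int n) \<omega> \<in> A} = A" for n
  proof (induction n)
    case (Suc n)
    have "{\<omega>. sh (int (Suc n)) \<omega> \<in> A} = left_shift -` {\<omega>. sh (int n) \<omega> \<in> A}"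
      by (auto simp: left_shift_eq_sh add.commute)
    then show ?case using Suc inv by simp
  qed simp
  have "\<bar>prob A - prob A * prob A\<bar> \<le> 0"
  proof (rule field_le_epsilon)
    fix e :: real assume "e > 0"
    \<comment> \<open>Five errors: two each for replacing \<open>A\<close> by \<open>B\<close> in
      the intersection and in the product, and one for mixing.\<close>
    define \<epsilon> where "\<epsilon> = e / 5"
    have \<epsilon>: "\<epsilon> > 0" using \<open>e > 0\<close> by (simp add: \<epsilon>_def)
    obtain m B where B: "B \<in> coord_algebra {- int m..int m}" and AB: "prob {\<omega>. (\<omega> \<in> A) \<noteq> (\<omega> \<in> B)} < \<epsilon>"
      using cylinder_approx[OF A \<epsilon>] by blast
    obtain g where g: "g \<ge> 1" "phi g < \<epsilon>" using phi_small[OF \<epsilon>] by blast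
    \<comment> \<open>The shift by \<open>2 * m + g\<close> moves the coordinates
      \<open>[-m, m]\<close> to \<open>[m + g, 3 * m + g]\<close>, at distance \<open>g\<close> from
      their old place.\<close>
    define k where "k = int (2 * m + g)"
    have Bm[measurable]: "B \<in> events" using B sets_coord_algebra by blast
    note A[measurable]
    have B1: "B \<in> coord_algebra {..int m}" using B coord_algebra_mono[of "{- int m..int m}" "{..int m}"] by auto
    have B2: "{\<omega>. sh k \<omega> \<in> B} \<in> coord_algebra {int m + int g..}"
      by (rule sets_sh_coord_algebra[OF B]) (auto simp: k_def)
    have B2m[measurable]: "{\<omega>. sh k \<omega> \<in> B} \<in> events" using B2 sets_coord_algebra by blast
    have D1[measurable]: "{\<omega>. (\<omega> \<in> A) \<noteq> (\<omega> \<in> B)} \<in> events"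
    proof -
      have "{\<omega>. (\<omega> \<in> A) \<noteq> (\<omega> \<in> B)} = (A - B) \<union> (B - A)" by auto
      then show ?thesis by simp
    qed
    have D2: "prob {\<omega>. (sh k \<omega> \<in> A) \<noteq> (sh k \<omega> \<in> B)} < \<epsilon>"
      using prob_sh[OF D1, of k] AB by simp
    have D2m[measurable]: "{\<omega>. (sh k \<omega> \<in> A) \<noteq> (sh k \<omega> \<in> B)} \<in> events"
      using measurable_sets[OF measurable_sh D1, of k] by (simp add: vimage_def)
    have sk: "sh k \<omega> \<in> A \<longleftrightarrow> \<omega> \<in> A" for \<omega> using inv_n[of "2 * m + g"] by (auto simp: k_def)
    have le: "prob U \<le> prob V + \<epsilon> + \<epsilon>" if "U \<subseteq> V \<union> {\<omega>. (\<omega> \<in> A) \<noteq> (\<omega> \<in> B)} \<union> {\<omega>. (sh k \<omega> \<in> A) \<noteq> (sh k \<omega> \<in> B)}" "V \<in> events" for U V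
    proof -
      have "prob U \<le> prob (V \<union> {\<omega>. (\<omega> \<in> A) \<noteq> (\<omega> \<in> B)} \<union> {\<omega>. (sh k \<omega> \<in> A) \<noteq> (sh k \<omega> \<in> B)})"
        by (rule finite_measure_mono[OF that(1)]) (intro sets.Un that(2) D1 D2m)
      also have "\<dots> \<le> prob (V \<union> {\<omega>. (\<omega> \<in> A) \<noteq> (\<omega> \<in> B)}) + prob {\<omega>. (sh k \<omega> \<in> A) \<noteq> (sh k \<omega> \<in> B)}"
        by (intro measure_Un_le sets.Un that(2) D1 D2m)
      also have "prob (V \<union> {\<omega>. (\<omega> \<in> A) \<noteq> (\<omega> \<in> B)}) \<le> prob V + prob {\<omega>. (\<omega> \<in> A) \<noteq> (\<omega> \<in> B)}"
        by (intro measure_Un_le that(2) D1)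
      finally show ?thesis using AB D2 by linarith
    qed
    have "prob A \<le> prob (B \<inter> {\<omega>. sh k \<omega> \<in> B}) + \<epsilon> + \<epsilon>" by (rule le) (use sk in auto)
    moreover have "prob (B \<inter> {\<omega>. sh k \<omega> \<in> B}) \<le> prob A + \<epsilon> + \<epsilon>" by (rule le) (use sk in auto)
    moreover have "\<bar>prob (B \<inter> {\<omega>. sh k \<omega> \<in> B}) - prob B * prob {\<omega>. sh k \<omega> \<in> B}\<bar> \<le> \<epsilon>"
    proof -
      have "\<bar>prob (B \<inter> {\<omega>. sh k \<omega> \<in> B}) - prob B * prob {\<omega>. sh k \<omega> \<in> B}\<bar> \<le> phi g * prob B"
        by (rule phi_bound[OF phi_fin[OF g(1)] B1 B2])
      also have "\<dots> \<le> \<epsilon> * 1" using g \<epsilon> phi_nonneg by (intro mult_mono) auto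
      finally show ?thesis by simp
    qed
    moreover have "\<bar>prob B * prob {\<omega>. sh k \<omega> \<in> B} - prob A * prob A\<bar> \<le> \<epsilon> + \<epsilon>"
    proof -
      have "prob A \<le> prob B + prob {\<omega>. (\<omega> \<in> A) \<noteq> (\<omega> \<in> B)}"
      proof -
        have "prob A \<le> prob (B \<union> {\<omega>. (\<omega> \<in> A) \<noteq> (\<omega> \<in> B)})" by (intro finite_measure_mono sets.Un Bm D1) auto
        also have "\<dots> \<le> prob B + prob {\<omega>. (\<omega> \<in> A) \<noteq> (\<omega> \<in> B)}" by (intro measure_Un_le A Bm D1)
        finally show ?thesis .
      qed
      moreover have "prob B \<le> prob A + prob {\<omega>. (\<omega> \<in> A) \<noteq> (\<omega> \<in> B)}"
      proof -
        have "prob B \<le> prob (A \<union> {\<omega>. (\<omega> \<in> A) \<noteq> (\<omega> \<in> B)})" by (intro finite_measure_mono sets.Un A D1) auto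
        also have "\<dots> \<le> prob A + prob {\<omega>. (\<omega> \<in> A) \<noteq> (\<omega> \<in> B)}" by (intro measure_Un_le A Bm D1)
        finally show ?thesis .
      qed
      ultimately have ab: "\<bar>prob B - prob A\<bar> \<le> \<epsilon>" using AB by linarith
      have "prob B * prob B - prob A * prob A = (prob B - prob A) * (prob B + prob A)" by (simp add: algebra_simps)
      then have "\<bar>prob B * prob B - prob A * prob A\<bar> = \<bar>prob B - prob A\<bar> * (prob B + prob A)"
        by (simp add: abs_mult)
      also have "\<dots> \<le> \<epsilon> * (1 + 1)" using ab \<epsilon> by (intro mult_mono add_mono) auto
      finally show ?thesis using prob_sh[OF Bm, of k] by simp
    qed
    ultimately have "\<bar>prob A - prob A * prob A\<bar> \<le> \<epsilon> + \<epsilon> + \<epsilon> + \<epsilon> + \<epsilon>" by linarith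
    then show "\<bar>prob A - prob A * prob A\<bar> \<le> 0 + e" by (simp add: \<epsilon>_def)
  qed
  then have "prob A * (1 - prob A) = 0" by (simp add: algebra_simps)
  then show ?thesis by auto
qed

lemma birkhoff_forward:
  fixes f :: "(int \<Rightarrow> 'a) \<Rightarrow> real"
  assumes f: "integrable P f"
  shows "AE \<omega> in P. (\<lambda>n. (\<Sum>i<n. f (sh (int i) \<omega>)) / real n) \<longlonglongrightarrow> expectation f"
proof -
  have "left_shift \<in> measurable P P" by (simp add: left_shift_eq_sh)
  from birkhoff_ergodic[OF this invariant ergodic f] show ?thesis by (simp add: funpow_left_shift)
qed

lemma birkhoff_backward:
  fixes f :: "(int \<Rightarrow> 'a) \<Rightarrow> real"
  assumes f: "integrable P f"
  shows "AE \<omega> in P. (\<lambda>n. (\<Sum>i<n. f (sh (- int i) \<omega>)) / real n) \<longlonglongrightarrow> expectation f"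
proof -
  have erg: "prob A = 0 \<or> prob A = 1" if A: "A \<in> events" "sh (- 1) -` A \<inter> space P = A" for A
  proof (rule ergodic[OF A(1)])
    have *: "sh (- 1) \<omega> \<in> A \<longleftrightarrow> \<omega> \<in> A" for \<omega> using A(2) by auto
    show "left_shift -` A \<inter> space P = A" using *[of "sh 1 _"] by (auto simp: left_shift_eq_sh)
  qed
  show ?thesis using birkhoff_ergodic[OF measurable_sh[of "-1"] distr_sh erg f] by (simp add: funpow_sh)
qed

lemma sum_two_sided:
  fixes f :: "int \<Rightarrow> real"
  shows "(\<Sum>i\<in>{- int s..<int s}. f i) = (\<Sum>i<s. f (int i)) + (\<Sum>i<s. f (- int i - 1))"
proof -
  have "{- int s..<int s} = (\<lambda>i. int i) ` {..<s} \<union> (\<lambda>i. - int i - 1) ` {..<s}"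
  proof (intro equalityI subsetI)
    fix x assume x: "x \<in> {- int s..<int s}"
    show "x \<in> (\<lambda>i. int i) ` {..<s} \<union> (\<lambda>i. - int i - 1) ` {..<s}"
    proof (cases "x \<ge> 0")
      case True then show ?thesis using x by (intro UnI1 image_eqI[of _ _ "nat x"]) auto
    next
      case False then show ?thesis using x by (intro UnI2 image_eqI[of _ _ "nat (- x - 1)"]) auto
    qed
  qed auto
  moreover have "(\<lambda>i. int i) ` {..<s} \<inter> (\<lambda>i. - int i - 1) ` {..<s} = {}" by auto
  ultimately show ?thesis
    by (simp add: sum.union_disjoint sum.reindex inj_on_def)
qed

lemma birkhoff_two_sided:
  fixes f :: "(int \<Rightarrow> 'a) \<Rightarrow> real"
  assumes f: "integrable P f"
  shows "AE \<omega> in P. (\<lambda>s. (\<Sum>i\<in>{- int s..<int s}. f (sh i \<omega>)) / real (2 * s)) \<longlonglongrightarrow> expectation f"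
  \<comment> \<open>The negative half of the window consists of the indices
    \<open>-1, ..., -s\<close>, so the backward average starts at
    \<open>sh (- 1) \<omega>\<close>.\<close>
  using birkhoff_forward[OF f] AE_sh[OF birkhoff_backward[OF f], of "-1"]
proof eventually_elim
  case (elim \<omega>)
  from tendsto_divide[OF tendsto_add[OF elim] tendsto_const[of 2]] show ?case
    by (simp add: sum_two_sided add_divide_distrib mult.commute)
qed

text \<open>A single term is the difference of consecutive Birkhoff sums, whose averages have the
  same limit. This controls an integrable function at a point that moves into the past.\<close>

lemma birkhoff_backward_term:
  fixes f :: "(int \<Rightarrow> 'a) \<Rightarrow> real"
  assumes f: "integrable P f"
  shows "AE \<omega> in P. (\<lambda>n. f (sh (- int n) \<omega>) / real n) \<longlonglongrightarrow> 0"
  using birkhoff_backward[OF f]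
proof eventually_elim
  case (elim \<omega>)
  let ?S = "\<lambda>n. \<Sum>i<n. f (sh (- int i) \<omega>)"
  have 1: "(\<lambda>n. ?S (Suc n) / real (Suc n)) \<longlonglongrightarrow> expectation f" using LIMSEQ_Suc[OF elim] .
  have 2: "(\<lambda>n. real (Suc n) / real n) \<longlonglongrightarrow> 1"
  proof (rule Lim_transform_eventually)
    show "(\<lambda>n. 1 + 1 / real n) \<longlonglongrightarrow> 1" using tendsto_add[OF tendsto_const[of 1] lim_1_over_n] by simp
    show "\<forall>\<^sub>F n in sequentially. 1 + 1 / real n = real (Suc n) / real n"
      using eventually_gt_at_top[of 0] by eventually_elim (simp add: field_simps)
  qed
  have "(\<lambda>n. ?S (Suc n) / real (Suc n) * (real (Suc n) / real n) - ?S n / real n) \<longlonglongrightarrow> expectation f * 1 - expectation f"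
    by (intro tendsto_diff tendsto_mult 1 2 elim)
  moreover have "?S (Suc n) / real (Suc n) * (real (Suc n) / real n) - ?S n / real n = f (sh (- int n) \<omega>) / real n" for n
    by (simp del: of_nat_Suc add: diff_divide_distrib[symmetric])
  ultimately show ?case by simp
qed

end

section \<open>Entropy rates and the Kolmogorov--Sinai entropy\<close>

lemma (in prob_space) nn_integral_atom_cond_prob:
  fixes X :: "'a \<Rightarrow> 'b::countable"
  assumes X[measurable]: "X \<in> measurable M (count_space UNIV)" and A[measurable]: "A \<in> events"
  shows "(\<integral>\<^sup>+\<omega>. f (X \<omega>) * indicator A \<omega> \<partial>M) = (\<integral>\<^sup>+\<omega>. f (X \<omega>) * ennreal (atom_cond_prob M A X \<omega>) \<partial>M)"
proof -
  note [measurable] = borel_measurable_discrete_comp[OF X, of f]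
  let ?B = "\<lambda>b. {\<omega>\<in>space M. X \<omega> = b}"
  have "(\<integral>\<^sup>+\<omega>. f (X \<omega>) * indicator A \<omega> \<partial>M)
      = emeasure (density M (\<lambda>\<omega>. f (X \<omega>) * indicator A \<omega>)) (space M)"
    by (simp add: emeasure_density mult.assoc cong: nn_integral_cong_simp)
  also have "\<dots> = (\<integral>\<^sup>+b. emeasure (density M (\<lambda>\<omega>. f (X \<omega>) * indicator A \<omega>)) (space M \<inter> ?B b) \<partial>count_space UNIV)"
    by (rule emeasure_sum_discrete[OF X, symmetric]) auto
  also have "\<dots> = (\<integral>\<^sup>+b. emeasure M (?B b) * (f b * ennreal (prob {\<omega>'\<in>space M. \<omega>' \<in> A \<and> X \<omega>' = b} / prob (?B b))) \<partial>count_space UNIV)"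
  proof (rule nn_integral_cong)
    fix b
    have "emeasure (density M (\<lambda>\<omega>. f (X \<omega>) * indicator A \<omega>)) (space M \<inter> ?B b)
      = (\<integral>\<^sup>+\<omega>. f (X \<omega>) * indicator A \<omega> * indicator (space M \<inter> ?B b) \<omega> \<partial>M)"
      by (subst emeasure_density) auto
    also have "\<dots> = (\<integral>\<^sup>+\<omega>. f b * indicator {\<omega>'\<in>space M. \<omega>' \<in> A \<and> X \<omega>' = b} \<omega> \<partial>M)"
      by (intro nn_integral_cong) (auto simp: indicator_def)
    also have "\<dots> = f b * ennreal (prob {\<omega>'\<in>space M. \<omega>' \<in> A \<and> X \<omega>' = b})"
      by (subst nn_integral_cmult_indicator) (auto simp: emeasure_eq_measure)
    also have "ennreal (prob {\<omega>'\<in>space M. \<omega>' \<in> A \<and> X \<omega>' = b})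
      = ennreal (prob (?B b)) * ennreal (prob {\<omega>'\<in>space M. \<omega>' \<in> A \<and> X \<omega>' = b} / prob (?B b))"
    proof (cases "prob (?B b) = 0")
      case True
      have "prob {\<omega>'\<in>space M. \<omega>' \<in> A \<and> X \<omega>' = b} \<le> prob (?B b)" by (rule finite_measure_mono) auto
      then show ?thesis using True measure_nonneg[of M "{\<omega>'\<in>space M. \<omega>' \<in> A \<and> X \<omega>' = b}"] by simp
    qed (subst ennreal_mult[symmetric], auto)
    finally show "emeasure (density M (\<lambda>\<omega>. f (X \<omega>) * indicator A \<omega>)) (space M \<inter> ?B b)
      = emeasure M (?B b) * (f b * ennreal (prob {\<omega>'\<in>space M. \<omega>' \<in> A \<and> X \<omega>' = b} / prob (?B b)))"
      by (simp only: emeasure_eq_measure mult.left_commute)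
  qed
  also have "\<dots> = (\<integral>\<^sup>+\<omega>. f (X \<omega>) * ennreal (atom_cond_prob M A X \<omega>) \<partial>M)"
    unfolding atom_cond_prob_def atom_prob_def
    by (rule nn_integral_discrete[OF X, symmetric,
          of "\<lambda>b. f b * ennreal (prob {\<omega>'\<in>space M. \<omega>' \<in> A \<and> X \<omega>' = b} / prob (?B b))"])
  finally show ?thesis .
qed

text \<open>The left side is the conditional entropy of \<open>X\<close> given \<open>Y\<close>. The
  conditional information is split along the values of \<open>X\<close>; on \<open>X = b\<close> the
  indicator is replaced by the conditional probability of \<open>b\<close> given \<open>Y\<close>,
  which produces \<open>eta\<close>. The sum over \<open>b\<close> is a nonnegative integral because
  \<open>X\<close> may take infinitely many values.\<close>

lemma (in prob_space) ent_conditional: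
  fixes X :: "'a \<Rightarrow> 'b::countable" and Y :: "'a \<Rightarrow> 'c::countable"
  assumes X[measurable]: "X \<in> measurable M (count_space UNIV)" and Y[measurable]: "Y \<in> measurable M (count_space UNIV)"
    and fX: "finite_ent M X" and fY: "finite_ent M Y"
  shows "ennreal (ent M (\<lambda>\<omega>. (X \<omega>, Y \<omega>)) - ent M Y)
    = (\<integral>\<^sup>+b. ennreal (expectation (\<lambda>\<omega>. eta (atom_cond_prob M {\<omega>\<in>space M. X \<omega> = b} Y \<omega>))) \<partial>count_space UNIV)"
proof -
  let ?XY = "\<lambda>\<omega>. (X \<omega>, Y \<omega>)"
  let ?B = "\<lambda>b. {\<omega>\<in>space M. X \<omega> = b}"
  note XY[measurable] = measurable_discrete_Pair[OF X Y]
  note [measurable] = measurable_atom_prob[OF XY] measurable_atom_prob[OF Y] measurable_atom_cond_prob[OF Y]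
  have fXY: "finite_ent M ?XY"
    by (rule finite_ent_join[OF X Y _ XY, of "\<lambda>_. ()"]) (use fX fY in auto)
  define h where "h \<omega> = - ln (atom_prob M ?XY \<omega>) + ln (atom_prob M Y \<omega>)" for \<omega>
  have [measurable]: "h \<in> borel_measurable M" unfolding h_def by measurable
  have h_cond: "AE \<omega> in M. h \<omega> = - ln (atom_cond_prob M (?B (X \<omega>)) Y \<omega>)"
    using atom_prob_AE_pos[OF XY] atom_prob_AE_pos[OF Y]
  proof eventually_elim
    case (elim \<omega>)
    have "atom_cond_prob M (?B (X \<omega>)) Y \<omega> = atom_prob M ?XY \<omega> / atom_prob M Y \<omega>"
      unfolding atom_cond_prob_def by (simp add: atom_prob_def conj_assoc cong: conj_cong)
    then show ?case using elim by (simp add: h_def ln_div)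
  qed
  have h_nonneg: "AE \<omega> in M. 0 \<le> h \<omega>"
    using h_cond
  proof eventually_elim
    case (elim \<omega>)
    have "atom_cond_prob M (?B (X \<omega>)) Y \<omega> \<in> {0..1}" by (rule atom_cond_prob_bounds[OF Y])
    then show ?case using elim by (cases "atom_cond_prob M (?B (X \<omega>)) Y \<omega> = 0") auto
  qed
  have "ent M ?XY - ent M Y = expectation h"
    using fXY fY by (simp add: ent_def h_def[abs_def] finite_ent_def)
  moreover have "integrable M h" using fXY fY unfolding h_def finite_ent_def by auto
  ultimately have "ennreal (ent M ?XY - ent M Y) = (\<integral>\<^sup>+\<omega>. ennreal (h \<omega>) \<partial>M)"
    using nn_integral_eq_integral[of M h] h_nonneg by simp
  also have "\<dots> = emeasure (density M (\<lambda>\<omega>. ennreal (h \<omega>))) (space M)"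
    by (simp add: emeasure_density nn_integral_set_ennreal cong: nn_integral_cong_simp)
  also have "\<dots> = (\<integral>\<^sup>+b. emeasure (density M (\<lambda>\<omega>. ennreal (h \<omega>))) (space M \<inter> ?B b) \<partial>count_space UNIV)"
    by (rule emeasure_sum_discrete[OF X, symmetric]) auto
  also have "\<dots> = (\<integral>\<^sup>+b. ennreal (expectation (\<lambda>\<omega>. eta (atom_cond_prob M (?B b) Y \<omega>))) \<partial>count_space UNIV)"
  proof (rule nn_integral_cong)
    fix b
    have "emeasure (density M (\<lambda>\<omega>. ennreal (h \<omega>))) (space M \<inter> ?B b)
      = (\<integral>\<^sup>+\<omega>. ennreal (h \<omega>) * indicator (space M \<inter> ?B b) \<omega> \<partial>M)"
      by (subst emeasure_density) auto
    also have "\<dots> = (\<integral>\<^sup>+\<omega>. ennreal (- ln (atom_cond_prob M (?B b) Y \<omega>)) * indicator (?B b) \<omega> \<partial>M)"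
      using h_cond by (intro nn_integral_cong_AE) (auto simp: indicator_def elim!: eventually_mono)
    also have "\<dots> = (\<integral>\<^sup>+\<omega>. ennreal (- ln (atom_cond_prob M (?B b) Y \<omega>)) * ennreal (atom_cond_prob M (?B b) Y \<omega>) \<partial>M)"
      using nn_integral_atom_cond_prob[OF Y, of "?B b" "\<lambda>y. ennreal (- ln (prob {\<omega>'\<in>space M. \<omega>' \<in> ?B b \<and> Y \<omega>' = y} / prob {\<omega>'\<in>space M. Y \<omega>' = y}))"]
      by (simp add: atom_cond_prob_def atom_prob_def)
    also have "\<dots> = (\<integral>\<^sup>+\<omega>. ennreal (eta (atom_cond_prob M (?B b) Y \<omega>)) \<partial>M)"
    proof (intro nn_integral_cong)
      fix \<omega>
      have "atom_cond_prob M (?B b) Y \<omega> \<in> {0..1}" by (rule atom_cond_prob_bounds[OF Y])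
      then show "ennreal (- ln (atom_cond_prob M (?B b) Y \<omega>)) * ennreal (atom_cond_prob M (?B b) Y \<omega>) = ennreal (eta (atom_cond_prob M (?B b) Y \<omega>))"
        by (cases "atom_cond_prob M (?B b) Y \<omega> = 0") (auto simp: eta_def ennreal_mult[symmetric] mult.commute)
    qed
    also have "\<dots> = ennreal (expectation (\<lambda>\<omega>. eta (atom_cond_prob M (?B b) Y \<omega>)))"
    proof (rule nn_integral_eq_integral)
      have c: "atom_cond_prob M (?B b) Y \<omega> \<in> {0..1}" for \<omega> by (rule atom_cond_prob_bounds[OF Y])
      then have *: "0 \<le> eta (atom_cond_prob M (?B b) Y \<omega>) \<and> eta (atom_cond_prob M (?B b) Y \<omega>) \<le> 1" for \<omega>
        using eta_nonneg eta_le_1 by auto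
      then show "AE \<omega> in M. 0 \<le> eta (atom_cond_prob M (?B b) Y \<omega>)" by simp
      show "integrable M (\<lambda>\<omega>. eta (atom_cond_prob M (?B b) Y \<omega>))"
        by (rule integrable_const_bound[where B=1]) (use * in auto)
    qed
    finally show "emeasure (density M (\<lambda>\<omega>. ennreal (h \<omega>))) (space M \<inter> ?B b)
      = ennreal (expectation (\<lambda>\<omega>. eta (atom_cond_prob M (?B b) Y \<omega>)))" .
  qed
  finally show ?thesis .
qed

lemma (in prob_space) ent_finite_range:
  fixes X :: "'a \<Rightarrow> 'b::countable"
  assumes X[measurable]: "X \<in> measurable M (count_space UNIV)" and fin: "finite (X ` space M)"
  shows "ent M X = (\<Sum>b\<in>X ` space M. eta (prob {\<omega>\<in>space M. X \<omega> = b}))"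
proof -
  let ?B = "\<lambda>b. {\<omega>\<in>space M. X \<omega> = b}"
  have "ent M X = expectation (\<lambda>\<omega>. \<Sum>b\<in>X ` space M. - ln (prob (?B b)) * indicator (?B b) \<omega>)"
    unfolding ent_def
  proof (rule Bochner_Integration.integral_cong)
    fix \<omega> assume \<omega>: "\<omega> \<in> space M"
    have "(\<Sum>b\<in>X ` space M. - ln (prob (?B b)) * indicator (?B b) \<omega>) = (\<Sum>b\<in>X ` space M. if b = X \<omega> then - ln (prob (?B b)) else 0)"
      using \<omega> by (intro sum.cong) (auto simp: indicator_def)
    also have "\<dots> = - ln (prob (?B (X \<omega>)))" using fin \<omega> by (subst sum.delta) auto
    finally show "- ln (atom_prob M X \<omega>) = (\<Sum>b\<in>X ` space M. - ln (prob (?B b)) * indicator (?B b) \<omega>)"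
      by (simp add: atom_prob_def)
  qed simp
  also have "\<dots> = (\<Sum>b\<in>X ` space M. - ln (prob (?B b)) * prob (?B b))"
    by (subst Bochner_Integration.integral_sum)
       (auto intro!: integrable_mult_right integrable_real_indicator simp: emeasure_eq_measure)
  finally show ?thesis by (simp add: eta_def mult.commute)
qed

lemma decreasing_average_LIMSEQ:
  fixes a :: "nat \<Rightarrow> real"
  assumes lim: "a \<longlonglongrightarrow> L" and ge: "\<And>n. L \<le> a n"
  shows "(\<lambda>n. (\<Sum>k<n. a k) / real n) \<longlonglongrightarrow> L"
proof (rule LIMSEQ_I)
  fix r :: real assume r: "r > 0"
  then obtain m where m: "\<And>k. k \<ge> m \<Longrightarrow> a k < L + r/2"
    using order_tendstoD(2)[OF lim, of "L + r/2"] by (auto simp: eventually_sequentially)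
  define C where "C = (\<Sum>k<m. a k - L)"
  have C: "C \<ge> 0" unfolding C_def using ge by (intro sum_nonneg) auto
  obtain n0 :: nat where n0: "real n0 > 2 * C / r" using reals_Archimedean2 by blast
  show "\<exists>no. \<forall>n\<ge>no. norm ((\<Sum>k<n. a k) / real n - L) < r"
  proof (intro exI[of _ "Suc (max n0 m)"] allI impI)
    fix n assume n: "n \<ge> Suc (max n0 m)"
    have e: "(\<Sum>k<n. a k) / real n - L = (\<Sum>k<n. a k - L) / real n"
      using n by (simp add: sum_subtractf field_simps)
    have "(\<Sum>k<n. a k - L) = C + (\<Sum>k=m..<n. a k - L)"
      unfolding C_def using n by (simp add: lessThan_atLeast0 sum.atLeastLessThan_concat)
    also have "(\<Sum>k=m..<n. a k - L) \<le> (\<Sum>k=m..<n. r/2)"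
    proof (rule sum_mono)
      fix k assume "k \<in> {m..<n}"
      then have "a k < L + r/2" by (intro m) simp
      then show "a k - L \<le> r/2" by linarith
    qed
    also have "\<dots> \<le> real n * (r/2)" using r by (simp add: mult_right_mono)
    also have "C < real n * (r/2)"
    proof -
      have "2 * C / r < real n" using n n0 by linarith
      then show ?thesis using r by (simp add: field_simps)
    qed
    finally have "(\<Sum>k<n. a k - L) < real n * (r/2) + real n * (r/2)" by simp
    then have "(\<Sum>k<n. a k - L) < real n * r" unfolding distrib_left[symmetric] by simp
    moreover have "(\<Sum>k<n. a k - L) \<ge> 0" using ge by (intro sum_nonneg) auto
    ultimately show "norm ((\<Sum>k<n. a k) / real n - L) < r"
      unfolding e using n by (simp add: divide_less_eq mult.commute)
  qed
qed

text \<open>The conditional entropy of one symbol given the \<open>n\<close> preceding ones.\<close>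

definition ent_incr :: "(int \<Rightarrow> 'a) measure \<Rightarrow> ((int \<Rightarrow> 'a) \<Rightarrow> 'b) \<Rightarrow> nat \<Rightarrow> real" where
  "ent_incr P X n = ent P (itinerary X (Suc n)) - ent P (itinerary X n)"

text \<open>For finite entropy the increments decrease, so this infimum is their limit and also the
  limit of the entropy per symbol.\<close>

definition entropy_rate :: "(int \<Rightarrow> 'a) measure \<Rightarrow> ((int \<Rightarrow> 'a) \<Rightarrow> 'b) \<Rightarrow> real" where
  "entropy_rate P X = (INF n. ent_incr P X n)"

context stationary
begin

abbreviation "rv X \<equiv> X \<in> measurable P (count_space UNIV)"

lemma rv_sh: "rv X \<Longrightarrow> rv (\<lambda>\<omega>. X (sh k \<omega>))"
  by (rule measurable_compose[OF measurable_sh])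

lemma itinerary_Suc_eq_iff:
  "itinerary X (Suc n) \<omega> = itinerary X (Suc n) \<omega>' \<longleftrightarrow> itinerary X n \<omega> = itinerary X n \<omega>' \<and> X (sh (int n) \<omega>) = X (sh (int n) \<omega>')"
  by (auto simp: itinerary_eq_iff less_Suc_eq)

lemma itinerary_Suc_eq_iff':
  "itinerary X (Suc n) \<omega> = itinerary X (Suc n) \<omega>' \<longleftrightarrow> X \<omega> = X \<omega>' \<and> itinerary X n (sh 1 \<omega>) = itinerary X n (sh 1 \<omega>')"
proof -
  have "itinerary X (Suc n) \<omega> = itinerary X (Suc n) \<omega>' \<longleftrightarrow> (\<forall>j<Suc n. X (sh (int j) \<omega>) = X (sh (int j) \<omega>'))"
    by (simp add: itinerary_eq_iff)
  also have "\<dots> \<longleftrightarrow> X \<omega> = X \<omega>' \<and> (\<forall>j<n. X (sh (int (Suc j)) \<omega>) = X (sh (int (Suc j)) \<omega>'))"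
    by (simp add: All_less_Suc2)
  finally show ?thesis by (simp add: itinerary_eq_iff add.commute)
qed

context
  fixes X :: "(int \<Rightarrow> 'a) \<Rightarrow> 'b::countable"
  assumes X: "rv X" and fX: "finite_ent P X"
begin

lemma finite_ent_itinerary: "finite_ent P (itinerary X n)"
proof (induction n)
  case 0
  have "itinerary X 0 = (\<lambda>_. [])" by (simp add: itinerary_def fun_eq_iff)
  then show ?case by (simp add: finite_ent_def atom_prob_def)
next
  case (Suc n)
  show ?case
    by (rule finite_ent_join[OF measurable_itinerary[OF X, of n] rv_sh[OF X, of "int n"] _ measurable_itinerary[OF X], of "\<lambda>_. ()"])
       (use Suc finite_ent_sh[OF X fX] in \<open>auto simp: itinerary_Suc_eq_iff\<close>)
qed

text \<open>Strong subadditivity for the first and the last \<open>Suc n\<close> of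
  \<open>n + 2\<close> symbols, which overlap in the \<open>n\<close> in the middle.\<close>

lemma ent_incr_Suc_le: "ent_incr P X (Suc n) \<le> ent_incr P X n"
proof -
  have "ent P (itinerary X (Suc (Suc n))) + ent P (\<lambda>\<omega>. itinerary X n (sh 1 \<omega>))
    \<le> ent P (itinerary X (Suc n)) + ent P (\<lambda>\<omega>. itinerary X (Suc n) (sh 1 \<omega>))"
  proof (rule ent_submodular)
    show "finite_ent P (\<lambda>\<omega>. itinerary X (Suc n) (sh 1 \<omega>))" by (rule finite_ent_sh[OF measurable_itinerary[OF X] finite_ent_itinerary])
  next
    fix \<omega> \<omega>'
    show "itinerary X (Suc (Suc n)) \<omega> = itinerary X (Suc (Suc n)) \<omega>' \<longleftrightarrow>
        itinerary X (Suc n) \<omega> = itinerary X (Suc n) \<omega>' \<and> itinerary X (Suc n) (sh 1 \<omega>) = itinerary X (Suc n) (sh 1 \<omega>')"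
      using itinerary_Suc_eq_iff'[of X "Suc n" \<omega> \<omega>'] itinerary_Suc_eq_iff'[of X n \<omega> \<omega>'] itinerary_Suc_eq_iff[of X n "sh 1 \<omega>" "sh 1 \<omega>'"]
      by blast
    show "itinerary X (Suc n) \<omega> = itinerary X (Suc n) \<omega>' \<Longrightarrow> itinerary X n (sh 1 \<omega>) = itinerary X n (sh 1 \<omega>')"
      by (simp add: itinerary_Suc_eq_iff')
    show "itinerary X (Suc n) (sh 1 \<omega>) = itinerary X (Suc n) (sh 1 \<omega>') \<Longrightarrow> itinerary X n (sh 1 \<omega>) = itinerary X n (sh 1 \<omega>')"
      by (simp add: itinerary_Suc_eq_iff)
  qed (intro measurable_itinerary X rv_sh finite_ent_itinerary)+
  then show ?thesis by (simp add: ent_incr_def ent_sh[OF measurable_itinerary[OF X]])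
qed

lemma ent_incr_nonneg: "0 \<le> ent_incr P X n"
  unfolding ent_incr_def
  using finite_ent_coarser(2)[OF measurable_itinerary[OF X, of "Suc n"] measurable_itinerary[OF X, of n] _ finite_ent_itinerary] by (simp add: itinerary_Suc_eq_iff)

lemma entropy_rate_le_ent_incr: "entropy_rate P X \<le> ent_incr P X n"
  unfolding entropy_rate_def by (rule cINF_lower) (auto intro!: bdd_belowI2[of _ 0] ent_incr_nonneg)

lemma entropy_rate_nonneg: "0 \<le> entropy_rate P X"
  unfolding entropy_rate_def by (rule cINF_greatest) (auto intro: ent_incr_nonneg)

lemma ent_incr_LIMSEQ: "ent_incr P X \<longlonglongrightarrow> entropy_rate P X"
  unfolding entropy_rate_def
  by (rule LIMSEQ_decseq_INF) (auto intro!: bdd_belowI2[of _ 0] ent_incr_nonneg decseq_SucI ent_incr_Suc_le)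

lemma ent_itinerary_LIMSEQ: "(\<lambda>n. ent P (itinerary X n) / real n) \<longlonglongrightarrow> entropy_rate P X"
proof -
  have "itinerary X 0 = (\<lambda>_. [])" by (simp add: itinerary_def fun_eq_iff)
  then have 0: "ent P (itinerary X 0) = 0" by (simp add: ent_const)
  have "(\<Sum>k<n. ent_incr P X k) = ent P (itinerary X n)" for n
    unfolding ent_incr_def by (subst sum_lessThan_telescope) (simp add: 0)
  then show ?thesis
    using decreasing_average_LIMSEQ[OF ent_incr_LIMSEQ entropy_rate_le_ent_incr] by simp
qed

end

text \<open>The symbols of \<open>X\<close> are added one at a time to a full itinerary of
  \<open>Y\<close>. Since that itinerary already contains \<open>Y\<close> at the time of the new
  symbol, strong subadditivity bounds the cost of each addition by the conditional entropy of
  \<open>X\<close> given \<open>Y\<close>.\<close>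

lemma entropy_rate_le_entropy_rate_add:
  fixes X :: "(int \<Rightarrow> 'a) \<Rightarrow> 'b::countable" and Y :: "(int \<Rightarrow> 'a) \<Rightarrow> 'c::countable"
  assumes X: "rv X" and Y: "rv Y" and fX: "finite_ent P X" and fY: "finite_ent P Y"
  shows "entropy_rate P X \<le> entropy_rate P Y + (ent P (\<lambda>\<omega>. (X \<omega>, Y \<omega>)) - ent P Y)"
proof -
  let ?V = "\<lambda>\<omega>. (X \<omega>, Y \<omega>)"
  have V: "rv ?V" by (rule measurable_discrete_Pair[OF X Y])
  have fV: "finite_ent P ?V" by (rule finite_ent_join[OF X Y _ V, of "\<lambda>_. ()"]) (use fX fY in auto)
  define J where "J n k \<omega> = (itinerary X k \<omega>, itinerary Y n \<omega>)" for n k \<omega>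
  have J: "rv (J n k)" for n k unfolding J_def by (intro measurable_discrete_Pair measurable_itinerary X Y)
  have fJ: "finite_ent P (J n k)" for n k
    by (rule finite_ent_join[OF measurable_itinerary[OF X, of k] measurable_itinerary[OF Y, of n] _ J, of "\<lambda>_. ()"])
       (auto simp: J_def finite_ent_itinerary X Y fX fY)
  have step: "ent P (J n (Suc k)) + ent P Y \<le> ent P (J n k) + ent P ?V" if "k < n" for n k
  proof -
    have "ent P (J n (Suc k)) + ent P (\<lambda>\<omega>. Y (sh (int k) \<omega>)) \<le> ent P (J n k) + ent P (\<lambda>\<omega>. ?V (sh (int k) \<omega>))"
    proof (rule ent_submodular[OF J rv_sh[OF V] rv_sh[OF Y] J _ _ _ fJ finite_ent_sh[OF V fV]])
      fix \<omega> \<omega>'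
      show "J n k \<omega> = J n k \<omega>' \<Longrightarrow> Y (sh (int k) \<omega>) = Y (sh (int k) \<omega>')"
        using that by (auto simp: J_def itinerary_eq_iff)
      show "J n (Suc k) \<omega> = J n (Suc k) \<omega>' \<longleftrightarrow> J n k \<omega> = J n k \<omega>' \<and> ?V (sh (int k) \<omega>) = ?V (sh (int k) \<omega>')"
        using that by (auto simp: J_def itinerary_eq_iff less_Suc_eq)
    qed auto
    then show ?thesis by (simp add: ent_sh[OF Y] ent_sh[OF V])
  qed
  define c where "c = ent P ?V - ent P Y"
  have "ent P (J n k) \<le> ent P (itinerary Y n) + real k * c" if "k \<le> n" for n k
    using that
  proof (induction k)
    case 0
    have "ent P (J n 0) = ent P (itinerary Y n)" by (rule ent_cong) (auto simp: J_def itinerary_def)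
    then show ?case by simp
  next
    case (Suc k)
    then show ?case using step[of k n] by (simp add: c_def algebra_simps)
  qed
  then have "ent P (J n n) \<le> ent P (itinerary Y n) + real n * c" for n by simp
  moreover have "ent P (itinerary X n) \<le> ent P (J n n)" for n
    by (rule finite_ent_coarser(2)[OF J measurable_itinerary[OF X] _ fJ]) (simp add: J_def)
  ultimately have *: "ent P (itinerary X n) \<le> ent P (itinerary Y n) + real n * c" for n by (meson order_trans)
  have "(\<lambda>n. ent P (itinerary Y n) / real n + c) \<longlonglongrightarrow> entropy_rate P Y + c"
    by (intro tendsto_add ent_itinerary_LIMSEQ Y fY tendsto_const)
  moreover have "\<forall>\<^sub>F n in sequentially. ent P (itinerary X n) / real n \<le> ent P (itinerary Y n) / real n + c"
    using eventually_gt_at_top[of 0]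
  proof eventually_elim
    case (elim n) then show ?case using *[of n] by (simp add: field_simps)
  qed
  ultimately have "entropy_rate P X \<le> entropy_rate P Y + c"
    by (rule tendsto_le[OF sequentially_bot _ ent_itinerary_LIMSEQ[OF X fX]])
  then show ?thesis by (simp add: c_def)
qed

lemma fibre_in_events: "rv X \<Longrightarrow> {\<omega>. X \<omega> = b} \<in> events"
  using measurable_sets[of X P "count_space UNIV" "{b}"] by (simp add: vimage_def)

text \<open>A cell of the refinement arises from the choice of one set in each pulled back
  partition. Any point of the intersection determines the chosen sets, so the cell is the itinerary
  class of that point.\<close>

lemma iterated_partition_fibres:
  assumes X: "finite (range X)"
  shows "iterated_partition P left_shift ((\<lambda>b. {\<omega>. X \<omega> = b}) ` range X) n
    = (\<lambda>w. {\<omega>. itinerary X n \<omega> = w}) ` range (itinerary X n)"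
proof -
  define Q where "Q i = pullback_partition P (left_shift ^^ i) ((\<lambda>b. {\<omega>. X \<omega> = b}) ` range X)" for i
  have Q: "Q i = {{\<omega>. X (sh (int i) \<omega>) = b} | b. b \<in> range X}" for i
    by (auto simp: Q_def pullback_partition_def vimage_def funpow_left_shift)
  have fib: "\<Inter> (f ` Q ` {..<n}) = {\<omega>'. itinerary X n \<omega>' = itinerary X n \<omega>}"
    if f: "\<And>R. R \<in> Q ` {..<n} \<Longrightarrow> f R \<in> R" and \<omega>: "\<omega> \<in> \<Inter> (f ` Q ` {..<n})" for f \<omega>
  proof -
    have "f (Q i) = {\<omega>'. X (sh (int i) \<omega>') = X (sh (int i) \<omega>)}" if "i < n" for i
    proof -
      have QQ: "Q i \<in> Q ` {..<n}" using that by simp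
      have "f (Q i) \<in> Q i" by (rule f[OF QQ])
      then obtain b where b: "f (Q i) = {\<omega>. X (sh (int i) \<omega>) = b}"
        unfolding Q[of i] by blast
      have "\<omega> \<in> f (Q i)" using \<omega> QQ by blast
      then show ?thesis unfolding b by simp
    qed
    then show ?thesis by (auto simp: itinerary_eq_iff)
  qed
  have "common_refinement (Q ` {..<n}) = (\<lambda>\<omega>. {\<omega>'. itinerary X n \<omega>' = itinerary X n \<omega>}) ` UNIV"
  proof (intro equalityI subsetI)
    fix C assume "C \<in> common_refinement (Q ` {..<n})"
    then obtain f where f: "f \<in> Pi (Q ` {..<n}) (\<lambda>R. R)" "C = \<Inter> (f ` Q ` {..<n})" "C \<noteq> {}"
      by (auto simp: common_refinement)
    then obtain \<omega> where "\<omega> \<in> C" by blast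
    have "C = {\<omega>'. itinerary X n \<omega>' = itinerary X n \<omega>}" unfolding f(2)
      by (rule fib[OF Pi_mem[OF f(1)]]) (use \<open>\<omega> \<in> C\<close> f(2) in auto)
    then show "C \<in> (\<lambda>\<omega>. {\<omega>'. itinerary X n \<omega>' = itinerary X n \<omega>}) ` UNIV" by blast
  next
    fix C assume "C \<in> (\<lambda>\<omega>. {\<omega>'. itinerary X n \<omega>' = itinerary X n \<omega>}) ` UNIV"
    then obtain \<omega> where C: "C = {\<omega>'. itinerary X n \<omega>' = itinerary X n \<omega>}" by blast
    define f where "f R = (SOME D. D \<in> R \<and> \<omega> \<in> D)" for R
    have f: "f R \<in> R \<and> \<omega> \<in> f R" if "R \<in> Q ` {..<n}" for R
      unfolding f_def by (rule someI_ex) (use that in \<open>auto simp: Q\<close>)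
    then have \<omega>: "\<omega> \<in> \<Inter> (f ` Q ` {..<n})" by blast
    have "C = \<Inter> (f ` Q ` {..<n})" unfolding C by (rule fib[symmetric, OF conjunct1[OF f] \<omega>])
    moreover have "f \<in> Pi (Q ` {..<n}) (\<lambda>R. R)" using f by auto
    ultimately show "C \<in> common_refinement (Q ` {..<n})" using \<omega> by (auto simp: common_refinement)
  qed
  then show ?thesis by (auto simp: iterated_partition_def Q_def image_def)
qed

lemma entropy_wrt_fibres:
  fixes X :: "(int \<Rightarrow> 'a) \<Rightarrow> 'b::countable"
  assumes X: "rv X" and fin: "finite (range X)"
  shows "entropy_wrt P left_shift ((\<lambda>b. {\<omega>. X \<omega> = b}) ` range X) = ereal (entropy_rate P X)"
proof -
  have fX: "finite_ent P X" by (rule finite_ent_finite_range[OF X]) (use fin in simp)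
  have fin_itinerary: "finite (range (itinerary X n))" for n
  proof (rule finite_subset)
    show "range (itinerary X n) \<subseteq> {w. set w \<subseteq> range X \<and> length w = n}" by (auto simp: itinerary_def)
    show "finite {w. set w \<subseteq> range X \<and> length w = n}" using finite_lists_length_eq[OF fin] .
  qed
  have "partition_entropy P (iterated_partition P left_shift ((\<lambda>b. {\<omega>. X \<omega> = b}) ` range X) n)
     = ereal (ent P (itinerary X n))" for n
  proof -
    have inj: "inj_on (\<lambda>w. {\<omega>. itinerary X n \<omega> = w}) (range (itinerary X n))" by (auto simp: inj_on_def)
    have "partition_entropy P (iterated_partition P left_shift ((\<lambda>b. {\<omega>. X \<omega> = b}) ` range X) n)
      = (\<Sum>A\<in>(\<lambda>w. {\<omega>. itinerary X n \<omega> = w}) ` range (itinerary X n). ereal (- (prob A * ln (prob A))))"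
      unfolding partition_entropy_def iterated_partition_fibres[OF fin]
      by (intro infsum_finite finite_imageI fin_itinerary)
    also have "\<dots> = (\<Sum>w\<in>range (itinerary X n). ereal (eta (prob {\<omega>. itinerary X n \<omega> = w})))"
      by (subst sum.reindex[OF inj]) (simp add: eta_def)
    also have "\<dots> = ereal (ent P (itinerary X n))"
      using fin_itinerary by (subst ent_finite_range[OF measurable_itinerary[OF X]]) auto
    finally show ?thesis .
  qed
  then have "(\<lambda>n. partition_entropy P (iterated_partition P left_shift ((\<lambda>b. {\<omega>. X \<omega> = b}) ` range X) n) / ereal (real n))
     = (\<lambda>n. ereal (ent P (itinerary X n)) / ereal (real n))" by simp
  moreover have "(\<lambda>n. ereal (ent P (itinerary X n)) / ereal (real n)) \<longlonglongrightarrow> ereal (entropy_rate P X)"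
  proof (rule Lim_transform_eventually)
    show "(\<lambda>n. ereal (ent P (itinerary X n) / real n)) \<longlonglongrightarrow> ereal (entropy_rate P X)"
      using ent_itinerary_LIMSEQ[OF X fX] by simp
    show "\<forall>\<^sub>F n in sequentially. ereal (ent P (itinerary X n) / real n) = ereal (ent P (itinerary X n)) / ereal (real n)"
      using eventually_gt_at_top[of 0] by eventually_elim simp
  qed
  ultimately show ?thesis unfolding entropy_wrt_def by (simp add: limI)
qed

end

section \<open>The Kolmogorov--Sinai entropy as an entropy rate\<close>

context stationary
begin

lemma rv_window: "rv (window m)"
  by (rule measurable_from_coord_sigma[OF measurable_window])

text \<open>The windows generate the whole sigma-algebra, so the conditional probability of
  \<open>X = b\<close> converges in L1 to an indicator, and \<open>eta\<close> vanishes at 0 and 1.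
  The finite range leaves finitely many such terms.\<close>

lemma ent_given_window_LIMSEQ:
  fixes X :: "(int \<Rightarrow> 'a) \<Rightarrow> 'b::countable"
  assumes X: "rv X" and fin: "finite (range X)" and fc: "finite_ent P coord0"
  shows "(\<lambda>m. ent P (\<lambda>\<omega>. (X \<omega>, window m \<omega>)) - ent P (window m)) \<longlonglongrightarrow> 0"
proof -
  have fX: "finite_ent P X" by (rule finite_ent_finite_range[OF X]) (use fin in simp)
  have fw: "finite_ent P (window m)" for m
    unfolding window_eq_itinerary[abs_def]
    by (rule finite_ent_sh[OF measurable_itinerary[OF measurable_coord0] finite_ent_itinerary[OF measurable_coord0 fc]])
  let ?B = "\<lambda>b. {\<omega>\<in>space P. X \<omega> = b}"
  let ?e = "\<lambda>b m. expectation (\<lambda>\<omega>. eta (atom_cond_prob P (?B b) (window m) \<omega>))"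
  have B: "?B b \<in> events" for b using fibre_in_events[OF X] by simp
  have e_nonneg: "0 \<le> ?e b m" for b m
    by (intro integral_nonneg_AE AE_I2) (use atom_cond_prob_bounds[OF rv_window] eta_nonneg in auto)
  have sum: "ent P (\<lambda>\<omega>. (X \<omega>, window m \<omega>)) - ent P (window m) = (\<Sum>b\<in>range X. ?e b m)" for m
  proof -
    have "?e b m = 0" if "b \<notin> range X" for b
    proof -
      have "?B b = {}" using that by auto
      then show ?thesis by (simp add: atom_cond_prob_def)
    qed
    then have "ennreal (ent P (\<lambda>\<omega>. (X \<omega>, window m \<omega>)) - ent P (window m)) = (\<Sum>b\<in>range X. ennreal (?e b m))"
      unfolding ent_conditional[OF X rv_window fX fw]
      using fin by (intro nn_integral_count_space') auto
    also have "\<dots> = ennreal (\<Sum>b\<in>range X. ?e b m)" by (rule sum_ennreal) (rule e_nonneg)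
    finally have 1: "ennreal (ent P (\<lambda>\<omega>. (X \<omega>, window m \<omega>)) - ent P (window m)) = ennreal (\<Sum>b\<in>range X. ?e b m)" .
    have rvp: "rv (\<lambda>\<omega>. (X \<omega>, window m \<omega>))" by (rule measurable_discrete_Pair[OF X rv_window])
    have "ent P (window m) \<le> ent P (\<lambda>\<omega>. (X \<omega>, window m \<omega>))"
      by (rule finite_ent_coarser(2)[OF rvp rv_window])
         (auto intro!: finite_ent_join[OF X rv_window _ rvp, of "\<lambda>_. ()"] fX fw)
    then have d: "0 \<le> ent P (\<lambda>\<omega>. (X \<omega>, window m \<omega>)) - ent P (window m)" by simp
    have s: "0 \<le> (\<Sum>b\<in>range X. ?e b m)" by (intro sum_nonneg e_nonneg)
    show ?thesis by (rule ennreal_inj[THEN iffD1, OF d s 1])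
  qed
  have lim: "(\<lambda>m. ?e b m) \<longlonglongrightarrow> 0" for b
  proof -
    have L1: "(\<lambda>k. expectation (\<lambda>\<omega>. \<bar>atom_cond_prob P (?B b) (window k) \<omega> - indicator (?B b) \<omega>\<bar>)) \<longlonglongrightarrow> 0"
    proof (rule atom_cond_prob_L1_convergence[where X=window, OF rv_window window_refines])
      show "\<exists>k S. G = {\<omega>\<in>space P. window k \<omega> \<in> S}" if "G \<in> {{\<omega>. \<omega> i = a} | i a. i \<in> UNIV}" for G
        using that coord_event_window by auto
      fix c :: real
      have "{\<omega>\<in>space P. c \<le> indicator (?B b) \<omega>} \<in> events" using B by measurable
      then show "{\<omega>\<in>space P. c \<le> indicator (?B b) \<omega>} \<in> sigma_sets (space P) {{\<omega>. \<omega> i = a} | i a. i \<in> UNIV}"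
        by (simp add: sets_P_coord coord_algebra_def)
    next
      fix k w
      have W: "{\<omega>\<in>space P. window k \<omega> = w} \<in> events" using fibre_in_events[OF rv_window] by simp
      have "expectation (\<lambda>\<omega>. indicator (?B b) \<omega> * indicator {\<omega>\<in>space P. window k \<omega> = w} \<omega> :: real)
        = expectation (indicator (?B b \<inter> {\<omega>\<in>space P. window k \<omega> = w}))"
        by (rule Bochner_Integration.integral_cong) (auto simp: indicator_def)
      also have "\<dots> = prob (?B b \<inter> {\<omega>\<in>space P. window k \<omega> = w})" using B W by simp
      also have "?B b \<inter> {\<omega>\<in>space P. window k \<omega> = w} = {\<omega>'\<in>space P. \<omega>' \<in> ?B b \<and> window k \<omega>' = w}" by auto
      finally show "expectation (\<lambda>\<omega>. indicator (?B b) \<omega> * indicator {\<omega>\<in>space P. window k \<omega> = w} \<omega> :: real)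
        = prob {\<omega>'\<in>space P. \<omega>' \<in> ?B b \<and> window k \<omega>' = w}" .
    qed (auto simp: indicator_def)
    have "(\<lambda>k. ?e b k) \<longlonglongrightarrow> expectation (\<lambda>\<omega>. eta (indicator (?B b) \<omega>))"
      by (rule eta_L1_convergence[OF measurable_atom_cond_prob[OF rv_window] borel_measurable_indicator[OF B] _ _ L1])
         (use atom_cond_prob_bounds[OF rv_window] in \<open>auto simp: indicator_def\<close>)
    also have "expectation (\<lambda>\<omega>. eta (indicator (?B b) \<omega>)) = expectation (\<lambda>\<omega>. 0)"
      by (rule Bochner_Integration.integral_cong) (auto simp: indicator_def)
    finally show ?thesis by simp
  qed
  have "(\<lambda>m. \<Sum>b\<in>range X. ?e b m) \<longlonglongrightarrow> (\<Sum>b\<in>range X. 0)" by (intro tendsto_sum lim)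
  then show ?thesis unfolding sum by simp
qed

text \<open>\<open>n\<close> consecutive windows of radius \<open>m\<close> carry the information of
  \<open>n + 2 * m\<close> consecutive symbols, and the \<open>2 * m\<close> extra symbols do not
  affect the rate.\<close>

lemma entropy_rate_window:
  assumes fc: "finite_ent P coord0"
  shows "entropy_rate P (window m) = entropy_rate P coord0"
proof -
  have fw: "finite_ent P (window m)"
    unfolding window_eq_itinerary[abs_def]
    by (rule finite_ent_sh[OF measurable_itinerary[OF measurable_coord0] finite_ent_itinerary[OF measurable_coord0 fc]])
  have eq: "ent P (itinerary (window m) n) = ent P (itinerary coord0 (n + 2 * m))" if "n > 0" for n
  proof -
    have "ent P (itinerary (window m) n) = ent P (\<lambda>\<omega>. itinerary coord0 (n + 2 * m) (sh (- int m) \<omega>))"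
    proof (rule ent_cong)
      fix \<omega> \<omega>' :: "int \<Rightarrow> 'a"
      have "itinerary (window m) n \<omega> = itinerary (window m) n \<omega>' \<longleftrightarrow>
        (\<forall>i<n. \<forall>j<2*m+1. \<omega> (int j - int m + int i) = \<omega>' (int j - int m + int i))"
        by (simp add: itinerary_eq_iff window_eq_itinerary sh_apply algebra_simps)
      also have "\<dots> \<longleftrightarrow> (\<forall>k<n + 2*m. \<omega> (int k - int m) = \<omega>' (int k - int m))"
      proof safe
        fix k assume *: "\<forall>i<n. \<forall>j<2*m+1. \<omega> (int j - int m + int i) = \<omega>' (int j - int m + int i)" and k: "k < n + 2*m"
        \<comment> \<open>The symbol at offset \<open>k\<close> is read from a window that covers
          it: the one at \<open>k\<close>, or the last one if \<open>k\<close> is too large.\<close>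
        define i where "i = (if k < n then k else n - 1)"
        have "i < n" "k - i < 2*m + 1" "i \<le> k" using k \<open>n > 0\<close> by (auto simp: i_def)
        then show "\<omega> (int k - int m) = \<omega>' (int k - int m)" using *[rule_format, of i "k - i"]
          by (simp add: of_nat_diff algebra_simps)
      next
        fix i j assume *: "\<forall>k<n + 2*m. \<omega> (int k - int m) = \<omega>' (int k - int m)" and "i < n" "j < 2*m+1"
        then show "\<omega> (int j - int m + int i) = \<omega>' (int j - int m + int i)"
          using *[rule_format, of "i + j"] by (simp add: algebra_simps)
      qed
      also have "\<dots> \<longleftrightarrow> itinerary coord0 (n + 2 * m) (sh (- int m) \<omega>) = itinerary coord0 (n + 2 * m) (sh (- int m) \<omega>')"
        by (simp add: itinerary_eq_iff sh_apply)
      finally show "itinerary (window m) n \<omega> = itinerary (window m) n \<omega>' \<longleftrightarrow>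
        itinerary coord0 (n + 2 * m) (sh (- int m) \<omega>) = itinerary coord0 (n + 2 * m) (sh (- int m) \<omega>')" .
    qed
    then show ?thesis by (simp add: ent_sh[OF measurable_itinerary[OF measurable_coord0]])
  qed
  have 1: "(\<lambda>n. ent P (itinerary coord0 (n + 2 * m)) / real (n + 2 * m)) \<longlonglongrightarrow> entropy_rate P coord0"
    using LIMSEQ_ignore_initial_segment[OF ent_itinerary_LIMSEQ[OF measurable_coord0 fc]] .
  have 2: "(\<lambda>n. 1 + real (2 * m) / real n) \<longlonglongrightarrow> 1 + 0"
    by (intro tendsto_add tendsto_const lim_const_over_n)
  have "(\<lambda>n. ent P (itinerary coord0 (n + 2 * m)) / real (n + 2 * m) * (1 + real (2 * m) / real n)) \<longlonglongrightarrow> entropy_rate P coord0 * (1 + 0)"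
    by (intro tendsto_mult 1 2)
  moreover have "\<forall>\<^sub>F n in sequentially. ent P (itinerary coord0 (n + 2 * m)) / real (n + 2 * m) * (1 + real (2 * m) / real n)
      = ent P (itinerary (window m) n) / real n"
    using eventually_gt_at_top[of 0]
  proof eventually_elim
    case (elim n)
    have "1 + real (2 * m) / real n = real (n + 2 * m) / real n" using elim by (simp add: field_simps)
    then show ?case using elim by (simp add: eq)
  qed
  ultimately have "(\<lambda>n. ent P (itinerary (window m) n) / real n) \<longlonglongrightarrow> entropy_rate P coord0"
    by (simp add: Lim_transform_eventually)
  then show ?thesis using ent_itinerary_LIMSEQ[OF rv_window fw] LIMSEQ_unique by blast
qed

text \<open>Comparison with windows, whose entropy rate does not depend on \<open>m\<close>; as
  \<open>m\<close> grows, the conditional entropy of \<open>X\<close> given the window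
  vanishes.\<close>

lemma entropy_rate_finite_le_entropy_rate_coord:
  fixes X :: "(int \<Rightarrow> 'a) \<Rightarrow> 'b::countable"
  assumes X: "rv X" and fin: "finite (range X)" and fc: "finite_ent P coord0"
  shows "entropy_rate P X \<le> entropy_rate P coord0"
proof -
  have fX: "finite_ent P X" by (rule finite_ent_finite_range[OF X]) (use fin in simp)
  have fw: "finite_ent P (window m)" for m
    unfolding window_eq_itinerary[abs_def]
    by (rule finite_ent_sh[OF measurable_itinerary[OF measurable_coord0] finite_ent_itinerary[OF measurable_coord0 fc]])
  have "entropy_rate P X \<le> entropy_rate P coord0 + (ent P (\<lambda>\<omega>. (X \<omega>, window m \<omega>)) - ent P (window m))" for m
    using entropy_rate_le_entropy_rate_add[OF X rv_window fX fw, of m] by (simp add: entropy_rate_window[OF fc])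
  moreover have "(\<lambda>m. entropy_rate P coord0 + (ent P (\<lambda>\<omega>. (X \<omega>, window m \<omega>)) - ent P (window m))) \<longlonglongrightarrow> entropy_rate P coord0 + 0"
    by (intro tendsto_add tendsto_const ent_given_window_LIMSEQ X fin fc)
  ultimately show ?thesis by (intro LIMSEQ_le_const[of _ "entropy_rate P coord0"]) auto
qed

text \<open>All symbols numbered \<open>k\<close> or more are merged. \<open>KS_entropy\<close>
  admits only finite partitions, whereas the alphabet may be infinite.\<close>

definition trunc0 :: "nat \<Rightarrow> (int \<Rightarrow> 'a) \<Rightarrow> nat" where
  "trunc0 k \<omega> = min (to_nat (\<omega> 0)) k"

lemma rv_trunc0: "rv (trunc0 k)"
  unfolding trunc0_def[abs_def] by (rule measurable_discrete_comp[OF measurable_coord0])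

lemma finite_range_trunc0: "finite (range (trunc0 k))"
  by (rule finite_subset[of _ "{..k}"]) (auto simp: trunc0_def)

text \<open>At each point the atom of the truncation is eventually the atom of the symbol; merging
  only decreases the information, so the full information dominates.\<close>

lemma ent_trunc0_LIMSEQ:
  assumes fc: "finite_ent P coord0"
  shows "(\<lambda>k. ent P (trunc0 k)) \<longlonglongrightarrow> ent P coord0"
  unfolding ent_def
proof (rule integral_dominated_convergence[where w="\<lambda>\<omega>. \<bar>ln (atom_prob P coord0 \<omega>)\<bar>"])
  show "integrable P (\<lambda>\<omega>. \<bar>ln (atom_prob P coord0 \<omega>)\<bar>)" using fc by (simp add: finite_ent_def)
  show "AE \<omega> in P. (\<lambda>k. - ln (atom_prob P (trunc0 k) \<omega>)) \<longlonglongrightarrow> - ln (atom_prob P coord0 \<omega>)"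
  proof (rule AE_I2)
    fix \<omega>
    have "\<forall>\<^sub>F k in sequentially. - ln (atom_prob P (trunc0 k) \<omega>) = - ln (atom_prob P coord0 \<omega>)"
      using eventually_gt_at_top[of "to_nat (\<omega> 0)"]
    proof eventually_elim
      case (elim k)
      have "trunc0 k \<omega>' = trunc0 k \<omega> \<longleftrightarrow> \<omega>' 0 = \<omega> 0" for \<omega>'
        using elim by (auto simp: trunc0_def min_def split: if_splits)
      then show ?case by (simp add: atom_prob_def)
    qed
    then show "(\<lambda>k. - ln (atom_prob P (trunc0 k) \<omega>)) \<longlonglongrightarrow> - ln (atom_prob P coord0 \<omega>)" by (rule tendsto_eventually)
  qed
  show "AE \<omega> in P. norm (- ln (atom_prob P (trunc0 k) \<omega>)) \<le> \<bar>ln (atom_prob P coord0 \<omega>)\<bar>" for k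
    using atom_prob_AE_pos[OF measurable_coord0]
  proof eventually_elim
    case (elim \<omega>)
    have "atom_prob P coord0 \<omega> \<le> atom_prob P (trunc0 k) \<omega>" by (rule atom_prob_mono[OF rv_trunc0]) (simp add: trunc0_def)
    then show ?case using elim atom_prob_le_1[of "trunc0 k" \<omega>] atom_prob_le_1[of coord0 \<omega>] by auto
  qed
qed (use measurable_atom_prob[OF rv_trunc0] measurable_atom_prob[OF measurable_coord0] in auto)

text \<open>The truncation is a function of the symbol, so the conditional entropy of the symbol
  given it is a difference of entropies.\<close>

lemma entropy_rate_coord_le_trunc0:
  assumes fc: "finite_ent P coord0"
  shows "entropy_rate P coord0 \<le> entropy_rate P (trunc0 k) + (ent P coord0 - ent P (trunc0 k))"
proof -
  have "finite_ent P (trunc0 k)" by (rule finite_ent_finite_range[OF rv_trunc0]) (use finite_range_trunc0 in simp)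
  then have "entropy_rate P coord0 \<le> entropy_rate P (trunc0 k) + (ent P (\<lambda>\<omega>. (\<omega> 0, trunc0 k \<omega>)) - ent P (trunc0 k))"
    by (rule entropy_rate_le_entropy_rate_add[OF measurable_coord0 rv_trunc0 fc])
  also have "ent P (\<lambda>\<omega>. (\<omega> 0, trunc0 k \<omega>)) = ent P coord0"
    by (rule ent_cong) (auto simp: trunc0_def)
  finally show ?thesis .
qed

text \<open>A finite partition consists of the fibres of a finite-valued variable, which gives the
  upper bound; the truncated symbols give the lower bound in the limit.\<close>

theorem KS_entropy_eq:
  assumes fc: "finite_ent P coord0"
  shows "KS_entropy P left_shift = ereal (entropy_rate P coord0)"
proof (rule antisym)
  show "KS_entropy P left_shift \<le> ereal (entropy_rate P coord0)"
    unfolding KS_entropy_def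
  proof (rule SUP_least, clarify)
    fix \<xi> assume \<xi>: "finite \<xi>" "\<xi> \<subseteq> events" "partition_on (space P) \<xi>"
    define cell where "cell \<omega> = (THE A. A \<in> \<xi> \<and> \<omega> \<in> A)" for \<omega>
    have cell: "cell \<omega> = A \<longleftrightarrow> \<omega> \<in> A" if "A \<in> \<xi>" for A \<omega>
    proof -
      have "\<exists>!A. A \<in> \<xi> \<and> \<omega> \<in> A"
        using \<xi>(3) unfolding partition_on_def disjoint_def by auto
      from theI'[OF this] have "cell \<omega> \<in> \<xi>" "\<omega> \<in> cell \<omega>" by (auto simp: cell_def)
      then show ?thesis using \<open>\<exists>!A. A \<in> \<xi> \<and> \<omega> \<in> A\<close> that by auto
    qed
    have cell_in: "cell \<omega> \<in> \<xi>" for \<omega>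
    proof -
      obtain A where "A \<in> \<xi>" "\<omega> \<in> A" using \<xi>(3) by (auto simp: partition_on_def)
      then show ?thesis using cell[of A \<omega>] by simp
    qed
    \<comment> \<open>The cells are numbered because the entropy lemmas ask for a countable type of
      values.\<close>
    define X where "X \<omega> = to_nat_on \<xi> (cell \<omega>)" for \<omega>
    have inj: "inj_on (to_nat_on \<xi>) \<xi>" using \<xi>(1) by (intro inj_on_to_nat_on countable_finite)
    have X_eq: "{\<omega>. X \<omega> = to_nat_on \<xi> A} = A" if "A \<in> \<xi>" for A
      using inj_on_eq_iff[OF inj cell_in that] cell[OF that] by (auto simp: X_def)
    have ne: "A \<noteq> {}" if "A \<in> \<xi>" for A using \<xi>(3) that by (auto simp: partition_on_def)
    have rng: "range X = to_nat_on \<xi> ` \<xi>"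
    proof
      show "range X \<subseteq> to_nat_on \<xi> ` \<xi>" using cell_in by (auto simp: X_def)
      show "to_nat_on \<xi> ` \<xi> \<subseteq> range X"
      proof clarify
        fix A assume A: "A \<in> \<xi>"
        then obtain \<omega> where "\<omega> \<in> A" using ne by blast
        then have "X \<omega> = to_nat_on \<xi> A" using X_eq[OF A] by blast
        then show "to_nat_on \<xi> A \<in> range X" by (metis rangeI)
      qed
    qed
    have fin: "finite (range X)" unfolding rng using \<xi>(1) by simp
    have X: "rv X"
    proof (subst measurable_count_space_eq_countable, simp, intro conjI ballI)
      show "X \<in> space P \<rightarrow> UNIV" by simp
      fix b :: nat
      show "X -` {b} \<inter> space P \<in> events"
      proof (cases "b \<in> range X")
        case True
        then obtain A where "A \<in> \<xi>" "b = to_nat_on \<xi> A" using rng by auto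
        then show ?thesis using X_eq[of A] \<xi>(2) by (auto simp: vimage_def)
      next
        case False
        then have "X -` {b} = {}" by auto
        then show ?thesis by simp
      qed
    qed
    have "(\<lambda>b. {\<omega>. X \<omega> = b}) ` range X = \<xi>"
      unfolding rng image_image using X_eq by simp
    then have "entropy_wrt P left_shift \<xi> = ereal (entropy_rate P X)" using entropy_wrt_fibres[OF X fin] by simp
    then show "entropy_wrt P left_shift \<xi> \<le> ereal (entropy_rate P coord0)"
      using entropy_rate_finite_le_entropy_rate_coord[OF X fin fc] by simp
  qed
  have le: "ereal (entropy_rate P (trunc0 k)) \<le> KS_entropy P left_shift" for k
  proof -
    let ?\<xi> = "(\<lambda>b. {\<omega>. trunc0 k \<omega> = b}) ` range (trunc0 k)"
    have "?\<xi> \<in> {\<xi>. finite \<xi> \<and> \<xi> \<subseteq> events \<and> partition_on (space P) \<xi>}"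
      using finite_range_trunc0 fibre_in_events[OF rv_trunc0]
      by (auto simp: partition_on_def disjoint_def)
    then show ?thesis
      unfolding KS_entropy_def entropy_wrt_fibres[OF rv_trunc0 finite_range_trunc0, symmetric]
      by (rule SUP_upper)
  qed
  have lim: "(\<lambda>k. ereal (entropy_rate P coord0 - (ent P coord0 - ent P (trunc0 k)))) \<longlonglongrightarrow> ereal (entropy_rate P coord0 - (ent P coord0 - ent P coord0))"
    by (intro tendsto_intros ent_trunc0_LIMSEQ fc)
  have le': "ereal (entropy_rate P coord0 - (ent P coord0 - ent P (trunc0 k))) \<le> KS_entropy P left_shift" for k
    using entropy_rate_coord_le_trunc0[OF fc, of k] by (intro order_trans[OF _ le[of k]]) simp
  have "ereal (entropy_rate P coord0 - (ent P coord0 - ent P coord0)) \<le> KS_entropy P left_shift"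
    by (rule LIMSEQ_le_const2[OF lim]) (use le' in blast)
  then show "ereal (entropy_rate P coord0) \<le> KS_entropy P left_shift" by simp
qed

text \<open>The premise is a sum in the extended reals. Being the supremum of its finite partial
  sums, it bounds them by a real number; this gives real summability, and the sum is the integral of
  the information function.\<close>

lemma finite_ent_coord0I:
  assumes "(\<Sum>\<^sub>\<infinity>a. ereal (- (prob (cylinder1 a) * ln (prob (cylinder1 a))))) < \<infinity>"
  shows "finite_ent P coord0"
proof -
  define f where "f a = eta (prob (cylinder1 a))" for a
  have f0: "0 \<le> f a" for a by (simp add: f_def eta_nonneg)
  have cyl: "cylinder1 a = {\<omega>\<in>space P. \<omega> 0 = a}" for a by (auto simp: cylinder1_def)
  have sum: "(\<Sum>\<^sub>\<infinity>a. ereal (f a)) < \<infinity>" using assms by (simp add: f_def eta_def)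
  have eqS: "(\<Sum>\<^sub>\<infinity>a. ereal (f a)) = (SUP F\<in>{F. finite F \<and> F \<subseteq> UNIV}. \<Sum>a\<in>F. ereal (f a))"
    by (rule nonneg_infsum_complete) (use f0 in auto)
  have fin: "(\<Sum>a\<in>F. ereal (f a)) \<le> (\<Sum>\<^sub>\<infinity>a. ereal (f a))" if "finite F" for F
    unfolding eqS by (rule SUP_upper) (use that in auto)
  define L where "L = real_of_ereal (\<Sum>\<^sub>\<infinity>a. ereal (f a))"
  have nn: "0 \<le> (\<Sum>\<^sub>\<infinity>a. ereal (f a))" using fin[of "{}"] by (simp add: zero_ereal_def)
  then have L: "(\<Sum>\<^sub>\<infinity>a. ereal (f a)) = ereal L" using sum unfolding L_def by (intro ereal_real[symmetric] ereal_real'[symmetric]) auto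
  have "sum f F \<le> L" if "finite F" for F using fin[OF that] unfolding L by simp
  then have "f summable_on UNIV" by (intro nonneg_bdd_above_summable_on) (use f0 in \<open>auto intro!: bdd_aboveI2\<close>)
  then have "(\<lambda>a. norm (f a)) summable_on UNIV" using f0 by simp
  then have int: "integrable (count_space UNIV) f"
    by (rule abs_summable_equivalent[THEN iffD1, unfolded Infinite_Set_Sum.abs_summable_on_def])
  have "(\<integral>\<^sup>+a. ennreal (f a) \<partial>count_space UNIV) < \<infinity>"
    using nn_integral_eq_integral[OF int] f0 by simp
  moreover have "(\<integral>\<^sup>+\<omega>. ennreal (- ln (atom_prob P coord0 \<omega>)) \<partial>P) = (\<integral>\<^sup>+a. ennreal (f a) \<partial>count_space UNIV)"
  proof -
    have "(\<integral>\<^sup>+\<omega>. ennreal (- ln (atom_prob P coord0 \<omega>)) \<partial>P)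
      = (\<integral>\<^sup>+a. emeasure P {\<omega>\<in>space P. \<omega> 0 = a} * ennreal (- ln (prob {\<omega>\<in>space P. \<omega> 0 = a})) \<partial>count_space UNIV)"
      unfolding atom_prob_def by (rule nn_integral_discrete[OF measurable_coord0])
    also have "\<dots> = (\<integral>\<^sup>+a. ennreal (f a) \<partial>count_space UNIV)"
    proof (rule nn_integral_cong)
      fix a
      have "0 \<le> - ln (prob {\<omega>\<in>space P. \<omega> 0 = a})"
        by (cases "prob {\<omega>\<in>space P. \<omega> 0 = a} = 0") (auto simp: less_le)
      then show "emeasure P {\<omega>\<in>space P. \<omega> 0 = a} * ennreal (- ln (prob {\<omega>\<in>space P. \<omega> 0 = a})) = ennreal (f a)"
        by (simp add: f_def eta_def cyl emeasure_eq_measure ennreal_mult[symmetric])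
    qed
    finally show ?thesis .
  qed
  ultimately have "(\<integral>\<^sup>+\<omega>. ennreal (- ln (atom_prob P coord0 \<omega>)) \<partial>P) < \<infinity>" by simp
  moreover have "AE \<omega> in P. 0 \<le> - ln (atom_prob P coord0 \<omega>)"
    using atom_prob_AE_pos[OF measurable_coord0] by eventually_elim (simp add: atom_prob_le_1)
  ultimately have "integrable P (\<lambda>\<omega>. - ln (atom_prob P coord0 \<omega>))"
    using measurable_atom_prob[OF measurable_coord0] by (intro integrableI_nonneg) auto
  then show ?thesis unfolding finite_ent_def by simp
qed

end

section \<open>Positivity of the entropy\<close>

context mixing
begin

text \<open>Observed only at multiples of \<open>g\<close>, the process is so close to independent
  that every pattern of \<open>m + 1\<close> symbols has probability at most
  \<open>\<rho> ^ (m + 1)\<close> with \<open>\<rho> < 1\<close>. Hence \<open>g * m + 1\<close>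
  consecutive symbols have entropy at least \<open>(m + 1) * (- ln \<rho>)\<close>.\<close>

lemma entropy_rate_coord_pos:
  fixes a b :: 'a
  assumes fc: "finite_ent P coord0" and ab: "a \<noteq> b"
    and pos: "\<And>a::'a. prob (cylinder1 a) > 0"
  shows "entropy_rate P coord0 > 0"
proof -
  have C: "cylinder1 c \<in> events" for c :: 'a using fibre_in_events[OF measurable_coord0] by (simp add: cylinder1_def)
  \<comment> \<open>Every symbol differs from \<open>a\<close> or from \<open>b\<close>, so its
    probability leaves room for at least one of these two.\<close>
  define p where "p = 1 - min (prob (cylinder1 a)) (prob (cylinder1 b))"
  have p1: "p < 1" using pos[of a] pos[of b] by (auto simp: p_def)
  have p: "prob (cylinder1 c) \<le> p" for c
  proof -
    have disj: "prob (cylinder1 c) + prob (cylinder1 d) \<le> 1" if "c \<noteq> d" for d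
    proof -
      have "prob (cylinder1 c) + prob (cylinder1 d) = prob (cylinder1 c \<union> cylinder1 d)"
        using that C by (intro finite_measure_Union[symmetric]) (auto simp: cylinder1_def)
      then show ?thesis by simp
    qed
    show ?thesis using disj[of a] disj[of b] ab unfolding p_def by (cases "c = a") auto
  qed
  have p0: "p \<ge> 0" using p[of a] measure_nonneg order_trans by blast
  \<comment> \<open>Half of the room below 1 is left to mixing:
    \<open>p + \<delta> = (1 + p) / 2 < 1\<close>.\<close>
  define \<delta> where "\<delta> = (1 - p) / 2"
  obtain g where g: "g \<ge> 1" "phi g < \<delta>" using phi_small[of \<delta>] p1 by (auto simp: \<delta>_def)
  define \<rho> where "\<rho> = p + \<delta>"
  have \<rho>: "0 < \<rho>" "\<rho> < 1" using p0 p1 unfolding \<rho>_def \<delta>_def by (simp_all add: field_simps)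
  have bound: "prob {\<omega>'. \<forall>j\<le>m. \<omega>' (int (g * j)) = \<omega> (int (g * j))} \<le> \<rho> ^ Suc m
      \<and> {\<omega>'. \<forall>j\<le>m. \<omega>' (int (g * j)) = \<omega> (int (g * j))} \<in> coord_algebra {..int (g * m)}" for m and \<omega> :: "int \<Rightarrow> 'a"
  proof (induction m)
    case 0
    have "{\<omega>'. \<forall>j\<le>0::nat. \<omega>' (int (g * j)) = \<omega> (int (g * j))} = cylinder1 (\<omega> 0)" by (auto simp: cylinder1_def)
    moreover have "cylinder1 (\<omega> 0) \<in> coord_algebra {..0}"
      unfolding coord_algebra_def cylinder1_def by (rule sigma_sets.Basic) auto
    moreover have "p \<le> \<rho>" using p1 by (simp add: \<rho>_def \<delta>_def)
    ultimately show ?case using p[of "\<omega> 0"] by simp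
  next
    case (Suc m)
    let ?G = "{\<omega>'. \<forall>j\<le>m. \<omega>' (int (g * j)) = \<omega> (int (g * j))}"
    let ?D = "{\<omega>'. \<omega>' (int (g * Suc m)) = \<omega> (int (g * Suc m))}"
    have eq: "{\<omega>'. \<forall>j\<le>Suc m. \<omega>' (int (g * j)) = \<omega> (int (g * j))} = ?G \<inter> ?D"
      unfolding le_Suc_eq by blast
    have D: "?D \<in> coord_algebra {int (g * m) + int g..}"
      unfolding coord_algebra_def by (rule sigma_sets.Basic) (auto simp: algebra_simps)
    have D': "?D \<in> coord_algebra {..int (g * Suc m)}"
      unfolding coord_algebra_def by (rule sigma_sets.Basic) auto
    have G': "?G \<in> coord_algebra {..int (g * Suc m)}"
      using Suc coord_algebra_mono[of "{..int (g * m)}" "{..int (g * Suc m)}"] by auto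
    have "\<bar>prob (?G \<inter> ?D) - prob ?G * prob ?D\<bar> \<le> phi g * prob ?G"
      by (rule phi_bound[OF phi_fin[OF g(1)] _ D]) (use Suc in simp)
    then have "prob (?G \<inter> ?D) \<le> prob ?G * (prob ?D + phi g)" by (simp add: algebra_simps)
    also have "prob ?D = prob (cylinder1 (\<omega> (int (g * Suc m))))"
      using prob_sh[OF C, of "int (g * Suc m)" "\<omega> (int (g * Suc m))"] by (simp add: cylinder1_def sh_apply)
    also have "prob ?G * (prob (cylinder1 (\<omega> (int (g * Suc m)))) + phi g) \<le> \<rho> ^ Suc m * (p + \<delta>)"
      using Suc p g phi_nonneg[of g] \<rho> by (intro mult_mono add_mono) auto
    also have "\<dots> = \<rho> ^ Suc (Suc m)" by (simp add: \<rho>_def)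
    finally have 1: "prob (?G \<inter> ?D) \<le> \<rho> ^ Suc (Suc m)" .
    have 2: "?G \<inter> ?D \<in> coord_algebra {..int (g * Suc m)}"
      using G' D' unfolding sets_coord_sigma[symmetric] by (rule sets.Int)
    show ?case unfolding eq using 1 2 by blast
  qed
  have fn: "finite_ent P (itinerary coord0 n)" for n by (rule finite_ent_itinerary[OF measurable_coord0 fc])
  have ent: "ent P (itinerary coord0 (Suc (g * m))) \<ge> real (Suc m) * (- ln \<rho>)" for m
  proof -
    have "AE \<omega> in P. real (Suc m) * (- ln \<rho>) \<le> - ln (atom_prob P (itinerary coord0 (Suc (g * m))) \<omega>)"
      using atom_prob_AE_pos[OF measurable_itinerary[OF measurable_coord0], of "Suc (g * m)"]
    proof eventually_elim
      case (elim \<omega>)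
      have "atom_prob P (itinerary coord0 (Suc (g * m))) \<omega> \<le> prob {\<omega>'. \<forall>j\<le>m. \<omega>' (int (g * j)) = \<omega> (int (g * j))}"
        unfolding atom_prob_def
      proof (rule finite_measure_mono)
        show "{\<omega>'\<in>space P. itinerary coord0 (Suc (g * m)) \<omega>' = itinerary coord0 (Suc (g * m)) \<omega>}
          \<subseteq> {\<omega>'. \<forall>j\<le>m. \<omega>' (int (g * j)) = \<omega> (int (g * j))}"
        proof clarify
          fix \<omega>' j assume eq: "itinerary coord0 (Suc (g * m)) \<omega>' = itinerary coord0 (Suc (g * m)) \<omega>" and "j \<le> m"
          have "g * j < Suc (g * m)" using \<open>j \<le> m\<close> by (simp add: less_Suc_eq_le)
          then show "\<omega>' (int (g * j)) = \<omega> (int (g * j))" using eq unfolding itinerary_eq_iff sh_apply by auto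
        qed
        show "{\<omega>'. \<forall>j\<le>m. \<omega>' (int (g * j)) = \<omega> (int (g * j))} \<in> events"
          using bound[of m \<omega>] sets_coord_algebra by blast
      qed
      also have "\<dots> \<le> \<rho> ^ Suc m" using bound[of m \<omega>] by blast
      finally have "ln (atom_prob P (itinerary coord0 (Suc (g * m))) \<omega>) \<le> ln (\<rho> ^ Suc m)" using elim \<rho> by simp
      also have "\<dots> = real (Suc m) * ln \<rho>" by (rule ln_realpow)
      finally show ?case by simp
    qed
    then have "expectation (\<lambda>_. real (Suc m) * (- ln \<rho>)) \<le> ent P (itinerary coord0 (Suc (g * m)))"
      unfolding ent_def using fn by (intro integral_mono_AE) (auto simp: finite_ent_def)
    then show ?thesis by (simp add: prob_space)
  qed
  have "(\<lambda>m. ent P (itinerary coord0 (Suc (g * m))) / real (Suc (g * m))) \<longlonglongrightarrow> entropy_rate P coord0"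
  proof (rule filterlim_compose[OF ent_itinerary_LIMSEQ[OF measurable_coord0 fc]])
    have "strict_mono (\<lambda>m. Suc (g * m))" using g by (intro strict_monoI) simp
    then show "filterlim (\<lambda>m. Suc (g * m)) sequentially sequentially" by (rule filterlim_subseq)
  qed
  moreover have "- ln \<rho> / real g \<le> ent P (itinerary coord0 (Suc (g * m))) / real (Suc (g * m))" for m
  proof -
    have l: "- ln \<rho> \<ge> 0" using \<rho> by simp
    have "real (Suc (g * m)) \<le> real g * real (Suc m)" 
    proof -
      have "Suc (g * m) \<le> g * Suc m" using g by simp
      then show ?thesis unfolding of_nat_mult[symmetric] of_nat_le_iff .
    qed
    then have "- ln \<rho> * real (Suc (g * m)) \<le> - ln \<rho> * (real g * real (Suc m))" by (rule mult_left_mono) (rule l)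
    also have "\<dots> = (real (Suc m) * - ln \<rho>) * real g" by simp
    also have "\<dots> \<le> ent P (itinerary coord0 (Suc (g * m))) * real g" by (intro mult_right_mono ent) auto
    finally have *: "- ln \<rho> * real (Suc (g * m)) \<le> ent P (itinerary coord0 (Suc (g * m))) * real g" .
    have cross: "\<And>a b c d :: real. a * d \<le> c * b \<Longrightarrow> b > 0 \<Longrightarrow> d > 0 \<Longrightarrow> a / b \<le> c / d"
      by (simp add: field_simps)
    show ?thesis by (rule cross[OF *]) (use g in \<open>auto simp del: of_nat_Suc\<close>)
  qed
  ultimately have "- ln \<rho> / real g \<le> entropy_rate P coord0" by (intro LIMSEQ_le_const) auto
  moreover have "- ln \<rho> / real g > 0" using \<rho> g by (intro divide_pos_pos) auto
  ultimately show ?thesis by linarith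
qed

end

section \<open>A two-sided Shannon--McMillan--Breiman theorem\<close>

lemma (in prob_space) expectation_atom_cond_prob:
  fixes X :: "'a \<Rightarrow> 'b::countable"
  assumes X: "X \<in> measurable M (count_space UNIV)" and A[measurable]: "A \<in> events"
  shows "expectation (atom_cond_prob M A X) = prob A"
proof -
  note [measurable] = measurable_atom_cond_prob[OF X]
  have "(\<integral>\<^sup>+\<omega>. ennreal (atom_cond_prob M A X \<omega>) \<partial>M) = ennreal (prob A)"
    using nn_integral_atom_cond_prob[OF X A, of "\<lambda>_. 1"] by (simp add: emeasure_eq_measure)
  then show ?thesis
    by (subst integral_eq_nn_integral) (use atom_cond_prob_bounds[OF X] in auto)
qed

text \<open>Jensen's inequality, through the tangent of \<open>eta\<close> at \<open>prob A\<close>.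
  It supplies the dominating terms for sums over an infinite alphabet.\<close>

lemma (in prob_space) expectation_eta_atom_cond_prob_le:
  fixes X :: "'a \<Rightarrow> 'b::countable"
  assumes X: "X \<in> measurable M (count_space UNIV)" and A: "A \<in> events"
  shows "expectation (\<lambda>\<omega>. eta (atom_cond_prob M A X \<omega>)) \<le> eta (prob A)"
proof -
  have b: "atom_cond_prob M A X \<omega> \<in> {0..1}" for \<omega> by (rule atom_cond_prob_bounds[OF X])
  note [measurable] = measurable_atom_cond_prob[OF X]
  show ?thesis
  proof (cases "prob A = 0")
    case True
    have "atom_cond_prob M A X \<omega> = 0" for \<omega>
    proof -
      have "prob {\<omega>'\<in>space M. \<omega>' \<in> A \<and> X \<omega>' = X \<omega>} \<le> prob A" by (rule finite_measure_mono) (use A in auto)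
      then show ?thesis using True measure_nonneg[of M "{\<omega>'\<in>space M. \<omega>' \<in> A \<and> X \<omega>' = X \<omega>}"] by (simp add: atom_cond_prob_def)
    qed
    then show ?thesis using True by simp
  next
    case False
    then have m: "prob A > 0" by (simp add: less_le)
    have i: "integrable M (atom_cond_prob M A X)"
      by (rule integrable_const_bound[where B=1]) (use b in auto)
    have "expectation (\<lambda>\<omega>. eta (atom_cond_prob M A X \<omega>)) \<le> expectation (\<lambda>\<omega>. prob A - atom_cond_prob M A X \<omega> - atom_cond_prob M A X \<omega> * ln (prob A))"
    proof (rule integral_mono)
      show "integrable M (\<lambda>\<omega>. eta (atom_cond_prob M A X \<omega>))"
      proof (rule integrable_const_bound[where B=1], rule AE_I2)
        fix \<omega> show "norm (eta (atom_cond_prob M A X \<omega>)) \<le> 1" using b[of \<omega>] eta_nonneg eta_le_1 by auto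
      qed measurable
      show "eta (atom_cond_prob M A X \<omega>) \<le> prob A - atom_cond_prob M A X \<omega> - atom_cond_prob M A X \<omega> * ln (prob A)" for \<omega>
        using eta_le_tangent[of "atom_cond_prob M A X \<omega>" "prob A"] b[of \<omega>] m by simp
    qed (use i in auto)
    also have "\<dots> = prob A - prob A - prob A * ln (prob A)"
      using i by (simp add: prob_space expectation_atom_cond_prob[OF X A])
    finally show ?thesis by (simp add: eta_def)
  qed
qed

section \<open>Markov approximations of word probabilities\<close>

context stationary
begin

lemma rv_itinerary_coord: "rv (itinerary coord0 n)"
  by (rule measurable_itinerary[OF measurable_coord0])

text \<open>
  The conditional probability of the symbol at \<open>k\<close> given those at \<open>0, ..., k - 1\<close>.
\<close>

definition step_cond :: "nat \<Rightarrow> (int \<Rightarrow> 'a) \<Rightarrow> real" where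
  "step_cond k \<omega> = atom_prob P (itinerary coord0 (Suc k)) \<omega> / atom_prob P (itinerary coord0 k) \<omega>"

lemma measurable_step_cond [measurable]: "step_cond k \<in> borel_measurable P"
  unfolding step_cond_def[abs_def] using measurable_atom_prob[OF rv_itinerary_coord] by measurable

lemma AE_step_cond_pos: "AE \<omega> in P. step_cond k \<omega> > 0"
  using atom_prob_AE_pos[OF rv_itinerary_coord, of k] atom_prob_AE_pos[OF rv_itinerary_coord, of "Suc k"]
  by eventually_elim (simp add: step_cond_def)

lemma
  assumes fc: "finite_ent P coord0"
  shows integrable_ln_step_cond: "integrable P (\<lambda>\<omega>. - ln (step_cond k \<omega>))"
    and expectation_ln_step_cond: "expectation (\<lambda>\<omega>. - ln (step_cond k \<omega>)) = ent_incr P coord0 k"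
proof -
  have f: "finite_ent P (itinerary coord0 n)" for n by (rule finite_ent_itinerary[OF measurable_coord0 fc])
  have eq: "AE \<omega> in P. ln (atom_prob P (itinerary coord0 k) \<omega>) - ln (atom_prob P (itinerary coord0 (Suc k)) \<omega>) = - ln (step_cond k \<omega>)"
    using atom_prob_AE_pos[OF rv_itinerary_coord, of k] atom_prob_AE_pos[OF rv_itinerary_coord, of "Suc k"]
    by eventually_elim (simp add: step_cond_def ln_div)
  have int: "integrable P (\<lambda>\<omega>. ln (atom_prob P (itinerary coord0 k) \<omega>) - ln (atom_prob P (itinerary coord0 (Suc k)) \<omega>))"
    using f by (auto simp: finite_ent_def)
  show "integrable P (\<lambda>\<omega>. - ln (step_cond k \<omega>))"
    by (rule integrable_cong_AE_imp[OF int _ eq]) measurable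
  have "expectation (\<lambda>\<omega>. - ln (step_cond k \<omega>))
    = expectation (\<lambda>\<omega>. ln (atom_prob P (itinerary coord0 k) \<omega>) - ln (atom_prob P (itinerary coord0 (Suc k)) \<omega>))"
    using measurable_atom_prob[OF rv_itinerary_coord] eq by (intro integral_cong_AE) auto
  also have "\<dots> = ent_incr P coord0 k" using f by (simp add: ent_incr_def ent_def finite_ent_def)
  finally show "expectation (\<lambda>\<omega>. - ln (step_cond k \<omega>)) = ent_incr P coord0 k" .
qed

text \<open>The probability of the first \<open>k + n\<close> symbols under the
  \<open>k\<close>-step Markov measure with the transition probabilities of
  \<open>P\<close>.\<close>

definition markov_weight :: "nat \<Rightarrow> nat \<Rightarrow> (int \<Rightarrow> 'a) \<Rightarrow> real" where
  "markov_weight k n \<omega> = atom_prob P (itinerary coord0 k) \<omega> * (\<Prod>i<n. step_cond k (sh (int i) \<omega>))"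

lemma atom_prob_itinerary_factor:
  "\<exists>f. \<forall>\<omega>. atom_prob P (itinerary coord0 k) (sh (int i) \<omega>) = f (itinerary coord0 (k + i) \<omega> :: 'a list)"
proof (rule exI, rule allI)
  fix \<omega> :: "int \<Rightarrow> 'a"
  have "itinerary coord0 k (sh (int i) \<omega>) = drop i (itinerary coord0 (k + i) \<omega>)"
    by (rule nth_equalityI) (auto simp: itinerary_def sh_apply algebra_simps)
  then show "atom_prob P (itinerary coord0 k) (sh (int i) \<omega>)
    = (\<lambda>w. measure P {\<omega>'\<in>space P. itinerary coord0 k \<omega>' = drop i w}) (itinerary coord0 (k + i) \<omega>)"
    by (simp add: atom_prob_def)
qed

text \<open>\<open>nn_integral_markov_ratio\<close> takes its weight as a function of the values of
  \<open>A\<close>, here of the word of length \<open>k + n\<close>.\<close>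

lemma markov_weight_fun: "\<exists>f. \<forall>\<omega>. markov_weight k n \<omega> = f (itinerary coord0 (k + n) \<omega>)"
proof -
  have take: "itinerary coord0 j \<omega> = take j (itinerary coord0 n \<omega>)" if "j \<le> n" for j n and \<omega> :: "int \<Rightarrow> 'a"
    using that by (intro nth_equalityI) (auto simp: itinerary_def)
  obtain f where f: "\<And>k i \<omega>. atom_prob P (itinerary coord0 k) (sh (int i) \<omega>) = f k i (itinerary coord0 (k + i) \<omega>)"
    using atom_prob_itinerary_factor by metis
  have "markov_weight k n \<omega> = f k 0 (take k (itinerary coord0 (k + n) \<omega>)) *
    (\<Prod>i<n. f (Suc k) i (take (Suc k + i) (itinerary coord0 (k + n) \<omega>)) / f k i (take (k + i) (itinerary coord0 (k + n) \<omega>)))" for \<omega>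
  proof -
    have "(\<Prod>i<n. step_cond k (sh (int i) \<omega>)) = (\<Prod>i<n. f (Suc k) i (take (Suc k + i) (itinerary coord0 (k + n) \<omega>)) / f k i (take (k + i) (itinerary coord0 (k + n) \<omega>)))"
    proof (rule prod.cong)
      fix i assume "i \<in> {..<n}"
      then have "Suc k + i \<le> k + n" "k + i \<le> k + n" by auto
      then show "step_cond k (sh (int i) \<omega>) = f (Suc k) i (take (Suc k + i) (itinerary coord0 (k + n) \<omega>)) / f k i (take (k + i) (itinerary coord0 (k + n) \<omega>))"
        by (simp only: step_cond_def f take[symmetric])
    qed simp
    moreover have "atom_prob P (itinerary coord0 k) \<omega> = f k 0 (take k (itinerary coord0 (k + n) \<omega>))"
      using f[of k 0 \<omega>] take[of k "k + n" \<omega>] by simp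
    ultimately show ?thesis by (simp add: markov_weight_def)
  qed
  then show ?thesis by (intro exI[of _ "\<lambda>w. f k 0 (take k w) * (\<Prod>i<n. f (Suc k) i (take (Suc k + i) w) / f k i (take (k + i) w))"]) simp
qed

lemma markov_weight_nonneg: "0 \<le> markov_weight k n \<omega>"
  unfolding markov_weight_def step_cond_def by (intro mult_nonneg_nonneg prod_nonneg divide_nonneg_nonneg ballI atom_prob_nonneg)

lemma measurable_markov_weight [measurable]: "markov_weight k n \<in> borel_measurable P"
  unfolding markov_weight_def[abs_def] using measurable_atom_prob[OF rv_itinerary_coord] by measurable

text \<open>Induction on \<open>n\<close>: one more symbol is an instance of
  \<open>nn_integral_markov_ratio\<close>, with the word so far as \<open>A\<close> and its last
  \<open>k\<close> symbols, without and with the new one, as \<open>Z\<close> and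
  \<open>B\<close>.\<close>

lemma nn_integral_markov_weight_le:
  "(\<integral>\<^sup>+\<omega>. ennreal (markov_weight k n \<omega> / atom_prob P (itinerary coord0 (k + n)) \<omega>) \<partial>P) \<le> 1"
proof (induction n)
  case 0
  have "(\<integral>\<^sup>+\<omega>. ennreal (markov_weight k 0 \<omega> / atom_prob P (itinerary coord0 (k + 0)) \<omega>) \<partial>P) \<le> (\<integral>\<^sup>+\<omega>. 1 \<partial>P)"
    by (rule nn_integral_mono) (simp add: markov_weight_def)
  then show ?case by (simp add: emeasure_space_1)
next
  case (Suc n)
  obtain f where f: "\<And>\<omega>. markov_weight k n \<omega> = f (itinerary coord0 (k + n) \<omega>)" using markov_weight_fun by blast
  let ?B = "\<lambda>\<omega>. itinerary coord0 (Suc k) (sh (int n) \<omega>)" and ?Z = "\<lambda>\<omega>. itinerary coord0 k (sh (int n) \<omega>)"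
  have "(\<integral>\<^sup>+\<omega>. ennreal (markov_weight k (Suc n) \<omega> / atom_prob P (itinerary coord0 (k + Suc n)) \<omega>) \<partial>P)
    = (\<integral>\<^sup>+\<omega>. ennreal (f (itinerary coord0 (k + n) \<omega>)) *
        ennreal (atom_prob P ?B \<omega> / (atom_prob P (itinerary coord0 (k + Suc n)) \<omega> * atom_prob P ?Z \<omega>)) \<partial>P)"
  proof (rule nn_integral_cong)
    fix \<omega>
    have "markov_weight k (Suc n) \<omega> / atom_prob P (itinerary coord0 (k + Suc n)) \<omega>
      = f (itinerary coord0 (k + n) \<omega>) * (atom_prob P ?B \<omega> / (atom_prob P (itinerary coord0 (k + Suc n)) \<omega> * atom_prob P ?Z \<omega>))"
      unfolding f[symmetric] atom_prob_sh[OF rv_itinerary_coord] by (simp add: markov_weight_def step_cond_def mult_ac)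
    then show "ennreal (markov_weight k (Suc n) \<omega> / atom_prob P (itinerary coord0 (k + Suc n)) \<omega>)
      = ennreal (f (itinerary coord0 (k + n) \<omega>)) * ennreal (atom_prob P ?B \<omega> / (atom_prob P (itinerary coord0 (k + Suc n)) \<omega> * atom_prob P ?Z \<omega>))"
      using markov_weight_nonneg[of k n \<omega>] by (subst ennreal_mult'[symmetric]) (auto simp: f)
  qed
  also have "\<dots> \<le> (\<integral>\<^sup>+\<omega>. ennreal (f (itinerary coord0 (k + n) \<omega>)) * ennreal (1 / atom_prob P (itinerary coord0 (k + n)) \<omega>) \<partial>P)"
  proof (rule nn_integral_markov_ratio[OF rv_itinerary_coord rv_sh[OF rv_itinerary_coord] rv_sh[OF rv_itinerary_coord]])
    fix \<omega> \<omega>' :: "int \<Rightarrow> 'a"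
    have Z: "?Z \<omega> = ?Z \<omega>' \<longleftrightarrow> (\<forall>j<k. \<omega> (int (n + j)) = \<omega>' (int (n + j)))" for \<omega> \<omega>' :: "int \<Rightarrow> 'a"
      by (simp add: itinerary_eq_iff sh_apply add.commute)
    show Z_eq: "itinerary coord0 (k + n) \<omega> = itinerary coord0 (k + n) \<omega>' \<Longrightarrow> ?Z \<omega> = ?Z \<omega>'"
    proof -
      assume "itinerary coord0 (k + n) \<omega> = itinerary coord0 (k + n) \<omega>'"
      then have e: "\<omega> (int i) = \<omega>' (int i)" if "i < k + n" for i using that by (simp add: itinerary_eq_iff sh_apply)
      show "?Z \<omega> = ?Z \<omega>'" unfolding Z by (intro allI impI, rule e) simp
    qed
    show "?B \<omega> = ?B \<omega>' \<Longrightarrow> ?Z \<omega> = ?Z \<omega>'" by (simp add: itinerary_Suc_eq_iff)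
    have "?B \<omega> = ?B \<omega>' \<longleftrightarrow> ?Z \<omega> = ?Z \<omega>' \<and> \<omega> (int (k + n)) = \<omega>' (int (k + n))"
      by (simp add: itinerary_Suc_eq_iff sh_apply add.commute)
    then show "itinerary coord0 (k + Suc n) \<omega> = itinerary coord0 (k + Suc n) \<omega>' \<longleftrightarrow>
        itinerary coord0 (k + n) \<omega> = itinerary coord0 (k + n) \<omega>' \<and> ?B \<omega> = ?B \<omega>'"
      using Z_eq by (simp only: add_Suc_right itinerary_Suc_eq_iff sh_apply add_0) blast
  qed
  also have "\<dots> = (\<integral>\<^sup>+\<omega>. ennreal (markov_weight k n \<omega> / atom_prob P (itinerary coord0 (k + n)) \<omega>) \<partial>P)"
  proof (rule nn_integral_cong)
    fix \<omega>
    show "ennreal (f (itinerary coord0 (k + n) \<omega>)) * ennreal (1 / atom_prob P (itinerary coord0 (k + n)) \<omega>) =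
      ennreal (markov_weight k n \<omega> / atom_prob P (itinerary coord0 (k + n)) \<omega>)"
      using markov_weight_nonneg[of k n \<omega>] by (subst ennreal_mult'[symmetric]) (auto simp: f)
  qed
  also have "\<dots> \<le> 1" by (rule Suc)
  finally show ?case .
qed

section \<open>Conditioning on the infinite past\<close>

definition past :: "nat \<Rightarrow> (int \<Rightarrow> 'a) \<Rightarrow> 'a list" where
  "past k \<omega> = itinerary coord0 k (sh (- int k) \<omega>)"

lemma rv_past: "rv (past k)"
  unfolding past_def[abs_def] by (rule rv_sh[OF rv_itinerary_coord])

lemma past_refines: "\<exists>f. \<forall>\<omega>. past k \<omega> = f (past (Suc k) \<omega>)"
proof -
  have "past k \<omega> = drop 1 (past (Suc k) \<omega>)" for \<omega>
    by (rule nth_equalityI) (auto simp: past_def itinerary_def sh_apply algebra_simps simp del: upt_Suc)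
  then show ?thesis by blast
qed

lemma coord_event_past:
  assumes "i < 0" shows "\<exists>k S. {\<omega>. \<omega> i = a} = {\<omega>. past k \<omega> \<in> S}"
proof -
  have "past (nat (- i)) \<omega> ! 0 = \<omega> i" for \<omega> using assms by (simp add: past_def itinerary_def sh_apply)
  then show ?thesis by (intro exI[of _ "nat (- i)"] exI[of _ "{w. w ! 0 = a}"]) auto
qed

abbreviation "past_sigma \<equiv> (coord_sigma {..<0} :: (int \<Rightarrow> 'a) measure)"

interpretation past: finite_measure_subalgebra P past_sigma
  by unfold_locales (rule subalg_coord)

definition symb :: "'a \<Rightarrow> (int \<Rightarrow> 'a) set" where "symb a = {\<omega>. \<omega> 0 = a}"

lemma symb_in_events: "symb a \<in> events"
  unfolding symb_def by (rule fibre_in_events[OF measurable_coord0])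

text \<open>
  The cut-off at 1 changes the conditional probability only on a null set and makes its bounds
  hold everywhere.
\<close>

definition past_cond :: "'a \<Rightarrow> (int \<Rightarrow> 'a) \<Rightarrow> real" where
  "past_cond a \<omega> = min 1 (enn2real (nn_cond_exp P past_sigma (indicator (symb a)) \<omega>))"

lemma measurable_past_cond: "past_cond a \<in> borel_measurable past_sigma"
  unfolding past_cond_def[abs_def] by measurable

lemma measurable_past_cond' [measurable]: "past_cond a \<in> borel_measurable P"
  by (rule measurable_from_coord_sigma[OF measurable_past_cond])

lemma past_cond_bounds: "past_cond a \<omega> \<in> {0..1}"
  by (simp add: past_cond_def)

lemma AE_past_cond_eq: "AE \<omega> in P. ennreal (past_cond a \<omega>) = nn_cond_exp P past_sigma (indicator (symb a)) \<omega>"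
proof -
  have [measurable]: "symb a \<in> events" by (rule symb_in_events)
  have "AE \<omega> in P. nn_cond_exp P past_sigma (indicator (symb a)) \<omega> \<le> nn_cond_exp P past_sigma (\<lambda>_. 1) \<omega>"
    by (rule past.nn_cond_exp_mono) (auto simp: indicator_def)
  moreover have "AE \<omega> in P. 1 = nn_cond_exp P past_sigma (\<lambda>_. 1) \<omega>"
    by (rule past.nn_cond_exp_F_meas) simp
  ultimately show ?thesis
  proof eventually_elim
    case (elim \<omega>)
    then have le: "nn_cond_exp P past_sigma (indicator (symb a)) \<omega> \<le> 1" by simp
    then have "enn2real (nn_cond_exp P past_sigma (indicator (symb a)) \<omega>) \<le> 1"
      by (metis enn2real_mono enn2real_1 ennreal_one_less_top)
    moreover have "nn_cond_exp P past_sigma (indicator (symb a)) \<omega> < top"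
      using le by (rule le_less_trans) simp
    ultimately show ?case by (simp add: past_cond_def)
  qed
qed

lemma nn_integral_past_cond:
  assumes f: "f \<in> borel_measurable past_sigma"
  shows "(\<integral>\<^sup>+\<omega>. f \<omega> * ennreal (past_cond a \<omega>) \<partial>P) = (\<integral>\<^sup>+\<omega>. f \<omega> * indicator (symb a) \<omega> \<partial>P)"
proof -
  have "(\<integral>\<^sup>+\<omega>. f \<omega> * ennreal (past_cond a \<omega>) \<partial>P)
    = (\<integral>\<^sup>+\<omega>. f \<omega> * nn_cond_exp P past_sigma (indicator (symb a)) \<omega> \<partial>P)"
    using AE_past_cond_eq[of a] by (intro nn_integral_cong_AE) (auto elim!: eventually_mono)
  also have "\<dots> = (\<integral>\<^sup>+\<omega>. f \<omega> * indicator (symb a) \<omega> \<partial>P)"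
    by (rule past.nn_cond_exp_intg[OF f]) (use symb_in_events in measurable)
  finally show ?thesis .
qed

text \<open>The conditional probability, given the past, of the symbol that actually occurs; its
  negative logarithm will have the entropy rate as its mean.\<close>

definition past_prob :: "(int \<Rightarrow> 'a) \<Rightarrow> real" where "past_prob \<omega> = past_cond (\<omega> 0) \<omega>"

lemma measurable_past_prob: "past_prob \<in> borel_measurable (coord_sigma {..0})"
proof -
  have 1: "coord0 \<in> measurable (coord_sigma {..0}) (count_space (UNIV :: 'a set))"
    by (rule measurable_coord) simp
  have less_imp_le_set: "{..<0::int} \<subseteq> {..0}" by auto
  have sub: "subalgebra (coord_sigma {..0}) past_sigma"
    using coord_algebra_mono[OF less_imp_le_set] by (simp add: subalgebra_def sets_coord_sigma)
  have 2: "past_cond a \<in> borel_measurable (coord_sigma {..0})" for a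
    by (rule measurable_from_subalg[OF sub measurable_past_cond])
  show ?thesis unfolding past_prob_def[abs_def]
    by (rule measurable_compose_countable'[OF 2 1]) simp
qed

lemma measurable_past_prob' [measurable]: "past_prob \<in> borel_measurable P"
  by (rule measurable_from_coord_sigma[OF measurable_past_prob])

lemma past_prob_bounds: "past_prob \<omega> \<in> {0..1}"
  unfolding past_prob_def by (rule past_cond_bounds)

text \<open>The probability that a symbol occurs although its conditional probability vanishes is
  the integral of that conditional probability over its own zero set.\<close>

lemma AE_past_prob_pos: "AE \<omega> in P. past_prob \<omega> > 0"
proof -
  have "AE \<omega> in P. \<forall>a. \<not> (past_cond a \<omega> = 0 \<and> \<omega> \<in> symb a)"
    unfolding AE_all_countable
  proof
    fix a
    let ?N = "{\<omega>. past_cond a \<omega> = 0}"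
    have N: "?N \<in> sets past_sigma"
      using measurable_sets[OF measurable_past_cond, of "{0}" a] by (simp add: vimage_def)
    have Ns: "?N \<inter> symb a \<in> events"
      using N symb_in_events[of a] sets_coord_algebra by (auto simp: sets_coord_sigma)
    have "(\<integral>\<^sup>+\<omega>. indicator ?N \<omega> * indicator (symb a) \<omega> \<partial>P) = (\<integral>\<^sup>+\<omega>. indicator ?N \<omega> * ennreal (past_cond a \<omega>) \<partial>P)"
      by (rule nn_integral_past_cond[symmetric]) (use N in measurable)
    also have "\<dots> = (\<integral>\<^sup>+\<omega>. 0 \<partial>P)" by (intro nn_integral_cong) (auto simp: indicator_def)
    finally have "emeasure P (?N \<inter> symb a) = 0"
      using Ns by (simp add: indicator_inter_arith[symmetric])
    then have "AE \<omega> in P. \<omega> \<notin> ?N \<inter> symb a" using Ns by (intro AE_not_in) (auto simp: null_sets_def)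
    then show "AE \<omega> in P. \<not> (past_cond a \<omega> = 0 \<and> \<omega> \<in> symb a)" by eventually_elim auto
  qed
  then show ?thesis
  proof eventually_elim
    case (elim \<omega>)
    then have "past_prob \<omega> \<noteq> 0" by (auto simp: past_prob_def symb_def)
    then show ?case using past_prob_bounds[of \<omega>] by (simp add: less_le)
  qed
qed

lemma past_cond_L1:
  "(\<lambda>k. expectation (\<lambda>\<omega>. \<bar>atom_cond_prob P (symb a) (past k) \<omega> - past_cond a \<omega>\<bar>)) \<longlonglongrightarrow> 0"
proof (rule atom_cond_prob_L1_convergence[where X=past, OF rv_past past_refines])
  show "\<exists>k S. G = {\<omega>\<in>space P. past k \<omega> \<in> S}" if "G \<in> {{\<omega>. \<omega> i = a} | i a. i \<in> {..<0}}" for G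
    using that coord_event_past by auto
  fix c :: real
  have "{\<omega>\<in>space past_sigma. c \<le> past_cond a \<omega>} \<in> sets past_sigma" using measurable_past_cond[of a] by measurable
  then show "{\<omega>\<in>space P. c \<le> past_cond a \<omega>} \<in> sigma_sets (space P) {{\<omega>. \<omega> i = a} | i a. i \<in> {..<0}}"
    by (simp add: sets_coord_sigma coord_algebra_def)
next
  show "past_cond a \<omega> \<in> {0..1}" for \<omega> by (rule past_cond_bounds)
next
  fix k w
  have pm: "past k \<in> measurable past_sigma (count_space UNIV)"
    unfolding past_def[abs_def] itinerary_def sh_apply sh_sh
  proof -
    have "(\<lambda>\<omega>. map (\<lambda>j. if j < k then \<omega> (0 + (int j + - int k)) else undefined) [0..<k]) \<in> measurable past_sigma (count_space UNIV)"
    proof (rule measurable_discrete_list)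
      fix j
      show "(\<lambda>\<omega>. if j < k then \<omega> (0 + (int j + - int k)) else undefined) \<in> measurable past_sigma (count_space (UNIV :: 'a set))"
        by (cases "j < k") (auto intro: measurable_coord)
    qed
    also have "(\<lambda>\<omega>. map (\<lambda>j. if j < k then \<omega> (0 + (int j + - int k)) else undefined) [0..<k])
      = (\<lambda>\<omega> :: int \<Rightarrow> 'a. map (\<lambda>j. \<omega> (0 + (int j + - int k))) [0..<k])" by (auto simp: fun_eq_iff)
    finally show "(\<lambda>\<omega> :: int \<Rightarrow> 'a. map (\<lambda>j. \<omega> (0 + (int j + - int k))) [0..<k]) \<in> measurable past_sigma (count_space UNIV)" .
  qed
  let ?W = "{\<omega>\<in>space P. past k \<omega> = w}"
  have W: "?W \<in> sets past_sigma"
    using measurable_sets[OF pm, of "{w}"] by (simp add: vimage_def)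
  then have We: "?W \<in> events" using sets_coord_algebra by (auto simp: sets_coord_sigma)
  have nn: "(\<integral>\<^sup>+\<omega>. ennreal (past_cond a \<omega> * indicator ?W \<omega>) \<partial>P) = ennreal (prob {\<omega>'\<in>space P. \<omega>' \<in> symb a \<and> past k \<omega>' = w})"
  proof -
    have "(\<integral>\<^sup>+\<omega>. ennreal (past_cond a \<omega> * indicator ?W \<omega>) \<partial>P) = (\<integral>\<^sup>+\<omega>. indicator ?W \<omega> * ennreal (past_cond a \<omega>) \<partial>P)"
      by (intro nn_integral_cong) (auto simp: indicator_def)
    also have "\<dots> = (\<integral>\<^sup>+\<omega>. indicator ?W \<omega> * indicator (symb a) \<omega> \<partial>P)"
      by (rule nn_integral_past_cond) (use W in measurable)
    also have "\<dots> = emeasure P (?W \<inter> symb a)"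
      using We symb_in_events by (simp add: indicator_inter_arith[symmetric])
    also have "?W \<inter> symb a = {\<omega>'\<in>space P. \<omega>' \<in> symb a \<and> past k \<omega>' = w}" by auto
    finally show ?thesis by (simp add: emeasure_eq_measure)
  qed
  show "expectation (\<lambda>\<omega>. past_cond a \<omega> * indicator ?W \<omega>) = prob {\<omega>'\<in>space P. \<omega>' \<in> symb a \<and> past k \<omega>' = w}"
  proof (subst integral_eq_nn_integral)
    show "(\<lambda>\<omega>. past_cond a \<omega> * indicator ?W \<omega>) \<in> borel_measurable P" using We by measurable
    show "AE \<omega> in P. 0 \<le> past_cond a \<omega> * indicator ?W \<omega>" using past_cond_bounds[of a] by simp
  qed (simp only: nn enn2real_ennreal measure_nonneg)
qed

text \<open>A shift by \<open>- k\<close> turns the last of \<open>Suc k\<close> symbols into the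
  symbol at 0 and the others into its past.\<close>

lemma ent_incr_eq_sum:
  assumes fc: "finite_ent P coord0"
  shows "ennreal (ent_incr P coord0 k)
    = (\<integral>\<^sup>+a. ennreal (expectation (\<lambda>\<omega>. eta (atom_cond_prob P (symb a) (past k) \<omega>))) \<partial>count_space UNIV)"
proof -
  have f: "finite_ent P (past k)" unfolding past_def[abs_def]
    by (rule finite_ent_sh[OF rv_itinerary_coord finite_ent_itinerary[OF measurable_coord0 fc]])
  have "ent P (\<lambda>\<omega>. (\<omega> 0, past k \<omega>)) = ent P (\<lambda>\<omega>. itinerary coord0 (Suc k) (sh (- int k) \<omega>))"
    by (rule ent_cong) (auto simp: past_def itinerary_Suc_eq_iff sh_apply)
  then have "ent_incr P coord0 k = ent P (\<lambda>\<omega>. (\<omega> 0, past k \<omega>)) - ent P (past k)"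
    unfolding past_def[abs_def] by (simp add: ent_incr_def ent_sh[OF rv_itinerary_coord])
  then show ?thesis using ent_conditional[OF measurable_coord0 rv_past fc f] by (simp add: symb_def)
qed

text \<open>The entropy increments are sums over symbols of \<open>e k a\<close>. Each term
  converges, by L1 convergence of the conditional probabilities, and all are dominated by
  \<open>e 0 a\<close>, whose sum is the finite entropy of one symbol. Splitting the mean of
  \<open>- ln (past_prob \<omega>)\<close> along the symbol at 0 gives the sum of the
  limits.\<close>

lemma expectation_past_prob:
  assumes fc: "finite_ent P coord0"
  shows "integrable P (\<lambda>\<omega>. - ln (past_prob \<omega>))" "expectation (\<lambda>\<omega>. - ln (past_prob \<omega>)) = entropy_rate P coord0"
proof -
  define e where "e k a = expectation (\<lambda>\<omega>. eta (atom_cond_prob P (symb a) (past k) \<omega>))" for k a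
  define einf where "einf a = expectation (\<lambda>\<omega>. eta (past_cond a \<omega>))" for a
  have e0: "0 \<le> e k a" for k a unfolding e_def
    by (intro integral_nonneg_AE AE_I2) (use atom_cond_prob_bounds[OF rv_past] eta_nonneg in auto)
  \<comment> \<open>The empty past carries no information, so \<open>e 0 a\<close> is the
    unconditional term.\<close>
  have "past 0 \<omega> = []" for \<omega> :: "int \<Rightarrow> 'a" by (simp add: past_def itinerary_def)
  then have ez: "e 0 a = eta (prob (symb a))" for a
    by (simp add: e_def atom_cond_prob_def atom_prob_def prob_space)
  have le: "e k a \<le> e 0 a" for k a
    unfolding ez unfolding e_def by (rule expectation_eta_atom_cond_prob_le[OF rv_past symb_in_events])
  have lim: "(\<lambda>k. e k a) \<longlonglongrightarrow> einf a" for a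
    unfolding e_def einf_def
    by (rule eta_L1_convergence[OF measurable_atom_cond_prob[OF rv_past] measurable_past_cond' _ _ past_cond_L1])
       (use atom_cond_prob_bounds[OF rv_past] past_cond_bounds in auto)
  have sum: "ennreal (ent_incr P coord0 k) = (\<integral>\<^sup>+a. ennreal (e k a) \<partial>count_space UNIV)" for k
    unfolding e_def by (rule ent_incr_eq_sum[OF fc])
  have "(\<lambda>k. \<integral>\<^sup>+a. ennreal (e k a) \<partial>count_space UNIV) \<longlonglongrightarrow> (\<integral>\<^sup>+a. ennreal (einf a) \<partial>count_space UNIV)"
  proof (rule nn_integral_dominated_convergence[where w="\<lambda>a. ennreal (e 0 a)"])
    show "(\<integral>\<^sup>+a. ennreal (e 0 a) \<partial>count_space UNIV) < \<infinity>" unfolding sum[symmetric] by simp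
  qed (use le lim in \<open>auto intro: ennreal_leI tendsto_ennrealI\<close>)
  moreover have "(\<lambda>k. ennreal (ent_incr P coord0 k)) \<longlonglongrightarrow> ennreal (entropy_rate P coord0)"
    by (intro tendsto_ennrealI ent_incr_LIMSEQ[OF measurable_coord0 fc])
  ultimately have inf: "(\<integral>\<^sup>+a. ennreal (einf a) \<partial>count_space UNIV) = ennreal (entropy_rate P coord0)"
    unfolding sum by (rule LIMSEQ_unique)
  have "(\<integral>\<^sup>+\<omega>. ennreal (- ln (past_prob \<omega>)) \<partial>P) = emeasure (density P (\<lambda>\<omega>. ennreal (- ln (past_prob \<omega>)))) (space P)"
    by (subst emeasure_density) (auto simp: nn_integral_set_ennreal)
  also have "\<dots> = (\<integral>\<^sup>+a. emeasure (density P (\<lambda>\<omega>. ennreal (- ln (past_prob \<omega>)))) (space P \<inter> {\<omega>\<in>space P. \<omega> 0 = a}) \<partial>count_space UNIV)"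
    by (rule emeasure_sum_discrete[OF measurable_coord0, symmetric]) auto
  also have "\<dots> = (\<integral>\<^sup>+a. ennreal (einf a) \<partial>count_space UNIV)"
  proof (rule nn_integral_cong)
    fix a
    have "emeasure (density P (\<lambda>\<omega>. ennreal (- ln (past_prob \<omega>)))) (space P \<inter> {\<omega>\<in>space P. \<omega> 0 = a})
      = (\<integral>\<^sup>+\<omega>. ennreal (- ln (past_prob \<omega>)) * indicator (symb a) \<omega> \<partial>P)"
      using symb_in_events[of a] by (subst emeasure_density) (auto simp: symb_def)
    also have "\<dots> = (\<integral>\<^sup>+\<omega>. ennreal (- ln (past_cond a \<omega>)) * indicator (symb a) \<omega> \<partial>P)"
      by (intro nn_integral_cong) (auto simp: indicator_def past_prob_def symb_def)
    also have "\<dots> = (\<integral>\<^sup>+\<omega>. ennreal (- ln (past_cond a \<omega>)) * ennreal (past_cond a \<omega>) \<partial>P)"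
      by (rule nn_integral_past_cond[symmetric]) (use measurable_past_cond in measurable)
    also have "\<dots> = (\<integral>\<^sup>+\<omega>. ennreal (eta (past_cond a \<omega>)) \<partial>P)"
    proof (intro nn_integral_cong)
      fix \<omega>
      show "ennreal (- ln (past_cond a \<omega>)) * ennreal (past_cond a \<omega>) = ennreal (eta (past_cond a \<omega>))"
        using past_cond_bounds[of a \<omega>]
        by (cases "past_cond a \<omega> = 0") (auto simp: eta_def ennreal_mult[symmetric] mult.commute)
    qed
    also have "\<dots> = ennreal (einf a)" unfolding einf_def
    proof (rule nn_integral_eq_integral)
      have b: "0 \<le> eta (past_cond a \<omega>) \<and> eta (past_cond a \<omega>) \<le> 1" for \<omega>
        using past_cond_bounds[of a \<omega>] eta_nonneg eta_le_1 by auto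
      show "AE \<omega> in P. 0 \<le> eta (past_cond a \<omega>)" using b by simp
      show "integrable P (\<lambda>\<omega>. eta (past_cond a \<omega>))"
        by (rule integrable_const_bound[where B=1]) (use b in auto)
    qed
    finally show "emeasure (density P (\<lambda>\<omega>. ennreal (- ln (past_prob \<omega>)))) (space P \<inter> {\<omega>\<in>space P. \<omega> 0 = a}) = ennreal (einf a)" .
  qed
  finally have nn: "(\<integral>\<^sup>+\<omega>. ennreal (- ln (past_prob \<omega>)) \<partial>P) = ennreal (entropy_rate P coord0)" unfolding inf .
  have pos: "AE \<omega> in P. 0 \<le> - ln (past_prob \<omega>)"
    using AE_past_prob_pos by eventually_elim (use past_prob_bounds in auto)
  show "integrable P (\<lambda>\<omega>. - ln (past_prob \<omega>))"
    by (rule integrableI_nonneg[OF _ pos]) (auto simp: nn)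
  show "expectation (\<lambda>\<omega>. - ln (past_prob \<omega>)) = entropy_rate P coord0"
    using pos entropy_rate_nonneg[OF measurable_coord0 fc] by (subst integral_eq_nn_integral) (auto simp: nn)
qed

text \<open>The reciprocal of the conditional probability of the word at
  \<open>0, ..., n - 1\<close> given everything before 0.\<close>

definition past_weight :: "nat \<Rightarrow> (int \<Rightarrow> 'a) \<Rightarrow> real" where
  "past_weight n \<omega> = (\<Prod>i<n. 1 / past_prob (sh (int i) \<omega>))"

lemma past_weight_nonneg: "0 \<le> past_weight n \<omega>"
  unfolding past_weight_def using past_prob_bounds by (intro prod_nonneg) auto

lemma measurable_past_weight [measurable]: "past_weight n \<in> borel_measurable P"
  unfolding past_weight_def[abs_def] by measurable

text \<open>Induction on the length of a fixed word: given the past of time \<open>n\<close>, the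
  conditional probability of the last symbol cancels its weight. Only an inequality remains, because
  the product is 0 instead of 1 where that probability vanishes.\<close>

lemma nn_integral_past_weight_word:
  "(\<integral>\<^sup>+\<omega>. ennreal (past_weight n \<omega>) * indicator {\<omega>. \<forall>i<n. \<omega> (int i) = w i} \<omega> \<partial>P) \<le> 1"
proof (induction n)
  case 0
  show ?case by (simp add: past_weight_def emeasure_space_1)
next
  case (Suc n)
  define V where "V \<omega> = ennreal (past_weight n \<omega>) * indicator {\<omega>. \<forall>i<n. \<omega> (int i) = w i} \<omega>" for \<omega>
  have word: "{\<omega>. \<forall>i<n. \<omega> (int i) = w i} \<in> events" for n
  proof -
    have "{\<omega>. \<forall>i<n. \<omega> (int i) = w i} = {\<omega>. itinerary coord0 n \<omega> = map w [0..<n]}"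
      by (auto simp: list_eq_iff_nth_eq sh_apply)
    then show ?thesis using fibre_in_events[OF rv_itinerary_coord] by simp
  qed
  \<comment> \<open>Seen from time \<open>n\<close>, the first \<open>n\<close> factors and symbols
    lie strictly in the past, which allows conditioning on \<open>past_sigma\<close>.\<close>
  have Vm: "(\<lambda>\<omega>. V (sh (- int n) \<omega>)) \<in> borel_measurable past_sigma"
  proof -
    have "(\<lambda>\<omega>. past_prob (sh (int i) (sh (- int n) \<omega>))) \<in> borel_measurable past_sigma" if "i < n" for i
    proof -
      have "sh (int i - int n) \<in> measurable past_sigma (coord_sigma {..0} :: (int \<Rightarrow> 'a) measure)"
        using that by (intro measurable_sh_coord_sigma) auto
      from measurable_compose[OF this measurable_past_prob] show ?thesis by simp
    qed
    then have 1: "(\<lambda>\<omega>. past_weight n (sh (- int n) \<omega>)) \<in> borel_measurable past_sigma"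
      unfolding past_weight_def by (intro borel_measurable_prod borel_measurable_divide) auto
    have "{\<omega>. \<forall>i<n. sh (- int n) \<omega> (int i) = w i} = (\<Inter>i\<in>{..<n}. {\<omega>. \<omega> (int i - int n) = w i})" 
      by (auto simp: sh_apply)
    also have "\<dots> \<inter> UNIV \<in> sets past_sigma"
    proof (cases "n = 0")
      case False
      have "{\<omega>. \<omega> (int i - int n) = w i} \<in> sets past_sigma" if "i < n" for i
        unfolding sets_coord_sigma coord_algebra_def using that by (intro sigma_sets.Basic) auto
      then have "(\<Inter>i\<in>{..<n}. {\<omega>. \<omega> (int i - int n) = w i}) \<in> sets past_sigma"
        using False by (intro sets.finite_INT) (auto simp: lessThan_empty_iff)
      then show ?thesis by simp
    qed auto
    finally have 2: "{\<omega>. \<forall>i<n. sh (- int n) \<omega> (int i) = w i} \<in> sets past_sigma" by simp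
    have "(\<lambda>\<omega>. ennreal (past_weight n (sh (- int n) \<omega>)) * indicator {\<omega>. \<forall>i<n. sh (- int n) \<omega> (int i) = w i} \<omega>) \<in> borel_measurable past_sigma"
      using 1 2 by measurable
    then show ?thesis by (simp add: V_def indicator_def)
  qed
  have Vb[measurable]: "V \<in> borel_measurable P" unfolding V_def[abs_def]
    by (intro borel_measurable_times_ennreal borel_measurable_indicator word
        measurable_compose[OF measurable_past_weight measurable_ennreal])
  have sy[measurable]: "symb a \<in> events" for a by (rule symb_in_events)
  have "(\<integral>\<^sup>+\<omega>. ennreal (past_weight (Suc n) \<omega>) * indicator {\<omega>. \<forall>i<Suc n. \<omega> (int i) = w i} \<omega> \<partial>P)
    = (\<integral>\<^sup>+\<omega>. (V \<omega> * ennreal (1 / past_cond (w n) (sh (int n) \<omega>))) * indicator (symb (w n)) (sh (int n) \<omega>) \<partial>P)"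
  proof (rule nn_integral_cong)
    fix \<omega>
    have "ennreal (past_weight (Suc n) \<omega>) = ennreal (past_weight n \<omega>) * ennreal (1 / past_prob (sh (int n) \<omega>))"
      using past_weight_nonneg[of n \<omega>] past_prob_bounds[of "sh (int n) \<omega>"]
      by (simp add: past_weight_def ennreal_mult[symmetric])
    then show "ennreal (past_weight (Suc n) \<omega>) * indicator {\<omega>. \<forall>i<Suc n. \<omega> (int i) = w i} \<omega>
      = (V \<omega> * ennreal (1 / past_cond (w n) (sh (int n) \<omega>))) * indicator (symb (w n)) (sh (int n) \<omega>)"
      by (auto simp: V_def indicator_def symb_def sh_apply past_prob_def less_Suc_eq)
  qed
  \<comment> \<open>The symbol at time \<open>n\<close> is moved to 0, where
    \<open>past_cond\<close> is defined.\<close>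
  also have "\<dots> = (\<integral>\<^sup>+\<omega>. (V (sh (- int n) \<omega>) * ennreal (1 / past_cond (w n) \<omega>)) * indicator (symb (w n)) \<omega> \<partial>P)"
    by (subst nn_integral_sh[of "\<lambda>\<omega>. (V \<omega> * ennreal (1 / past_cond (w n) (sh (int n) \<omega>))) * indicator (symb (w n)) (sh (int n) \<omega>)" "- int n", symmetric])
       simp_all
  also have "\<dots> = (\<integral>\<^sup>+\<omega>. (V (sh (- int n) \<omega>) * ennreal (1 / past_cond (w n) \<omega>)) * ennreal (past_cond (w n) \<omega>) \<partial>P)"
    by (rule nn_integral_past_cond[symmetric]) (use Vm measurable_past_cond[of "w n"] in measurable)
  also have "\<dots> \<le> (\<integral>\<^sup>+\<omega>. V (sh (- int n) \<omega>) \<partial>P)"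
  proof (rule nn_integral_mono)
    fix \<omega>
    have "ennreal (1 / past_cond (w n) \<omega>) * ennreal (past_cond (w n) \<omega>) \<le> 1"
      using past_cond_bounds[of "w n" \<omega>] by (auto simp: ennreal_mult[symmetric])
    then have "V (sh (- int n) \<omega>) * (ennreal (1 / past_cond (w n) \<omega>) * ennreal (past_cond (w n) \<omega>)) \<le> V (sh (- int n) \<omega>) * 1"
      by (rule mult_left_mono) simp
    then show "(V (sh (- int n) \<omega>) * ennreal (1 / past_cond (w n) \<omega>)) * ennreal (past_cond (w n) \<omega>) \<le> V (sh (- int n) \<omega>)"
      by (simp add: mult.assoc)
  qed
  also have "\<dots> = (\<integral>\<^sup>+\<omega>. V \<omega> \<partial>P)" by (rule nn_integral_sh[OF Vb])
  also have "\<dots> \<le> 1" unfolding V_def by (rule Suc)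
  finally show ?case .
qed

text \<open>Summation over words: where a given word occurs, \<open>atom_prob\<close> is the
  probability of that word, and \<open>past_weight\<close> integrates to at most 1 there.\<close>

lemma nn_integral_past_weight_le:
  "(\<integral>\<^sup>+\<omega>. ennreal (atom_prob P (itinerary coord0 n) \<omega> * past_weight n \<omega>) \<partial>P) \<le> 1"
proof -
  let ?f = "\<lambda>\<omega>. ennreal (atom_prob P (itinerary coord0 n) \<omega> * past_weight n \<omega>)"
  let ?B = "\<lambda>w. {\<omega>\<in>space P. itinerary coord0 n \<omega> = w}"
  have [measurable]: "?f \<in> borel_measurable P" using measurable_atom_prob[OF rv_itinerary_coord] by measurable
  have Bw[measurable]: "?B w \<in> events" for w
  proof -
    have "itinerary coord0 n -` {w} \<inter> space P \<in> events" by (rule measurable_sets[OF rv_itinerary_coord]) simp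
    also have "itinerary coord0 n -` {w} \<inter> space P = ?B w" by auto
    finally show ?thesis .
  qed
  have "(\<integral>\<^sup>+\<omega>. ?f \<omega> \<partial>P) = emeasure (density P ?f) (space P)"
    by (subst emeasure_density) auto
  also have "\<dots> = (\<integral>\<^sup>+w. emeasure (density P ?f) (space P \<inter> ?B w) \<partial>count_space UNIV)"
    by (rule emeasure_sum_discrete[OF rv_itinerary_coord, symmetric]) auto
  also have "\<dots> \<le> (\<integral>\<^sup>+w. emeasure P (space P \<inter> ?B w) \<partial>count_space UNIV)"
  proof (rule nn_integral_mono)
    fix w
    have "emeasure (density P ?f) (space P \<inter> ?B w) = (\<integral>\<^sup>+\<omega>. ?f \<omega> * indicator (space P \<inter> ?B w) \<omega> \<partial>P)"
      by (subst emeasure_density) (auto simp: fibre_in_events[OF rv_itinerary_coord])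
    also have "\<dots> \<le> (\<integral>\<^sup>+\<omega>. ennreal (prob (?B w)) * (ennreal (past_weight n \<omega>) * indicator {\<omega>. \<forall>i<n. \<omega> (int i) = w ! i} \<omega>) \<partial>P)"
    proof (rule nn_integral_mono)
      fix \<omega>
      show "?f \<omega> * indicator (space P \<inter> ?B w) \<omega> \<le> ennreal (prob (?B w)) * (ennreal (past_weight n \<omega>) * indicator {\<omega>. \<forall>i<n. \<omega> (int i) = w ! i} \<omega>)"
      proof (cases "itinerary coord0 n \<omega> = w")
        case True
        then have "\<forall>i<n. \<omega> (int i) = w ! i" by (auto simp: sh_apply)
        then show ?thesis using True past_weight_nonneg[of n \<omega>] by (simp add: atom_prob_def ennreal_mult)
      qed auto
    qed
    also have "\<dots> = ennreal (prob (?B w)) * (\<integral>\<^sup>+\<omega>. ennreal (past_weight n \<omega>) * indicator {\<omega>. \<forall>i<n. \<omega> (int i) = w ! i} \<omega> \<partial>P)"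
    proof (rule nn_integral_cmult)
      have "{\<omega>. \<forall>i<n. \<omega> (int i) = w ! i} = {\<omega>. itinerary coord0 n \<omega> = map (\<lambda>i. w ! i) [0..<n]}"
        by (auto simp: list_eq_iff_nth_eq sh_apply)
      then have word: "{\<omega>. \<forall>i<n. \<omega> (int i) = w ! i} \<in> events" using fibre_in_events[OF rv_itinerary_coord] by simp
      show "(\<lambda>\<omega>. ennreal (past_weight n \<omega>) * indicator {\<omega>. \<forall>i<n. \<omega> (int i) = w ! i} \<omega>) \<in> borel_measurable P"
        by (intro borel_measurable_times_ennreal borel_measurable_indicator word
            measurable_compose[OF measurable_past_weight measurable_ennreal])
    qed
    also have "\<dots> \<le> ennreal (prob (?B w)) * 1" by (intro mult_left_mono nn_integral_past_weight_word) simp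
    finally show "emeasure (density P ?f) (space P \<inter> ?B w) \<le> emeasure P (space P \<inter> ?B w)"
      by (simp add: emeasure_eq_measure)
  qed
  also have "\<dots> = emeasure P (space P)" by (rule emeasure_sum_discrete[OF rv_itinerary_coord]) auto
  also have "\<dots> = 1" by (rule emeasure_space_1)
  finally show ?thesis .
qed

end

section \<open>Information of growing windows\<close>

context mixing
begin

lemma atom_prob_itinerary_le_window:
  assumes "\<And>i. - int s \<le> i \<Longrightarrow> i \<le> int s \<Longrightarrow> a \<le> i \<and> i < a + int n"
  shows "atom_prob P (itinerary coord0 n) (sh a \<omega>) \<le> atom_prob P (window s) \<omega>"
proof -
  have "atom_prob P (\<lambda>\<omega>. itinerary coord0 n (sh a \<omega>)) \<omega> \<le> atom_prob P (window s) \<omega>"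
  proof (rule atom_prob_mono[OF rv_window])
    fix \<omega> \<omega>' :: "int \<Rightarrow> 'a"
    assume eq: "itinerary coord0 n (sh a \<omega>) = itinerary coord0 n (sh a \<omega>')"
    have *: "\<omega> i = \<omega>' i" if "a \<le> i" "i < a + int n" for i
    proof -
      define j where "j = nat (i - a)"
      have j: "j < n" "i = int j + a" using that by (auto simp: j_def)
      have "itinerary coord0 n (sh a \<omega>) ! j = itinerary coord0 n (sh a \<omega>') ! j" using eq by simp
      then show ?thesis using j by (simp add: sh_apply)
    qed
    show "window s \<omega> = window s \<omega>'"
      unfolding window_def by (rule map_cong) (use * assms in auto)
  qed
  then show ?thesis by (simp add: atom_prob_sh[OF rv_itinerary_coord])
qed

lemma window_le_atom_prob_itinerary:
  assumes "\<And>j. j < n \<Longrightarrow> - int s \<le> a + int j \<and> a + int j \<le> int s"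
  shows "atom_prob P (window s) \<omega> \<le> atom_prob P (itinerary coord0 n) (sh a \<omega>)"
proof -
  have "atom_prob P (window s) \<omega> \<le> atom_prob P (\<lambda>\<omega>. itinerary coord0 n (sh a \<omega>)) \<omega>"
  proof (rule atom_prob_mono[OF rv_sh[OF rv_itinerary_coord]])
    fix \<omega> \<omega>' :: "int \<Rightarrow> 'a"
    assume eq: "window s \<omega> = window s \<omega>'"
    have *: "\<omega> i = \<omega>' i" if "- int s \<le> i" "i \<le> int s" for i
    proof -
      define j where "j = nat (i + int s)"
      have j: "j < 2 * s + 1" "i = int j + - int s" using that by (auto simp: j_def)
      have "window s \<omega> ! j = window s \<omega>' ! j" using eq by simp
      then show ?thesis using j by (simp add: window_eq_itinerary sh_apply)
    qed
    show "itinerary coord0 n (sh a \<omega>) = itinerary coord0 n (sh a \<omega>')"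
      unfolding itinerary_eq_iff sh_sh using * assms by (simp add: sh_apply add.commute)
  qed
  then show ?thesis by (simp add: atom_prob_sh[OF rv_itinerary_coord])
qed

lemma sum_shift_two_sided:
  "(\<Sum>i<2 * s. f (int i - int s)) = (\<Sum>i\<in>{- int s..<int s}. f i)"
proof (rule sum.reindex_bij_witness[of _ "\<lambda>i. nat (i + int s)" "\<lambda>i. int i - int s"])
qed auto

text \<open>The window \<open>[-s, s]\<close> contains the word at \<open>-s, ..., s - 1\<close>, so
  its probability is at most \<open>exp (\<delta> * s)\<close> divided by the
  \<open>past_weight\<close> of that word. This weight is the exponential of a two-sided Birkhoff
  sum whose terms have mean \<open>entropy_rate P coord0\<close>.\<close>

lemma window_info_lower:
  assumes fc: "finite_ent P coord0"
  shows "AE \<omega> in P. \<forall>c<entropy_rate P coord0. eventually (\<lambda>s. c * (2 * real s) \<le> - ln (atom_prob P (window s) \<omega>)) sequentially"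
proof -
  note int = expectation_past_prob[OF fc]
  have r: "AE \<omega> in P. \<forall>\<delta>>0. eventually (\<lambda>s. atom_prob P (itinerary coord0 (2 * s)) (sh (- int s) \<omega>) * past_weight (2 * s) (sh (- int s) \<omega>)
      \<le> exp (\<delta> * real s)) sequentially"
  proof (rule eventually_le_exp)
    note [measurable] = measurable_atom_prob[OF rv_itinerary_coord]
    show "(\<lambda>\<omega>. atom_prob P (itinerary coord0 (2 * s)) (sh (- int s) \<omega>) * past_weight (2 * s) (sh (- int s) \<omega>)) \<in> borel_measurable P" for s
      by measurable
    show "(\<integral>\<^sup>+\<omega>. ennreal (atom_prob P (itinerary coord0 (2 * s)) (sh (- int s) \<omega>) * past_weight (2 * s) (sh (- int s) \<omega>)) \<partial>P) \<le> 1" for s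
      by (subst nn_integral_sh[where f="\<lambda>\<omega>. ennreal (atom_prob P (itinerary coord0 (2 * s)) \<omega> * past_weight (2 * s) \<omega>)"])
         (measurable, rule nn_integral_past_weight_le)
  qed
  have pos1: "AE \<omega> in P. \<forall>i. past_prob (sh i \<omega>) > 0"
    unfolding AE_all_countable by (intro allI AE_sh AE_past_prob_pos)
  have pos2: "AE \<omega> in P. \<forall>s. atom_prob P (window s) \<omega> > 0"
    unfolding AE_all_countable by (intro allI atom_prob_AE_pos rv_window)
  show ?thesis
    using r pos1 pos2 birkhoff_two_sided[OF int(1)]
  proof eventually_elim
    case (elim \<omega>)
    show ?case
    proof (intro allI impI)
      fix c assume c: "c < entropy_rate P coord0"
      \<comment> \<open>Half of the gap goes to the Birkhoff average, the other half to the factor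
        \<open>exp (\<delta> * s)\<close>.\<close>
      define \<delta> where "\<delta> = (entropy_rate P coord0 - c) / 2"
      have \<delta>: "\<delta> > 0" "c + \<delta> < entropy_rate P coord0" using c by (auto simp: \<delta>_def field_simps)
      let ?S = "\<lambda>s. \<Sum>i\<in>{- int s..<int s}. - ln (past_prob (sh i \<omega>))"
      have "eventually (\<lambda>s. c + \<delta> < ?S s / real (2 * s)) sequentially"
        using elim(4) \<delta>(2) int(2) by (intro order_tendstoD(1)) auto
      moreover have "eventually (\<lambda>s. atom_prob P (itinerary coord0 (2 * s)) (sh (- int s) \<omega>) * past_weight (2 * s) (sh (- int s) \<omega>) \<le> exp (\<delta> * real s)) sequentially"
        using elim(1) \<delta> by blast
      ultimately show "eventually (\<lambda>s. c * (2 * real s) \<le> - ln (atom_prob P (window s) \<omega>)) sequentially"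
        using eventually_gt_at_top[of 0]
      proof eventually_elim
        case (elim s)
        have pw: "past_weight (2 * s) (sh (- int s) \<omega>) = exp (?S s)"
        proof -
          have "past_weight (2 * s) (sh (- int s) \<omega>) = (\<Prod>i<2 * s. exp (- ln (past_prob (sh (int i - int s) \<omega>))))"
            unfolding past_weight_def
            by (rule prod.cong) (use pos1 \<open>\<forall>i. past_prob (sh i \<omega>) > 0\<close> in \<open>auto simp: exp_minus field_simps\<close>)
          also have "\<dots> = exp (\<Sum>i<2 * s. - ln (past_prob (sh (int i - int s) \<omega>)))" by (simp add: exp_sum)
          also have "(\<Sum>i<2 * s. - ln (past_prob (sh (int i - int s) \<omega>))) = ?S s"
            by (rule sum_shift_two_sided[where f="\<lambda>i. - ln (past_prob (sh i \<omega>))"])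
          finally show ?thesis .
        qed
        let ?w = "atom_prob P (window s) \<omega>"
        have w: "?w > 0" using \<open>\<forall>s. atom_prob P (window s) \<omega> > 0\<close> by blast
        have "?w \<le> atom_prob P (itinerary coord0 (2 * s)) (sh (- int s) \<omega>)" by (rule window_le_atom_prob_itinerary) auto
        then have "?w * exp (?S s) \<le> atom_prob P (itinerary coord0 (2 * s)) (sh (- int s) \<omega>) * exp (?S s)"
          by (rule mult_right_mono) simp
        also have "\<dots> \<le> exp (\<delta> * real s)" using elim(2) by (simp add: pw)
        finally have "ln (?w * exp (?S s)) \<le> ln (exp (\<delta> * real s))" using w by (subst ln_le_cancel_iff) auto
        then have "ln ?w + ?S s \<le> \<delta> * real s" using w by (simp add: ln_mult)
        moreover have "(c + \<delta>) * real (2 * s) \<le> ?S s" using elim(1,3) by (simp add: field_simps)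
        moreover have "\<delta> * real s \<le> \<delta> * real (2 * s)" using \<delta> by (intro mult_left_mono) auto
        ultimately show "c * (2 * real s) \<le> - ln ?w" by (simp add: algebra_simps)
      qed
    qed
  qed
qed

text \<open>The window of radius \<open>t - 1\<close> lies inside the word at
  \<open>-t - k, ..., t - 1\<close>, which is compared with its \<open>k\<close>-step Markov weight.
  The \<open>2 * t\<close> transitions form a Birkhoff sum with mean
  \<open>ent_incr P coord0 k\<close>, close to the entropy rate for large \<open>k\<close>; the
  initial word of length \<open>k\<close> sits at a point moving into the past and is negligible by
  \<open>birkhoff_backward_term\<close>.\<close>

lemma window_info_upper:
  assumes fc: "finite_ent P coord0"
  shows "AE \<omega> in P. \<forall>c>entropy_rate P coord0. eventually (\<lambda>s. - ln (atom_prob P (window s) \<omega>) \<le> c * (2 * real s)) sequentially"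
proof -
  have fn: "finite_ent P (itinerary coord0 k)" for k by (rule finite_ent_itinerary[OF measurable_coord0 fc])
  let ?q = "\<lambda>k t \<omega>. markov_weight k (2 * t) (sh (- int t - int k) \<omega>) / atom_prob P (itinerary coord0 (k + 2 * t)) (sh (- int t - int k) \<omega>)"
  have r: "AE \<omega> in P. \<forall>\<delta>>0. eventually (\<lambda>t. ?q k t \<omega> \<le> exp (\<delta> * real t)) sequentially" for k
  proof (rule eventually_le_exp)
    note [measurable] = measurable_atom_prob[OF rv_itinerary_coord]
    show "?q k t \<in> borel_measurable P" for t by measurable
    show "(\<integral>\<^sup>+\<omega>. ennreal (?q k t \<omega>) \<partial>P) \<le> 1" for t
      by (subst nn_integral_sh[where f="\<lambda>\<omega>. ennreal (markov_weight k (2 * t) \<omega> / atom_prob P (itinerary coord0 (k + 2 * t)) \<omega>)"])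
         (measurable, rule nn_integral_markov_weight_le)
  qed
  have b1: "AE \<omega> in P. (\<lambda>t. (\<Sum>i\<in>{- int t..<int t}. - ln (step_cond k (sh i (sh (- int k) \<omega>)))) / real (2 * t)) \<longlonglongrightarrow> ent_incr P coord0 k" for k
    using AE_sh[OF birkhoff_two_sided[OF integrable_ln_step_cond[OF fc, of k]], of "- int k"]
    unfolding expectation_ln_step_cond[OF fc] .
  have b2: "AE \<omega> in P. (\<lambda>t. - ln (atom_prob P (itinerary coord0 k) (sh (- int t) (sh (- int k) \<omega>))) / real t) \<longlonglongrightarrow> 0" for k
    by (rule AE_sh[OF birkhoff_backward_term]) (use fn[of k] in \<open>simp add: finite_ent_def\<close>)
  have all: "AE \<omega> in P. \<forall>k. (\<forall>\<delta>>0. eventually (\<lambda>t. ?q k t \<omega> \<le> exp (\<delta> * real t)) sequentially) \<and>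
      ((\<lambda>t. (\<Sum>i\<in>{- int t..<int t}. - ln (step_cond k (sh i (sh (- int k) \<omega>)))) / real (2 * t)) \<longlonglongrightarrow> ent_incr P coord0 k) \<and>
      ((\<lambda>t. - ln (atom_prob P (itinerary coord0 k) (sh (- int t) (sh (- int k) \<omega>))) / real t) \<longlonglongrightarrow> 0)"
    unfolding AE_all_countable using r b1 b2 by (intro allI) (simp add: AE_conj_iff)
  have pos1: "AE \<omega> in P. \<forall>k i. step_cond k (sh i \<omega>) > 0"
    unfolding AE_all_countable by (intro allI AE_sh AE_step_cond_pos)
  have pos2: "AE \<omega> in P. \<forall>n i. atom_prob P (itinerary coord0 n) (sh i \<omega>) > 0"
    unfolding AE_all_countable by (intro allI AE_sh atom_prob_AE_pos rv_itinerary_coord)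
  show ?thesis
    using all pos1 pos2
  proof eventually_elim
    case (elim \<omega>)
    show ?case
    proof (intro allI impI)
      fix c assume c: "c > entropy_rate P coord0"
      obtain k where k: "ent_incr P coord0 k < c"
        using order_tendstoD(2)[OF ent_incr_LIMSEQ[OF measurable_coord0 fc] c] by (auto simp: eventually_sequentially)
      \<comment> \<open>The gap is cut into quarters. The Birkhoff error, the initial word and the
        factor \<open>exp (\<delta> * t)\<close> use two of them; another one pays below for the
        step from \<open>t\<close> to the radius \<open>t - 1\<close>.\<close>
      define \<delta> where "\<delta> = (c - ent_incr P coord0 k) / 4"
      have \<delta>: "\<delta> > 0" "ent_incr P coord0 k + 4 * \<delta> = c" using k by (simp_all add: \<delta>_def field_simps)
      let ?\<omega> = "sh (- int k) \<omega>"
      let ?S = "\<lambda>t. \<Sum>i\<in>{- int t..<int t}. - ln (step_cond k (sh i ?\<omega>))"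
      let ?a = "\<lambda>t. - ln (atom_prob P (itinerary coord0 k) (sh (- int t) ?\<omega>))"
      have e1: "eventually (\<lambda>t. ?S t / real (2 * t) < ent_incr P coord0 k + \<delta>) sequentially"
        using elim(1) \<delta>(1) by (intro order_tendstoD(2)) auto
      have e2: "eventually (\<lambda>t. ?a t / real t < \<delta>) sequentially"
        using elim(1) \<delta>(1) by (intro order_tendstoD(2)) auto
      have e3: "eventually (\<lambda>t. ?q k t \<omega> \<le> exp (\<delta> * real t)) sequentially"
        using elim(1) \<delta>(1) by blast
      have ev: "eventually (\<lambda>t. - ln (atom_prob P (window (t - 1)) \<omega>) \<le> (c - \<delta>) * (2 * real t)) sequentially"
        using e1 e2 e3 eventually_gt_at_top[of 0]
      proof eventually_elim
        case (elim t)
        have u: "\<And>i. step_cond k (sh i \<omega>) > 0" and at: "\<And>n i. atom_prob P (itinerary coord0 n) (sh i \<omega>) > 0"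
          using \<open>\<forall>k i. step_cond k (sh i \<omega>) > 0\<close> \<open>\<forall>n i. atom_prob P (itinerary coord0 n) (sh i \<omega>) > 0\<close> by auto
        let ?b = "atom_prob P (itinerary coord0 (k + 2 * t)) (sh (- int t - int k) \<omega>)"
        have mw: "markov_weight k (2 * t) (sh (- int t - int k) \<omega>) = exp (- ?a t - ?S t)"
        proof -
          have "(\<Prod>i<2 * t. step_cond k (sh (int i) (sh (- int t - int k) \<omega>))) = (\<Prod>i<2 * t. exp (ln (step_cond k (sh (int i - int t) ?\<omega>))))"
            using u by (intro prod.cong) (auto simp: algebra_simps)
          also have "\<dots> = exp (\<Sum>i<2 * t. ln (step_cond k (sh (int i - int t) ?\<omega>)))" by (simp add: exp_sum)
          also have "(\<Sum>i<2 * t. ln (step_cond k (sh (int i - int t) ?\<omega>))) = (\<Sum>i\<in>{- int t..<int t}. ln (step_cond k (sh i ?\<omega>)))"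
            by (rule sum_shift_two_sided[where f="\<lambda>i. ln (step_cond k (sh i ?\<omega>))"])
          also have "\<dots> = - ?S t" by (simp add: sum_negf)
          finally have "(\<Prod>i<2 * t. step_cond k (sh (int i) (sh (- int t - int k) \<omega>))) = exp (- ?S t)" .
          moreover have "atom_prob P (itinerary coord0 k) (sh (- int t - int k) \<omega>) = exp (- ?a t)" using at by simp
          ultimately show ?thesis unfolding markov_weight_def by (simp only: exp_diff exp_minus[of "?S t"] divide_inverse)
        qed
        have b: "?b > 0" by (rule at)
        have "exp (- ?a t - ?S t) \<le> exp (\<delta> * real t) * ?b" using elim(3) b unfolding mw by (simp add: divide_le_eq)
        then have "ln (exp (- ?a t - ?S t)) \<le> ln (exp (\<delta> * real t) * ?b)" using b by (subst ln_le_cancel_iff) auto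
        then have 1: "- ln ?b \<le> \<delta> * real t + ?a t + ?S t" using b by (simp add: ln_mult)
        have "?b \<le> atom_prob P (window (t - 1)) \<omega>" by (rule atom_prob_itinerary_le_window) (use elim(4) in \<open>auto simp: of_nat_diff\<close>)
        then have "- ln (atom_prob P (window (t - 1)) \<omega>) \<le> - ln ?b" using b by simp
        also note 1
        also have "?a t \<le> \<delta> * real t"
          by (rule less_imp_le, rule iffD1[OF pos_divide_less_eq elim(2)]) (use elim(4) in simp)
        also have "?S t \<le> (ent_incr P coord0 k + \<delta>) * real (2 * t)"
          by (rule less_imp_le, rule iffD1[OF pos_divide_less_eq elim(1)]) (use elim(4) in simp)
        also have "\<delta> * real t + \<delta> * real t + (ent_incr P coord0 k + \<delta>) * real (2 * t) \<le> (c - \<delta>) * (2 * real t)"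
          unfolding \<delta>(2)[symmetric] using mult_nonneg_nonneg[of \<delta> "real t"] \<delta>(1) by (simp add: algebra_simps)
        finally show ?case by simp
      qed
      have pos: "c - \<delta> \<ge> 0" using \<delta> ent_incr_nonneg[OF measurable_coord0 fc, of k] by simp
      obtain n0 :: nat where n0: "real n0 \<ge> c / \<delta>" using real_arch_simple by blast
      have "eventually (\<lambda>s. - ln (atom_prob P (window (Suc s - 1)) \<omega>) \<le> (c - \<delta>) * (2 * real (Suc s))) sequentially"
        using ev by (subst eventually_sequentially_Suc)
      then show "eventually (\<lambda>s. - ln (atom_prob P (window s) \<omega>) \<le> c * (2 * real s)) sequentially"
        using eventually_ge_at_top[of n0]
      proof eventually_elim
        case (elim s)
        have "c / \<delta> \<le> real s" using n0 elim(2) by linarith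
        then have "c \<le> \<delta> * real s" using \<delta> by (simp add: field_simps)
        then have "(c - \<delta>) * (2 * real (Suc s)) \<le> c * (2 * real s)" using \<delta> by (simp add: algebra_simps)
        then show ?case using elim(1) by simp
      qed
    qed
  qed
qed

end

section \<open>Matching times\<close>

text \<open>Chebyshev's inequality for the number of events that occur: where none occurs, the
  squared deviation from the mean is the square of the mean. The double sum is the variance.\<close>

lemma (in prob_space) second_moment:
  assumes I: "finite I" and E: "\<And>n. n \<in> I \<Longrightarrow> E n \<in> events"
  shows "prob (space M - (\<Union>n\<in>I. E n)) * (\<Sum>n\<in>I. prob (E n))\<^sup>2
    \<le> (\<Sum>m\<in>I. \<Sum>n\<in>I. prob (E m \<inter> E n) - prob (E m) * prob (E n))"
proof -
  define S where "S = (\<Sum>n\<in>I. prob (E n))"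
  define X where "X \<omega> = (\<Sum>n\<in>I. indicator (E n) \<omega> :: real)" for \<omega> :: 'a
  let ?N = "space M - (\<Union>n\<in>I. E n)"
  have N: "?N \<in> events" using I E by (intro sets.compl_sets sets.finite_UN) auto
  have ii: "integrable M (indicator A :: 'a \<Rightarrow> real)" if "A \<in> events" for A
    using that by (intro integrable_real_indicator) (auto simp: emeasure_eq_measure)
  have sq: "(X \<omega> - S)\<^sup>2 = (\<Sum>m\<in>I. \<Sum>n\<in>I. indicator (E m \<inter> E n) \<omega>) - 2 * S * X \<omega> + S\<^sup>2" for \<omega>
    by (simp add: X_def power2_diff power2_eq_square sum_product indicator_inter_arith algebra_simps)
  have i1: "integrable M X" unfolding X_def[abs_def] using E by (intro Bochner_Integration.integrable_sum ii)
  have i2: "integrable M (\<lambda>\<omega>. \<Sum>m\<in>I. \<Sum>n\<in>I. indicator (E m \<inter> E n) \<omega> :: real)"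
    using E by (intro Bochner_Integration.integrable_sum ii sets.Int)
  have i3: "integrable M (\<lambda>\<omega>. (X \<omega> - S)\<^sup>2)" unfolding sq using i1 i2 by simp
  have eX: "expectation X = S"
    unfolding X_def[abs_def] S_def using E ii by (subst Bochner_Integration.integral_sum) auto
  have "prob ?N * S\<^sup>2 = expectation (\<lambda>\<omega>. indicator ?N \<omega> * S\<^sup>2)" using N by simp
  also have "\<dots> \<le> expectation (\<lambda>\<omega>. (X \<omega> - S)\<^sup>2)"
  proof (rule integral_mono)
    show "integrable M (\<lambda>\<omega>. indicator ?N \<omega> * S\<^sup>2)" using ii[OF N] by simp
    show "indicator ?N \<omega> * S\<^sup>2 \<le> (X \<omega> - S)\<^sup>2" for \<omega>
    proof (cases "\<omega> \<in> ?N")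
      case True
      then have "X \<omega> = 0" by (auto simp: X_def)
      then show ?thesis using True by simp
    qed simp
  qed (rule i3)
  also have "\<dots> = expectation (\<lambda>\<omega>. \<Sum>m\<in>I. \<Sum>n\<in>I. indicator (E m \<inter> E n) \<omega>) - 2 * S * expectation X + S\<^sup>2"
    unfolding sq using i1 i2 by (simp add: prob_space)
  also have "expectation (\<lambda>\<omega>. \<Sum>m\<in>I. \<Sum>n\<in>I. indicator (E m \<inter> E n) \<omega>) = (\<Sum>m\<in>I. \<Sum>n\<in>I. prob (E m \<inter> E n))"
  proof -
    have "expectation (\<lambda>\<omega>. \<Sum>n\<in>I. indicator (E m \<inter> E n) \<omega> :: real) = (\<Sum>n\<in>I. prob (E m \<inter> E n))" if m: "m \<in> I" for m
    proof (subst Bochner_Integration.integral_sum)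
      show "integrable M (\<lambda>\<omega>. indicator (E m \<inter> E n) \<omega> :: real)" if "n \<in> I" for n
        using ii[OF sets.Int[OF E[OF m] E[OF that]]] .
      show "(\<Sum>n\<in>I. expectation (\<lambda>\<omega>. indicator (E m \<inter> E n) \<omega> :: real)) = (\<Sum>n\<in>I. prob (E m \<inter> E n))"
        using E m by (intro sum.cong) auto
    qed
    moreover have "integrable M (\<lambda>\<omega>. \<Sum>n\<in>I. indicator (E m \<inter> E n) \<omega> :: real)" if "m \<in> I" for m
      using E that by (intro Bochner_Integration.integrable_sum ii sets.Int)
    ultimately show ?thesis by (subst Bochner_Integration.integral_sum) simp_all
  qed
  also have "(\<Sum>m\<in>I. \<Sum>n\<in>I. prob (E m \<inter> E n)) - 2 * S * expectation X + S\<^sup>2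
    = (\<Sum>m\<in>I. \<Sum>n\<in>I. prob (E m \<inter> E n) - prob (E m) * prob (E n))"
    by (simp add: eX S_def power2_eq_square sum_product sum_subtractf)
  finally show ?thesis unfolding S_def .
qed

lemma card_fibres_le:
  fixes f :: "'b \<Rightarrow> int"
  assumes F: "finite F" and K: "\<And>k. at_most K {n. f n = k}"
  shows "finite {n. f n \<in> F}" "real (card {n. f n \<in> F}) \<le> K * real (card F)"
proof -
  have eq: "{n. f n \<in> F} = (\<Union>k\<in>F. {n. f n = k})" by auto
  show "finite {n. f n \<in> F}" unfolding eq using F K by (auto simp: at_most_def)
  have "card {n. f n \<in> F} \<le> (\<Sum>k\<in>F. card {n. f n = k})" unfolding eq by (rule card_UN_le[OF F])
  then have "real (card {n. f n \<in> F}) \<le> (\<Sum>k\<in>F. real (card {n. f n = k}))"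
    by (simp flip: of_nat_sum)
  also have "\<dots> \<le> (\<Sum>k\<in>F. K)" using K by (intro sum_mono) (auto simp: at_most_def)
  finally show "real (card {n. f n \<in> F}) \<le> K * real (card F)" by (simp add: mult.commute)
qed

lemma at_most_mono: "at_most K B \<Longrightarrow> A \<subseteq> B \<Longrightarrow> at_most K A"
  unfolding at_most_def by (meson card_mono finite_subset of_nat_le_iff order_trans)

section \<open>Separated cylinder events and matches with one target\<close>

context stationary
begin

definition psi :: "nat \<Rightarrow> real" where "psi k = enn2real (psi_mix P k)"

lemma psi_nonneg: "0 \<le> psi k" by (simp add: psi_def)

lemma psi_bound:
  assumes fin: "psi_mix P k < \<infinity>" and G: "\<Gamma> \<in> coord_algebra {..m}" and D: "\<Delta> \<in> coord_algebra {m + int k..}"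
  shows "\<bar>prob (\<Gamma> \<inter> \<Delta>) - prob \<Gamma> * prob \<Delta>\<bar> \<le> psi k * (prob \<Gamma> * prob \<Delta>)"
proof (cases "prob \<Gamma> * prob \<Delta> = 0")
  case True
  have "prob (\<Gamma> \<inter> \<Delta>) \<le> prob \<Gamma>" "prob (\<Gamma> \<inter> \<Delta>) \<le> prob \<Delta>"
    using G D sets_coord_algebra by (auto intro!: finite_measure_mono)
  then show ?thesis using True measure_nonneg[of P "\<Gamma> \<inter> \<Delta>"] by auto
next
  case False
  then have pos: "prob \<Gamma> * prob \<Delta> > 0" by (simp add: less_le)
  have "ennreal \<bar>prob (\<Gamma> \<inter> \<Delta>) / (prob \<Gamma> * prob \<Delta>) - 1\<bar> \<le> psi_dep P (coord_algebra {..m}) (coord_algebra {m + int k..})"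
    unfolding psi_dep_def using False G D by (intro SUP_upper2[of "(\<Gamma>, \<Delta>)"]) auto
  also have "\<dots> \<le> psi_mix P k" unfolding psi_mix_def by (rule SUP_upper) simp
  also have "\<dots> = ennreal (psi k)" unfolding psi_def using fin by simp
  finally have le: "\<bar>prob (\<Gamma> \<inter> \<Delta>) / (prob \<Gamma> * prob \<Delta>) - 1\<bar> \<le> psi k"
    by (subst (asm) ennreal_le_iff) (auto simp: psi_def)
  have "prob (\<Gamma> \<inter> \<Delta>) - prob \<Gamma> * prob \<Delta> = (prob (\<Gamma> \<inter> \<Delta>) / (prob \<Gamma> * prob \<Delta>) - 1) * (prob \<Gamma> * prob \<Delta>)"
    using False by (simp add: field_simps)
  then have "\<bar>prob (\<Gamma> \<inter> \<Delta>) - prob \<Gamma> * prob \<Delta>\<bar> = \<bar>prob (\<Gamma> \<inter> \<Delta>) / (prob \<Gamma> * prob \<Delta>) - 1\<bar> * (prob \<Gamma> * prob \<Delta>)"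
    using pos by (metis abs_mult abs_of_pos)
  also have "\<dots> \<le> psi k * (prob \<Gamma> * prob \<Delta>)" using le pos by (intro mult_right_mono) auto
  finally show ?thesis .
qed

lemma coord_algebra_INT:
  assumes "finite J" "\<And>j. j \<in> J \<Longrightarrow> D j \<in> coord_algebra I"
  shows "(\<Inter>j\<in>J. D j) \<in> coord_algebra I"
proof (cases "J = {}")
  case True then show ?thesis by (simp add: sets_coord_sigma[symmetric])
next
  case False then show ?thesis using assms unfolding sets_coord_sigma[symmetric] by (intro sets.finite_INT) auto
qed

text \<open>Induction over the blocks in the order of their positions: the rightmost block keeps
  distance \<open>g\<close> from all the others together, so \<open>psi_bound\<close> applies once
  per block and costs a factor \<open>1 + psi g\<close> or \<open>1 - psi g\<close>.\<close>

lemma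
  fixes pos :: "'j \<Rightarrow> int"
  assumes J: "finite J" and fin: "psi_mix P g < \<infinity>"
    and D: "\<And>j. j \<in> J \<Longrightarrow> D j \<in> coord_algebra {pos j - int s..pos j + int s}"
    and sep: "\<And>i j. i \<in> J \<Longrightarrow> j \<in> J \<Longrightarrow> i \<noteq> j \<Longrightarrow> \<bar>pos i - pos j\<bar> \<ge> 2 * int s + int g"
  shows prob_INT_le: "prob (\<Inter>j\<in>J. D j) \<le> (1 + psi g) ^ card J * (\<Prod>j\<in>J. prob (D j))"
    and prob_INT_ge: "psi g \<le> 1 \<Longrightarrow> (1 - psi g) ^ card J * (\<Prod>j\<in>J. prob (D j)) \<le> prob (\<Inter>j\<in>J. D j)"
proof -
  have "prob (\<Inter>j\<in>J. D j) \<le> (1 + psi g) ^ card J * (\<Prod>j\<in>J. prob (D j)) \<and>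
    (psi g \<le> 1 \<longrightarrow> (1 - psi g) ^ card J * (\<Prod>j\<in>J. prob (D j)) \<le> prob (\<Inter>j\<in>J. D j))"
    using J D sep
  proof (induction J rule: finite_ranking_induct[where f=pos])
    case empty then show ?case by simp
  next
    case (insert j J)
    show ?case
    proof (cases "j \<in> J")
      case True
      then show ?thesis using insert.IH insert.prems by (simp add: insert_absorb)
    next
      case False
      let ?G = "\<Inter>j\<in>J. D j"
      have IH: "prob ?G \<le> (1 + psi g) ^ card J * (\<Prod>j\<in>J. prob (D j))"
        "psi g \<le> 1 \<Longrightarrow> (1 - psi g) ^ card J * (\<Prod>j\<in>J. prob (D j)) \<le> prob ?G"
        using insert.IH insert.prems by auto
      have G: "?G \<in> coord_algebra {..pos j - int s - int g}"
      proof (rule coord_algebra_INT[OF insert.hyps(1)])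
        fix i assume i: "i \<in> J"
        then have "\<bar>pos i - pos j\<bar> \<ge> 2 * int s + int g" using insert.prems(2)[of i j] False by auto
        moreover have "pos i \<le> pos j" using insert.hyps(2) i by blast
        ultimately have "{pos i - int s..pos i + int s} \<subseteq> {..pos j - int s - int g}" by auto
        then show "D i \<in> coord_algebra {..pos j - int s - int g}"
          using insert.prems(1)[of i] i coord_algebra_mono by blast
      qed
      have Dj: "D j \<in> coord_algebra {pos j - int s - int g + int g..}"
        using insert.prems(1)[of j] coord_algebra_mono[of "{pos j - int s..pos j + int s}" "{pos j - int s - int g + int g..}"] by auto
      have b: "\<bar>prob (?G \<inter> D j) - prob ?G * prob (D j)\<bar> \<le> psi g * (prob ?G * prob (D j))"
        by (rule psi_bound[OF fin G Dj])
      have eq: "(\<Inter>j\<in>insert j J. D j) = ?G \<inter> D j" by auto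
      have p: "(\<Prod>j\<in>insert j J. prob (D j)) = (\<Prod>j\<in>J. prob (D j)) * prob (D j)" "card (insert j J) = Suc (card J)"
        using False insert.hyps(1) by (auto simp: mult.commute)
      have "prob (?G \<inter> D j) \<le> (1 + psi g) * (prob ?G * prob (D j))" using b by (simp add: algebra_simps)
      also have "\<dots> \<le> (1 + psi g) * (((1 + psi g) ^ card J * (\<Prod>j\<in>J. prob (D j))) * prob (D j))"
        using IH(1) psi_nonneg[of g] by (intro mult_left_mono mult_right_mono) auto
      finally have 1: "prob (?G \<inter> D j) \<le> (1 + psi g) ^ Suc (card J) * ((\<Prod>j\<in>J. prob (D j)) * prob (D j))"
        by (simp add: mult_ac)
      have 2: "(1 - psi g) ^ Suc (card J) * ((\<Prod>j\<in>J. prob (D j)) * prob (D j)) \<le> prob (?G \<inter> D j)" if "psi g \<le> 1"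
      proof -
        have "(1 - psi g) ^ Suc (card J) * ((\<Prod>j\<in>J. prob (D j)) * prob (D j))
          = (1 - psi g) * (((1 - psi g) ^ card J * (\<Prod>j\<in>J. prob (D j))) * prob (D j))" by (simp add: mult_ac)
        also have "\<dots> \<le> (1 - psi g) * (prob ?G * prob (D j))"
          using IH(2)[OF that] that by (intro mult_left_mono mult_right_mono) auto
        also have "\<dots> \<le> prob (?G \<inter> D j)" using b by (simp add: algebra_simps)
        finally show ?thesis .
      qed
      show ?thesis unfolding eq p using 1 2 by blast
    qed
  qed
  then show "prob (\<Inter>j\<in>J. D j) \<le> (1 + psi g) ^ card J * (\<Prod>j\<in>J. prob (D j))"
    and "psi g \<le> 1 \<Longrightarrow> (1 - psi g) ^ card J * (\<Prod>j\<in>J. prob (D j)) \<le> prob (\<Inter>j\<in>J. D j)" by auto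
qed

definition match :: "nat \<Rightarrow> (int \<Rightarrow> 'a) \<Rightarrow> nat \<Rightarrow> (int \<Rightarrow> 'a) set" where
  "match s x p = {\<omega>. window s (sh (int p) \<omega>) = window s x}"

lemma match_coord_algebra: "match s x p \<in> coord_algebra {int p - int s..int p + int s}"
proof -
  have "window s -` {window s x} \<inter> space (coord_sigma {- int s..int s}) \<in> sets (coord_sigma {- int s..int s})"
    by (rule measurable_sets[OF measurable_window]) simp
  then have "{\<omega>. window s \<omega> = window s x} \<in> coord_algebra {- int s..int s}"
    by (simp add: sets_coord_sigma vimage_def)
  from sets_sh_coord_algebra[OF this, of "int p" "{int p - int s..int p + int s}"]
  show ?thesis by (auto simp: match_def)
qed

lemma match_events [measurable]: "match s x p \<in> events"
  using match_coord_algebra sets_coord_algebra by blast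

lemma prob_match: "prob (match s x p) = atom_prob P (window s) x"
  using prob_sh[OF fibre_in_events[OF rv_window], of "int p" s "window s x"]
  by (simp add: match_def atom_prob_def)

lemma match_pair_bound:
  assumes K: "\<And>k. at_most K {n. int (f n) = k}"
  shows "finite {n. \<bar>int (f n) - a\<bar> < int d}" "real (card {n. \<bar>int (f n) - a\<bar> < int d}) \<le> K * real (2 * d)"
proof -
  have eq: "{n. \<bar>int (f n) - a\<bar> < int d} = {n. int (f n) \<in> {a - int d<..<a + int d}}" by auto
  show "finite {n. \<bar>int (f n) - a\<bar> < int d}" unfolding eq by (rule card_fibres_le(1)[OF _ K]) simp
  have "0 \<le> K" using K[of 0] unfolding at_most_def by (meson of_nat_0_le_iff order_trans)
  have "real (card {n. \<bar>int (f n) - a\<bar> < int d}) \<le> K * real (card {a - int d<..<a + int d})"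
    unfolding eq by (rule card_fibres_le(2)[OF _ K]) simp
  also have "\<dots> \<le> K * real (2 * d)" using \<open>0 \<le> K\<close> by (intro mult_left_mono) auto
  finally show "real (card {n. \<bar>int (f n) - a\<bar> < int d}) \<le> K * real (2 * d)" .
qed

end

context mixing
begin

text \<open>\<open>phi_bound\<close> controls the covariance by the probability of the earlier
  event; both events have the same probability, so the order is immaterial. The two windows of
  radius \<open>s\<close> lose \<open>2 * s\<close> of the distance of their centres.\<close>

lemma match_cov_le:
  assumes "\<bar>int p - int p'\<bar> > 2 * int s"
  shows "prob (match s x p \<inter> match s x p') - prob (match s x p) * prob (match s x p')
    \<le> phi (nat (\<bar>int p - int p'\<bar> - 2 * int s)) * atom_prob P (window s) x"
proof -
  have *: "prob (match s x p \<inter> match s x p') - prob (match s x p) * prob (match s x p')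
    \<le> phi (nat (int p' - int p - 2 * int s)) * atom_prob P (window s) x" if lt: "int p' - int p > 2 * int s" for p p'
  proof -
    let ?k = "nat (int p' - int p - 2 * int s)"
    have k: "?k \<ge> 1" using lt by auto
    have "match s x p \<in> coord_algebra {..int p + int s}"
      using match_coord_algebra[of s x p] coord_algebra_mono[of "{int p - int s..int p + int s}" "{..int p + int s}"] by auto
    moreover have "match s x p' \<in> coord_algebra {int p + int s + int ?k..}"
      using match_coord_algebra[of s x p'] lt
        coord_algebra_mono[of "{int p' - int s..int p' + int s}" "{int p + int s + int ?k..}"] by auto
    ultimately have "\<bar>prob (match s x p \<inter> match s x p') - prob (match s x p) * prob (match s x p')\<bar> \<le> phi ?k * prob (match s x p)"
      by (rule phi_bound[OF phi_fin[OF k]])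
    then have "prob (match s x p \<inter> match s x p') - prob (match s x p) * prob (match s x p') \<le> phi ?k * prob (match s x p)"
      by linarith
    also have "prob (match s x p) = atom_prob P (window s) x" by (rule prob_match)
    finally show ?thesis unfolding prob_match .
  qed
  show ?thesis
  proof (cases "p \<le> p'")
    case True
    then have a: "\<bar>int p - int p'\<bar> = int p' - int p" by simp
    have lt: "int p' - int p > 2 * int s" using assms a by simp
    show ?thesis unfolding a by (rule *[OF lt])
  next
    case False
    then have a: "\<bar>int p - int p'\<bar> = int p - int p'" by simp
    have lt: "int p - int p' > 2 * int s" using assms a by simp
    have "prob (match s x p' \<inter> match s x p) - prob (match s x p') * prob (match s x p)
      \<le> phi (nat (\<bar>int p - int p'\<bar> - 2 * int s)) * atom_prob P (window s) x" unfolding a by (rule *[OF lt])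
    then show ?thesis by (subst Int_commute, subst mult.commute[of "prob (match s x p)"])
  qed
qed

text \<open>The weights bound the covariances with a match at \<open>a\<close>, up to the window
  probability. At most \<open>4 * s + 1\<close> positions give overlapping windows; on either side
  distinct positions have distinct distances, so the other weights sum to at most the
  series.\<close>

lemma sum_phi_le:
  fixes F :: "int set"
  assumes F: "finite F"
  shows "(\<Sum>k\<in>F. if \<bar>a - k\<bar> \<le> 2 * int s then 1 else phi (nat (\<bar>a - k\<bar> - 2 * int s)))
    \<le> real (4 * s + 1) + 2 * (\<Sum>n. phi (Suc n))"
proof -
  let ?w = "\<lambda>k. if \<bar>a - k\<bar> \<le> 2 * int s then 1 else phi (nat (\<bar>a - k\<bar> - 2 * int s))"
  let ?A = "{k\<in>F. \<bar>a - k\<bar> \<le> 2 * int s}" and ?R = "{k\<in>F. k - a > 2 * int s}" and ?L = "{k\<in>F. a - k > 2 * int s}"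
  have F_eq: "F = ?A \<union> (?R \<union> ?L)" by auto
  have "sum ?w F = sum ?w ?A + (sum ?w ?R + sum ?w ?L)"
    using F by (subst F_eq, subst sum.union_disjoint, force, force, force, subst sum.union_disjoint) auto
  also have "sum ?w ?A = real (card ?A)" by simp
  also have "card ?A \<le> card {a - 2 * int s..a + 2 * int s}" by (rule card_mono) auto
  also have "\<dots> = 4 * s + 1" by simp
  also have "sum ?w ?R \<le> (\<Sum>n. phi (Suc n))"
  proof -
    have "sum ?w ?R = (\<Sum>n\<in>(\<lambda>k. nat (k - a - 2 * int s) - 1) ` ?R. phi (Suc n))"
      by (subst sum.reindex) (auto simp: inj_on_def intro!: sum.cong arg_cong[where f=phi])
    also have "\<dots> \<le> (\<Sum>n. phi (Suc n))" by (rule sum_le_suminf[OF summable_phi]) (use F phi_nonneg in auto)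
    finally show ?thesis .
  qed
  also have "sum ?w ?L \<le> (\<Sum>n. phi (Suc n))"
  proof -
    have "sum ?w ?L = (\<Sum>n\<in>(\<lambda>k. nat (a - k - 2 * int s) - 1) ` ?L. phi (Suc n))"
      by (subst sum.reindex) (auto simp: inj_on_def intro!: sum.cong arg_cong[where f=phi])
    also have "\<dots> \<le> (\<Sum>n. phi (Suc n))" by (rule sum_le_suminf[OF summable_phi]) (use F phi_nonneg in auto)
    finally show ?thesis .
  qed
  finally show ?thesis by simp
qed

text \<open>Second moment method: the mean number of matches is \<open>N * c\<close> with
  \<open>c\<close> the window probability, and the variance is at most \<open>N * c\<close> times a
  factor linear in \<open>s\<close>, since each position is used at most \<open>K\<close>
  times.\<close>

lemma no_match_prob_single:
  assumes K: "\<And>k. at_most K {n. int (f n) = k}" and N: "N \<ge> 1" and pos: "atom_prob P (window s) x > 0"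
  shows "prob (space P - (\<Union>n\<in>{1..N}. match s x (f n)))
    \<le> K * (real (4 * s + 1) + 2 * (\<Sum>n. phi (Suc n))) / (real N * atom_prob P (window s) x)"
proof -
  let ?c = "atom_prob P (window s) x" and ?E = "\<lambda>n. match s x (f n)"
  let ?B = "K * (real (4 * s + 1) + 2 * (\<Sum>n. phi (Suc n)))"
  let ?w = "\<lambda>a k. if \<bar>a - k\<bar> \<le> 2 * int s then 1 else phi (nat (\<bar>a - k\<bar> - 2 * int s))"
  have K0: "0 \<le> K" using K[of 0] unfolding at_most_def by (meson of_nat_0_le_iff order_trans)
  have row: "(\<Sum>n\<in>{1..N}. prob (?E m \<inter> ?E n) - prob (?E m) * prob (?E n)) \<le> ?c * ?B" for m
  proof -
    have "(\<Sum>n\<in>{1..N}. prob (?E m \<inter> ?E n) - prob (?E m) * prob (?E n)) \<le> (\<Sum>n\<in>{1..N}. ?c * ?w (int (f m)) (int (f n)))"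
    proof (rule sum_mono)
      fix n
      show "prob (?E m \<inter> ?E n) - prob (?E m) * prob (?E n) \<le> ?c * ?w (int (f m)) (int (f n))"
      proof (cases "\<bar>int (f m) - int (f n)\<bar> \<le> 2 * int s")
        case True
        have "prob (?E m \<inter> ?E n) \<le> prob (?E m)" by (intro finite_measure_mono) auto
        moreover have "0 \<le> ?c * ?c" by (intro mult_nonneg_nonneg atom_prob_nonneg)
        ultimately have "prob (?E m \<inter> ?E n) - ?c * ?c \<le> ?c" unfolding prob_match by linarith
        then show ?thesis using True by (simp add: prob_match)
      next
        case False
        then show ?thesis using match_cov_le[of s "f m" "f n" x] by (simp add: mult.commute)
      qed
    qed
    also have "\<dots> = ?c * (\<Sum>n\<in>{1..N}. ?w (int (f m)) (int (f n)))" by (simp only: sum_distrib_left)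
    also have "(\<Sum>n\<in>{1..N}. ?w (int (f m)) (int (f n)))
      = (\<Sum>k\<in>(\<lambda>n. int (f n)) ` {1..N}. \<Sum>n\<in>{n\<in>{1..N}. int (f n) = k}. ?w (int (f m)) (int (f n)))"
      by (rule sum.image_gen) simp
    also have "\<dots> \<le> (\<Sum>k\<in>(\<lambda>n. int (f n)) ` {1..N}. K * ?w (int (f m)) k)"
    proof (rule sum_mono)
      fix k
      have "(\<Sum>n\<in>{n\<in>{1..N}. int (f n) = k}. ?w (int (f m)) (int (f n))) = real (card {n\<in>{1..N}. int (f n) = k}) * ?w (int (f m)) k"
        by simp
      also have "\<dots> \<le> K * ?w (int (f m)) k"
        using at_most_mono[OF K[of k], of "{n\<in>{1..N}. int (f n) = k}"] phi_nonneg
        by (intro mult_right_mono) (auto simp: at_most_def)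
      finally show "(\<Sum>n\<in>{n\<in>{1..N}. int (f n) = k}. ?w (int (f m)) (int (f n))) \<le> K * ?w (int (f m)) k" .
    qed
    also have "\<dots> \<le> ?B"
      unfolding sum_distrib_left[symmetric] using sum_phi_le[of "(\<lambda>n. int (f n)) ` {1..N}" "int (f m)" s] K0
      by (intro mult_left_mono) auto
    finally show ?thesis using pos by (simp add: mult_left_mono)
  qed
  have "prob (space P - (\<Union>n\<in>{1..N}. ?E n)) * (\<Sum>n\<in>{1..N}. prob (?E n))\<^sup>2
    \<le> (\<Sum>m\<in>{1..N}. \<Sum>n\<in>{1..N}. prob (?E m \<inter> ?E n) - prob (?E m) * prob (?E n))"
    by (rule second_moment) auto
  also have "\<dots> \<le> (\<Sum>m\<in>{1..N}. ?c * ?B)" by (intro sum_mono row)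
  finally have "prob (space P - (\<Union>n\<in>{1..N}. ?E n)) * (real N * ?c)\<^sup>2 \<le> real N * (?c * ?B)"
    by (simp add: prob_match)
  then have "prob (space P - (\<Union>n\<in>{1..N}. ?E n)) * (real N * ?c) * (real N * ?c) \<le> ?B * (real N * ?c)"
    by (simp add: power2_eq_square mult_ac)
  then have "prob (space P - (\<Union>n\<in>{1..N}. ?E n)) * (real N * ?c) \<le> ?B"
    by (rule mult_right_le_imp_le) (use N pos in auto)
  then show ?thesis using N pos by (subst pos_le_divide_eq) auto
qed

end

section \<open>Simultaneous matches with several targets\<close>

lemma power_diff_le:
  fixes a b A :: real
  assumes "0 \<le> b" "b \<le> a" "a \<le> A" "1 \<le> A"
  shows "a ^ n - b ^ n \<le> real n * (a - b) * A ^ n"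
proof (induction n)
  case (Suc n)
  have A: "A ^ n \<le> A ^ Suc n" using assms by (intro power_increasing) auto
  have "a ^ Suc n - b ^ Suc n = a * (a ^ n - b ^ n) + (a - b) * b ^ n" by (simp add: algebra_simps)
  also have "\<dots> \<le> A * (real n * (a - b) * A ^ n) + (a - b) * A ^ Suc n"
  proof (intro add_mono)
    have "0 \<le> a ^ n - b ^ n" using assms by (simp add: power_mono)
    then show "a * (a ^ n - b ^ n) \<le> A * (real n * (a - b) * A ^ n)"
      using assms Suc by (intro mult_mono) auto
    have "b ^ n \<le> A ^ n" using assms by (intro power_mono) auto
    then show "(a - b) * b ^ n \<le> (a - b) * A ^ Suc n" using assms by (intro mult_left_mono order_trans[OF _ A]) auto
  qed
  also have "\<dots> = real (Suc n) * (a - b) * A ^ Suc n" by (simp add: algebra_simps)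
  finally show ?case .
qed simp

text \<open>Used with \<open>d = 2 * s + g\<close>: the windows of radius \<open>s\<close> read at
  time \<open>n\<close> then have pairwise distance at least \<open>g\<close>.\<close>

definition spread :: "nat \<Rightarrow> (nat \<Rightarrow> nat \<Rightarrow> nat) \<Rightarrow> nat \<Rightarrow> nat \<Rightarrow> bool" where
  "spread l q d n \<longleftrightarrow> (\<forall>i\<in>{1..l}. \<forall>j\<in>{1..l}. i \<noteq> j \<longrightarrow> int d \<le> \<bar>int (q i n) - int (q j n)\<bar>)"

text \<open>Two spread times that are not close provide \<open>2 * l\<close> pairwise separated
  windows.\<close>

definition close :: "nat \<Rightarrow> (nat \<Rightarrow> nat \<Rightarrow> nat) \<Rightarrow> nat \<Rightarrow> nat \<Rightarrow> nat \<Rightarrow> bool" where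
  "close l q d m n \<longleftrightarrow> (\<exists>i\<in>{1..l}. \<exists>j\<in>{1..l}. \<bar>int (q i m) - int (q j n)\<bar> < int d)"

context stationary
begin

definition multi_match :: "nat \<Rightarrow> (nat \<Rightarrow> nat \<Rightarrow> nat) \<Rightarrow> nat \<Rightarrow> (nat \<Rightarrow> int \<Rightarrow> 'a) \<Rightarrow> nat \<Rightarrow> (int \<Rightarrow> 'a) set" where
  "multi_match l q s x n = (\<Inter>i\<in>{1..l}. match s (x i) (q i n))"

definition hit :: "nat \<Rightarrow> (nat \<Rightarrow> nat \<Rightarrow> nat) \<Rightarrow> nat \<Rightarrow> (nat \<Rightarrow> int \<Rightarrow> 'a) \<Rightarrow> nat \<Rightarrow> (int \<Rightarrow> 'a) set" where
  "hit l q s x N = (\<Union>n\<in>{1..N}. multi_match l q s x n)"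

lemma
  assumes psi_sum: "(\<Sum>n. psi_mix P (Suc n)) < \<infinity>"
  shows psi_fin: "g \<ge> 1 \<Longrightarrow> psi_mix P g < \<infinity>"
    and psi_decay: "\<exists>C>0. \<forall>g\<ge>1. psi g \<le> C / real g"
proof -
  note bounds = antimono_summable_bounds[of "psi_mix P", OF psi_mix_antimono psi_sum]
  show "g \<ge> 1 \<Longrightarrow> psi_mix P g < \<infinity>" using bounds(1)[of "g - 1"] by simp
  show "\<exists>C>0. \<forall>g\<ge>1. psi g \<le> C / real g" unfolding psi_def by (rule bounds(3))
qed

end

context mixing
begin

context
  fixes l :: nat and q :: "nat \<Rightarrow> nat \<Rightarrow> nat" and K :: real
  assumes l: "l > 1"
    and psi_sum: "(\<Sum>n. psi_mix P (Suc n)) < \<infinity>"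
    and K: "\<And>i j (k::int). i \<in> {1..l} \<Longrightarrow> j \<in> {1..l} \<Longrightarrow> i \<noteq> j \<Longrightarrow>
      at_most K {n. int (q i n) - int (q j n) = k \<or> int (q i n) = k}"
begin

lemma K_diff: "i \<in> {1..l} \<Longrightarrow> j \<in> {1..l} \<Longrightarrow> i \<noteq> j \<Longrightarrow> at_most K {n. int (q i n) - int (q j n) = k}"
  by (rule at_most_mono[OF K[of i j k]]) auto

lemma K_val: assumes "i \<in> {1..l}" shows "at_most K {n. int (q i n) = k}"
proof -
  define j where "j = (if i = 1 then 2 else 1 :: nat)"
  have "j \<in> {1..l}" "i \<noteq> j" using l assms by (auto simp: j_def)
  then show ?thesis using assms by (intro at_most_mono[OF K[of i j k]]) auto
qed

lemma K_nonneg: "0 \<le> K"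
  using K_val[of 1 0] l unfolding at_most_def by (meson atLeastAtMost_iff less_imp_le of_nat_0_le_iff order_refl order_trans)

text \<open>At most \<open>l * l\<close> pairs of indices, at most \<open>2 * d\<close> small
  differences for each pair, and each difference attained at most \<open>K\<close> times.\<close>

lemma card_not_spread:
  "finite {n. \<not> spread l q d n}" "real (card {n. \<not> spread l q d n}) \<le> (real l)\<^sup>2 * (K * real (2 * d))"
proof -
  let ?P = "{(i, j). i \<in> {1..l} \<and> j \<in> {1..l} \<and> i \<noteq> j}"
  let ?U = "\<lambda>(i, j). {n. int (q i n) - int (q j n) \<in> {- int d<..<int d}}"
  have P: "finite ?P" by (rule finite_subset[of _ "{1..l} \<times> {1..l}"]) auto
  have cP: "card ?P \<le> l\<^sup>2"
  proof -
    have "card ?P \<le> card ({1..l} \<times> {1..l})" by (rule card_mono) auto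
    then show ?thesis by (simp add: power2_eq_square card_cartesian_product)
  qed
  have eq: "{n. \<not> spread l q d n} = (\<Union>p\<in>?P. ?U p)"
    unfolding spread_def by (auto simp: abs_less_iff not_le) force+
  have U: "finite (?U p) \<and> real (card (?U p)) \<le> K * real (2 * d)" if pP: "p \<in> ?P" for p
  proof -
    obtain i j where p: "p = (i, j)" "i \<in> {1..l}" "j \<in> {1..l}" "i \<noteq> j" using pP by auto
    have "real (card {n. int (q i n) - int (q j n) \<in> {- int d<..<int d}}) \<le> K * real (card {- int d<..<int d})"
      by (rule card_fibres_le(2)) (use p K_diff in auto)
    also have "\<dots> \<le> K * real (2 * d)" using K_nonneg by (intro mult_left_mono) auto
    finally show ?thesis unfolding p using card_fibres_le(1)[of "{- int d<..<int d}" K, OF _ K_diff[OF p(2-4)]] by simp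
  qed
  show "finite {n. \<not> spread l q d n}" unfolding eq using P U by blast
  have "card {n. \<not> spread l q d n} \<le> (\<Sum>p\<in>?P. card (?U p))" unfolding eq by (rule card_UN_le[OF P])
  then have "real (card {n. \<not> spread l q d n}) \<le> (\<Sum>p\<in>?P. real (card (?U p)))" by (simp flip: of_nat_sum)
  also have "\<dots> \<le> (\<Sum>p\<in>?P. K * real (2 * d))" using U by (intro sum_mono) blast
  also have "\<dots> = real (card ?P) * (K * real (2 * d))" by simp
  also have "\<dots> \<le> (real l)\<^sup>2 * (K * real (2 * d))"
  proof (rule mult_right_mono)
    have "real (card ?P) \<le> real (l\<^sup>2)" using cP by (simp only: of_nat_le_iff)
    then show "real (card ?P) \<le> (real l)\<^sup>2" by simp
  qed (use K_nonneg in simp)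
  finally show "real (card {n. \<not> spread l q d n}) \<le> (real l)\<^sup>2 * (K * real (2 * d))" .
qed

lemma multi_match_events: "multi_match l q s x n \<in> events"
  unfolding multi_match_def using l by (intro sets.finite_INT) auto

lemma
  assumes g: "g \<ge> 1" and n: "spread l q (2 * s + g) n"
  shows prob_multi_match_le: "prob (multi_match l q s x n) \<le> (1 + psi g) ^ l * (\<Prod>i\<in>{1..l}. atom_prob P (window s) (x i))"
    and prob_multi_match_ge: "psi g \<le> 1 \<Longrightarrow> (1 - psi g) ^ l * (\<Prod>i\<in>{1..l}. atom_prob P (window s) (x i)) \<le> prob (multi_match l q s x n)"
proof -
  have sep: "\<bar>int (q i n) - int (q j n)\<bar> \<ge> 2 * int s + int g" if "i \<in> {1..l}" "j \<in> {1..l}" "i \<noteq> j" for i j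
    using n that by (auto simp: spread_def)
  show "prob (multi_match l q s x n) \<le> (1 + psi g) ^ l * (\<Prod>i\<in>{1..l}. atom_prob P (window s) (x i))"
    using prob_INT_le[where J="{1..l}" and pos="\<lambda>i. int (q i n)" and D="\<lambda>i. match s (x i) (q i n)",
      OF _ psi_fin[OF psi_sum g] match_coord_algebra sep]
    by (simp add: multi_match_def prob_match)
  show "psi g \<le> 1 \<Longrightarrow> (1 - psi g) ^ l * (\<Prod>i\<in>{1..l}. atom_prob P (window s) (x i)) \<le> prob (multi_match l q s x n)"
    using prob_INT_ge[where J="{1..l}" and pos="\<lambda>i. int (q i n)" and D="\<lambda>i. match s (x i) (q i n)",
      OF _ psi_fin[OF psi_sum g] match_coord_algebra sep]
    by (simp add: multi_match_def prob_match)
qed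

text \<open>At spread times a gap of 1 already gives the product of the window probabilities up to a
  constant. The other times number only O(s), and there the match with the first target alone is
  counted.\<close>

lemma multi_match_prob_upper:
  "prob (hit l q s x N) \<le> real N * (1 + psi 1) ^ l * (\<Prod>i\<in>{1..l}. atom_prob P (window s) (x i))
    + ((real l)\<^sup>2 * (K * real (2 * (2 * s + 1)))) * atom_prob P (window s) (x 1)"
proof -
  let ?\<Pi> = "\<Prod>i\<in>{1..l}. atom_prob P (window s) (x i)" and ?c = "atom_prob P (window s) (x 1)"
  let ?G = "{n\<in>{1..N}. spread l q (2 * s + 1) n}" and ?B = "{n\<in>{1..N}. \<not> spread l q (2 * s + 1) n}"
  have "prob (hit l q s x N) \<le> (\<Sum>n\<in>{1..N}. prob (multi_match l q s x n))"
    unfolding hit_def using multi_match_events by (intro measure_UNION_le) auto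
  also have "\<dots> = (\<Sum>n\<in>?G. prob (multi_match l q s x n)) + (\<Sum>n\<in>?B. prob (multi_match l q s x n))"
    by (subst sum.union_disjoint[symmetric]) (auto intro: sum.cong)
  also have "(\<Sum>n\<in>?G. prob (multi_match l q s x n)) \<le> (\<Sum>n\<in>?G. (1 + psi 1) ^ l * ?\<Pi>)"
    by (intro sum_mono prob_multi_match_le) auto
  also have "\<dots> = real (card ?G) * ((1 + psi 1) ^ l * ?\<Pi>)" by simp
  also have "\<dots> \<le> real N * ((1 + psi 1) ^ l * ?\<Pi>)"
  proof (rule mult_right_mono)
    have "card ?G \<le> card {1..N}" by (rule card_mono) auto
    then show "real (card ?G) \<le> real N" by simp
    show "0 \<le> (1 + psi 1) ^ l * ?\<Pi>"
      using psi_nonneg[of 1] by (intro mult_nonneg_nonneg prod_nonneg zero_le_power) (auto simp: atom_prob_nonneg)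
  qed
  also have "(\<Sum>n\<in>?B. prob (multi_match l q s x n)) \<le> (\<Sum>n\<in>?B. ?c)"
  proof (rule sum_mono)
    fix n
    have "prob (multi_match l q s x n) \<le> prob (match s (x 1) (q 1 n))"
      by (rule finite_measure_mono) (use l in \<open>auto simp: multi_match_def\<close>)
    then show "prob (multi_match l q s x n) \<le> ?c" by (simp add: prob_match)
  qed
  also have "\<dots> = real (card ?B) * ?c" by simp
  also have "\<dots> \<le> ((real l)\<^sup>2 * (K * real (2 * (2 * s + 1)))) * ?c"
  proof (rule mult_right_mono)
    have "card ?B \<le> card {n. \<not> spread l q (2 * s + 1) n}" by (rule card_mono[OF card_not_spread(1)]) auto
    then show "real (card ?B) \<le> (real l)\<^sup>2 * (K * real (2 * (2 * s + 1)))"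
      using card_not_spread(2)[of "2 * s + 1"] by linarith
  qed (rule atom_prob_nonneg)
  finally show ?thesis by (simp add: mult.assoc)
qed

lemma card_close:
  "finite {m. close l q d m n}" "real (card {m. close l q d m n}) \<le> (real l)\<^sup>2 * (K * real (2 * d))"
proof -
  let ?P = "{1..l} \<times> {1..l}"
  let ?U = "\<lambda>(i, j). {m. \<bar>int (q i m) - int (q j n)\<bar> < int d}"
  have eq: "{m. close l q d m n} = (\<Union>p\<in>?P. ?U p)" unfolding close_def by auto
  have U: "finite (?U p) \<and> real (card (?U p)) \<le> K * real (2 * d)" if pP: "p \<in> ?P" for p
  proof -
    obtain i j where p: "p = (i, j)" "i \<in> {1..l}" "j \<in> {1..l}" using pP by auto
    show ?thesis unfolding p using match_pair_bound[of K "q i", OF K_val[OF p(2)], of "int (q j n)" d] by simp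
  qed
  show "finite {m. close l q d m n}" unfolding eq using U by blast
  have "card {m. close l q d m n} \<le> (\<Sum>p\<in>?P. card (?U p))" unfolding eq by (rule card_UN_le) simp
  then have "real (card {m. close l q d m n}) \<le> (\<Sum>p\<in>?P. real (card (?U p)))" by (simp flip: of_nat_sum)
  also have "\<dots> \<le> (\<Sum>p\<in>?P. K * real (2 * d))" using U by (intro sum_mono) blast
  also have "\<dots> = (real l)\<^sup>2 * (K * real (2 * d))" by (simp add: power2_eq_square)
  finally show "real (card {m. close l q d m n}) \<le> (real l)\<^sup>2 * (K * real (2 * d))" .
qed

text \<open>All \<open>2 * l\<close> windows are pairwise separated, so the joint probability and
  the product of the probabilities both differ from the same product of window probabilities by
  powers of \<open>1 + psi g\<close> and \<open>1 - psi g\<close>.\<close>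

lemma multi_match_cov_far:
  assumes g: "g \<ge> 1" and t: "psi g \<le> 1 / 2"
    and m: "spread l q (2 * s + g) m" and n: "spread l q (2 * s + g) n" and far: "\<not> close l q (2 * s + g) m n"
  shows "prob (multi_match l q s x m \<inter> multi_match l q s x n) - prob (multi_match l q s x m) * prob (multi_match l q s x n)
    \<le> (4 * real l * 4 ^ l * psi g) * (\<Prod>i\<in>{1..l}. atom_prob P (window s) (x i))\<^sup>2"
proof -
  let ?\<Pi> = "\<Prod>i\<in>{1..l}. atom_prob P (window s) (x i)"
  have \<Pi>: "0 \<le> ?\<Pi>" by (intro prod_nonneg) (simp add: atom_prob_nonneg)
  have mn: "m \<noteq> n"
  proof
    assume "m = n"
    then have "close l q (2 * s + g) m n" using l g unfolding close_def by (intro bexI[of _ 1]) auto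
    then show False using far by simp
  qed
  let ?J = "{1..l} \<times> {m, n}"
  let ?D = "\<lambda>(i, b). match s (x i) (q i b)" and ?pos = "\<lambda>(i, b). int (q i b)"
  have "prob (\<Inter>j\<in>?J. ?D j) \<le> (1 + psi g) ^ card ?J * (\<Prod>j\<in>?J. prob (?D j))"
  proof (rule prob_INT_le[where pos="?pos", OF _ psi_fin[OF psi_sum g]])
    show "?D j \<in> coord_algebra {?pos j - int s..?pos j + int s}" for j
      by (cases j) (simp add: match_coord_algebra)
    fix a b assume ab: "a \<in> ?J" "b \<in> ?J" "a \<noteq> b"
    obtain i u j v where e: "a = (i, u)" "b = (j, v)" by (cases a, cases b) auto
    have ij: "i \<in> {1..l}" "j \<in> {1..l}" "u \<in> {m, n}" "v \<in> {m, n}" using ab e by auto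
    have sp: "spread l q (2 * s + g) u" using ij m n by auto
    show "\<bar>?pos a - ?pos b\<bar> \<ge> 2 * int s + int g"
    proof (cases "u = v")
      case True
      then show ?thesis using sp ij ab e unfolding spread_def by auto
    next
      case False
      have far': "\<not> \<bar>int (q j m) - int (q i n)\<bar> < int (2 * s + g)" "\<not> \<bar>int (q i m) - int (q j n)\<bar> < int (2 * s + g)"
        using far ij unfolding close_def by blast+
      have "u = m \<and> v = n \<or> u = n \<and> v = m" using False ij by auto
      then have "\<not> \<bar>int (q i u) - int (q j v)\<bar> < int (2 * s + g)"
        using far' abs_minus_commute[of "int (q j m)" "int (q i n)"] by auto
      then show ?thesis using e by simp
    qed
  qed simp
  also have "(\<Inter>j\<in>?J. ?D j) = multi_match l q s x m \<inter> multi_match l q s x n" by (auto simp: multi_match_def)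
  also have "card ?J = 2 * l" using mn by (simp add: card_cartesian_product)
  also have "(\<Prod>j\<in>?J. prob (?D j)) = ?\<Pi>\<^sup>2"
  proof -
    have "(\<Prod>j\<in>?J. prob (?D j)) = (\<Prod>i\<in>{1..l}. \<Prod>b\<in>{m, n}. atom_prob P (window s) (x i))"
      by (subst prod.cartesian_product) (simp add: case_prod_unfold prob_match)
    then show ?thesis using mn by (simp add: prod.distrib power2_eq_square)
  qed
  finally have up: "prob (multi_match l q s x m \<inter> multi_match l q s x n) \<le> (1 + psi g) ^ (2 * l) * ?\<Pi>\<^sup>2" .
  have t1: "psi g \<le> 1" using t by simp
  have "((1 - psi g) ^ l * ?\<Pi>) * ((1 - psi g) ^ l * ?\<Pi>) \<le> prob (multi_match l q s x m) * prob (multi_match l q s x n)"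
    using prob_multi_match_ge[OF g m t1, of x] prob_multi_match_ge[OF g n t1, of x] t1 \<Pi> by (intro mult_mono) auto
  then have low: "(1 - psi g) ^ (2 * l) * ?\<Pi>\<^sup>2 \<le> prob (multi_match l q s x m) * prob (multi_match l q s x n)"
  proof -
    have "(1 - psi g) ^ (2 * l) = (1 - psi g) ^ l * (1 - psi g) ^ l" by (simp add: mult_2 power_add)
    then show "(1 - psi g) ^ (2 * l) * ?\<Pi>\<^sup>2 \<le> prob (multi_match l q s x m) * prob (multi_match l q s x n)"
      if "((1 - psi g) ^ l * ?\<Pi>) * ((1 - psi g) ^ l * ?\<Pi>) \<le> prob (multi_match l q s x m) * prob (multi_match l q s x n)"
      using that by (simp only: power2_eq_square mult_ac)
  qed
  \<comment> \<open>The factors are the exponent \<open>2 * l\<close>, the difference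
    \<open>2 * psi g\<close> of the bases, and \<open>2 ^ (2 * l)\<close> because the larger base is
    at most 2.\<close>
  have "(1 + psi g) ^ (2 * l) - (1 - psi g) ^ (2 * l) \<le> real (2 * l) * ((1 + psi g) - (1 - psi g)) * 2 ^ (2 * l)"
    by (rule power_diff_le) (use t psi_nonneg[of g] in auto)
  also have "\<dots> = 4 * real l * 4 ^ l * psi g" by (simp add: power_mult)
  finally have "((1 + psi g) ^ (2 * l) - (1 - psi g) ^ (2 * l)) * ?\<Pi>\<^sup>2 \<le> (4 * real l * 4 ^ l * psi g) * ?\<Pi>\<^sup>2"
    by (rule mult_right_mono) simp
  then show ?thesis using up low by (simp add: left_diff_distrib)
qed

text \<open>Second moment method over the spread times, of which there are at least
  \<open>J\<close>. The covariance of a close pair is at most one probability, and each time has few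
  close partners; this gives the first term. The covariances of far pairs are small only relative to
  the products, so their share does not decrease with \<open>N\<close> and forms the second
  term.\<close>

lemma no_multi_match_prob:
  assumes g: "g \<ge> 1" and t: "psi g \<le> 1 / 2" and pos: "\<And>i. i \<in> {1..l} \<Longrightarrow> atom_prob P (window s) (x i) > 0"
    and J: "real N - (real l)\<^sup>2 * (K * real (2 * (2 * s + g))) \<ge> J" "J > 0"
  shows "prob (space P - hit l q s x N)
    \<le> ((real l)\<^sup>2 * (K * real (2 * (2 * s + g)))) * 2 ^ l / (J * (\<Prod>i\<in>{1..l}. atom_prob P (window s) (x i)))
      + 4 ^ l * (4 * real l * 4 ^ l * psi g)"
proof -
  let ?d = "2 * s + g"
  let ?\<Pi> = "\<Prod>i\<in>{1..l}. atom_prob P (window s) (x i)" and ?E = "multi_match l q s x"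
  let ?B = "(real l)\<^sup>2 * (K * real (2 * ?d))" and ?F = "4 * real l * 4 ^ l * psi g"
  define I where "I = {n\<in>{1..N}. spread l q ?d n}"
  have \<Pi>: "0 < ?\<Pi>" using pos by (intro prod_pos) auto
  have B0: "0 \<le> ?B" using K_nonneg by simp
  have F0: "0 \<le> ?F" using psi_nonneg by simp
  have I: "finite I" "I \<subseteq> {1..N}" by (auto simp: I_def)
  have cI: "real (card I) \<ge> J"
  proof -
    have "card {1..N} \<le> card I + card {n. \<not> spread l q ?d n}"
      by (rule order_trans[OF card_mono card_Un_le]) (use card_not_spread(1) I in \<open>auto simp: I_def\<close>)
    then have "real N \<le> real (card I) + real (card {n. \<not> spread l q ?d n})" by simp
    then show ?thesis using card_not_spread(2)[of ?d] J(1) by linarith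
  qed
  define S where "S = (\<Sum>n\<in>I. prob (?E n))"
  have half: "?\<Pi> / 2 ^ l \<le> prob (?E n)" if "n \<in> I" for n
  proof -
    have "(1 / 2) ^ l * ?\<Pi> \<le> (1 - psi g) ^ l * ?\<Pi>" using t \<Pi> by (intro mult_right_mono power_mono) auto
    also have "\<dots> \<le> prob (?E n)" using that t by (intro prob_multi_match_ge[OF g]) (auto simp: I_def)
    finally show ?thesis by (simp add: power_one_over)
  qed
  have S_ge: "real (card I) * (?\<Pi> / 2 ^ l) \<le> S"
  proof -
    have "(\<Sum>n\<in>I. ?\<Pi> / 2 ^ l) \<le> S" unfolding S_def by (intro sum_mono half)
    then show ?thesis by simp
  qed
  have cI0: "real (card I) > 0" using cI J by linarith
  have S_pos: "S > 0"
    by (rule less_le_trans[OF _ S_ge]) (use cI0 \<Pi> in \<open>auto intro!: mult_pos_pos divide_pos_pos\<close>)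
  have row: "(\<Sum>m\<in>I. prob (?E m \<inter> ?E n) - prob (?E m) * prob (?E n)) \<le> ?B * prob (?E n) + real (card I) * (?F * ?\<Pi>\<^sup>2)"
    if n: "n \<in> I" for n
  proof -
    have "(\<Sum>m\<in>I. prob (?E m \<inter> ?E n) - prob (?E m) * prob (?E n))
      \<le> (\<Sum>m\<in>I. (if close l q ?d m n then prob (?E n) else 0) + ?F * ?\<Pi>\<^sup>2)"
    proof (rule sum_mono)
      fix m assume m: "m \<in> I"
      show "prob (?E m \<inter> ?E n) - prob (?E m) * prob (?E n) \<le> (if close l q ?d m n then prob (?E n) else 0) + ?F * ?\<Pi>\<^sup>2"
      proof (cases "close l q ?d m n")
        case True
        have "prob (?E m \<inter> ?E n) \<le> prob (?E n)" using multi_match_events by (intro finite_measure_mono) auto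
        moreover have "0 \<le> prob (?E m) * prob (?E n)" by simp
        moreover have "0 \<le> ?F * ?\<Pi>\<^sup>2" by (rule mult_nonneg_nonneg[OF F0 zero_le_power2])
        ultimately have "prob (?E m \<inter> ?E n) - prob (?E m) * prob (?E n) \<le> prob (?E n) + ?F * ?\<Pi>\<^sup>2" by linarith
        then show ?thesis using True by simp
      next
        case False
        have "prob (?E m \<inter> ?E n) - prob (?E m) * prob (?E n) \<le> ?F * ?\<Pi>\<^sup>2"
          by (rule multi_match_cov_far[OF g t]) (use m n False in \<open>auto simp: I_def\<close>)
        then show ?thesis using False by simp
      qed
    qed
    also have "\<dots> = real (card {m\<in>I. close l q ?d m n}) * prob (?E n) + real (card I) * (?F * ?\<Pi>\<^sup>2)"
      using I by (simp add: sum.distrib sum.If_cases Int_def)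
    also have "real (card {m\<in>I. close l q ?d m n}) * prob (?E n) \<le> ?B * prob (?E n)"
    proof (rule mult_right_mono)
      have "card {m\<in>I. close l q ?d m n} \<le> card {m. close l q ?d m n}" by (rule card_mono[OF card_close(1)]) auto
      then show "real (card {m\<in>I. close l q ?d m n}) \<le> ?B" using card_close(2)[of ?d n] by linarith
    qed simp
    finally show ?thesis by simp
  qed
  have "prob (space P - (\<Union>n\<in>I. ?E n)) * S\<^sup>2 \<le> (\<Sum>m\<in>I. \<Sum>n\<in>I. prob (?E m \<inter> ?E n) - prob (?E m) * prob (?E n))"
    unfolding S_def by (rule second_moment[OF I(1) multi_match_events])
  also have "\<dots> = (\<Sum>n\<in>I. \<Sum>m\<in>I. prob (?E m \<inter> ?E n) - prob (?E m) * prob (?E n))" by (rule sum.swap)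
  also have "\<dots> \<le> (\<Sum>n\<in>I. ?B * prob (?E n) + real (card I) * (?F * ?\<Pi>\<^sup>2))" by (intro sum_mono row)
  also have "\<dots> = ?B * S + (real (card I) * ?\<Pi>)\<^sup>2 * ?F"
    by (simp only: sum.distrib S_def sum_distrib_left) (simp add: power2_eq_square)
  \<comment> \<open>Every event has probability at least \<open>?\<Pi> / 2 ^ l\<close>, since
    \<open>psi g \<le> 1 / 2\<close>; this expresses the far pairs through \<open>S\<close>
    itself.\<close>
  also have "\<dots> \<le> ?B * S + (2 ^ l * S)\<^sup>2 * ?F"
  proof (rule add_left_mono[OF mult_right_mono[OF power_mono F0]])
    show "real (card I) * ?\<Pi> \<le> 2 ^ l * S" using S_ge by (simp add: field_simps)
  qed (use \<Pi> in auto)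
  also have "?B * S + (2 ^ l * S)\<^sup>2 * ?F = (?B / S + 4 ^ l * ?F) * S\<^sup>2"
  proof -
    have "(2 ^ l * S)\<^sup>2 = (2 ^ l * 2 ^ l) * S\<^sup>2" by (simp only: power2_eq_square mult_ac)
    also have "2 ^ l * 2 ^ l = (4 ^ l :: real)" by (simp flip: power_mult_distrib)
    finally have "(2 ^ l * S)\<^sup>2 * ?F = 4 ^ l * ?F * S\<^sup>2" by simp
    moreover have "?B * S = ?B / S * S\<^sup>2" using S_pos by (simp add: power2_eq_square)
    ultimately show ?thesis by (simp only: distrib_right)
  qed
  finally have "prob (space P - (\<Union>n\<in>I. ?E n)) * S\<^sup>2 \<le> (?B / S + 4 ^ l * ?F) * S\<^sup>2" .
  then have "prob (space P - (\<Union>n\<in>I. ?E n)) \<le> ?B / S + 4 ^ l * ?F"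
    by (rule mult_right_le_imp_le) (use S_pos in simp)
  moreover have "?B / S \<le> ?B * 2 ^ l / (J * ?\<Pi>)"
  proof -
    have "J * ?\<Pi> / 2 ^ l \<le> real (card I) * (?\<Pi> / 2 ^ l)" using cI \<Pi> by (simp add: divide_right_mono mult_right_mono)
    then have "J * ?\<Pi> / 2 ^ l \<le> S" using S_ge by linarith
    moreover have "J * ?\<Pi> / 2 ^ l > 0" using J \<Pi> by (intro divide_pos_pos mult_pos_pos) auto
    ultimately have "?B / S \<le> ?B / (J * ?\<Pi> / 2 ^ l)"
      using S_pos by (intro divide_left_mono B0 mult_pos_pos)
    then show ?thesis by simp
  qed
  moreover have "prob (space P - (\<Union>n\<in>{1..N}. ?E n)) \<le> prob (space P - (\<Union>n\<in>I. ?E n))"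
    using I multi_match_events by (intro finite_measure_mono sets.compl_sets sets.finite_UN) auto
  ultimately show ?thesis unfolding hit_def by linarith
qed

end

end

section \<open>Almost sure hitting at exponential times\<close>

lemma summable_linear_exp:
  fixes \<kappa> :: real
  assumes "\<kappa> > 0"
  shows "summable (\<lambda>s. C * (real s + 1) * exp (- \<kappa> * real s))"
proof -
  \<comment> \<open>Chosen so that \<open>s + 1 \<le> D * (1 + \<kappa> / 2 * s) \<le> D * exp
    (\<kappa> / 2 * s)\<close>: half of the exponent absorbs the linear factor.\<close>
  define D where "D = max 1 (2 / \<kappa>)"
  have bound: "(real s + 1) * exp (- \<kappa> * real s) \<le> D * exp (- \<kappa> / 2) ^ s" for s
  proof -
    have "real s + 1 \<le> D * (1 + \<kappa> / 2 * real s)"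
    proof -
      have "real s = (2 / \<kappa>) * (\<kappa> / 2 * real s)" using assms by simp
      also have "\<dots> \<le> D * (\<kappa> / 2 * real s)" using assms by (intro mult_right_mono) (auto simp: D_def)
      finally have "real s \<le> D * (\<kappa> / 2 * real s)" .
      moreover have "1 \<le> D" by (simp add: D_def)
      ultimately show ?thesis by (simp add: distrib_left)
    qed
    also have "\<dots> \<le> D * exp (\<kappa> / 2 * real s)" by (intro mult_left_mono exp_ge_add_one_self) (simp add: D_def)
    finally have "(real s + 1) * exp (- \<kappa> * real s) \<le> D * exp (\<kappa> / 2 * real s) * exp (- \<kappa> * real s)"
      by (intro mult_right_mono) auto
    also have "\<dots> = D * exp (- \<kappa> / 2) ^ s"
      by (simp add: mult.assoc exp_add[symmetric] exp_of_nat_mult[symmetric] algebra_simps)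
    finally show ?thesis .
  qed
  have "summable (\<lambda>s. D * exp (- \<kappa> / 2) ^ s)" using assms by (intro summable_mult summable_geometric) auto
  then have "summable (\<lambda>s. (real s + 1) * exp (- \<kappa> * real s))"
    by (rule summable_comparison_test') (use bound in auto)
  from summable_mult[OF this, of C] show ?thesis by (simp add: mult.assoc)
qed

lemma (in prob_space) AE_eventually_not:
  assumes A: "\<And>s::nat. A s \<in> events" and "\<kappa> > 0"
    and le: "eventually (\<lambda>s. prob (A s) \<le> C * (real s + 1) * exp (- \<kappa> * real s)) sequentially"
  shows "AE \<omega> in M. eventually (\<lambda>s. \<omega> \<notin> A s) sequentially"
proof -
  have "AE \<omega> in M. eventually (\<lambda>s. \<omega> \<in> space M - A s) sequentially"
  proof (rule borel_cantelli_AE1[OF A])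
    show "summable (\<lambda>s. prob (A s))"
      by (rule summable_comparison_test_ev[OF _ summable_linear_exp[OF \<open>\<kappa> > 0\<close>]]) (use le in simp)
  qed (auto simp: emeasure_eq_measure)
  then show ?thesis by eventually_elim (auto elim: eventually_mono)
qed

lemma real_nat_floor_bounds:
  fixes y :: real
  assumes "y \<ge> 1"
  shows "real (nat \<lfloor>y\<rfloor>) \<le> y" "y / 2 \<le> real (nat \<lfloor>y\<rfloor>)" "nat \<lfloor>y\<rfloor> \<ge> 1"
proof -
  have f: "\<lfloor>y\<rfloor> \<ge> 1" using assms by simp
  have r: "real (nat \<lfloor>y\<rfloor>) = of_int \<lfloor>y\<rfloor>" using f by (simp add: of_nat_nat)
  show "real (nat \<lfloor>y\<rfloor>) \<le> y" unfolding r by simp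
  have "of_int \<lfloor>y\<rfloor> \<ge> (1::real)" using f by linarith
  then show "y / 2 \<le> real (nat \<lfloor>y\<rfloor>)" unfolding r by linarith
  show "nat \<lfloor>y\<rfloor> \<ge> 1" using f by linarith
qed

context mixing
begin

text \<open>A property of a single target. Once it holds for all entries of a tuple, the hitting
  estimates apply to this fixed tuple, and no joint measurability in the tuple and
  \<open>\<omega>\<close> is involved.\<close>

definition typical :: "real \<Rightarrow> (int \<Rightarrow> 'a) \<Rightarrow> bool" where
  "typical h x \<longleftrightarrow> (\<forall>s. 0 < atom_prob P (window s) x) \<and>
    (\<forall>c<h. eventually (\<lambda>s. c * (2 * real s) \<le> - ln (atom_prob P (window s) x)) sequentially) \<and>
    (\<forall>c>h. eventually (\<lambda>s. - ln (atom_prob P (window s) x) \<le> c * (2 * real s)) sequentially)"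

lemma AE_typical:
  assumes fc: "finite_ent P coord0"
  shows "AE x in P. typical (entropy_rate P coord0) x"
proof -
  have "AE x in P. \<forall>s. 0 < atom_prob P (window s) x"
    unfolding AE_all_countable by (intro allI atom_prob_AE_pos rv_window)
  then show ?thesis using window_info_lower[OF fc] window_info_upper[OF fc]
    by eventually_elim (simp add: typical_def)
qed

context
  fixes l :: nat and x :: "nat \<Rightarrow> int \<Rightarrow> 'a" and h :: real and q :: "nat \<Rightarrow> nat \<Rightarrow> nat" and K :: real
  assumes l: "l \<ge> 1" and h: "h > 0"
    and x: "\<And>i. i \<in> {1..l} \<Longrightarrow> typical h (x i)"
begin

lemma hit_events: "hit l q s x N \<in> events"
  unfolding hit_def multi_match_def using l by (intro sets.finite_UN sets.finite_INT) auto

lemma eventually_c_le: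
  assumes "\<epsilon> > 0"
  shows "eventually (\<lambda>s. \<forall>i\<in>{1..l}. atom_prob P (window s) (x i) \<le> exp (- (2 * real s * (h - \<epsilon>)))) sequentially"
proof (rule eventually_ball_finite, simp, rule ballI)
  fix i assume i: "i \<in> {1..l}"
  have "eventually (\<lambda>s. (h - \<epsilon>) * (2 * real s) \<le> - ln (atom_prob P (window s) (x i))) sequentially"
    using x[OF i] assms by (simp add: typical_def)
  then show "eventually (\<lambda>s. atom_prob P (window s) (x i) \<le> exp (- (2 * real s * (h - \<epsilon>)))) sequentially"
  proof eventually_elim
    case (elim s)
    have "atom_prob P (window s) (x i) = exp (ln (atom_prob P (window s) (x i)))" using x[OF i] by (simp add: typical_def)
    also have "\<dots> \<le> exp (- (2 * real s * (h - \<epsilon>)))" using elim by (simp add: mult_ac)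
    finally show ?case .
  qed
qed

lemma eventually_c_ge:
  assumes "\<epsilon> > 0"
  shows "eventually (\<lambda>s. \<forall>i\<in>{1..l}. exp (- (2 * real s * (h + \<epsilon>))) \<le> atom_prob P (window s) (x i)) sequentially"
proof (rule eventually_ball_finite, simp, rule ballI)
  fix i assume i: "i \<in> {1..l}"
  have "eventually (\<lambda>s. - ln (atom_prob P (window s) (x i)) \<le> (h + \<epsilon>) * (2 * real s)) sequentially"
    using x[OF i] assms by (simp add: typical_def)
  then show "eventually (\<lambda>s. exp (- (2 * real s * (h + \<epsilon>))) \<le> atom_prob P (window s) (x i)) sequentially"
  proof eventually_elim
    case (elim s)
    have "exp (- (2 * real s * (h + \<epsilon>))) \<le> exp (ln (atom_prob P (window s) (x i)))" using elim by (simp add: mult_ac)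
    also have "\<dots> = atom_prob P (window s) (x i)" using x[OF i] by (simp add: typical_def)
    finally show ?case .
  qed
qed

lemma prod_exp_const: "(\<Prod>i\<in>{1..l}. exp (- y)) = exp (- (real l * y))"
  by (simp add: exp_of_nat_mult[symmetric])

lemma eventually_cprod_le:
  assumes "\<epsilon> > 0"
  shows "eventually (\<lambda>s. (\<Prod>i\<in>{1..l}. atom_prob P (window s) (x i)) \<le> exp (- (real l * (2 * real s * (h - \<epsilon>))))) sequentially"
  using eventually_c_le[OF assms]
proof eventually_elim
  case (elim s)
  have "(\<Prod>i\<in>{1..l}. atom_prob P (window s) (x i)) \<le> (\<Prod>i\<in>{1..l}. exp (- (2 * real s * (h - \<epsilon>))))"
    using elim by (intro prod_mono) (auto simp: atom_prob_nonneg)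
  then show ?case by (simp only: prod_exp_const)
qed

lemma eventually_cprod_ge:
  assumes "\<epsilon> > 0"
  shows "eventually (\<lambda>s. exp (- (real l * (2 * real s * (h + \<epsilon>)))) \<le> (\<Prod>i\<in>{1..l}. atom_prob P (window s) (x i))) sequentially"
  using eventually_c_ge[OF assms]
proof eventually_elim
  case (elim s)
  have "(\<Prod>i\<in>{1..l}. exp (- (2 * real s * (h + \<epsilon>)))) \<le> (\<Prod>i\<in>{1..l}. atom_prob P (window s) (x i))"
    using elim by (intro prod_mono) auto
  then show ?case by (simp only: prod_exp_const)
qed

text \<open>Up to this time the expected number of matches is of order
  \<open>exp (- 2 * s * l * \<epsilon>)\<close>. The term with \<open>B\<close> accounts for the
  O(s) times at which the windows interfere; there \<open>2 * \<epsilon> < h\<close> makes a single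
  match improbable enough. With the bound as a premise, one and several targets are treated
  alike.\<close>

lemma AE_not_hit:
  assumes M0: "0 \<le> M" and B0: "0 \<le> B"
    and le: "\<And>s N. prob (hit l q s x N) \<le> real N * M * (\<Prod>i\<in>{1..l}. atom_prob P (window s) (x i)) + B * (real s + 1) * atom_prob P (window s) (x 1)"
    and e: "0 < \<epsilon>" "2 * \<epsilon> < h"
  shows "AE \<omega> in P. eventually (\<lambda>s. \<omega> \<notin> hit l q s x (nat \<lfloor>exp (real l * (2 * real s * (h - 2 * \<epsilon>)))\<rfloor>)) sequentially"
proof (rule AE_eventually_not[OF hit_events, where \<kappa>="2 * \<epsilon>" and C="M + B"])
  show "eventually (\<lambda>s. prob (hit l q s x (nat \<lfloor>exp (real l * (2 * real s * (h - 2 * \<epsilon>)))\<rfloor>))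
      \<le> (M + B) * (real s + 1) * exp (- (2 * \<epsilon>) * real s)) sequentially"
    using eventually_cprod_le[OF e(1)] eventually_c_le[OF e(1)]
  proof eventually_elim
    case (elim s)
    let ?E = "exp (- (2 * \<epsilon>) * real s)"
    let ?y = "exp (real l * (2 * real s * (h - 2 * \<epsilon>)))"
    have "real (nat \<lfloor>?y\<rfloor>) * M * (\<Prod>i\<in>{1..l}. atom_prob P (window s) (x i)) \<le> ?y * M * exp (- (real l * (2 * real s * (h - \<epsilon>))))"
      using elim(1) M0 by (intro mult_mono) (auto intro!: prod_nonneg simp: atom_prob_nonneg of_nat_nat)
    also have "\<dots> = M * exp (- (real l * (2 * real s * \<epsilon>)))"
      by (simp add: exp_add[symmetric] algebra_simps)
    also have "\<dots> \<le> M * ?E"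
    proof -
      have "1 * (2 * real s * \<epsilon>) \<le> real l * (2 * real s * \<epsilon>)" using l e by (intro mult_right_mono) auto
      then show ?thesis using M0 by (intro mult_left_mono) (auto simp: mult_ac)
    qed
    also have "\<dots> \<le> M * (real s + 1) * ?E"
    proof (rule mult_right_mono)
      have "M * 1 \<le> M * (real s + 1)" using M0 by (intro mult_left_mono) auto
      then show "M \<le> M * (real s + 1)" by simp
    qed simp
    finally have 1: "real (nat \<lfloor>?y\<rfloor>) * M * (\<Prod>i\<in>{1..l}. atom_prob P (window s) (x i)) \<le> M * (real s + 1) * ?E" .
    have "atom_prob P (window s) (x 1) \<le> exp (- (2 * real s * (h - \<epsilon>)))" using elim(2) l by auto
    also have "\<dots> \<le> ?E"
    proof -
      have "\<epsilon> * (2 * real s) \<le> (h - \<epsilon>) * (2 * real s)" using e by (intro mult_right_mono) auto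
      then show ?thesis by (simp add: mult_ac)
    qed
    finally have "B * (real s + 1) * atom_prob P (window s) (x 1) \<le> B * (real s + 1) * ?E" using B0 by (intro mult_left_mono) auto
    with 1 le[of s "nat \<lfloor>?y\<rfloor>"] show ?case by (simp add: distrib_right)
  qed
qed (use e in auto)

lemma AE_hitI:
  assumes "\<kappa> > 0" "\<epsilon> > 0"
    and "eventually (\<lambda>s. prob (space P - hit l q s x (nat \<lfloor>exp (real l * (2 * real s * (h + 2 * \<epsilon>)))\<rfloor>))
      \<le> C * (real s + 1) * exp (- \<kappa> * real s)) sequentially"
  shows "AE \<omega> in P. eventually (\<lambda>s. \<omega> \<in> hit l q s x (nat \<lfloor>exp (real l * (2 * real s * (h + 2 * \<epsilon>)))\<rfloor>)) sequentially"
proof -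
  have "AE \<omega> in P. eventually (\<lambda>s. \<omega> \<notin> space P - hit l q s x (nat \<lfloor>exp (real l * (2 * real s * (h + 2 * \<epsilon>)))\<rfloor>)) sequentially"
    by (rule AE_eventually_not[OF _ assms(1,3)]) (intro sets.compl_sets hit_events)
  then show ?thesis by simp
qed

text \<open>The mean number of matches is at least \<open>exp (2 * \<epsilon> * s) / 2\<close>,
  against a variance factor linear in \<open>s\<close>.\<close>

lemma AE_hit_single:
  assumes l1: "l = 1" and K: "\<And>k::int. at_most K {n. int (q 1 n) = k}" and e: "\<epsilon> > 0"
  shows "AE \<omega> in P. eventually (\<lambda>s. \<omega> \<in> hit l q s x (nat \<lfloor>exp (real l * (2 * real s * (h + 2 * \<epsilon>)))\<rfloor>)) sequentially"
proof (rule AE_hitI[where \<kappa>="2 * \<epsilon>", OF _ e])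
  let ?\<Phi> = "\<Sum>n. phi (Suc n)"
  have \<Phi>: "?\<Phi> \<ge> 0" by (rule suminf_nonneg[OF summable_phi]) (rule phi_nonneg)
  have K0: "0 \<le> K" using K[of 0] unfolding at_most_def by (meson of_nat_0_le_iff order_trans)
  show "eventually (\<lambda>s. prob (space P - hit l q s x (nat \<lfloor>exp (real l * (2 * real s * (h + 2 * \<epsilon>)))\<rfloor>))
      \<le> (2 * K * (4 + 2 * ?\<Phi>)) * (real s + 1) * exp (- (2 * \<epsilon>) * real s)) sequentially"
    using eventually_c_ge[OF e]
  proof eventually_elim
    case (elim s)
    let ?y = "exp (real l * (2 * real s * (h + 2 * \<epsilon>)))"
    let ?N = "nat \<lfloor>?y\<rfloor>"
    have N: "?N \<ge> 1" "?y / 2 \<le> real ?N" using real_nat_floor_bounds[of ?y] h e by auto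
    have c: "exp (- (2 * real s * (h + \<epsilon>))) \<le> atom_prob P (window s) (x 1)" using elim l by auto
    have c0: "atom_prob P (window s) (x 1) > 0" using x[of 1] l by (auto simp: typical_def)
    have hit: "hit l q s x ?N = (\<Union>n\<in>{1..?N}. match s (x 1) (q 1 n))" unfolding hit_def multi_match_def by (simp add: l1)
    have "prob (space P - hit l q s x ?N) \<le> K * (real (4 * s + 1) + 2 * ?\<Phi>) / (real ?N * atom_prob P (window s) (x 1))"
      unfolding hit by (rule no_match_prob_single[OF K N(1) c0])
    also have "\<dots> \<le> K * ((4 + 2 * ?\<Phi>) * (real s + 1)) / (?y / 2 * exp (- (2 * real s * (h + \<epsilon>))))"
    proof (rule frac_le)
      have "real (4 * s + 1) + 2 * ?\<Phi> \<le> (4 + 2 * ?\<Phi>) * (real s + 1)" using \<Phi> by (simp add: algebra_simps)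
      then show "K * (real (4 * s + 1) + 2 * ?\<Phi>) \<le> K * ((4 + 2 * ?\<Phi>) * (real s + 1))" using K0 by (rule mult_left_mono)
      show "0 \<le> K * ((4 + 2 * ?\<Phi>) * (real s + 1))" using K0 \<Phi> by (intro mult_nonneg_nonneg) auto
      show "?y / 2 * exp (- (2 * real s * (h + \<epsilon>))) \<le> real ?N * atom_prob P (window s) (x 1)" using N(2) c by (intro mult_mono) auto
    qed simp
    also have "?y / 2 * exp (- (2 * real s * (h + \<epsilon>))) = exp (2 * \<epsilon> * real s) / 2"
      by (simp add: l1 exp_add[symmetric] algebra_simps)
    also have "K * ((4 + 2 * ?\<Phi>) * (real s + 1)) / (exp (2 * \<epsilon> * real s) / 2)
      = (2 * K * (4 + 2 * ?\<Phi>)) * (real s + 1) * exp (- (2 * \<epsilon>) * real s)"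
      by (simp add: exp_minus field_simps)
    finally show ?case .
  qed
qed (use e in simp)

text \<open>The gap has to serve two purposes. The relative error \<open>psi g \<le> C / g\<close>
  must be summable in \<open>s\<close>, so \<open>g\<close> is taken of order
  \<open>exp (\<kappa> * s)\<close>; the number of interfering times, at most of order
  \<open>(s + 1) * exp (\<kappa> * s)\<close>, must be small against the expected number of matches,
  which is at least of order \<open>exp (2 * \<kappa> * s)\<close> for
  \<open>\<kappa> = l * \<epsilon>\<close>.\<close>

lemma AE_hit_multi:
  assumes l2: "l > 1" and psi_sum: "(\<Sum>n. psi_mix P (Suc n)) < \<infinity>"
    and K: "\<And>i j (k::int). i \<in> {1..l} \<Longrightarrow> j \<in> {1..l} \<Longrightarrow> i \<noteq> j \<Longrightarrow>
      at_most K {n. int (q i n) - int (q j n) = k \<or> int (q i n) = k}"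
    and e: "\<epsilon> > 0"
  shows "AE \<omega> in P. eventually (\<lambda>s. \<omega> \<in> hit l q s x (nat \<lfloor>exp (real l * (2 * real s * (h + 2 * \<epsilon>)))\<rfloor>)) sequentially"
proof -
  have K0: "0 \<le> K" by (rule K_nonneg[where q=q and K=K, OF l2 psi_sum K])
  obtain C where C: "C > 0" "\<And>g. g \<ge> 1 \<Longrightarrow> psi g \<le> C / real g" using psi_decay[OF psi_sum] by blast
  define \<kappa> where "\<kappa> = real l * \<epsilon>"
  have \<kappa>: "\<kappa> > 0" using l e by (simp add: \<kappa>_def)
  define L where "L = 4 * (real l)\<^sup>2 * K"
  have L0: "0 \<le> L" using K0 by (simp add: L_def)
  define F where "F = 4 ^ l * (4 * real l * 4 ^ l)"
  have F0: "0 \<le> F" by (simp add: F_def)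
  define g where "g s = nat \<lceil>exp (\<kappa> * real s)\<rceil>" for s :: nat
  have g: "g s \<ge> 1" "exp (\<kappa> * real s) \<le> real (g s)" "real (g s) \<le> 2 * exp (\<kappa> * real s)" for s
  proof -
    have one: "1 \<le> exp (\<kappa> * real s)" using \<kappa> by simp
    have r: "real (g s) = of_int \<lceil>exp (\<kappa> * real s)\<rceil>" using one by (simp add: g_def of_nat_nat)
    show "exp (\<kappa> * real s) \<le> real (g s)" unfolding r by simp
    then show "g s \<ge> 1" using one by linarith
    show "real (g s) \<le> 2 * exp (\<kappa> * real s)" unfolding r using one by linarith
  qed
  \<comment> \<open>For large \<open>s\<close> this ensures \<open>psi (g s) \<le> 1 / 2\<close> and
    keeps the interfering times below a quarter of the time horizon.\<close>
  have ev_exp: "eventually (\<lambda>s. D * (real s + 1) \<le> exp (\<kappa> * real s)) sequentially" for D :: real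
  proof -
    have "(\<lambda>s. D * (real s + 1) * exp (- \<kappa> * real s)) \<longlonglongrightarrow> 0"
      by (rule summable_LIMSEQ_zero[OF summable_linear_exp[OF \<kappa>]])
    then have "eventually (\<lambda>s. D * (real s + 1) * exp (- \<kappa> * real s) < 1) sequentially"
      by (rule order_tendstoD) simp
    then show ?thesis by eventually_elim (simp add: exp_minus field_simps)
  qed
  show ?thesis
  proof (rule AE_hitI[where \<kappa>=\<kappa>, OF \<kappa> e])
    show "eventually (\<lambda>s. prob (space P - hit l q s x (nat \<lfloor>exp (real l * (2 * real s * (h + 2 * \<epsilon>)))\<rfloor>))
      \<le> (4 * L * 2 ^ l + F * C) * (real s + 1) * exp (- \<kappa> * real s)) sequentially"
      using eventually_cprod_ge[OF e] ev_exp[of "2 * C"] ev_exp[of "4 * L"]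
    proof eventually_elim
      case (elim s)
      let ?e = "exp (\<kappa> * real s)"
      have e1: "1 \<le> ?e" using \<kappa> by simp
      let ?y = "exp (real l * (2 * real s * (h + 2 * \<epsilon>)))"
      let ?N = "nat \<lfloor>?y\<rfloor>"
      have y_ge: "?e ^ 2 \<le> ?y"
      proof -
        have "2 * (\<kappa> * real s) \<le> real l * (2 * real s * (h + 2 * \<epsilon>))"
        proof -
          have "(2 * real s * \<epsilon>) \<le> (2 * real s * (h + 2 * \<epsilon>))" using h e by (intro mult_left_mono) auto
          then have "real l * (2 * real s * \<epsilon>) \<le> real l * (2 * real s * (h + 2 * \<epsilon>))" by (rule mult_left_mono) simp
          then show ?thesis unfolding \<kappa>_def by (simp only: mult_ac)
        qed
        then show ?thesis by (simp add: exp_double[symmetric])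
      qed
      have N: "?y / 2 \<le> real ?N" using real_nat_floor_bounds[of ?y] h e by auto
      have psi_le: "psi (g s) \<le> C / ?e"
      proof -
        have "C / real (g s) \<le> C / ?e" using C(1) g(2)[of s] by (intro divide_left_mono) (auto intro: mult_pos_pos less_le_trans[OF exp_gt_zero])
        then show ?thesis using C(2)[OF g(1), of s] by linarith
      qed
      have t: "psi (g s) \<le> 1 / 2"
      proof -
        have "2 * C * 1 \<le> 2 * C * (real s + 1)" using C(1) by (intro mult_left_mono) auto
        then have "2 * C \<le> ?e" using elim(2) by linarith
        then have "C / ?e \<le> 1 / 2" by (simp add: field_simps)
        then show ?thesis using psi_le by linarith
      qed
      define B where "B = (real l)\<^sup>2 * (K * real (2 * (2 * s + g s)))"
      have B_le: "B \<le> L * (real s + 1) * ?e"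
      proof -
        have "real (2 * (2 * s + g s)) \<le> 4 * ((real s + 1) * ?e)"
        proof -
          have "real s \<le> real s * ?e" using e1 mult_left_mono[of 1 ?e "real s"] by simp
          then show ?thesis using g(3)[of s] by (simp add: algebra_simps)
        qed
        then have "(real l)\<^sup>2 * (K * real (2 * (2 * s + g s))) \<le> (real l)\<^sup>2 * (K * (4 * ((real s + 1) * ?e)))"
          using K0 by (intro mult_left_mono) auto
        then show ?thesis by (simp add: B_def L_def mult_ac)
      qed
      have B0: "0 \<le> B" unfolding B_def using K0 by simp
      have B_y: "B \<le> ?y / 4"
      proof -
        have "4 * B \<le> (4 * L * (real s + 1)) * ?e" using B_le by simp
        also have "\<dots> \<le> ?e * ?e" using elim(3) by (intro mult_right_mono) auto
        also have "\<dots> \<le> ?y" using y_ge by (simp add: power2_eq_square)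
        finally show ?thesis by simp
      qed
      \<comment> \<open>At most half of the horizon is lost by rounding down to \<open>?N\<close>,
        and at most a quarter to interfering times.\<close>
      have J: "?y / 4 \<le> real ?N - B" using N B_y by linarith
      have pos: "\<And>i. i \<in> {1..l} \<Longrightarrow> atom_prob P (window s) (x i) > 0" using x by (simp add: typical_def)
      have "prob (space P - hit l q s x ?N) \<le> B * 2 ^ l / (?y / 4 * (\<Prod>i\<in>{1..l}. atom_prob P (window s) (x i))) + 4 ^ l * (4 * real l * 4 ^ l * psi (g s))"
        unfolding B_def
        by (rule no_multi_match_prob[where q=q and K=K, OF l2 psi_sum K g(1) t pos]) (use J in \<open>auto simp: B_def\<close>)
      also have "4 ^ l * (4 * real l * 4 ^ l * psi (g s)) \<le> F * (C / ?e)"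
        using psi_le F0 unfolding F_def by (simp only: mult.assoc[symmetric]) (intro mult_left_mono, auto)
      also have "F * (C / ?e) \<le> F * C * (real s + 1) * exp (- \<kappa> * real s)"
      proof -
        have "F * C * 1 \<le> F * C * (real s + 1)" using F0 C(1) by (intro mult_left_mono) auto
        then have "F * C * exp (- \<kappa> * real s) \<le> F * C * (real s + 1) * exp (- \<kappa> * real s)" by (intro mult_right_mono) auto
        then show ?thesis by (simp add: exp_minus divide_inverse mult_ac)
      qed
      also have "B * 2 ^ l / (?y / 4 * (\<Prod>i\<in>{1..l}. atom_prob P (window s) (x i))) \<le> L * (real s + 1) * ?e * 2 ^ l / (?e ^ 2 / 4)"
      proof (rule frac_le)
        show "B * 2 ^ l \<le> L * (real s + 1) * ?e * 2 ^ l" using B_le by (intro mult_right_mono) auto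
        show "0 \<le> L * (real s + 1) * ?e * 2 ^ l" using L0 by simp
        have "?e ^ 2 = ?y * exp (- (real l * (2 * real s * (h + \<epsilon>))))"
          by (simp add: exp_double[symmetric] exp_add[symmetric] \<kappa>_def algebra_simps)
        also have "\<dots> \<le> ?y * (\<Prod>i\<in>{1..l}. atom_prob P (window s) (x i))" using elim(1) by (intro mult_left_mono) auto
        finally show "?e ^ 2 / 4 \<le> ?y / 4 * (\<Prod>i\<in>{1..l}. atom_prob P (window s) (x i))" by simp
      qed simp
      also have "L * (real s + 1) * ?e * 2 ^ l / (?e ^ 2 / 4) = 4 * L * 2 ^ l * (real s + 1) * exp (- \<kappa> * real s)"
        by (simp add: exp_minus power2_eq_square field_simps)
      finally show ?case by (simp add: distrib_right)
    qed
  qed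
qed

end

end

text \<open>A deterministic inversion: level \<open>s\<close> is reached near time
  \<open>exp (2 * l * s * h)\<close>, so by time \<open>N\<close> the level is about
  \<open>ln N / (2 * l * h)\<close>, and each level is worth \<gamma>. Asking only for arbitrarily
  small elements of \<open>E\<close> allows \<open>E\<close> to be countable.\<close>

lemma max_log_dist_growth:
  fixes M :: "nat \<Rightarrow> ereal" and \<gamma> h :: real and l :: nat
  assumes \<gamma>: "\<gamma> > 0" and h: "h > 0" and l: "l \<ge> 1"
    and M: "\<And>s N. N \<ge> 1 \<Longrightarrow> ereal (\<gamma> * (real s + 1)) \<le> M N \<longleftrightarrow> H s N"
    and mono: "\<And>s N N'. H s N \<Longrightarrow> N \<le> N' \<Longrightarrow> H s N'"
    and hit: "\<And>\<epsilon>. \<epsilon> \<in> E \<Longrightarrow> eventually (\<lambda>s. H s (nat \<lfloor>exp (real l * (2 * real s * (h + 2 * \<epsilon>)))\<rfloor>)) sequentially"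
    and nohit: "\<And>\<epsilon>. \<epsilon> \<in> E \<Longrightarrow> 2 * \<epsilon> < h \<Longrightarrow> eventually (\<lambda>s. \<not> H s (nat \<lfloor>exp (real l * (2 * real s * (h - 2 * \<epsilon>)))\<rfloor>)) sequentially"
    and E: "\<And>\<delta>::real. \<delta> > 0 \<Longrightarrow> \<exists>\<epsilon>\<in>E. 0 < \<epsilon> \<and> \<epsilon> < \<delta>"
  shows "(\<lambda>N. M N / ereal (ln (real N))) \<longlonglongrightarrow> ereal \<gamma> / (2 * ereal (real l) * ereal h)"
proof -
  define lim where "lim k = \<gamma> / (2 * real l * k)" for k
  have cont: "(lim \<longlongrightarrow> lim h) (nhds h)"
    unfolding lim_def using h l by (intro tendsto_intros filterlim_ident) auto
  have ln_top: "filterlim (\<lambda>N. ln (real N)) at_top sequentially"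
    by (rule filterlim_compose[OF ln_at_top filterlim_real_sequentially])
  have "(\<lambda>N. M N / ereal (ln (real N))) \<longlonglongrightarrow> ereal (lim h)"
  proof (rule order_tendstoI)
    fix a assume a: "a < ereal (lim h)"
    \<comment> \<open>If the bound is \<open>-\<infinity>\<close>, any real number below the limit
      serves.\<close>
    then obtain a' where a': "a \<le> ereal a'" "a' < lim h"
      by (cases a) (auto intro: that[of "lim h - 1"])
    have "eventually (\<lambda>k. a' < lim k) (nhds h)" using cont a'(2) by (rule order_tendstoD)
    then obtain d where d: "d > 0" "\<And>k. \<bar>k - h\<bar> < d \<Longrightarrow> a' < lim k"
      unfolding eventually_nhds_metric dist_real_def by blast
    obtain \<epsilon> where \<epsilon>: "\<epsilon> \<in> E" "0 < \<epsilon>" "\<epsilon> < d / 2" using E[of "d/2"] d by auto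
    define k where "k = h + 2 * \<epsilon>"
    have k: "k > 0" "a' < lim k" using \<epsilon> h d(2)[of k] by (auto simp: k_def)
    define r where "r = 2 * real l * k"
    have r: "r > 0" using k l by (simp add: r_def)
    \<comment> \<open>Rounded down: the time attached to this level does not exceed
      \<open>N\<close>, so the level is reached by \<open>N\<close>.\<close>
    define s where "s N = nat \<lfloor>ln (real N) / r\<rfloor>" for N :: nat
    have s_top: "filterlim s sequentially sequentially"
      unfolding filterlim_at_top
    proof
      fix Z
      have "eventually (\<lambda>N. r * real Z \<le> ln (real N)) sequentially" using ln_top by (simp add: filterlim_at_top)
      then show "eventually (\<lambda>N. Z \<le> s N) sequentially"
      proof eventually_elim
        case (elim N)
        have "real Z \<le> ln (real N) / r" using elim r by (simp add: field_simps)
        then show ?case unfolding s_def by (simp add: le_nat_floor)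
      qed
    qed
    have "eventually (\<lambda>N. H (s N) (nat \<lfloor>exp (real l * (2 * real (s N) * (h + 2 * \<epsilon>)))\<rfloor>)) sequentially"
      by (rule eventually_compose_filterlim[OF hit[OF \<epsilon>(1)] s_top])
    then show "eventually (\<lambda>N. a < M N / ereal (ln (real N))) sequentially"
      using eventually_gt_at_top[of 1]
    proof eventually_elim
      case (elim N)
      have N: "ln (real N) > 0" "N \<ge> 1" using elim(2) by auto
      have fl: "real (s N) \<le> ln (real N) / r" "ln (real N) / r < real (s N) + 1"
        using N r unfolding s_def by (auto simp: of_nat_nat)
      have "real l * (2 * real (s N) * (h + 2 * \<epsilon>)) = real (s N) * r" by (simp add: r_def k_def)
      also have "\<dots> \<le> ln (real N)" using fl(1) r by (simp add: field_simps)
      finally have "exp (real l * (2 * real (s N) * (h + 2 * \<epsilon>))) \<le> exp (ln (real N))" by simp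
      then have "exp (real l * (2 * real (s N) * (h + 2 * \<epsilon>))) \<le> real N" using N by simp
      then have "nat \<lfloor>exp (real l * (2 * real (s N) * (h + 2 * \<epsilon>)))\<rfloor> \<le> N" by linarith
      then have "H (s N) N" using mono elim(1) by blast
      then have "ereal (\<gamma> * (real (s N) + 1)) \<le> M N" using M N(2) by blast
      moreover have "\<gamma> * (ln (real N) / r) \<le> \<gamma> * (real (s N) + 1)" using fl(2) \<gamma> by (intro mult_left_mono) auto
      ultimately have "ereal (\<gamma> * (ln (real N) / r)) \<le> M N" by (meson ereal_less_eq(3) order_trans)
      then have "ereal (\<gamma> * (ln (real N) / r)) / ereal (ln (real N)) \<le> M N / ereal (ln (real N))"
        using N by (intro ereal_divide_right_mono) auto
      moreover have "ereal (\<gamma> * (ln (real N) / r)) / ereal (ln (real N)) = ereal (lim k)"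
        using N by (simp add: lim_def r_def)
      moreover have "a < ereal (lim k)" using a'(1) k(2) by (auto intro: le_less_trans)
      ultimately show ?case by simp
    qed
  next
    fix b assume b: "b > ereal (lim h)"
    then obtain b' where b': "ereal b' \<le> b" "b' > lim h"
      by (cases b) (auto intro: that[of "lim h + 1"])
    \<comment> \<open>The room between \<open>b''\<close> and \<open>b'\<close> is kept for the
      rounding error \<open>2 * \<gamma> / ln N\<close>.\<close>
    define b'' where "b'' = (b' + lim h) / 2"
    have b'': "lim h < b''" "b'' < b'" using b'(2) by (auto simp: b''_def field_simps)
    have "eventually (\<lambda>k. lim k < b'') (nhds h)" using cont b''(1) by (rule order_tendstoD)
    then obtain d where d: "d > 0" "\<And>k. \<bar>k - h\<bar> < d \<Longrightarrow> lim k < b''"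
      unfolding eventually_nhds_metric dist_real_def by blast
    obtain \<epsilon> where \<epsilon>: "\<epsilon> \<in> E" "0 < \<epsilon>" "\<epsilon> < min d h / 2" using E[of "min d h / 2"] d h by auto
    define k where "k = h - 2 * \<epsilon>"
    have k: "k > 0" "lim k < b''" using \<epsilon> h d(2)[of k] by (auto simp: k_def)
    define r where "r = 2 * real l * k"
    have r: "r > 0" using k l by (simp add: r_def)
    \<comment> \<open>Rounded up: the time attached to this level is at least \<open>N\<close>, so
      the level is not reached by \<open>N\<close>.\<close>
    define s where "s N = nat \<lceil>ln (real N) / r\<rceil>" for N :: nat
    have s_top: "filterlim s sequentially sequentially"
      unfolding filterlim_at_top
    proof
      fix Z
      have "eventually (\<lambda>N. r * real Z \<le> ln (real N)) sequentially" using ln_top by (simp add: filterlim_at_top)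
      then show "eventually (\<lambda>N. Z \<le> s N) sequentially"
      proof eventually_elim
        case (elim N)
        have "real Z \<le> ln (real N) / r" using elim r by (simp add: field_simps)
        then show ?case unfolding s_def by linarith
      qed
    qed
    have ev1: "eventually (\<lambda>N. \<not> H (s N) (nat \<lfloor>exp (real l * (2 * real (s N) * (h - 2 * \<epsilon>)))\<rfloor>)) sequentially"
      using \<epsilon> by (intro eventually_compose_filterlim[OF nohit[OF \<epsilon>(1)] s_top]) auto
    have ev2: "eventually (\<lambda>N. ln (real N) > 2 * \<gamma> / (b' - b'')) sequentially"
      using ln_top by (simp add: filterlim_at_top_dense)
    show "eventually (\<lambda>N. M N / ereal (ln (real N)) < b) sequentially"
      using ev1 ev2 eventually_gt_at_top[of 1]
    proof eventually_elim
      case (elim N)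
      have N: "ln (real N) > 0" "N \<ge> 1" using elim(3) by auto
      have fl: "ln (real N) / r \<le> real (s N)" "real (s N) \<le> ln (real N) / r + 1"
        using N r unfolding s_def by (auto simp: of_nat_nat)
      have "ln (real N) \<le> real (s N) * r" using fl(1) r by (simp add: field_simps)
      also have "\<dots> = real l * (2 * real (s N) * (h - 2 * \<epsilon>))" by (simp add: r_def k_def)
      finally have "exp (ln (real N)) \<le> exp (real l * (2 * real (s N) * (h - 2 * \<epsilon>)))" by simp
      then have "real N \<le> exp (real l * (2 * real (s N) * (h - 2 * \<epsilon>)))" using N by simp
      then have "N \<le> nat \<lfloor>exp (real l * (2 * real (s N) * (h - 2 * \<epsilon>)))\<rfloor>" by (simp add: le_nat_floor)
      then have "\<not> H (s N) N" using mono elim(1) by blast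
      \<comment> \<open>Failing at level \<open>s\<close> still allows values up to
        \<open>\<gamma> * (s + 1)\<close>; together with the rounding up this costs
        \<open>2 * \<gamma>\<close>.\<close>
      then have "M N \<le> ereal (\<gamma> * (real (s N) + 1))" using M N(2) by (meson linear)
      moreover have "\<gamma> * (real (s N) + 1) \<le> \<gamma> * (ln (real N) / r + 2)" using fl(2) \<gamma> by (intro mult_left_mono) auto
      ultimately have "M N \<le> ereal (\<gamma> * (ln (real N) / r + 2))" by (meson ereal_less_eq(3) order_trans)
      then have "M N / ereal (ln (real N)) \<le> ereal (\<gamma> * (ln (real N) / r + 2)) / ereal (ln (real N))"
        using N by (intro ereal_divide_right_mono) auto
      also have "\<dots> = ereal (lim k + 2 * \<gamma> / ln (real N))"
        using N r by (simp add: lim_def r_def field_simps)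
      also have "lim k + 2 * \<gamma> / ln (real N) < b'"
      proof -
        have "2 * \<gamma> / ln (real N) < b' - b''" using elim(2) N(1) b''(2) by (simp add: field_simps)
        then show ?thesis using k(2) by linarith
      qed
      finally show ?case using b'(1) by (auto intro: less_le_trans)
    qed
  qed
  moreover have "ereal \<gamma> / (2 * ereal (real l) * ereal h) = ereal (lim h)"
  proof -
    have "2 * ereal (real l) * ereal h = ereal (2 * real l * h)" by (simp only: numeral_eq_ereal times_ereal.simps)
    then show ?thesis using h l by (simp add: lim_def)
  qed
  ultimately show ?thesis by simp
qed

lemma window_eq_iff:
  "window s \<omega> = window s \<omega>' \<longleftrightarrow> (\<forall>k\<le>s. \<omega> (int k) = \<omega>' (int k) \<and> \<omega> (- int k) = \<omega>' (- int k))"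
proof -
  have "window s \<omega> = window s \<omega>' \<longleftrightarrow> (\<forall>j<2 * s + 1. \<omega> (int j - int s) = \<omega>' (int j - int s))"
    by (simp add: window_eq_itinerary itinerary_eq_iff sh_apply)
  also have "\<dots> \<longleftrightarrow> (\<forall>k\<le>s. \<omega> (int k) = \<omega>' (int k) \<and> \<omega> (- int k) = \<omega>' (- int k))"
  proof safe
    fix k assume *: "\<forall>j<2 * s + 1. \<omega> (int j - int s) = \<omega>' (int j - int s)" and k: "k \<le> s"
    have "int (s + k) - int s = int k" "int (s - k) - int s = - int k" using k by simp_all
    moreover have "s + k < 2 * s + 1" "s - k < 2 * s + 1" using k by simp_all
    ultimately show "\<omega> (int k) = \<omega>' (int k)" "\<omega> (- int k) = \<omega>' (- int k)"
      using * by metis+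
  next
    fix j assume *: "\<forall>k\<le>s. \<omega> (int k) = \<omega>' (int k) \<and> \<omega> (- int k) = \<omega>' (- int k)" and j: "j < 2 * s + 1"
    show "\<omega> (int j - int s) = \<omega>' (int j - int s)"
    proof (cases "j \<ge> s")
      case True
      then have e: "int j - int s = int (j - s)" by simp
      have "j - s \<le> s" using j by simp
      then show ?thesis unfolding e using * by blast
    next
      case False
      then have e: "int j - int s = - int (s - j)" by simp
      have "s - j \<le> s" by simp
      then show ?thesis unfolding e using * by blast
    qed
  qed
  finally show ?thesis .
qed

text \<open>Agreement on \<open>[-s, s]\<close> puts the first disagreement at index
  \<open>s + 1\<close> or later, hence the summand 1. Identical sequences are covered by the value
  infinity.\<close>

lemma log_dist_ge_iff:
  assumes \<gamma>: "\<gamma> > 0"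
  shows "ereal (\<gamma> * (real s + 1)) \<le> log_dist \<gamma> x \<omega> \<longleftrightarrow> window s \<omega> = window s x"
proof (cases "\<omega> = x")
  case True then show ?thesis by (simp add: log_dist_def seq_dist_def)
next
  case False
  let ?D = "\<lambda>i::nat. \<omega> (int i) \<noteq> x (int i) \<or> \<omega> (- int i) \<noteq> x (- int i)"
  define L where "L = (LEAST i. ?D i)"
  obtain j where j: "\<omega> j \<noteq> x j" using False by auto
  have "?D (nat \<bar>j\<bar>)" using j by (cases "j \<ge> 0") auto
  then have L: "?D L" unfolding L_def by (rule LeastI)
  have below: "\<not> ?D k" if "k < L" for k using not_less_Least[of k ?D] that by (simp add: L_def)
  have "log_dist \<gamma> x \<omega> = ereal (\<gamma> * real L)"
    using False by (simp add: log_dist_def seq_dist_def L_def)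
  moreover have "\<gamma> * (real s + 1) \<le> \<gamma> * real L \<longleftrightarrow> Suc s \<le> L"
    using \<gamma> by (subst mult_le_cancel_left_pos) auto
  moreover have "Suc s \<le> L \<longleftrightarrow> window s \<omega> = window s x"
    unfolding window_eq_iff using L below by (metis Suc_le_eq le_less_trans not_less)
  ultimately show ?thesis by simp
qed

section \<open>The limit for typical targets\<close>

context mixing
begin

lemma max_log_dist_ge_iff:
  assumes \<gamma>: "\<gamma> > 0" and l: "l \<ge> 1" and N: "N \<ge> 1"
  shows "ereal (\<gamma> * (real s + 1)) \<le> max_log_dist \<gamma> l q x N \<omega> \<longleftrightarrow> \<omega> \<in> hit l q s x N"
proof -
  have "ereal (\<gamma> * (real s + 1)) \<le> max_log_dist \<gamma> l q x N \<omega> \<longleftrightarrow>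
    (\<exists>n\<in>{1..N}. \<forall>i\<in>{1..l}. ereal (\<gamma> * (real s + 1)) \<le> log_dist \<gamma> (x i) (sh (int (q i n)) \<omega>))"
    unfolding max_log_dist_def funpow_left_shift using l N
    by (subst Max_ge_iff) (auto simp: Min_ge_iff)
  then show ?thesis unfolding hit_def multi_match_def log_dist_ge_iff[OF \<gamma>] by (simp add: match_def)
qed

lemma hit_mono: "\<omega> \<in> hit l q s x N \<Longrightarrow> N \<le> N' \<Longrightarrow> \<omega> \<in> hit l q s x N'"
  unfolding hit_def by auto

lemma AE_max_log_dist_limit:
  assumes fc: "finite_ent P coord0" and hpos: "entropy_rate P coord0 > 0"
    and psi_sum: "l > 1 \<Longrightarrow> (\<Sum>n. psi_mix P (Suc n)) < \<infinity>"
    and l: "l \<ge> 1"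
    and K_multi: "\<And>i j (k::int). i \<in> {1..l} \<Longrightarrow> j \<in> {1..l} \<Longrightarrow> i \<noteq> j \<Longrightarrow>
      at_most K {n. int (q i n) - int (q j n) = k \<or> int (q i n) = k}"
    and K_single: "\<And>k::int. l = 1 \<Longrightarrow> at_most K {n. int (q 1 n) = k}"
    and \<gamma>: "\<gamma> > 0"
    and x: "\<And>i. i \<in> {1..l} \<Longrightarrow> typical (entropy_rate P coord0) (x i)"
  shows "AE \<omega> in P. (\<lambda>N. max_log_dist \<gamma> l q x N \<omega> / ereal (ln (real N)))
         \<longlonglongrightarrow> ereal \<gamma> / (2 * ereal (real l) * ereal (entropy_rate P coord0))"
proof -
  let ?h = "entropy_rate P coord0"
  \<comment> \<open>For one target the plain union bound gives \<open>M = 1\<close> and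
    \<open>B = 0\<close>; for several, \<open>M\<close> comes from mixing with gap 1 and
    \<open>B\<close> from the times at which the windows interfere.\<close>
  obtain M B where MB: "0 \<le> M" "0 \<le> B" and le: "\<And>s N. prob (hit l q s x N)
      \<le> real N * M * (\<Prod>i\<in>{1..l}. atom_prob P (window s) (x i)) + B * (real s + 1) * atom_prob P (window s) (x 1)"
  proof (cases "l = 1")
    case True
    have "prob (hit l q s x N) \<le> real N * 1 * (\<Prod>i\<in>{1..l}. atom_prob P (window s) (x i)) + 0 * (real s + 1) * atom_prob P (window s) (x 1)" for s N
    proof -
      have "prob (hit l q s x N) = prob (\<Union>n\<in>{1..N}. match s (x 1) (q 1 n))" unfolding hit_def multi_match_def by (simp add: True)
      also have "\<dots> \<le> (\<Sum>n\<in>{1..N}. prob (match s (x 1) (q 1 n)))" by (intro measure_UNION_le) auto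
      also have "\<dots> = real N * atom_prob P (window s) (x 1)" by (simp add: prob_match)
      finally show ?thesis by (simp add: True)
    qed
    then show thesis by (intro that[of 1 0]) auto
  next
    case False
    then have l2: "l > 1" using l by simp
    note psi = psi_sum[OF l2]
    have K0: "0 \<le> K" by (rule K_nonneg[where q=q and K=K, OF l2 psi K_multi])
    show thesis
    proof (rule that[of "(1 + psi 1) ^ l" "4 * (real l)\<^sup>2 * K"])
      fix s N
      have "prob (hit l q s x N) \<le> real N * (1 + psi 1) ^ l * (\<Prod>i\<in>{1..l}. atom_prob P (window s) (x i))
        + ((real l)\<^sup>2 * (K * real (2 * (2 * s + 1)))) * atom_prob P (window s) (x 1)"
        using multi_match_prob_upper[where q=q and K=K, OF l2 psi K_multi, of s x N] by simp
      also have "((real l)\<^sup>2 * (K * real (2 * (2 * s + 1)))) * atom_prob P (window s) (x 1)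
        \<le> 4 * (real l)\<^sup>2 * K * (real s + 1) * atom_prob P (window s) (x 1)"
      proof (rule mult_right_mono[OF _ atom_prob_nonneg])
        have "real (2 * (2 * s + 1)) \<le> 4 * (real s + 1)" by simp
        then have "(real l)\<^sup>2 * (K * real (2 * (2 * s + 1))) \<le> (real l)\<^sup>2 * (K * (4 * (real s + 1)))"
          using K0 by (intro mult_left_mono) auto
        then show "(real l)\<^sup>2 * (K * real (2 * (2 * s + 1))) \<le> 4 * (real l)\<^sup>2 * K * (real s + 1)" by (simp only: mult_ac)
      qed
      finally show "prob (hit l q s x N) \<le> real N * (1 + psi 1) ^ l * (\<Prod>i\<in>{1..l}. atom_prob P (window s) (x i))
        + 4 * (real l)\<^sup>2 * K * (real s + 1) * atom_prob P (window s) (x 1)" by simp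
    qed (use K0 psi_nonneg[of 1] in auto)
  qed
  \<comment> \<open>A countable set of tolerances accumulating at 0, so that the exceptional null
    sets can be united.\<close>
  define E where "E = range (\<lambda>k. 1 / real (Suc k))"
  have "AE \<omega> in P. \<forall>\<epsilon>\<in>E. eventually (\<lambda>s. \<omega> \<in> hit l q s x (nat \<lfloor>exp (real l * (2 * real s * (?h + 2 * \<epsilon>)))\<rfloor>)) sequentially"
  proof (subst AE_ball_countable)
    show "countable E" by (simp add: E_def)
    show "\<forall>\<epsilon>\<in>E. AE \<omega> in P. eventually (\<lambda>s. \<omega> \<in> hit l q s x (nat \<lfloor>exp (real l * (2 * real s * (?h + 2 * \<epsilon>)))\<rfloor>)) sequentially"
    proof
      fix \<epsilon> assume "\<epsilon> \<in> E"
      then have \<epsilon>: "\<epsilon> > 0" by (auto simp: E_def)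
      show "AE \<omega> in P. eventually (\<lambda>s. \<omega> \<in> hit l q s x (nat \<lfloor>exp (real l * (2 * real s * (?h + 2 * \<epsilon>)))\<rfloor>)) sequentially"
      proof (cases "l = 1")
        case True
        show ?thesis by (rule AE_hit_single[where q=q and K=K and x=x, OF l hpos x True K_single[OF True] \<epsilon>])
      next
        case False
        then have l2: "l > 1" using l by simp
        show ?thesis by (rule AE_hit_multi[where q=q and K=K and x=x, OF l hpos x l2 psi_sum[OF l2] K_multi \<epsilon>])
      qed
    qed
  qed
  moreover have "AE \<omega> in P. \<forall>\<epsilon>\<in>E. 2 * \<epsilon> < ?h \<longrightarrow>
      eventually (\<lambda>s. \<omega> \<notin> hit l q s x (nat \<lfloor>exp (real l * (2 * real s * (?h - 2 * \<epsilon>)))\<rfloor>)) sequentially"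
  proof (subst AE_ball_countable)
    show "countable E" by (simp add: E_def)
    show "\<forall>\<epsilon>\<in>E. AE \<omega> in P. 2 * \<epsilon> < ?h \<longrightarrow>
      eventually (\<lambda>s. \<omega> \<notin> hit l q s x (nat \<lfloor>exp (real l * (2 * real s * (?h - 2 * \<epsilon>)))\<rfloor>)) sequentially"
    proof
      fix \<epsilon> assume "\<epsilon> \<in> E"
      then have \<epsilon>: "\<epsilon> > 0" by (auto simp: E_def)
      show "AE \<omega> in P. 2 * \<epsilon> < ?h \<longrightarrow>
        eventually (\<lambda>s. \<omega> \<notin> hit l q s x (nat \<lfloor>exp (real l * (2 * real s * (?h - 2 * \<epsilon>)))\<rfloor>)) sequentially"
      proof (cases "2 * \<epsilon> < ?h")
        case True
        show ?thesis using AE_not_hit[where q=q and x=x, OF l hpos x MB le \<epsilon> True] by simp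
      qed simp
    qed
  qed
  ultimately show ?thesis
  proof eventually_elim
    case (elim \<omega>)
    show ?case
    proof (rule max_log_dist_growth[where H="\<lambda>s N. \<omega> \<in> hit l q s x N" and E=E, OF \<gamma> hpos l])
      fix \<delta> :: real assume "\<delta> > 0"
      then obtain k where "1 / real (Suc k) < \<delta>" using nat_approx_posE by blast
      then show "\<exists>\<epsilon>\<in>E. 0 < \<epsilon> \<and> \<epsilon> < \<delta>" by (auto simp: E_def)
    qed (use elim max_log_dist_ge_iff[OF \<gamma> l] hit_mono in auto)
  qed
qed

end

theorem theorem2p5:
  fixes P :: "(int \<Rightarrow> 'a::countable) measure"
    and l :: nat
    and q :: "nat \<Rightarrow> nat \<Rightarrow> nat"
    and K \<gamma> :: real
  assumes alphabet: "\<exists>a b :: 'a. a \<noteq> b"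
    and prob: "prob_space P"
    and sets_P: "sets P = sets seq_space"
    and invariant: "distr P P left_shift = P"
    and cylinders_pos: "\<And>a. measure P (cylinder1 a) > 0"
    and finite_entropy:
      "(\<Sum>\<^sub>\<infinity>a. ereal (- (measure P (cylinder1 a) * ln (measure P (cylinder1 a))))) < \<infinity>"
    and l_pos: "l \<ge> 1"
    and phi_summable: "l = 1 \<Longrightarrow> (\<Sum>n. phi_mix P (Suc n)) < \<infinity>"
    and psi_summable: "l > 1 \<Longrightarrow> (\<Sum>n. psi_mix P (Suc n)) < \<infinity>"
    and K_pos: "K > 0"
    and a_several: "\<And>i j (k::int). i \<in> {1..l} \<Longrightarrow> j \<in> {1..l} \<Longrightarrow> i \<noteq> j \<Longrightarrow>
      at_most K {n. int (q i n) - int (q j n) = k \<or> int (q i n) = k}"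
    and a_single: "\<And>k::int. l = 1 \<Longrightarrow> at_most K {n. int (q 1 n) = k}"
    and b: "at_most K {(m, n). m < n \<and> (MAX i\<in>{1..l}. q i n) \<le> (MAX i\<in>{1..l}. q i m)}"
    and \<gamma>_pos: "\<gamma> > 0"
  shows "0 < KS_entropy P left_shift \<and>
    (AE \<omega>' in PiM {1..l} (\<lambda>_. P). AE \<omega> in P.
       (\<lambda>N. max_log_dist \<gamma> l q \<omega>' N \<omega> / ereal (ln (real N)))
         \<longlonglongrightarrow> ereal \<gamma> / (2 * ereal (real l) * KS_entropy P left_shift))"
proof -
  interpret prob_space P by (rule prob)
  interpret stationary P by unfold_locales (rule sets_P, rule invariant)
  \<comment> \<open>For \<open>l > 1\<close> it is \<psi> that is assumed summable; it dominates
    \<phi>, so ergodicity and entropy are treated alike in both cases.\<close>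
  have "(\<Sum>n. phi_mix P (Suc n)) < \<infinity>"
  proof (cases "l = 1")
    case False
    then have "(\<Sum>n. psi_mix P (Suc n)) < \<infinity>" using l_pos by (intro psi_summable) simp
    moreover have "(\<Sum>n. phi_mix P (Suc n)) \<le> (\<Sum>n. psi_mix P (Suc n))"
      by (intro suminf_le phi_mix_le_psi_mix) auto
    ultimately show ?thesis by (rule le_less_trans[rotated])
  qed (rule phi_summable)
  then interpret mixing P by unfold_locales
  have fc: "finite_ent P coord0" by (rule finite_ent_coord0I[OF finite_entropy])
  obtain a b :: 'a where "a \<noteq> b" using alphabet by blast
  then have h: "entropy_rate P coord0 > 0" by (rule entropy_rate_coord_pos[OF fc _ cylinders_pos])
  \<comment> \<open>Each of the finitely many entries of the tuple has law \<open>P\<close>.\<close>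
  have "AE \<omega>' in PiM {1..l} (\<lambda>_. P). \<forall>i\<in>{1..l}. typical (entropy_rate P coord0) (\<omega>' i)"
    by (rule AE_finite_allI) (auto intro: AE_PiM_component prob AE_typical[OF fc])
  then have "AE \<omega>' in PiM {1..l} (\<lambda>_. P). AE \<omega> in P.
     (\<lambda>N. max_log_dist \<gamma> l q \<omega>' N \<omega> / ereal (ln (real N)))
       \<longlonglongrightarrow> ereal \<gamma> / (2 * ereal (real l) * ereal (entropy_rate P coord0))"
    by eventually_elim
       (rule AE_max_log_dist_limit[where q=q and K=K, OF fc h psi_summable l_pos a_several a_single \<gamma>_pos], auto)
  then show ?thesis using h by (simp add: KS_entropy_eq[OF fc])
qed

end
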